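(* Let $n,d,k\in\mathbb{N}$ with $n\ge 2$ and $k\ge 3$, let $1\le i\le l$, put $\widetilde\Omega_i=D\times[0,t_i]$ and $\widetilde\Omega_{*i}=\partial D\times[0,t_i]$, and suppose that the solution $u$ of the heat problem satisfies $u\in H^k(\widetilde\Omega_i)$. Then for every integer $N>5$ there exists an HLConcPINN $u_{\theta_i}$ (together with HLConcPINNs $u_{\theta_1},\dots,u_{\theta_{i-1}}$ for the earlier time blocks, which enter the definition of $R_{tb_i}$) such that $$\|R_{int_i}\|_{L^2(\widetilde\Omega_i)}\lesssim N^{-k+2}\ln^2 N,$$ $$\|R_{tb_i}(\cdot,t_{j-1})\|_{L^2(D)}\lesssim N^{-k+1}\ln N\quad(1\le j\le i),\qquad \|R_{sb_i}\|_{L^2(\widetilde\Omega_{*i})}\lesssim N^{-k+1}\ln N .$$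
   Context: Heat problem. $D\subset\mathbb{R}^d$ is an open connected bounded domain with $C^k$ boundary $\partial D$, $T>0$, and $u:D\times[0,T]\to\mathbb{R}$ solves $\partial_t u-\Delta u=f$ in $D\times[0,T]$, $u(x,0)=u_{in}(x)$ in $D$, $u=u_d$ on $\partial D\times[0,T]$, for given data $f,u_{in},u_d$. Time blocks. For an integer $l\ge1$ put $\Delta t=T/l$ and $t_i=i\Delta t$, $0\le i\le l$. HLConcPINN (hidden-layer concatenated neural network). With $L\ge 3$, input dimension $l_0$, output dimension $l_L$ and hidden widths $l_1,\dots,l_{L-1}$, it is a map $z\in\mathbb{R}^{l_0}\mapsto\sum_{m=1}^{L-1}M_m h_m(z)+b_L$, where $h_0(z)=z$ and $h_m(z)=\sigma_m(W_m h_{m-1}(z)+b_m)$, with $W_m\in\mathbb{R}^{l_m\times l_{m-1}}$, $b_m\in\mathbb{R}^{l_m}$, $M_m\in\mathbb{R}^{l_L\times l_m}$, $b_L\in\mathbb{R}^{l_L}$; activations act componentwise, $\sigma_1=\sigma_2=\tanh$, and $\sigma_m$ for $m\ge3$ are smooth activation functions. $\theta$ denotes the collection of all parameters. Here $l_0=d+1$ (input $(x,t)$), $l_L=1$, and $u_{\theta_i}$ is considered on $D\times[0,t_i]$. Residuals. $R_{int_i}=\partial_t u_{\theta_i}-\Delta u_{\theta_i}-f$; $R_{tb_i}(x,t_{j-1})=u_{\theta_i}(x,t_{j-1})-u_{\theta_{j-1}}(x,t_{j-1})$ for $x\in D$, $1\le j\le i$, with the convention $u_{\theta_0}(x,t_0)=u_{in}(x)$;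 $R_{sb_i}=u_{\theta_i}-u_d$ on $\partial D$. $a\lesssim b$ means $a\le Cb$ with a constant $C$ independent of $N$. *)

theory Defs
  imports "HOL-Analysis.Analysis"
begin

section \<open>Smooth functions and domains with smooth boundary\<close>

definition partial :: "'a::euclidean_space \<Rightarrow> ('a \<Rightarrow> real) \<Rightarrow> 'a \<Rightarrow> real" where
  "partial b f x = deriv (\<lambda>s. f (x + s *\<^sub>R b)) 0"

primrec Ck :: "nat \<Rightarrow> ('a::euclidean_space \<Rightarrow> real) \<Rightarrow> bool" where
  "Ck 0 f \<longleftrightarrow> continuous_on UNIV f"
| "Ck (Suc k) f \<longleftrightarrow> (\<forall>x. f differentiable (at x)) \<and> (\<forall>b\<in>Basis. Ck k (partial b f))"

definition smooth :: "('a::euclidean_space \<Rightarrow> real) \<Rightarrow> bool" where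
  "smooth f \<longleftrightarrow> (\<forall>k. Ck k f)"

text \<open>Near each boundary point, after relabelling and reorienting the coordinate axes, the domain
  is the region above the graph of a \<open>C\<^sup>k\<close> function \<open>\<gamma>\<close> of the other \<open>d - 1\<close> coordinates.
  Here \<open>\<gamma>\<close> is a function on the whole space that does not depend on the \<open>i\<close>-th coordinate.\<close>

definition Ck_boundary :: "nat \<Rightarrow> (real^'d) set \<Rightarrow> bool" where
  "Ck_boundary k D \<longleftrightarrow> (\<forall>p\<in>frontier D. \<exists>r>0. \<exists>i. \<exists>s\<in>{-1, 1}. \<exists>\<gamma>.
     Ck k \<gamma> \<and> (\<forall>x c. \<gamma> (x + c *\<^sub>R axis i 1) = \<gamma> x) \<and>
     D \<inter> ball p r = {x \<in> ball p r. s * x $ i > \<gamma> x})"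


section \<open>Square-integrable functions\<close>

definition L2 :: "'a measure \<Rightarrow> ('a \<Rightarrow> real) set" where
  "L2 M = {g \<in> borel_measurable M. integrable M (\<lambda>x. (g x)\<^sup>2)}"

definition L2_norm :: "'a measure \<Rightarrow> ('a \<Rightarrow> real) \<Rightarrow> real" where
  "L2_norm M g = sqrt (\<integral>x. (g x)\<^sup>2 \<partial>M)"

definition tendsto_L2 :: "'a measure \<Rightarrow> (nat \<Rightarrow> 'a \<Rightarrow> real) \<Rightarrow> ('a \<Rightarrow> real) \<Rightarrow> bool" where
  "tendsto_L2 M F g \<longleftrightarrow> (\<forall>n. (\<lambda>x. F n x - g x) \<in> L2 M) \<and>
     (\<lambda>n. L2_norm M (\<lambda>x. F n x - g x)) \<longlonglongrightarrow> 0"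


section \<open>Weak derivatives and the Sobolev space \<open>H\<^sup>k\<close>\<close>

text \<open>A multi-index is given as the list of the coordinate directions in which one differentiates;
  the order in the list is immaterial for smooth functions.\<close>

definition test_fun :: "'a::euclidean_space set \<Rightarrow> ('a \<Rightarrow> real) \<Rightarrow> bool" where
  "test_fun \<Omega> \<phi> \<longleftrightarrow> smooth \<phi> \<and> (\<exists>K. compact K \<and> K \<subseteq> \<Omega> \<and> (\<forall>x. x \<notin> K \<longrightarrow> \<phi> x = 0))"

definition loc_integrable :: "'a::euclidean_space set \<Rightarrow> ('a \<Rightarrow> real) \<Rightarrow> bool" where
  "loc_integrable \<Omega> g \<longleftrightarrow> (\<forall>K. compact K \<and> K \<subseteq> \<Omega> \<longrightarrow> g absolutely_integrable_on K)"

definition weak_deriv ::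
  "'a::euclidean_space set \<Rightarrow> 'a list \<Rightarrow> ('a \<Rightarrow> real) \<Rightarrow> ('a \<Rightarrow> real) \<Rightarrow> bool" where
  "weak_deriv \<Omega> bs u v \<longleftrightarrow> loc_integrable \<Omega> u \<and> loc_integrable \<Omega> v \<and>
     (\<forall>\<phi>. test_fun \<Omega> \<phi> \<longrightarrow>
        (\<integral>x. u x * foldr partial bs \<phi> x \<partial>lebesgue_on \<Omega>) =
        (-1) ^ length bs * (\<integral>x. v x * \<phi> x \<partial>lebesgue_on \<Omega>))"

definition sobolev_H :: "nat \<Rightarrow> 'a::euclidean_space set \<Rightarrow> ('a \<Rightarrow> real) set" where
  "sobolev_H k \<Omega> = {u \<in> L2 (lebesgue_on \<Omega>). \<forall>bs. set bs \<subseteq> Basis \<and> length bs \<le> k \<longrightarrow>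
     (\<exists>v \<in> L2 (lebesgue_on \<Omega>). weak_deriv \<Omega> bs u v)}"


section \<open>Surface measure and traces\<close>

text \<open>The \<open>s\<close>-dimensional Hausdorff measure, normalised so that on \<open>s\<close>-dimensional \<open>C\<^sup>1\<close> surfaces it
  is the surface measure. Empty covering sets have weight 0 also for \<open>s = 0\<close>, where one obtains
  the counting measure. The outer measure below is a metric outer measure, hence countably
  additive on the Borel sets.\<close>

definition hausdorff_outer :: "nat \<Rightarrow> 'a::euclidean_space set \<Rightarrow> ennreal" where
  "hausdorff_outer s A = (SUP \<delta>\<in>{0<..}.
     INF U\<in>{U :: nat \<Rightarrow> 'a set. A \<subseteq> (\<Union>i. U i) \<and> (\<forall>i. bounded (U i) \<and> diameter (U i) \<le> (\<delta>::real))}.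
       \<Sum>i. if U i = {} then 0
           else ennreal (unit_ball_vol (real s) * (diameter (U i) / 2) ^ s))"

definition hausdorff_measure :: "nat \<Rightarrow> 'a::euclidean_space measure" where
  "hausdorff_measure s = measure_of UNIV (sets borel) (hausdorff_outer s)"

definition lateral_measure :: "(real^'d) set \<Rightarrow> real \<Rightarrow> ((real^'d) \<times> real) measure" where
  "lateral_measure D \<tau> = completion
     (restrict_space (hausdorff_measure (CARD('d) - 1)) (frontier D) \<Otimes>\<^sub>M
      restrict_space lborel {0..\<tau>})"

text \<open>\<open>g\<close> is the trace of \<open>u \<in> H\<^sup>1(\<Omega>)\<close> on a part of the boundary that is parametrised by
  \<open>\<iota>\<close> and measured by \<open>N\<close>: the trace operator is the continuous extension to \<open>H\<^sup>1(\<Omega>)\<close> of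
  the restriction of functions that are smooth up to the boundary.\<close>

definition has_trace :: "'a::euclidean_space set \<Rightarrow> 'b measure \<Rightarrow> ('b \<Rightarrow> 'a) \<Rightarrow>
    ('a \<Rightarrow> real) \<Rightarrow> ('b \<Rightarrow> real) \<Rightarrow> bool" where
  "has_trace \<Omega> N \<iota> u g \<longleftrightarrow> g \<in> L2 N \<and> (\<exists>\<phi> :: nat \<Rightarrow> 'a \<Rightarrow> real. (\<forall>n. smooth (\<phi> n)) \<and>
     tendsto_L2 (lebesgue_on \<Omega>) \<phi> u \<and>
     (\<forall>b\<in>Basis. \<exists>v. weak_deriv \<Omega> [b] u v \<and>
        tendsto_L2 (lebesgue_on \<Omega>) (\<lambda>n. partial b (\<phi> n)) v) \<and>
     tendsto_L2 N (\<lambda>n y. \<phi> n (\<iota> y)) g)"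


section \<open>The heat problem\<close>

abbreviation time_dir :: "(real^'d) \<times> real" where
  "time_dir \<equiv> (0, 1)"

abbreviation space_dir :: "'d \<Rightarrow> (real^'d) \<times> real" where
  "space_dir a \<equiv> (axis a 1, 0)"

text \<open>Strong solutions: the equation holds almost everywhere with weak derivatives, the initial
  and boundary data are attained in the sense of traces.\<close>

definition heat_solution :: "(real^'d) set \<Rightarrow> real \<Rightarrow> ((real^'d) \<times> real \<Rightarrow> real) \<Rightarrow>
    ((real^'d) \<Rightarrow> real) \<Rightarrow> ((real^'d) \<times> real \<Rightarrow> real) \<Rightarrow> ((real^'d) \<times> real \<Rightarrow> real) \<Rightarrow> bool" where
  "heat_solution D T f u_in u_d u \<longleftrightarrow>
     (let \<Omega> = D \<times> {0<..<T} in
       u \<in> sobolev_H 1 \<Omega> \<and>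
       (\<exists>u_t u_xx. weak_deriv \<Omega> [time_dir] u u_t \<and>
          (\<forall>a. weak_deriv \<Omega> [space_dir a, space_dir a] u (u_xx a)) \<and>
          (AE z in lebesgue_on \<Omega>. u_t z - (\<Sum>a\<in>UNIV. u_xx a z) = f z)) \<and>
       has_trace \<Omega> (lebesgue_on D) (\<lambda>x. (x, 0)) u u_in \<and>
       has_trace \<Omega> (lateral_measure D T) (\<lambda>z. z) u u_d)"

definition block_time :: "real \<Rightarrow> nat \<Rightarrow> nat \<Rightarrow> real" where
  "block_time T l i = real i * (T / real l)"


section \<open>Hidden-layer concatenated neural networks\<close>

text \<open>Vectors and matrices are functions on indices starting at 0, of which only the values
  below the respective layer width are relevant. The output bias \<open>b\<^sub>L\<close> is \<open>bias \<theta> L\<close>.\<close>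

record hlconc_params =
  width :: "nat \<Rightarrow> nat"
  weight :: "nat \<Rightarrow> nat \<Rightarrow> nat \<Rightarrow> real"
  bias :: "nat \<Rightarrow> nat \<Rightarrow> real"
  out_weight :: "nat \<Rightarrow> nat \<Rightarrow> nat \<Rightarrow> real"

primrec hidden :: "(nat \<Rightarrow> real \<Rightarrow> real) \<Rightarrow> hlconc_params \<Rightarrow> (nat \<Rightarrow> real) \<Rightarrow> nat \<Rightarrow> nat \<Rightarrow> real" where
  "hidden \<sigma> \<theta> z 0 = z"
| "hidden \<sigma> \<theta> z (Suc m) = (\<lambda>r. \<sigma> (Suc m)
     ((\<Sum>c<width \<theta> m. weight \<theta> (Suc m) r c * hidden \<sigma> \<theta> z m c) + bias \<theta> (Suc m) r))"

definition hlconc :: "nat \<Rightarrow> (nat \<Rightarrow> real \<Rightarrow> real) \<Rightarrow> hlconc_params \<Rightarrow> (nat \<Rightarrow> real) \<Rightarrow> nat \<Rightarrow> real" where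
  "hlconc L \<sigma> \<theta> z r =
     (\<Sum>m=1..<L. \<Sum>c<width \<theta> m. out_weight \<theta> m r c * hidden \<sigma> \<theta> z m c) + bias \<theta> L r"

definition hlconc_shape :: "nat \<Rightarrow> nat \<Rightarrow> nat \<Rightarrow> hlconc_params \<Rightarrow> bool" where
  "hlconc_shape L d_in d_out \<theta> \<longleftrightarrow>
     width \<theta> 0 = d_in \<and> width \<theta> L = d_out \<and> (\<forall>m\<in>{1..<L}. width \<theta> m \<ge> 1)"

definition hlconc_activations :: "nat \<Rightarrow> (nat \<Rightarrow> real \<Rightarrow> real) \<Rightarrow> bool" where
  "hlconc_activations L \<sigma> \<longleftrightarrow> \<sigma> 1 = tanh \<and> \<sigma> 2 = tanh \<and> (\<forall>m. 3 \<le> m \<and> m < L \<longrightarrow> smooth (\<sigma> m))"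

text \<open>The input \<open>(x, t)\<close> as a vector with \<open>d + 1\<close> entries; \<open>from_nat_into UNIV\<close> enumerates the
  coordinates of \<open>x\<close> by \<open>{..<d}\<close>.\<close>

definition st_input :: "(real^'d) \<times> real \<Rightarrow> nat \<Rightarrow> real" where
  "st_input z j = (if j < CARD('d) then fst z $ from_nat_into (UNIV :: 'd set) j else snd z)"

definition net :: "nat \<Rightarrow> (nat \<Rightarrow> real \<Rightarrow> real) \<Rightarrow> hlconc_params \<Rightarrow> (real^'d) \<times> real \<Rightarrow> real" where
  "net L \<sigma> \<theta> z = hlconc L \<sigma> \<theta> (st_input z) 0"


section \<open>Residuals\<close>

definition R_int ::
  "((real^'d) \<times> real \<Rightarrow> real) \<Rightarrow> ((real^'d) \<times> real \<Rightarrow> real) \<Rightarrow> (real^'d) \<times> real \<Rightarrow> real" where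
  "R_int f v z =
     partial time_dir v z - (\<Sum>a\<in>UNIV. partial (space_dir a) (partial (space_dir a) v) z) - f z"

text \<open>\<open>v j\<close> is the network of block \<open>j\<close>, \<open>\<tau> j\<close> is the time \<open>t\<^sub>j\<close>; the value of \<open>v 0\<close> is not used.\<close>

definition R_tb :: "((real^'d) \<Rightarrow> real) \<Rightarrow> (nat \<Rightarrow> real) \<Rightarrow> (nat \<Rightarrow> (real^'d) \<times> real \<Rightarrow> real) \<Rightarrow>
    nat \<Rightarrow> nat \<Rightarrow> (real^'d) \<Rightarrow> real" where
  "R_tb u_in \<tau> v i j x = v i (x, \<tau> (j - 1)) -
     (if j = 1 then u_in x else v (j - 1) (x, \<tau> (j - 1)))"

definition R_sb ::
  "((real^'d) \<times> real \<Rightarrow> real) \<Rightarrow> ((real^'d) \<times> real \<Rightarrow> real) \<Rightarrow> (real^'d) \<times> real \<Rightarrow> real" where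
  "R_sb u_d v z = v z - u_d z"

end

theory Submission
  imports Defs
begin

text \<open>The widths of the networks and the size of their weights are not restricted, so no rate has to be
  earned: it suffices to make all residuals smaller than an arbitrary \<open>\<delta> > 0\<close> by one function, used
  on all time blocks. On the cylinder, smooth functions are dense in \<open>H\<^sup>2\<close> (localise, shift inwards
  along the graph direction, mollify). A smooth function is approximated in \<open>C\<^sup>2\<close> on compact sets by
  exponential sums, through convolution with a concentrating kernel that is itself an exponential sum,
  and \<open>exp\<close> is a limit of affine images of \<open>tanh\<close>, since
  \<open>(1 + tanh (s/2 + \<beta>)) / (2 * exp (2 * \<beta>)) \<longlonglongrightarrow> exp s\<close> as \<open>\<beta>\<close> tends to \<open>-\<infinity>\<close>.
  Sums of \<open>tanh\<close> ridge functions are HLConcPINNs, so networks are dense in \<open>H\<^sup>2\<close>. The interior residual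
  is then small because \<open>u\<close> satisfies the equation, and the initial and lateral residuals are small by
  the trace inequalities on the bottom and on the lateral boundary.\<close>

section \<open>Smooth functions and bump functions\<close>

text \<open>The regularity of \<open>u\<close> is assumed on the cylinder up to \<open>t_i\<close>,
  whereas the equation and the traces refer to the cylinder up to \<open>T\<close> and come with
  weak derivatives and approximating sequences of their own. Uniqueness of weak derivatives and
  their restriction to open subsets identify all of these with one Borel family on the shorter
  cylinder. Traces are handled by inserting a smooth \<open>\<phi>\<close> from an approximating
  sequence: in \<open>(g - \<phi>) + (\<phi> - u_d)\<close> the first summand is smooth and small in
  H^1, so trace inequalities are proved for smooth functions alone. They integrate a one-dimensional
  estimate along a fixed direction, and the surface measure enters through upper bounds from
  explicit covers. Exponentials stand between smooth functions and networks because they form an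
  algebra that is preserved by convolution with compactly supported functions: powers of a single
  bump become kernels, and derivatives of the convolution fall on the function to be approximated,
  so that values and derivatives converge together.\<close>

lemma has_real_derivative_line:
  fixes f :: "'a::euclidean_space \<Rightarrow> real"
  assumes "(f has_derivative f') (at (x + s *\<^sub>R b))"
  shows "((\<lambda>s. f (x + s *\<^sub>R b)) has_real_derivative f' b) (at s)"
proof -
  have "((\<lambda>s. x + s *\<^sub>R b) has_derivative (\<lambda>s. s *\<^sub>R b)) (at s)"
    by (auto intro!: derivative_eq_intros)
  from has_derivative_compose[OF this assms]
  have "((\<lambda>s. f (x + s *\<^sub>R b)) has_derivative (\<lambda>s. f' (s *\<^sub>R b))) (at s)" .
  moreover have "linear f'" using assms has_derivative_linear by blast
  ultimately show ?thesis
    by (intro has_derivative_imp_has_field_derivative) (auto simp: linear_cmul)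
qed

text \<open>\<open>partial\<close> is a one-dimensional \<open>deriv\<close>, with a meaningful
  value only where the restriction to the line is differentiable. Its rules of calculus are obtained
  by passing to a Frechet derivative here.\<close>

lemma partial_eqI:
  fixes f :: "'a::euclidean_space \<Rightarrow> real"
  assumes "(f has_derivative f') (at x)"
  shows "partial b f x = f' b"
  unfolding partial_def
  by (rule DERIV_imp_deriv) (use has_real_derivative_line[of f f' x 0 b] assms in simp)

lemma has_derivative_partial:
  fixes f :: "'a::euclidean_space \<Rightarrow> real"
  assumes "f differentiable (at x)"
  shows "(f has_derivative (\<lambda>h. \<Sum>b\<in>Basis. (h \<bullet> b) * partial b f x)) (at x)"
proof -
  obtain f' where f': "(f has_derivative f') (at x)" using assms differentiable_def by blast
  have lin: "linear f'" using f' has_derivative_linear by blast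
  have "f' h = (\<Sum>b\<in>Basis. (h \<bullet> b) * partial b f x)" for h
  proof -
    have "f' h = f' (\<Sum>b\<in>Basis. (h \<bullet> b) *\<^sub>R b)" by (simp add: euclidean_representation)
    also have "\<dots> = (\<Sum>b\<in>Basis. (h \<bullet> b) * f' b)"
      using lin by (simp add: linear_sum linear_cmul)
    finally show ?thesis using partial_eqI[OF f'] by simp
  qed
  then have "f' = (\<lambda>h. \<Sum>b\<in>Basis. (h \<bullet> b) * partial b f x)" by auto
  with f' show ?thesis by simp
qed

lemma has_real_derivative_partial:
  fixes f :: "'a::euclidean_space \<Rightarrow> real"
  assumes "f differentiable (at (x + s *\<^sub>R b))"
  shows "((\<lambda>s. f (x + s *\<^sub>R b)) has_real_derivative partial b f (x + s *\<^sub>R b)) (at s)"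
  using assms has_real_derivative_line partial_eqI unfolding differentiable_def by metis

text \<open>The recursion in \<open>Ck\<close> asks for continuity only at the innermost level; for
  the function itself it comes from differentiability.\<close>

lemma Ck_SucD: "Ck (Suc k) f \<Longrightarrow> Ck k f"
proof (induction k arbitrary: f)
  case 0
  then show ?case
    by (auto simp: continuous_on_eq_continuous_at intro: differentiable_imp_continuous_within)
next
  case (Suc k)
  then show ?case by (metis Ck.simps(2))
qed

lemma Ck_mono: "Ck m f \<Longrightarrow> k \<le> m \<Longrightarrow> Ck k f"
  by (induction m) (auto simp: le_Suc_eq dest: Ck_SucD simp del: Ck.simps)

lemma Ck_continuous: "Ck k f \<Longrightarrow> continuous_on S f"
  using Ck_mono[of k f 0] continuous_on_subset by auto

lemma smooth_partial: "smooth f \<Longrightarrow> b \<in> Basis \<Longrightarrow> smooth (partial b f)"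
  unfolding smooth_def by (metis Ck.simps(2))

lemma smooth_differentiable: "smooth f \<Longrightarrow> f differentiable (at x)"
  unfolding smooth_def by (metis Ck.simps(2))

lemma smooth_continuous: "smooth f \<Longrightarrow> continuous_on S f"
  unfolding smooth_def using Ck_continuous by blast

section \<open>Calculus of \<open>partial\<close> and closure properties of
  \<open>Ck\<close>\<close>

lemma partial_const [simp]: "partial b (\<lambda>x. c) = (\<lambda>x. 0)"
  by (rule ext) (simp add: partial_def)

lemma Ck_const: "Ck k (\<lambda>x. c)"
  by (induction k arbitrary: c) auto

lemma partial_add:
  assumes "f differentiable (at x)" "g differentiable (at x)"
  shows "partial b (\<lambda>x. f x + g x) x = partial b f x + partial b g x"
proof -
  obtain f' g' where "(f has_derivative f') (at x)" "(g has_derivative g') (at x)"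
    using assms differentiable_def by blast
  then show ?thesis using partial_eqI has_derivative_add by metis
qed

lemma partial_mult:
  assumes "f differentiable (at x)" "g differentiable (at x)"
  shows "partial b (\<lambda>x. f x * g x) x = f x * partial b g x + partial b f x * g x"
proof -
  obtain f' g' where fg: "(f has_derivative f') (at x)" "(g has_derivative g') (at x)"
    using assms differentiable_def by blast
  show ?thesis using partial_eqI[OF has_derivative_mult[OF fg]] partial_eqI[OF fg(1)] partial_eqI[OF fg(2)] by simp
qed

lemma partial_cmult:
  assumes "f differentiable (at x)"
  shows "partial b (\<lambda>x. c * f x) x = c * partial b f x"
  using partial_mult[of "\<lambda>_. c" x f b] assms by simp

lemma partial_diff:
  assumes "f differentiable (at x)" "g differentiable (at x)"
  shows "partial b (\<lambda>x. f x - g x) x = partial b f x - partial b g x"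
  using partial_add[of f x "\<lambda>x. (-1) * g x" b] partial_cmult[of g x b "-1"] assms by simp

lemma Ck_add: "Ck k f \<Longrightarrow> Ck k g \<Longrightarrow> Ck k (\<lambda>x. f x + g x)"
proof (induction k arbitrary: f g)
  case 0 then show ?case by (auto intro: continuous_on_add)
next
  case (Suc k)
  have "partial b (\<lambda>x. f x + g x) = (\<lambda>x. partial b f x + partial b g x)" for b
    using Suc.prems partial_add by fastforce
  then show ?case using Suc by auto
qed

lemma Ck_mult: "Ck k f \<Longrightarrow> Ck k g \<Longrightarrow> Ck k (\<lambda>x. f x * g x)"
proof (induction k arbitrary: f g)
  case 0 then show ?case by (auto intro: continuous_on_mult)
next
  case (Suc k)
  have "partial b (\<lambda>x. f x * g x) = (\<lambda>x. f x * partial b g x + partial b f x * g x)" for b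
    using Suc.prems partial_mult by fastforce
  moreover have "Ck k f" "Ck k g" using Suc.prems Ck_SucD by auto
  ultimately show ?case using Suc by (auto intro!: Ck_add)
qed

lemma Ck_cmult: "Ck k f \<Longrightarrow> Ck k (\<lambda>x. c * f x)"
  by (rule Ck_mult[OF Ck_const])

lemma Ck_diff: "Ck k f \<Longrightarrow> Ck k g \<Longrightarrow> Ck k (\<lambda>x. f x - g x)"
  using Ck_add[of k f "\<lambda>x. (-1) * g x"] Ck_cmult[of k g "-1"] by simp

lemma Ck_uminus: "Ck k f \<Longrightarrow> Ck k (\<lambda>x. - f x)"
  using Ck_cmult[of k f "-1"] by simp

lemma Ck_sum: "(\<And>i. i \<in> I \<Longrightarrow> Ck k (f i)) \<Longrightarrow> Ck k (\<lambda>x. \<Sum>i\<in>I. f i x)"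
  by (induction I rule: infinite_finite_induct) (auto intro: Ck_const Ck_add simp del: Ck.simps)

text \<open>By the chain rule a derivative is the product of a composition of the same kind,
  \<open>partial 1 G\<close> after \<open>q\<close>, with a derivative of \<open>q\<close>; the
  induction therefore keeps \<open>G\<close> arbitrary.\<close>

lemma Ck_compose_real:
  fixes G :: "real \<Rightarrow> real"
  shows "Ck k G \<Longrightarrow> Ck k q \<Longrightarrow> Ck k (\<lambda>x. G (q x))"
proof (induction k arbitrary: G q)
  case 0 then show ?case using continuous_on_compose2[of UNIV G UNIV q] by auto
next
  case (Suc k)
  have eq: "partial b (\<lambda>x. G (q x)) x = partial 1 G (q x) * partial b q x" 
   and dif: "(\<lambda>x. G (q x)) differentiable (at x)" for b x
  proof -
    obtain q' where q': "(q has_derivative q') (at x)" using Suc.prems differentiable_def by fastforce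
    have "(G has_derivative (\<lambda>h. \<Sum>b\<in>Basis. (h \<bullet> b) * partial b G (q x))) (at (q x))"
      using Suc.prems by (intro has_derivative_partial) auto
    from has_derivative_compose[OF q' this] 
    show "partial b (\<lambda>x. G (q x)) x = partial 1 G (q x) * partial b q x" 
      "(\<lambda>x. G (q x)) differentiable (at x)"
      using partial_eqI[OF q', of b] by (auto simp: partial_eqI differentiable_def mult.commute)
  qed
  have "Ck k q" "\<And>b. b \<in> Basis \<Longrightarrow> Ck k (partial b q)" "Ck k (partial 1 G)"
    using Suc.prems Ck_SucD[OF Suc.prems(2)] by auto
  then have "Ck k (\<lambda>x. partial 1 G (q x) * partial b q x)" if "b \<in> Basis" for b
    using that Suc.IH by (intro Ck_mult) auto
  moreover have "partial b (\<lambda>x. G (q x)) = (\<lambda>x. partial 1 G (q x) * partial b q x)" for b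
    using eq by auto
  ultimately show ?case using dif by (simp)
qed

lemma partial_inner: "partial b (\<lambda>x. x \<bullet> a) = (\<lambda>x. b \<bullet> a)"
proof
  fix x show "partial b (\<lambda>x. x \<bullet> a) x = b \<bullet> a"
    by (rule partial_eqI) (auto intro!: derivative_eq_intros)
qed

lemma Ck_inner: "Ck k (\<lambda>x. x \<bullet> a)"
  by (cases k) (auto simp: partial_inner Ck_const intro!: continuous_intros)

lemma Ck_inner_self: "Ck k (\<lambda>x. (x - p) \<bullet> (x - p))"
proof -
  have "(\<lambda>x. (x - p) \<bullet> (x - p)) = (\<lambda>x. \<Sum>b\<in>Basis. (x \<bullet> b - p \<bullet> b) * (x \<bullet> b - p \<bullet> b))"
  proof
    fix x show "(x - p) \<bullet> (x - p) = (\<Sum>b\<in>Basis. (x \<bullet> b - p \<bullet> b) * (x \<bullet> b - p \<bullet> b))"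
      by (subst euclidean_inner) (simp add: inner_diff_left)
  qed
  then show ?thesis by (auto intro!: Ck_sum Ck_mult Ck_diff Ck_inner Ck_const simp del: Ck.simps)
qed

text \<open>The derivative of a reciprocal is a polynomial in the reciprocal and the derivative of
  \<open>f\<close>, so the induction hypothesis for the reciprocal itself, one order lower, closes
  the argument.\<close>

lemma Ck_inverse:
  assumes nz: "\<And>x. f x \<noteq> 0"
  shows "Ck k f \<Longrightarrow> Ck k (\<lambda>x. inverse (f x))"
proof (induction k)
  case 0 then show ?case using nz by (auto intro: continuous_on_inverse)
next
  case (Suc k)
  have "partial b (\<lambda>x. inverse (f x)) x = (-1) * (partial b f x * (inverse (f x) * inverse (f x)))" 
    and dif: "(\<lambda>x. inverse (f x)) differentiable (at x)" for b x
  proof -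
    obtain f' where f': "(f has_derivative f') (at x)" using Suc.prems differentiable_def by fastforce
    have "((\<lambda>x. inverse (f x)) has_derivative (\<lambda>h. - (inverse (f x) * f' h * inverse (f x)))) (at x)"
      by (rule Deriv.has_derivative_inverse[OF nz f'])
    from partial_eqI[OF this] this partial_eqI[OF f']
    show "partial b (\<lambda>x. inverse (f x)) x = (-1) * (partial b f x * (inverse (f x) * inverse (f x)))"
      "(\<lambda>x. inverse (f x)) differentiable (at x)"
      by (auto simp: differentiable_def)
  qed
  then have "partial b (\<lambda>x. inverse (f x)) = (\<lambda>x. (-1) * (partial b f x * (inverse (f x) * inverse (f x))))" for b
    by auto
  moreover have "Ck k (\<lambda>x. inverse (f x))" using Suc.IH[OF Ck_SucD[OF Suc.prems]] .
  ultimately show ?case using Suc.prems dif by (auto intro!: Ck_mult Ck_uminus)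
qed

lemma partial_reflect:
  assumes "f differentiable (at (c - y))"
  shows "partial b (\<lambda>y. f (c - y)) y = - partial b f (c - y)" "(\<lambda>y. f (c - y)) differentiable (at y)"
proof -
  obtain f' where f': "(f has_derivative f') (at (c - y))" using assms differentiable_def by blast
  have "((\<lambda>y. c - y) has_derivative (\<lambda>h. - h)) (at y)" by (auto intro!: derivative_eq_intros)
  from has_derivative_compose[OF this f'] 
  have d: "((\<lambda>y. f (c - y)) has_derivative (\<lambda>h. f' (- h))) (at y)" .
  have "linear f'" using f' has_derivative_linear by blast
  then show "partial b (\<lambda>y. f (c - y)) y = - partial b f (c - y)" 
    using partial_eqI[OF d] partial_eqI[OF f'] by (simp add: linear_neg)
  show "(\<lambda>y. f (c - y)) differentiable (at y)" using d differentiable_def by blast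
qed

lemma Ck_reflect: "Ck k f \<Longrightarrow> Ck k (\<lambda>y. f (c - y))"
proof (induction k arbitrary: f)
  case 0 then show ?case by (auto intro!: continuous_on_compose2[of UNIV f] continuous_intros)
next
  case (Suc k)
  have "partial b (\<lambda>y. f (c - y)) = (\<lambda>y. - partial b f (c - y))" for b
    using Suc.prems partial_reflect by fastforce
  moreover have "(\<lambda>y. f (c - y)) differentiable (at y)" for y 
    using Suc.prems partial_reflect by fastforce
  ultimately show ?case using Suc by (auto intro!: Ck_uminus)
qed

lemma partial_translate: "partial b (\<lambda>x. f (x + c)) = (\<lambda>x. partial b f (x + c))"
  by (rule ext) (simp add: partial_def ac_simps)

lemma Ck_translate: "Ck k f \<Longrightarrow> Ck k (\<lambda>x. f (x + c))"
proof (induction k arbitrary: f)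
  case 0 then show ?case by (auto intro!: continuous_on_compose2[of UNIV f] continuous_intros)
next
  case (Suc k)
  have "(\<lambda>x. f (x + c)) differentiable (at x)" for x
  proof -
    have "((\<lambda>x. x + c) has_derivative (\<lambda>h. h)) (at x)" by (auto intro!: derivative_eq_intros)
    moreover have "f differentiable (at (x + c))" using Suc.prems by simp
    ultimately show ?thesis
      using has_derivative_compose[of "\<lambda>x. x + c"] unfolding differentiable_def by blast
  qed
  then show ?case using Suc by (auto simp: partial_translate)
qed

lemma partial_cong_open:
  assumes "open S" "x \<in> S" "\<And>y. y \<in> S \<Longrightarrow> f y = g y" 
  shows "partial b f x = partial b g x"
proof -
  have "\<forall>\<^sub>F s in nhds 0. x + s *\<^sub>R b \<in> S"
  proof -
    have "((\<lambda>s. x + s *\<^sub>R b) \<longlongrightarrow> x + 0 *\<^sub>R b) (nhds 0)" by (intro tendsto_intros filterlim_ident)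
    then show ?thesis using assms by (simp add: topological_tendstoD)
  qed
  then have "\<forall>\<^sub>F s in nhds 0. f (x + s *\<^sub>R b) = g (x + s *\<^sub>R b)"
    by eventually_elim (use assms in auto)
  then show ?thesis unfolding partial_def by (intro deriv_cong_ev) auto
qed

lemma partial_zero_outside:
  assumes "closed K" "\<And>y. y \<notin> K \<Longrightarrow> f y = 0" "x \<notin> K"
  shows "partial b f x = 0"
  using partial_cong_open[of "- K" x f "\<lambda>_. 0" b] assms by auto

lemma smooth_add: "smooth f \<Longrightarrow> smooth g \<Longrightarrow> smooth (\<lambda>x. f x + g x)"
  and smooth_mult: "smooth f \<Longrightarrow> smooth g \<Longrightarrow> smooth (\<lambda>x. f x * g x)"
  and smooth_cmult: "smooth f \<Longrightarrow> smooth (\<lambda>x. c * f x)"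
  and smooth_diff: "smooth f \<Longrightarrow> smooth g \<Longrightarrow> smooth (\<lambda>x. f x - g x)"
  and smooth_const: "smooth (\<lambda>x. c)"
  and smooth_reflect: "smooth f \<Longrightarrow> smooth (\<lambda>x. f (a - x))"
  unfolding smooth_def by (auto intro: Ck_add Ck_mult Ck_cmult Ck_diff Ck_const Ck_reflect simp del: Ck.simps)

text \<open>Derivatives of \<open>exp (- 1/t)\<close> have the form \<open>p (1/t) * exp (- 1/t)\<close> with a polynomial \<open>p\<close>,
  so this family is closed under differentiation.\<close>

definition flat_exp :: "real poly \<Rightarrow> real \<Rightarrow> real" where
  "flat_exp p t = (if t > 0 then poly p (inverse t) * exp (- inverse t) else 0)"

lemma tendsto_poly_times_exp: "((\<lambda>x::real. poly p x * exp (- x)) \<longlongrightarrow> 0) at_top"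
proof -
  have "((\<lambda>x::real. \<Sum>i\<le>degree p. coeff p i * (x ^ i / exp x)) \<longlongrightarrow> (\<Sum>i\<le>degree p. coeff p i * 0)) at_top"
    by (intro tendsto_intros tendsto_power_div_exp_0)
  moreover have "poly p x * exp (- x) = (\<Sum>i\<le>degree p. coeff p i * (x ^ i / exp x))" for x :: real
    by (simp add: poly_altdef sum_distrib_right exp_minus divide_inverse mult.assoc)
  ultimately show ?thesis by simp
qed

text \<open>For \<open>t > 0\<close> the chain rule yields \<open>1/t\<close> squared times
  \<open>(p - p')(1/t)\<close>, whence the factor \<open>[:0,0,1:]\<close>. At 0 the right
  difference quotient is again a polynomial in \<open>1/h\<close> times \<open>exp (- 1/h)\<close>,
  which tends to 0.\<close>

lemma flat_exp_deriv:
  "(flat_exp p has_real_derivative flat_exp ([:0,0,1:] * (p - pderiv p)) t) (at t)"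
proof -
  consider "t > 0" | "t < 0" | "t = 0" by linarith
  then show ?thesis
  proof cases
    case 1
    have "((\<lambda>t. poly p (inverse t) * exp (- inverse t)) has_real_derivative flat_exp ([:0,0,1:] * (p - pderiv p)) t) (at t)"
      using 1 by (auto intro!: derivative_eq_intros DERIV_chain'[OF _ poly_DERIV] 
        simp: flat_exp_def field_simps power2_eq_square)
    moreover have "\<And>s. s \<in> {0<..} \<Longrightarrow> poly p (inverse s) * exp (- inverse s) = flat_exp p s" by (simp add: flat_exp_def)
    ultimately show ?thesis using 1 has_field_derivative_transform_within_open[of _ _ t "{0<..}" "flat_exp p"] by auto
  next
    case 2
    have "((\<lambda>t. 0) has_real_derivative 0) (at t)" by simp
    moreover have "\<And>s. s \<in> {..<0} \<Longrightarrow> 0 = flat_exp p s" by (simp add: flat_exp_def)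
    ultimately show ?thesis using 2 has_field_derivative_transform_within_open[of "\<lambda>_. 0" 0 t "{..<0}" "flat_exp p"] 
      by (auto simp: flat_exp_def)
  next
    case 3
    have "((\<lambda>h. flat_exp p h / h) \<longlongrightarrow> 0) (at_right 0)"
    proof -
      have "((\<lambda>h::real. poly ([:0,1:] * p) (inverse h) * exp (- inverse h)) \<longlongrightarrow> 0) (at_right 0)"
        using filterlim_compose[OF tendsto_poly_times_exp filterlim_inverse_at_top_right] .
      moreover have "\<forall>\<^sub>F h in at_right 0. poly ([:0,1:] * p) (inverse h) * exp (- inverse h) = flat_exp p h / h"
        unfolding eventually_at_right_field by (intro exI[of _ 1]) (simp add: flat_exp_def divide_inverse mult_ac)
      ultimately show ?thesis by (rule Lim_transform_eventually)
    qed
    moreover have "((\<lambda>h. flat_exp p h / h) \<longlongrightarrow> 0) (at_left 0)"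
      by (rule tendsto_eventually, unfold eventually_at_left_field, intro exI[of _ "-1"])
        (simp add: flat_exp_def)
    ultimately have "((\<lambda>h. flat_exp p h / h) \<longlongrightarrow> 0) (at 0)"
      by (rule filterlim_split_at[rotated])
    then show ?thesis using 3 by (simp add: DERIV_def flat_exp_def)
  qed
qed

lemma Ck_flat_exp: "Ck k (flat_exp p)"
proof (induction k arbitrary: p)
  case 0
  then show ?case using DERIV_isCont[OF flat_exp_deriv] by (simp add: continuous_at_imp_continuous_on)
next
  case (Suc k)
  have "partial 1 (flat_exp p) = flat_exp ([:0,0,1:] * (p - pderiv p))"
    by (rule ext, subst partial_eqI[OF flat_exp_deriv[unfolded has_field_derivative_def]]) simp
  moreover have "flat_exp p differentiable (at x)" for x 
    using flat_exp_deriv[of p x] real_differentiable_def by blast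
  ultimately show ?case using Suc by simp
qed

section \<open>Cutoff functions and mollifiers\<close>

lemma smooth_bump_ball:
  fixes p :: "'a::euclidean_space"
  assumes "0 < r" "r < R"
  obtains h where "smooth h" "\<And>x. 0 \<le> h x" "\<And>x. h x \<le> 1"
    "\<And>x. dist x p \<le> r \<Longrightarrow> h x = 1" "\<And>x. dist x p \<ge> R \<Longrightarrow> h x = 0"
proof
  define g where "g = flat_exp 1"
  have g0: "g t \<ge> 0" "t \<le> 0 \<Longrightarrow> g t = 0" "t > 0 \<Longrightarrow> g t > 0" for t by (auto simp: g_def flat_exp_def)
  \<comment> \<open>\<open>q\<close> is affine in the squared distance to \<open>p\<close>, equal to
    1 on the sphere of radius \<open>r\<close> and to 0 on that of radius \<open>R\<close>. Since
    \<open>q\<close> and \<open>1 - q\<close> are never both nonpositive, the denominator of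
    \<open>h\<close> is positive everywhere.\<close>
  define q where "q x = (R\<^sup>2 - (x - p) \<bullet> (x - p)) * inverse (R\<^sup>2 - r\<^sup>2)" for x :: 'a
  define h where "h x = g (q x) * inverse (g (q x) + g (1 - q x))" for x
  have pos: "g (q x) + g (1 - q x) > 0" for x
    using g0(1)[of "q x"] g0(1)[of "1 - q x"] g0(3)[of "q x"] g0(3)[of "1 - q x"] by linarith
  have rR: "R\<^sup>2 - r\<^sup>2 > 0" using assms by (simp add: power_strict_mono)
  have Ckq: "Ck k q" for k unfolding q_def
    by (subst mult.commute) (intro Ck_cmult Ck_diff Ck_const Ck_inner_self)
  have "Ck k g" for k unfolding g_def by (rule Ck_flat_exp)
  then have "Ck k (\<lambda>x. g (q x))" "Ck k (\<lambda>x. g (1 - q x))" for k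
    using Ck_compose_real[OF _ Ckq] Ck_compose_real[of _ g "\<lambda>x. 1 - q x"] Ck_diff[OF Ck_const Ckq]
    by blast+
  then have "Ck k h" for k unfolding h_def
    by (intro Ck_mult Ck_inverse Ck_add) (use pos less_imp_neq in metis)+
  then show "smooth h" by (simp add: smooth_def)
  show "0 \<le> h x" "h x \<le> 1" for x using pos[of x] g0(1)[of "q x"] g0(1)[of "1 - q x"] by (auto simp: h_def field_simps)
  have d: "(x - p) \<bullet> (x - p) = (dist x p)\<^sup>2" for x by (simp add: dist_norm power2_norm_eq_inner)
  show "h x = 1" if "dist x p \<le> r" for x
  proof -
    have "(dist x p)\<^sup>2 \<le> r\<^sup>2" using that by (simp add: power_mono)
    then have "q x \<ge> 1" using rR by (simp add: q_def d field_simps)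
    then show ?thesis using g0(2)[of "1 - q x"] pos[of x] by (simp add: h_def)
  qed
  show "h x = 0" if "dist x p \<ge> R" for x
  proof -
    have "(dist x p)\<^sup>2 \<ge> R\<^sup>2" using that assms by (intro power_mono) auto
    then have "q x \<le> 0" using rR by (simp add: q_def d field_simps)
    then show ?thesis using g0(2)[of "q x"] by (simp add: h_def)
  qed
qed

lemma smooth_mollifier:
  assumes "\<delta> > 0"
  obtains \<rho> :: "'a::euclidean_space \<Rightarrow> real" where "smooth \<rho>" "\<And>x. 0 \<le> \<rho> x" 
    "\<And>x. norm x \<ge> \<delta> \<Longrightarrow> \<rho> x = 0" "integrable lborel \<rho>" "(\<integral>x. \<rho> x \<partial>lborel) = 1"
proof -
  obtain h :: "'a \<Rightarrow> real" where h: "smooth h" "\<And>x. 0 \<le> h x" "\<And>x. h x \<le> 1"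
    "\<And>x. dist x 0 \<le> \<delta>/2 \<Longrightarrow> h x = 1" "\<And>x. dist x 0 \<ge> \<delta> \<Longrightarrow> h x = 0"
    using smooth_bump_ball[of "\<delta>/2" \<delta> 0] assms by auto
  have cont: "continuous_on UNIV h" using h(1) by (rule smooth_continuous)
  then have bm: "h \<in> borel_measurable borel" by (rule borel_measurable_continuous_onI)
  have int: "integrable lborel h"
  proof (rule Bochner_Integration.integrable_bound)
    show "integrable lborel (indicat_real (cball 0 \<delta> :: 'a set))" 
      by (simp add: integrable_indicator_iff emeasure_lborel_cball_finite[unfolded infinity_ennreal_def])
    show "AE x in lborel. norm (h x) \<le> norm (indicat_real (cball 0 \<delta>) x)"
      using h by (auto simp: indicator_def)
  qed (use bm in simp)
  have "(\<integral>x. indicat_real (cball 0 (\<delta>/2) :: 'a set) x \<partial>lborel) \<le> (\<integral>x. h x \<partial>lborel)"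
  proof (rule integral_mono)
    show "integrable lborel (indicat_real (cball 0 (\<delta>/2) :: 'a set))"
      by (simp add: integrable_indicator_iff emeasure_lborel_cball_finite[unfolded infinity_ennreal_def])
  qed (use int h in \<open>auto simp: indicator_def\<close>)
  moreover have "(\<integral>x. indicat_real (cball 0 (\<delta>/2) :: 'a set) x \<partial>lborel) > 0"
    using content_cball_pos[of "\<delta>/2" "0::'a"] assms by simp
  ultimately have pos: "(\<integral>x. h x \<partial>lborel) > 0" by linarith
  show ?thesis
  proof (rule that[of "\<lambda>x. inverse (\<integral>x. h x \<partial>lborel) * h x"])
    show "smooth (\<lambda>x. inverse (\<integral>x. h x \<partial>lborel) * h x)" by (rule smooth_cmult[OF h(1)])
  qed (use pos h int in auto)
qed

section \<open>Mollification\<close>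

lemma lborel_distr_reflect: "distr lborel borel (\<lambda>y. c - y) = (lborel :: 'a::euclidean_space measure)"
  by (subst (2) lborel_affine[of "-1" c]) (simp_all add: density_1)

lemma
  fixes f :: "'a::euclidean_space \<Rightarrow> real"
  assumes f[measurable]: "f \<in> borel_measurable borel"
  shows integrable_translate_iff: "integrable lborel (\<lambda>x. f (x + c)) \<longleftrightarrow> integrable lborel f"
    and integral_translate: "(\<integral>x. f (x + c) \<partial>lborel) = (\<integral>x. f x \<partial>lborel)"
    and integrable_reflect_iff: "integrable lborel (\<lambda>x. f (c - x)) \<longleftrightarrow> integrable lborel f"
    and integral_reflect: "(\<integral>x. f (c - x) \<partial>lborel) = (\<integral>x. f x \<partial>lborel)"
  using integrable_distr_eq[of "(+) c" lborel borel f] integral_distr[of "(+) c" lborel borel f]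
    integrable_distr_eq[of "\<lambda>x. c - x" lborel borel f] integral_distr[of "\<lambda>x. c - x" lborel borel f]
  by (simp_all add: lborel_distr_plus lborel_distr_reflect add.commute)

section \<open>Continuity of translations in L^1 and L^2\<close>

text \<open>Regularity from both sides gives an open superset and a closed subset; the latter
  becomes compact by intersection with a large ball, beyond which only little of the finite measure
  of \<open>A\<close> is left.\<close>

lemma finite_measure_compact_open_approx:
  fixes A :: "'a::euclidean_space set"
  assumes A: "A \<in> sets borel" "emeasure lborel A < \<infinity>" and "e > 0"
  obtains K V where "compact K" "open V" "K \<subseteq> A" "A \<subseteq> V" "emeasure lborel (V - K) < ennreal e"
proof -
  have Al: "A \<in> sets lebesgue" using A by simp
  have e3: "e/4 > 0" using \<open>e > 0\<close> by simp
  from sets_lebesgue_outer_open[OF Al e3] obtain V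
    where V: "open V" "A \<subseteq> V" "emeasure lebesgue (V - A) < ennreal (e/4)" by metis
  from sets_lebesgue_inner_closed[OF Al e3] obtain T
    where T: "closed T" "T \<subseteq> A" "emeasure lebesgue (A - T) < ennreal (e/4)" by metis
  have "(\<lambda>n. emeasure lborel (A - cball 0 (real n))) \<longlonglongrightarrow> emeasure lborel (\<Inter>n. A - cball 0 (real n))"
  proof (rule Lim_emeasure_decseq)
    show "decseq (\<lambda>n. A - cball 0 (real n))" 
      unfolding decseq_def by (intro allI impI Diff_mono order_refl subset_cball) simp
    fix i
    have "emeasure lborel (A - cball 0 (real i)) \<le> emeasure lborel A"
      using A(1) by (intro emeasure_mono) simp_all
    then show "emeasure lborel (A - cball 0 (real i)) \<noteq> \<infinity>" using A(2) leD by (metis infinity_ennreal_def)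
  next
    show "range (\<lambda>n. A - cball 0 (real n)) \<subseteq> sets lborel"
      using A(1) by (auto intro!: sets.Diff)
  qed
  moreover have "(\<Inter>n. A - cball 0 (real n)) = {}" by (auto simp: real_arch_simple)
  ultimately have "(\<lambda>n. emeasure lborel (A - cball 0 (real n))) \<longlonglongrightarrow> 0" by (simp only: emeasure_empty)
  then have "\<forall>\<^sub>F n in sequentially. emeasure lborel (A - cball 0 (real n)) < ennreal (e/4)"
    by (rule order_tendstoD) (use \<open>e > 0\<close> in simp)
  then obtain n where n: "emeasure lborel (A - cball 0 (real n)) < ennreal (e/4)"
    by (auto simp: eventually_sequentially)
  show ?thesis
  proof
    show "compact (T \<inter> cball 0 (real n))" using T by (simp add: closed_Int_compact)
    have [measurable]: "V \<in> sets borel" "T \<in> sets borel" using V T by auto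
    note [measurable] = A(1)
    have "emeasure lborel (V - T \<inter> cball 0 (real n)) \<le> emeasure lborel (((V - A) \<union> (A - T)) \<union> (A - cball 0 (real n)))"
      using T V by (intro emeasure_mono) auto
    also have "\<dots> \<le> emeasure lborel ((V - A) \<union> (A - T)) + emeasure lborel (A - cball 0 (real n))"
      by (intro emeasure_subadditive) auto
    also have "\<dots> \<le> emeasure lborel (V - A) + emeasure lborel (A - T) + emeasure lborel (A - cball 0 (real n))"
      by (intro add_right_mono emeasure_subadditive) auto
    also have "\<dots> \<le> ennreal (e/4) + ennreal (e/4) + ennreal (e/4)"
      using V(3) T(3) n \<open>V \<in> sets borel\<close> \<open>T \<in> sets borel\<close> A(1) by (intro add_mono less_imp_le) simp_all
    also have "\<dots> = ennreal (3 * e / 4)" using \<open>e > 0\<close> by (simp flip: ennreal_plus)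
    also have "\<dots> < ennreal e" using \<open>e > 0\<close> by (intro ennreal_lessI) auto
    finally show "emeasure lborel (V - T \<inter> cball 0 (real n)) < ennreal e" .
  qed (use V T in auto)
qed

definition L1_shift_cont :: "('a::euclidean_space \<Rightarrow> real) \<Rightarrow> bool" where
  "L1_shift_cont f \<longleftrightarrow> (\<forall>e>0. \<exists>\<eta>>0. \<forall>z. norm z < \<eta> \<longrightarrow> (\<integral>x. \<bar>f (x + z) - f x\<bar> \<partial>lborel) < e)"

text \<open>Induction along the construction of integrable functions. For an indicator, squeeze
  \<open>A\<close> between a compact \<open>K\<close> and an open \<open>V\<close>: a shift shorter
  than the distance from \<open>K\<close> to the complement of \<open>V\<close> changes the
  indicator only at points which, before or after the shift, lie in the small set
  \<open>V - K\<close>. The property survives limits because translation preserves the integral of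
  the error.\<close>

lemma L1_shift_cont_integrable:
  fixes f :: "'a::euclidean_space \<Rightarrow> real"
  assumes "integrable lborel f"
  shows "L1_shift_cont f"
  using assms
proof (induction rule: integrable_induct)
  case (base A c)
  show ?case unfolding L1_shift_cont_def
  proof (intro allI impI)
    fix e :: real assume "e > 0"
    \<comment> \<open>The set \<open>V - K\<close> and its translate contribute at most
      \<open>\<bar>c\<bar> * e'\<close> each.\<close>
    define e' where "e' = e / (4 * (\<bar>c\<bar> + 1))"
    have e': "e' > 0" using \<open>e > 0\<close> by (simp add: e'_def add_nonneg_pos)
    obtain K V where KV: "compact K" "open V" "K \<subseteq> A" "A \<subseteq> V" "emeasure lborel (V - K) < ennreal e'"
      using finite_measure_compact_open_approx[of A e'] base e' by auto
    obtain \<eta> where \<eta>: "\<eta> > 0" "(\<Union>x\<in>K. cball x \<eta>) \<subseteq> V"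
      using compact_subset_open_imp_cball_epsilon_subset[OF KV(1,2)] KV(3,4) by blast
    have [measurable]: "V - K \<in> sets borel" "A \<in> sets borel" using KV base by (auto simp: borel_compact)
    have iVK: "integrable lborel (indicat_real (V - K))"
      using less_trans[OF KV(5) ennreal_less_top] by (simp add: integrable_indicator_iff)
    have mVK: "(\<integral>x. indicat_real (V - K) x \<partial>lborel) \<le> e'"
    proof -
      have "measure lborel (V - K) \<le> e'"
        unfolding measure_def using KV(5) e' by (intro enn2real_leI) simp_all
      then show ?thesis by simp
    qed
    show "\<exists>\<eta>>0. \<forall>z. norm z < \<eta> \<longrightarrow> (\<integral>x. \<bar>indicat_real A (x + z) *\<^sub>R c - indicat_real A x *\<^sub>R c\<bar> \<partial>lborel) < e"
    proof (intro exI[of _ \<eta>] conjI \<eta>(1) allI impI)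
      fix z :: 'a assume z: "norm z < \<eta>"
      have iz: "integrable lborel (\<lambda>x. indicat_real (V - K) (x + z))"
        using iVK by (subst integrable_translate_iff) auto
      have pw: "\<bar>indicat_real A (x + z) *\<^sub>R c - indicat_real A x *\<^sub>R c\<bar> \<le> \<bar>c\<bar> * (indicat_real (V - K) (x + z) + indicat_real (V - K) x)" for x
      proof -
        have "x + z \<in> V" if "x \<in> K"
        proof -
          have "x + z \<in> cball x \<eta>" using z by (simp add: dist_norm)
          then show ?thesis using \<eta>(2) that by blast
        qed
        moreover have "x \<in> V" if "x + z \<in> K" 
        proof -
          have "x \<in> cball (x + z) \<eta>" using z by (simp add: dist_norm)
          then show ?thesis using \<eta>(2) that by blast
        qed
        ultimately show ?thesis using KV(3,4) by (auto simp: indicator_def)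
      qed
      have "(\<integral>x. \<bar>indicat_real A (x + z) *\<^sub>R c - indicat_real A x *\<^sub>R c\<bar> \<partial>lborel)
         \<le> (\<integral>x. \<bar>c\<bar> * (indicat_real (V - K) (x + z) + indicat_real (V - K) x) \<partial>lborel)"
      proof (rule integral_mono)
        show i: "integrable lborel (\<lambda>x. \<bar>c\<bar> * (indicat_real (V - K) (x + z) + indicat_real (V - K) x))"
          using iz iVK by simp
        show "integrable lborel (\<lambda>x. \<bar>indicat_real A (x + z) *\<^sub>R c - indicat_real A x *\<^sub>R c\<bar>)"
          by (rule Bochner_Integration.integrable_bound[OF i]) (use pw in \<open>auto simp: abs_mult\<close>)
      qed (use pw in auto)
      also have "\<dots> = \<bar>c\<bar> * (2 * (\<integral>x. indicat_real (V - K) x \<partial>lborel))"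
        using iz iVK integral_translate[of "indicat_real (V - K)" z] by simp
      also have "\<dots> \<le> \<bar>c\<bar> * (2 * e')" using mVK by (intro mult_left_mono) auto
      also have "\<dots> < e" using \<open>e > 0\<close> by (simp add: e'_def field_simps add_pos_nonneg)
      finally show "(\<integral>x. \<bar>indicat_real A (x + z) *\<^sub>R c - indicat_real A x *\<^sub>R c\<bar> \<partial>lborel) < e" .
    qed
  qed
next
  case (add f g)
  show ?case unfolding L1_shift_cont_def
  proof (intro allI impI)
    fix e :: real assume "e > 0"
    then have "e/2 > 0" by simp
    obtain \<eta>1 where \<eta>1: "\<eta>1 > 0" "\<And>z. norm z < \<eta>1 \<Longrightarrow> (\<integral>x. \<bar>f (x + z) - f x\<bar> \<partial>lborel) < e/2"
      using add(3)[unfolded L1_shift_cont_def, rule_format, OF \<open>e/2 > 0\<close>] by blast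
    obtain \<eta>2 where \<eta>2: "\<eta>2 > 0" "\<And>z. norm z < \<eta>2 \<Longrightarrow> (\<integral>x. \<bar>g (x + z) - g x\<bar> \<partial>lborel) < e/2"
      using add(4)[unfolded L1_shift_cont_def, rule_format, OF \<open>e/2 > 0\<close>] by blast
    note \<eta> = \<eta>1 \<eta>2
    have "(\<integral>x. \<bar>(f (x + z) + g (x + z)) - (f x + g x)\<bar> \<partial>lborel) < e" if z: "norm z < min \<eta>1 \<eta>2" for z
    proof -
      have if_: "integrable lborel (\<lambda>x. f (x + z))" "integrable lborel (\<lambda>x. g (x + z))"
        using add(1,2) by (auto simp: integrable_translate_iff borel_measurable_integrable)
      have "(\<integral>x. \<bar>(f (x + z) + g (x + z)) - (f x + g x)\<bar> \<partial>lborel) 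
        \<le> (\<integral>x. \<bar>f (x + z) - f x\<bar> + \<bar>g (x + z) - g x\<bar> \<partial>lborel)"
        using if_ add(1,2) by (intro integral_mono) auto
      also have "\<dots> = (\<integral>x. \<bar>f (x + z) - f x\<bar> \<partial>lborel) + (\<integral>x. \<bar>g (x + z) - g x\<bar> \<partial>lborel)"
        using if_ add(1,2) by (intro Bochner_Integration.integral_add) auto
      finally show ?thesis using \<eta>(2)[of z] \<eta>(4)[of z] z by simp
    qed
    then show "\<exists>\<eta>>0. \<forall>z. norm z < \<eta> \<longrightarrow> (\<integral>x. \<bar>(f (x + z) + g (x + z)) - (f x + g x)\<bar> \<partial>lborel) < e"
      using \<eta> by (intro exI[of _ "min \<eta>1 \<eta>2"]) auto
  qed
next
  case (lim f s)
  \<comment> \<open>The approximants of the induction rule satisfy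
    \<open>norm (s i x) \<le> 2 * norm (f x)\<close>, which explains the dominating function
    below.\<close>
  have "(\<lambda>i. \<integral>x. \<bar>s i x - f x\<bar> \<partial>lborel) \<longlonglongrightarrow> (\<integral>x. 0 \<partial>(lborel::'a measure))"
  proof (rule integral_dominated_convergence[where w="\<lambda>x. 3 * \<bar>f x\<bar>"])
    show "AE x in lborel. (\<lambda>i. \<bar>s i x - f x\<bar>) \<longlonglongrightarrow> 0"
    proof (rule AE_I2)
      fix x
      have "(\<lambda>i. s i x) \<longlonglongrightarrow> f x" using lim(2) by simp
      then show "(\<lambda>i. \<bar>s i x - f x\<bar>) \<longlonglongrightarrow> 0" by (intro tendsto_rabs_zero LIM_zero)
    qed
    show "AE x in lborel. norm \<bar>s i x - f x\<bar> \<le> 3 * \<bar>f x\<bar>" for i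
    proof (rule AE_I2)
      fix x show "norm \<bar>s i x - f x\<bar> \<le> 3 * \<bar>f x\<bar>" using lim(3)[of x i] by simp
    qed
    show "(\<lambda>x. 0) \<in> borel_measurable (lborel::'a measure)" by simp
    show "(\<lambda>x. \<bar>s i x - f x\<bar>) \<in> borel_measurable lborel" for i
      using lim(1)[of i] lim(4) by (simp add: borel_measurable_integrable)
    show "integrable lborel (\<lambda>x. 3 * \<bar>f x\<bar>)" using lim(4) by simp
  qed
  then have tend: "(\<lambda>i. \<integral>x. \<bar>s i x - f x\<bar> \<partial>lborel) \<longlonglongrightarrow> 0" by simp
  show ?case unfolding L1_shift_cont_def
  proof (intro allI impI)
    fix e :: real assume "e > 0"
    then have "e/3 > 0" by simp
    then obtain i where i: "(\<integral>x. \<bar>s i x - f x\<bar> \<partial>lborel) < e/3"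
      using order_tendstoD(2)[OF tend \<open>e/3 > 0\<close>] by (auto simp: eventually_sequentially)
    obtain \<eta> where \<eta>: "\<eta> > 0" "\<And>z. norm z < \<eta> \<Longrightarrow> (\<integral>x. \<bar>s i (x + z) - s i x\<bar> \<partial>lborel) < e/3"
      using lim(5)[of i, unfolded L1_shift_cont_def, rule_format, OF \<open>e/3 > 0\<close>] by blast
    have "(\<integral>x. \<bar>f (x + z) - f x\<bar> \<partial>lborel) < e" if z: "norm z < \<eta>" for z
    proof -
      have ii: "integrable lborel (\<lambda>x. f (x + z))" "integrable lborel (\<lambda>x. s i (x + z))"
        using lim(1)[of i] lim(4) by (auto simp: integrable_translate_iff borel_measurable_integrable)
      have "(\<integral>x. \<bar>f (x + z) - f x\<bar> \<partial>lborel) 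
        \<le> (\<integral>x. \<bar>s i (x + z) - f (x + z)\<bar> + \<bar>s i (x + z) - s i x\<bar> + \<bar>s i x - f x\<bar> \<partial>lborel)"
        using ii lim(1)[of i] lim(4) by (intro integral_mono) auto
      also have "\<dots> = (\<integral>x. \<bar>s i (x + z) - f (x + z)\<bar> \<partial>lborel) + (\<integral>x. \<bar>s i (x + z) - s i x\<bar> \<partial>lborel) + (\<integral>x. \<bar>s i x - f x\<bar> \<partial>lborel)"
        using ii lim(1)[of i] lim(4) by (simp add: Bochner_Integration.integral_add)
      also have "(\<integral>x. \<bar>s i (x + z) - f (x + z)\<bar> \<partial>lborel) = (\<integral>x. \<bar>s i x - f x\<bar> \<partial>lborel)"
        using lim(1)[of i] lim(4) by (intro integral_translate) (simp add: borel_measurable_integrable)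
      finally show ?thesis using i \<eta>(2)[OF z] by simp
    qed
    then show "\<exists>\<eta>>0. \<forall>z. norm z < \<eta> \<longrightarrow> (\<integral>x. \<bar>f (x + z) - f x\<bar> \<partial>lborel) < e"
      using \<eta>(1) by blast
  qed
qed

lemma square_diff_le_diff_squares:
  fixes a b :: real
  assumes "a \<ge> 0" "b \<ge> 0"
  shows "(a - b)\<^sup>2 \<le> \<bar>a\<^sup>2 - b\<^sup>2\<bar>"
proof -
  have "(a - b)\<^sup>2 = \<bar>a - b\<bar> * \<bar>a - b\<bar>" by (simp add: power2_eq_square)
  also have "\<dots> \<le> \<bar>a - b\<bar> * \<bar>a + b\<bar>" using assms by (intro mult_left_mono) auto
  also have "\<dots> = \<bar>a\<^sup>2 - b\<^sup>2\<bar>" by (simp add: abs_mult[symmetric] power2_eq_square algebra_simps)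
  finally show ?thesis .
qed

text \<open>The L^1 result, applied to the squares of the positive and the negative part, already
  covers L^2: for nonnegative reals
  \<open>(a - b)\<^sup>2 \<le> \<bar>a\<^sup>2 - b\<^sup>2\<bar>\<close>.\<close>

lemma L2_shift_cont:
  fixes W :: "'a::euclidean_space \<Rightarrow> real"
  assumes W[measurable]: "W \<in> borel_measurable borel" and i: "integrable lborel (\<lambda>x. (W x)\<^sup>2)" and "e > 0"
  shows "\<exists>\<eta>>0. \<forall>z. norm z < \<eta> \<longrightarrow> (\<integral>\<^sup>+x. ennreal ((W (x + z) - W x)\<^sup>2) \<partial>lborel) \<le> ennreal e"
proof -
  define P where "P x = max (W x) 0" for x
  define Q where "Q x = max (- W x) 0" for x
  have PQ[measurable]: "P \<in> borel_measurable borel" "Q \<in> borel_measurable borel" unfolding P_def Q_def by measurable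
  have PQi: "integrable lborel (\<lambda>x. (P x)\<^sup>2)" "integrable lborel (\<lambda>x. (Q x)\<^sup>2)"
    by (rule Bochner_Integration.integrable_bound[OF i], simp, simp add: P_def Q_def max_def)+
  have "e/4 > 0" using \<open>e > 0\<close> by simp
  obtain \<eta>1 where \<eta>1: "\<eta>1 > 0" "\<And>z. norm z < \<eta>1 \<Longrightarrow> (\<integral>x. \<bar>(P (x + z))\<^sup>2 - (P x)\<^sup>2\<bar> \<partial>lborel) < e/4"
    using L1_shift_cont_integrable[OF PQi(1), unfolded L1_shift_cont_def, rule_format, OF \<open>e/4 > 0\<close>] by blast
  obtain \<eta>2 where \<eta>2: "\<eta>2 > 0" "\<And>z. norm z < \<eta>2 \<Longrightarrow> (\<integral>x. \<bar>(Q (x + z))\<^sup>2 - (Q x)\<^sup>2\<bar> \<partial>lborel) < e/4"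
    using L1_shift_cont_integrable[OF PQi(2), unfolded L1_shift_cont_def, rule_format, OF \<open>e/4 > 0\<close>] by blast
  note \<eta> = \<eta>1 \<eta>2
  have "(\<integral>\<^sup>+x. ennreal ((W (x + z) - W x)\<^sup>2) \<partial>lborel) \<le> ennreal e" if z: "norm z < min \<eta>1 \<eta>2" for z
  proof -
    have ii: "integrable lborel (\<lambda>x. (P (x + z))\<^sup>2)" "integrable lborel (\<lambda>x. (Q (x + z))\<^sup>2)"
      using PQi integrable_translate_iff[of "\<lambda>x. (P x)\<^sup>2"] integrable_translate_iff[of "\<lambda>x. (Q x)\<^sup>2"] by auto
    have "(W (x + z) - W x)\<^sup>2 \<le> 2 * \<bar>(P (x + z))\<^sup>2 - (P x)\<^sup>2\<bar> + 2 * \<bar>(Q (x + z))\<^sup>2 - (Q x)\<^sup>2\<bar>" for x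
    proof -
      have "W y = P y - Q y" for y by (simp add: P_def Q_def)
      from this[of x] this[of "x + z"] have "W (x + z) - W x = (P (x + z) - P x) - (Q (x + z) - Q x)" by linarith
      then have "(W (x + z) - W x)\<^sup>2 = ((P (x + z) - P x) - (Q (x + z) - Q x))\<^sup>2" by (simp only:)
      also have "\<dots> \<le> 2 * (P (x + z) - P x)\<^sup>2 + 2 * (Q (x + z) - Q x)\<^sup>2"
        using zero_le_power2[of "(P (x + z) - P x) + (Q (x + z) - Q x)"]
        by (simp add: power2_eq_square algebra_simps)
      also have "\<dots> \<le> 2 * \<bar>(P (x + z))\<^sup>2 - (P x)\<^sup>2\<bar> + 2 * \<bar>(Q (x + z))\<^sup>2 - (Q x)\<^sup>2\<bar>"
        by (intro add_mono mult_left_mono square_diff_le_diff_squares) (auto simp: P_def Q_def)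
      finally show ?thesis .
    qed
    then have "(\<integral>\<^sup>+x. ennreal ((W (x + z) - W x)\<^sup>2) \<partial>lborel) 
      \<le> (\<integral>\<^sup>+x. ennreal (2 * \<bar>(P (x + z))\<^sup>2 - (P x)\<^sup>2\<bar> + 2 * \<bar>(Q (x + z))\<^sup>2 - (Q x)\<^sup>2\<bar>) \<partial>lborel)"
      by (intro nn_integral_mono ennreal_leI)
    also have "\<dots> = ennreal (\<integral>x. 2 * \<bar>(P (x + z))\<^sup>2 - (P x)\<^sup>2\<bar> + 2 * \<bar>(Q (x + z))\<^sup>2 - (Q x)\<^sup>2\<bar> \<partial>lborel)"
      using ii PQi by (intro nn_integral_eq_integral) auto
    also have "(\<integral>x. 2 * \<bar>(P (x + z))\<^sup>2 - (P x)\<^sup>2\<bar> + 2 * \<bar>(Q (x + z))\<^sup>2 - (Q x)\<^sup>2\<bar> \<partial>lborel)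
      = 2 * (\<integral>x. \<bar>(P (x + z))\<^sup>2 - (P x)\<^sup>2\<bar> \<partial>lborel) + 2 * (\<integral>x. \<bar>(Q (x + z))\<^sup>2 - (Q x)\<^sup>2\<bar> \<partial>lborel)"
      using ii PQi by (subst Bochner_Integration.integral_add) auto
    also have "\<dots> \<le> e" using \<eta>(2)[of z] \<eta>(4)[of z] z by simp
    finally show ?thesis by (simp add: ennreal_leI)
  qed
  then show ?thesis using \<eta> by (intro exI[of _ "min \<eta>1 \<eta>2"]) auto
qed

lemma L1_shift_cont_nn:
  fixes W :: "'a::euclidean_space \<Rightarrow> real"
  assumes i: "integrable lborel W" and "e > 0"
  shows "\<exists>\<eta>>0. \<forall>z. norm z < \<eta> \<longrightarrow> (\<integral>\<^sup>+x. ennreal \<bar>W (x + z) - W x\<bar> \<partial>lborel) \<le> ennreal e"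
proof -
  obtain \<eta> where \<eta>: "\<eta> > 0" "\<And>z. norm z < \<eta> \<Longrightarrow> (\<integral>x. \<bar>W (x + z) - W x\<bar> \<partial>lborel) < e"
    using L1_shift_cont_integrable[OF i, unfolded L1_shift_cont_def, rule_format, OF \<open>e > 0\<close>] by blast
  have "(\<integral>\<^sup>+x. ennreal \<bar>W (x + z) - W x\<bar> \<partial>lborel) \<le> ennreal e" if "norm z < \<eta>" for z
  proof -
    have "integrable lborel (\<lambda>x. W (x + z))" using i integrable_translate_iff[of W z] by (simp add: borel_measurable_integrable)
    then have "(\<integral>\<^sup>+x. ennreal \<bar>W (x + z) - W x\<bar> \<partial>lborel) = ennreal (\<integral>x. \<bar>W (x + z) - W x\<bar> \<partial>lborel)"
      using i by (intro nn_integral_eq_integral) auto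
    then show ?thesis using \<eta>(2)[OF that] by (simp add: ennreal_leI)
  qed
  then show ?thesis using \<eta>(1) by blast
qed

section \<open>Convolution: smoothness and convergence of mollifications\<close>

text \<open>The second argument is the kernel: it carries the difference of the variables, and
  derivatives of the convolution fall on it.\<close>

definition conv :: "('a::euclidean_space \<Rightarrow> real) \<Rightarrow> ('a \<Rightarrow> real) \<Rightarrow> 'a \<Rightarrow> real" where
  "conv g k x = (\<integral>y. g y * k (x - y) \<partial>lborel)"

lemma compact_support_bounded:
  fixes k :: "'a::euclidean_space \<Rightarrow> real"
  assumes "continuous_on UNIV k" "\<And>x. norm x \<ge> r \<Longrightarrow> k x = 0"
  obtains B where "B > 0" "\<And>x. \<bar>k x\<bar> \<le> B"
proof -
  have "compact (k ` cball 0 r)"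
    by (intro compact_continuous_image continuous_on_subset[OF assms(1)]) auto
  then obtain B where B: "B > 0" "\<And>y. y \<in> k ` cball 0 r \<Longrightarrow> norm y \<le> B"
    using compact_imp_bounded bounded_pos by metis
  have "\<bar>k x\<bar> \<le> B" for x
  proof (cases "norm x \<ge> r")
    case True then show ?thesis using assms(2) B(1) by simp
  next
    case False
    then have "k x \<in> k ` cball 0 r" by auto
    then show ?thesis using B(2)[of "k x"] by simp
  qed
  with B(1) show ?thesis using that by blast
qed

lemma integrable_mult_bounded:
  fixes g :: "'a::euclidean_space \<Rightarrow> real"
  assumes "integrable lborel g" "k \<in> borel_measurable borel" "\<And>x. \<bar>k x\<bar> \<le> B"
  shows "integrable lborel (\<lambda>y. g y * k y)"
proof (rule Bochner_Integration.integrable_bound)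
  show "integrable lborel (\<lambda>y. B * g y)" using assms(1) by simp
  show "AE x in lborel. norm (g x * k x) \<le> norm (B * g x)"
  proof (rule AE_I2)
    fix x show "norm (g x * k x) \<le> norm (B * g x)"
      using mult_left_mono[OF order_trans[OF assms(3) abs_ge_self], of "\<bar>g x\<bar>" x] by (simp add: abs_mult mult.commute)
  qed
  show "(\<lambda>y. g y * k y) \<in> borel_measurable lborel"
    using assms(1,2) by (simp add: borel_measurable_integrable)
qed

lemma conv_integrable:
  fixes g :: "'a::euclidean_space \<Rightarrow> real"
  assumes "integrable lborel g" "continuous_on UNIV k" "\<And>x. \<bar>k x\<bar> \<le> B"
  shows "integrable lborel (\<lambda>y. g y * k (x - y))"
proof -
  have "continuous_on UNIV (\<lambda>y. k (x - y))"
    by (intro continuous_on_compose2[OF assms(2)] continuous_intros) auto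
  then show ?thesis
    using assms(3) by (intro integrable_mult_bounded[OF assms(1), of _ B] borel_measurable_continuous_onI) auto
qed

lemma conv_continuous:
  fixes g :: "'a::euclidean_space \<Rightarrow> real"
  assumes g: "integrable lborel g" and k: "continuous_on UNIV k" "\<And>x. \<bar>k x\<bar> \<le> B"
  shows "continuous_on UNIV (conv g k)"
proof -
  have "conv g k \<midarrow>x\<rightarrow> conv g k x" for x
    unfolding tendsto_at_iff_sequentially
  proof (intro allI impI)
    fix X :: "nat \<Rightarrow> 'a" assume X: "X \<longlonglongrightarrow> x"
    have "(\<lambda>i. \<integral>y. g y * k (X i - y) \<partial>lborel) \<longlonglongrightarrow> (\<integral>y. g y * k (x - y) \<partial>lborel)"
    proof (rule integral_dominated_convergence[where w="\<lambda>y. \<bar>B * g y\<bar>"])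
      show "(\<lambda>y. g y * k (x - y)) \<in> borel_measurable lborel" "\<And>i. (\<lambda>y. g y * k (X i - y)) \<in> borel_measurable lborel"
        using conv_integrable[OF g k] borel_measurable_integrable by blast+
      show "integrable lborel (\<lambda>y. \<bar>B * g y\<bar>)" using g by simp
      show "AE y in lborel. (\<lambda>i. g y * k (X i - y)) \<longlonglongrightarrow> g y * k (x - y)"
      proof (rule AE_I2)
        fix y
        have "isCont k (x - y)" using k(1) by (simp add: continuous_on_eq_continuous_at)
        moreover have "(\<lambda>i. X i - y) \<longlonglongrightarrow> x - y" using X by (intro tendsto_intros)
        ultimately have "(\<lambda>i. k (X i - y)) \<longlonglongrightarrow> k (x - y)" by (rule isCont_tendsto_compose)
        then show "(\<lambda>i. g y * k (X i - y)) \<longlonglongrightarrow> g y * k (x - y)" by (rule tendsto_mult_left)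
      qed
      show "AE y in lborel. norm (g y * k (X i - y)) \<le> \<bar>B * g y\<bar>" for i
      proof (rule AE_I2)
        fix y show "norm (g y * k (X i - y)) \<le> \<bar>B * g y\<bar>"
          using mult_left_mono[OF order_trans[OF k(2) abs_ge_self], of "\<bar>g y\<bar>" "X i - y"] by (simp add: abs_mult mult.commute)
      qed
    qed
    then show "(conv g k \<circ> X) \<longlonglongrightarrow> conv g k x" by (simp add: conv_def comp_def)
  qed
  then show ?thesis by (simp add: continuous_on_eq_continuous_at isCont_def)
qed

lemma bounded_partials_lipschitz:
  fixes k :: "'a::euclidean_space \<Rightarrow> real"
  assumes "convex S" "\<And>x. x \<in> S \<Longrightarrow> k differentiable (at x)"
    and B: "\<And>b x. b \<in> Basis \<Longrightarrow> x \<in> S \<Longrightarrow> \<bar>partial b k x\<bar> \<le> B"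
    and "x \<in> S" "y \<in> S"
  shows "\<bar>k x - k y\<bar> \<le> (real DIM('a) * B) * norm (x - y)"
proof -
  have "norm (k x - k y) \<le> (real DIM('a) * B) * norm (x - y)"
  proof (rule differentiable_bound[OF \<open>convex S\<close> _ _ assms(4,5)])
    fix z assume z: "z \<in> S"
    show "(k has_derivative (\<lambda>h. \<Sum>b\<in>Basis. (h \<bullet> b) * partial b k z)) (at z within S)"
      using has_derivative_at_withinI[OF has_derivative_partial[OF assms(2)[OF z]]] .
    show "onorm (\<lambda>h. \<Sum>b\<in>Basis. (h \<bullet> b) * partial b k z) \<le> real DIM('a) * B"
    proof (rule onorm_le)
      fix h :: 'a
      have "norm (\<Sum>b\<in>Basis. (h \<bullet> b) * partial b k z) \<le> (\<Sum>b\<in>(Basis::'a set). norm h * B)"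
      proof (rule sum_norm_le)
        fix b :: 'a assume b: "b \<in> Basis"
        show "norm ((h \<bullet> b) * partial b k z) \<le> norm h * B"
          using Basis_le_norm[OF b, of h] B[OF b z] by (simp add: abs_mult mult_mono)
      qed
      then show "norm (\<Sum>b\<in>Basis. (h \<bullet> b) * partial b k z) \<le> real DIM('a) * B * norm h"
        by (simp add: mult_ac)
    qed
  qed
  then show ?thesis by simp
qed

text \<open>Differentiation under the integral by dominated convergence of the first-order
  remainders \<open>?E\<close>: divided by \<open>norm h\<close> they tend to 0 pointwise and stay
  below the constant \<open>A\<close>, as \<open>k\<close> has bounded partial derivatives. A full
  Frechet derivative is produced, since \<open>Ck\<close> demands differentiability and not merely
  partial derivatives.\<close>

lemma conv_partial:
  fixes g :: "'a::euclidean_space \<Rightarrow> real"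
  assumes g: "integrable lborel g" and k: "Ck (Suc 0) k" "\<And>x. norm x \<ge> r \<Longrightarrow> k x = 0"
  shows "conv g k differentiable (at x)" "b \<in> Basis \<Longrightarrow> partial b (conv g k) x = conv g (partial b k) x"
proof -
  have dk: "k differentiable (at z)" and cp: "b \<in> Basis \<Longrightarrow> continuous_on UNIV (partial b k)" for z b using k by auto
  have ck: "continuous_on UNIV k" using Ck_continuous[OF k(1)] .
  obtain B0 where B0: "\<And>x. \<bar>k x\<bar> \<le> B0" using compact_support_bounded[OF ck k(2)] by blast
  have pz: "partial b k z = 0" if "norm z \<ge> r + 1" for b z
    using partial_zero_outside[of "cball 0 r" k z b] k(2) that by auto
  have "\<exists>B. \<forall>z. \<bar>partial b k z\<bar> \<le> B" if "b \<in> Basis" for b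
    using compact_support_bounded[OF cp[OF that], of "r + 1"] pz by blast
  then obtain Bf where Bf: "\<And>b z. b \<in> Basis \<Longrightarrow> \<bar>partial b k z\<bar> \<le> Bf b" by metis
  define B where "B = (\<Sum>b\<in>(Basis::'a set). \<bar>Bf b\<bar>)"
  have B: "\<bar>partial b k z\<bar> \<le> B" if "b \<in> Basis" for b z
  proof -
    have "Bf b \<le> B" unfolding B_def using member_le_sum[of b Basis "\<lambda>b. \<bar>Bf b\<bar>"] that by force
    then show ?thesis using Bf[OF that, of z] by linarith
  qed
  have B_nonneg: "B \<ge> 0" unfolding B_def by (intro sum_nonneg) auto
  \<comment> \<open>One copy of \<open>DIM('a) * B\<close> bounds the increment of \<open>k\<close>
    by the mean value inequality, the other bounds the linear term.\<close>
  define A where "A = 2 * (real DIM('a) * B)"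
  have A_nonneg: "A \<ge> 0" using B_nonneg by (simp add: A_def)
  let ?D = "\<lambda>h. \<Sum>b\<in>Basis. (h \<bullet> b) * conv g (partial b k) x"
  let ?E = "\<lambda>h y. k (x + h - y) - k (x - y) - (\<Sum>b\<in>Basis. (h \<bullet> b) * partial b k (x - y))"
  have ip: "integrable lborel (\<lambda>y. g y * partial b k (z - y))" if "b \<in> Basis" for b z
    using conv_integrable[OF g cp[OF that] B[OF that]] .
  have ik: "integrable lborel (\<lambda>y. g y * k (z - y))" for z using conv_integrable[OF g ck B0] .
  have isum: "integrable lborel (\<lambda>y. \<Sum>b\<in>Basis. (h \<bullet> b) * (g y * partial b k (x - y)))" for h
    by (intro Bochner_Integration.integrable_sum integrable_mult_right ip)
  have gE: "g y * ?E h y = g y * k (x + h - y) - g y * k (x - y) - (\<Sum>b\<in>Basis. (h \<bullet> b) * (g y * partial b k (x - y)))" for h y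
    by (simp add: right_diff_distrib sum_distrib_left mult.left_commute)
  have iE: "integrable lborel (\<lambda>y. g y * ?E h y)" for h
    unfolding gE by (intro Bochner_Integration.integrable_diff ik isum)
  have E: "conv g k (x + h) - conv g k x - ?D h = (\<integral>y. g y * ?E h y \<partial>lborel)" for h
  proof -
    have "(\<integral>y. g y * ?E h y \<partial>lborel) = (\<integral>y. g y * k (x + h - y) \<partial>lborel) - (\<integral>y. g y * k (x - y) \<partial>lborel)
       - (\<integral>y. (\<Sum>b\<in>Basis. (h \<bullet> b) * (g y * partial b k (x - y))) \<partial>lborel)"
      unfolding gE by (subst Bochner_Integration.integral_diff, intro Bochner_Integration.integrable_diff ik, rule isum)
        (subst Bochner_Integration.integral_diff, rule ik, rule ik, rule refl)
    also have "(\<integral>y. (\<Sum>b\<in>Basis. (h \<bullet> b) * (g y * partial b k (x - y))) \<partial>lborel) = ?D h"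
      unfolding conv_def using ip by (subst Bochner_Integration.integral_sum) auto
    finally show ?thesis by (simp add: conv_def)
  qed
  have Ebound: "\<bar>?E h y\<bar> \<le> A * norm h" for h y
  proof -
    have "\<bar>k (x + h - y) - k (x - y)\<bar> \<le> (real DIM('a) * B) * norm ((x + h - y) - (x - y))"
      by (rule bounded_partials_lipschitz[of UNIV k B "x + h - y" "x - y"]) (use dk B in auto)
    moreover have "\<bar>\<Sum>b\<in>Basis. (h \<bullet> b) * partial b k (x - y)\<bar> \<le> (\<Sum>b\<in>(Basis::'a set). norm h * B)"
    proof (rule order_trans[OF sum_abs], rule sum_mono)
      fix b :: 'a assume b: "b \<in> Basis"
      show "\<bar>(h \<bullet> b) * partial b k (x - y)\<bar> \<le> norm h * B"
        using Basis_le_norm[OF b, of h] B[OF b, of "x - y"] by (simp add: abs_mult mult_mono)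
    qed
    ultimately show ?thesis by (simp add: A_def algebra_simps)
  qed
  have "(conv g k has_derivative ?D) (at x)"
    unfolding has_derivative_at
  proof
    show "bounded_linear ?D"
      by (intro bounded_linear_sum bounded_linear_mult_left bounded_linear_compose[OF bounded_linear_mult_left] bounded_linear_inner_left)
    show "(\<lambda>h. norm (conv g k (x + h) - conv g k x - ?D h) / norm h) \<midarrow>0\<rightarrow> 0"
      unfolding tendsto_at_iff_sequentially E
    proof (intro allI impI)
      fix X :: "nat \<Rightarrow> 'a" assume X: "\<forall>i. X i \<in> UNIV - {0}" "X \<longlonglongrightarrow> 0"
      have "(\<lambda>i. \<integral>y. g y * (?E (X i) y / norm (X i)) \<partial>lborel) \<longlonglongrightarrow> (\<integral>y. 0 \<partial>(lborel::'a measure))"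
      proof (rule integral_dominated_convergence[where w="\<lambda>y. \<bar>A * g y\<bar>"])
        show "(\<lambda>y. g y * (?E (X i) y / norm (X i))) \<in> borel_measurable lborel" for i
          using borel_measurable_integrable[OF integrable_divide[OF iE[of "X i"], of "norm (X i)"]] by simp
        show "integrable lborel (\<lambda>y. \<bar>A * g y\<bar>)" using g by simp
        show "AE y in lborel. (\<lambda>i. g y * (?E (X i) y / norm (X i))) \<longlonglongrightarrow> 0"
        proof (rule AE_I2)
          fix y
          have "(\<lambda>h. norm (k (x - y + h) - k (x - y) - (\<Sum>b\<in>Basis. (h \<bullet> b) * partial b k (x - y))) / norm h) \<midarrow>0\<rightarrow> 0"
            using has_derivative_partial[OF dk] unfolding has_derivative_at by blast
          then have "((\<lambda>h. norm (k (x - y + h) - k (x - y) - (\<Sum>b\<in>Basis. (h \<bullet> b) * partial b k (x - y))) / norm h) \<circ> X) \<longlonglongrightarrow> 0"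
            unfolding tendsto_at_iff_sequentially using X by blast
          then have "(\<lambda>i. norm (?E (X i) y / norm (X i))) \<longlonglongrightarrow> 0" by (simp add: comp_def add_diff_eq add.commute diff_add_eq)
          then have "(\<lambda>i. ?E (X i) y / norm (X i)) \<longlonglongrightarrow> 0" by (rule tendsto_norm_zero_cancel)
          from tendsto_mult_left[OF this, of "g y"] show "(\<lambda>i. g y * (?E (X i) y / norm (X i))) \<longlonglongrightarrow> 0" by simp
        qed
        show "AE y in lborel. norm (g y * (?E (X i) y / norm (X i))) \<le> \<bar>A * g y\<bar>" for i
        proof (rule AE_I2)
          fix y
          have "\<bar>?E (X i) y / norm (X i)\<bar> \<le> A" using Ebound[of "X i" y] X by (simp add: field_simps)
          from mult_left_mono[OF this, of "\<bar>g y\<bar>"]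
          show "norm (g y * (?E (X i) y / norm (X i))) \<le> \<bar>A * g y\<bar>"
            unfolding real_norm_def abs_mult[of "g y"] abs_mult[of A] abs_of_nonneg[OF A_nonneg]
            by (simp only: mult.commute[of A] abs_ge_zero)
        qed
      qed simp
      then have "(\<lambda>i. \<bar>\<integral>y. g y * (?E (X i) y / norm (X i)) \<partial>lborel\<bar>) \<longlonglongrightarrow> 0" using tendsto_rabs_zero by fastforce
      then show "((\<lambda>h. norm (\<integral>y. g y * ?E h y \<partial>lborel) / norm h) \<circ> X) \<longlonglongrightarrow> 0"
        by (simp add: comp_def)
    qed
  qed
  then show "conv g k differentiable (at x)" "b \<in> Basis \<Longrightarrow> partial b (conv g k) x = conv g (partial b k) x"
    by (auto simp: differentiable_def partial_eqI inner_Basis if_distrib[of "\<lambda>c. c * _"] cong: if_cong)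
qed

lemma Ck_conv:
  fixes g :: "'a::euclidean_space \<Rightarrow> real"
  assumes g: "integrable lborel g" and k: "Ck n k" "\<And>x. norm x \<ge> r \<Longrightarrow> k x = 0"
  shows "Ck n (conv g k)"
  using k
proof (induction n arbitrary: k r)
  case 0
  then obtain B where "\<And>x. \<bar>k x\<bar> \<le> B" using compact_support_bounded by (metis Ck.simps(1))
  then show ?case using conv_continuous[OF g] 0 by auto
next
  case (Suc n)
  have k1: "Ck (Suc 0) k" using Ck_mono[OF Suc.prems(1), of "Suc 0"] by simp
  \<comment> \<open>Vanishing passes to derivatives on the open complement of the ball only.
    Enlarging the radius by 1 at each order takes care of the sphere itself, which is why the
    induction also keeps \<open>r\<close> arbitrary.\<close>
  have "partial b k z = 0" if "norm z \<ge> r + 1" for b z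
    using partial_zero_outside[of "cball 0 r" k z b] Suc.prems(2) that by auto
  then have "Ck n (conv g (partial b k))" if "b \<in> Basis" for b
    using Suc.IH[of "partial b k" "r + 1"] Suc.prems(1) that by simp
  moreover have "partial b (conv g k) = conv g (partial b k)" if "b \<in> Basis" for b
    using conv_partial(2)[OF g k1 Suc.prems(2) that] by blast
  ultimately show ?case using conv_partial(1)[OF g k1 Suc.prems(2)] by simp
qed

lemma smooth_conv:
  assumes "integrable lborel g" "smooth k" "\<And>x. norm x \<ge> r \<Longrightarrow> k x = 0"
  shows "smooth (conv g k)"
  using assms Ck_conv unfolding smooth_def by blast

lemma conv_commute:
  fixes g k :: "'a::euclidean_space \<Rightarrow> real"
  assumes [measurable]: "g \<in> borel_measurable borel" "k \<in> borel_measurable borel"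
  shows "conv g k x = (\<integral>z. g (x - z) * k z \<partial>lborel)"
  unfolding conv_def using integral_reflect[of "\<lambda>y. g y * k (x - y)" x] by simp

text \<open>Borel functions on the whole space, so that shifts, reflections and Fubini apply
  directly; functions on a domain are represented by extension by 0.\<close>

definition sq_integrable :: "('a::euclidean_space \<Rightarrow> real) \<Rightarrow> bool" where
  "sq_integrable g \<longleftrightarrow> g \<in> borel_measurable borel \<and> integrable lborel (\<lambda>x. (g x)\<^sup>2)"

text \<open>A squared norm with extended values: estimates can be chained before integrability is
  known.\<close>

definition sq_int :: "'a::euclidean_space set \<Rightarrow> ('a \<Rightarrow> real) \<Rightarrow> ennreal" where
  "sq_int \<Omega> g = (\<integral>\<^sup>+x\<in>\<Omega>. ennreal ((g x)\<^sup>2) \<partial>lborel)"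

lemma smooth_measurable: "smooth f \<Longrightarrow> f \<in> borel_measurable borel"
  by (rule borel_measurable_continuous_onI[OF smooth_continuous])

text \<open>Common core of the L^1 and L^2 estimates. As \<open>\<rho>\<close> is a probability
  density, Jensen's inequality bounds \<open>\<Phi>\<close> of the mollification error by an average
  over translates; exchanging the integrals leaves translations by \<open>a - z\<close>, all shorter
  than \<open>\<eta>\<close>. The shift \<open>a\<close> is for the inward translation at the
  boundary.\<close>

lemma mollify_estimate:
  fixes W \<rho> :: "'a::euclidean_space \<Rightarrow> real"
  assumes W[measurable]: "W \<in> borel_measurable borel"
    and \<rho>: "smooth \<rho>" "\<And>x. 0 \<le> \<rho> x" "\<And>x. norm x \<ge> \<delta> \<Longrightarrow> \<rho> x = 0" "integrable lborel \<rho>" "(\<integral>x. \<rho> x \<partial>lborel) = 1"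
    and \<Phi>[measurable]: "\<Phi> \<in> borel_measurable borel" and \<Phi>0: "\<And>t. \<Phi> t \<ge> 0"
    and jensen: "\<And>x. ennreal (\<Phi> (conv W \<rho> (x + a) - W x)) \<le> (\<integral>\<^sup>+z. ennreal (\<Phi> (W (x + a - z) - W x) * \<rho> z) \<partial>lborel)"
    and shift: "\<And>z. norm z < \<eta> \<Longrightarrow> (\<integral>\<^sup>+x. ennreal (\<Phi> (W (x + z) - W x)) \<partial>lborel) \<le> ennreal e"
    and small: "norm a + \<delta> \<le> \<eta>"
  shows "(\<integral>\<^sup>+x. ennreal (\<Phi> (conv W \<rho> (x + a) - W x)) \<partial>lborel) \<le> ennreal e"
proof -
  have [measurable]: "\<rho> \<in> borel_measurable borel" by (rule smooth_measurable[OF \<rho>(1)])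
  have "(\<integral>\<^sup>+x. ennreal (\<Phi> (conv W \<rho> (x + a) - W x)) \<partial>lborel)
     \<le> (\<integral>\<^sup>+x. (\<integral>\<^sup>+z. ennreal (\<Phi> (W (x + a - z) - W x) * \<rho> z) \<partial>lborel) \<partial>lborel)"
    by (intro nn_integral_mono jensen)
  also have "\<dots> = (\<integral>\<^sup>+z. (\<integral>\<^sup>+x. ennreal (\<Phi> (W (x + a - z) - W x) * \<rho> z) \<partial>lborel) \<partial>lborel)"
    by (rule lborel_pair.Fubini') measurable
  also have "\<dots> \<le> (\<integral>\<^sup>+z. ennreal e * ennreal (\<rho> z) \<partial>lborel)"
  proof (rule nn_integral_mono)
    fix z :: 'a
    have "(\<integral>\<^sup>+x. ennreal (\<Phi> (W (x + a - z) - W x) * \<rho> z) \<partial>lborel) 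
      = (\<integral>\<^sup>+x. ennreal (\<Phi> (W (x + (a - z)) - W x)) * ennreal (\<rho> z) \<partial>lborel)"
      using \<rho>(2) \<Phi>0 by (simp add: ennreal_mult add_diff_eq)
    also have "\<dots> = (\<integral>\<^sup>+x. ennreal (\<Phi> (W (x + (a - z)) - W x)) \<partial>lborel) * ennreal (\<rho> z)"
      by (rule nn_integral_multc) measurable
    also have "\<dots> \<le> ennreal e * ennreal (\<rho> z)"
    proof (cases "norm z \<ge> \<delta>")
      case True then show ?thesis using \<rho>(3) by simp
    next
      case False
      then have "norm (a - z) < \<eta>" using norm_triangle_ineq4[of a z] small by linarith
      then show ?thesis using shift by (intro mult_right_mono) auto
    qed
    finally show "(\<integral>\<^sup>+x. ennreal (\<Phi> (W (x + a - z) - W x) * \<rho> z) \<partial>lborel) \<le> ennreal e * ennreal (\<rho> z)" .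
  qed
  also have "\<dots> = ennreal e * (\<integral>\<^sup>+z. ennreal (\<rho> z) \<partial>lborel)" by (rule nn_integral_cmult) measurable
  also have "(\<integral>\<^sup>+z. ennreal (\<rho> z) \<partial>lborel) = ennreal 1" using \<rho>(2,4,5) by (subst nn_integral_eq_integral) auto
  finally show ?thesis by simp
qed

lemma conv_reflect_integrable:
  fixes g :: "'a::euclidean_space \<Rightarrow> real"
  assumes "integrable lborel g" "continuous_on UNIV k" "\<And>x. norm x \<ge> r \<Longrightarrow> k x = 0"
  shows "integrable lborel (\<lambda>z. g (c - z) * k z)"
proof -
  obtain B where B: "\<And>x. \<bar>k x\<bar> \<le> B" using compact_support_bounded[OF assms(2,3)] by blast
  have "integrable lborel (\<lambda>z. g (c - z))" using assms(1) integrable_reflect_iff[of g c] by (simp add: borel_measurable_integrable)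
  then show ?thesis using assms(2) B by (intro integrable_mult_bounded[of _ k B] borel_measurable_continuous_onI)
qed

lemma mollify_L2:
  fixes W \<rho> :: "'a::euclidean_space \<Rightarrow> real"
  assumes W: "sq_integrable W" "integrable lborel W"
    and \<rho>: "smooth \<rho>" "\<And>x. 0 \<le> \<rho> x" "\<And>x. norm x \<ge> \<delta> \<Longrightarrow> \<rho> x = 0" "integrable lborel \<rho>" "(\<integral>x. \<rho> x \<partial>lborel) = 1"
    and shift: "\<And>z. norm z < \<eta> \<Longrightarrow> (\<integral>\<^sup>+x. ennreal ((W (x + z) - W x)\<^sup>2) \<partial>lborel) \<le> ennreal e"
    and small: "norm a + \<delta> \<le> \<eta>"
  shows "(\<integral>\<^sup>+x. ennreal ((conv W \<rho> (x + a) - W x)\<^sup>2) \<partial>lborel) \<le> ennreal e"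
proof (rule mollify_estimate[where \<Phi>="\<lambda>t. t\<^sup>2", OF _ \<rho> _ _ _ shift small])
  show W': "W \<in> borel_measurable borel" using W(1) by (simp add: sq_integrable_def)
  fix x :: 'a
  have cr: "continuous_on UNIV \<rho>" using smooth_continuous[OF \<rho>(1)] .
  have i1: "integrable lborel (\<lambda>z. W (x + a - z) * \<rho> z)" by (rule conv_reflect_integrable[OF W(2) cr \<rho>(3)])
  have i2: "integrable lborel (\<lambda>z. (W (x + a - z))\<^sup>2 * \<rho> z)" 
    by (rule conv_reflect_integrable[OF _ cr \<rho>(3), of "\<lambda>z. (W z)\<^sup>2"]) (use W(1) in \<open>simp add: sq_integrable_def\<close>)
  define m where "m = conv W \<rho> (x + a)"
  have m: "m = (\<integral>z. W (x + a - z) * \<rho> z \<partial>lborel)" unfolding m_def 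
    by (rule conv_commute[OF W' smooth_measurable[OF \<rho>(1)]])
  have e: "(W (x + a - z) - c)\<^sup>2 * \<rho> z = (W (x + a - z))\<^sup>2 * \<rho> z - (2 * c) * (W (x + a - z) * \<rho> z) + c\<^sup>2 * \<rho> z" for c z
    by (simp add: power2_eq_square algebra_simps)
  have i3: "integrable lborel (\<lambda>z. (W (x + a - z) - c)\<^sup>2 * \<rho> z)" for c
    unfolding e using i1 i2 \<rho>(4) by (intro Bochner_Integration.integrable_add Bochner_Integration.integrable_diff integrable_mult_right)
  have I: "(\<integral>z. (W (x + a - z) - c)\<^sup>2 * \<rho> z \<partial>lborel) = (\<integral>z. (W (x + a - z))\<^sup>2 * \<rho> z \<partial>lborel) - 2 * c * m + c\<^sup>2" for c
    unfolding e m using i1 i2 \<rho>(4,5) 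
    by (subst Bochner_Integration.integral_add Bochner_Integration.integral_diff; simp)+
  \<comment> \<open>Jensen's inequality for the square: the variance about the mean \<open>m\<close>
    is nonnegative, and by \<open>I\<close> it differs from the second moment about
    \<open>W x\<close> by \<open>(m - W x)\<^sup>2\<close>.\<close>
  have "0 \<le> (\<integral>z. (W (x + a - z) - m)\<^sup>2 * \<rho> z \<partial>lborel)" using \<rho>(2) by (intro integral_nonneg_AE) auto
  then have "(m - W x)\<^sup>2 \<le> (\<integral>z. (W (x + a - z) - W x)\<^sup>2 * \<rho> z \<partial>lborel)"
    unfolding I by (simp add: power2_eq_square algebra_simps)
  also have "ennreal \<dots> = (\<integral>\<^sup>+z. ennreal ((W (x + a - z) - W x)\<^sup>2 * \<rho> z) \<partial>lborel)"
    using \<rho>(2) i3 by (intro nn_integral_eq_integral[symmetric]) auto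
  finally show "ennreal ((conv W \<rho> (x + a) - W x)\<^sup>2) \<le> (\<integral>\<^sup>+z. ennreal ((W (x + a - z) - W x)\<^sup>2 * \<rho> z) \<partial>lborel)"
    by (simp add: m_def ennreal_leI)
qed auto

lemma mollify_L1:
  fixes W \<rho> :: "'a::euclidean_space \<Rightarrow> real"
  assumes W: "integrable lborel W"
    and \<rho>: "smooth \<rho>" "\<And>x. 0 \<le> \<rho> x" "\<And>x. norm x \<ge> \<delta> \<Longrightarrow> \<rho> x = 0" "integrable lborel \<rho>" "(\<integral>x. \<rho> x \<partial>lborel) = 1"
    and shift: "\<And>z. norm z < \<eta> \<Longrightarrow> (\<integral>\<^sup>+x. ennreal \<bar>W (x + z) - W x\<bar> \<partial>lborel) \<le> ennreal e"
    and small: "\<delta> \<le> \<eta>"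
  shows "(\<integral>\<^sup>+x. ennreal \<bar>conv W \<rho> x - W x\<bar> \<partial>lborel) \<le> ennreal e"
proof -
  have W': "W \<in> borel_measurable borel" using W by (simp add: borel_measurable_integrable)
  have "(\<integral>\<^sup>+x. ennreal \<bar>conv W \<rho> (x + 0) - W x\<bar> \<partial>lborel) \<le> ennreal e"
  proof (rule mollify_estimate[where \<Phi>=abs, OF W' \<rho> _ _ _ shift])
    fix x :: 'a
    have cr: "continuous_on UNIV \<rho>" using smooth_continuous[OF \<rho>(1)] .
    have i1: "integrable lborel (\<lambda>z. W (x - z) * \<rho> z)" by (rule conv_reflect_integrable[OF W(1) cr \<rho>(3)])
    have i2: "integrable lborel (\<lambda>z. W (x - z) * \<rho> z - W x * \<rho> z)" using i1 \<rho>(4) by simp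
    have "conv W \<rho> x - W x = (\<integral>z. W (x - z) * \<rho> z - W x * \<rho> z \<partial>lborel)" 
      using i1 \<rho>(4,5) by (simp add: conv_commute[OF W' smooth_measurable[OF \<rho>(1)]] Bochner_Integration.integral_diff)
    then have "\<bar>conv W \<rho> x - W x\<bar> \<le> (\<integral>z. \<bar>W (x - z) * \<rho> z - W x * \<rho> z\<bar> \<partial>lborel)" 
      using integral_abs_bound by simp
    also have "\<dots> = (\<integral>z. \<bar>W (x - z) - W x\<bar> * \<rho> z \<partial>lborel)"
      using \<rho>(2) by (simp add: abs_mult flip: left_diff_distrib)
    finally have "ennreal \<bar>conv W \<rho> x - W x\<bar> \<le> ennreal (\<integral>z. \<bar>W (x - z) - W x\<bar> * \<rho> z \<partial>lborel)"
      by (rule ennreal_leI)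
    also have "\<dots> = (\<integral>\<^sup>+z. ennreal (\<bar>W (x - z) - W x\<bar> * \<rho> z) \<partial>lborel)"
      using \<rho>(2) integrable_abs[OF i2]
      by (intro nn_integral_eq_integral[symmetric]) (simp_all add: abs_mult flip: left_diff_distrib)
    finally show "ennreal \<bar>conv W \<rho> (x + 0) - W x\<bar> \<le> (\<integral>\<^sup>+z. ennreal (\<bar>W (x + 0 - z) - W x\<bar> * \<rho> z) \<partial>lborel)"
      by simp
  qed (use small in auto)
  then show ?thesis by simp
qed

lemma test_fun_mollifier:
  fixes \<rho> :: "'a::euclidean_space \<Rightarrow> real"
  assumes "smooth \<rho>" "\<And>x. norm x \<ge> \<delta> \<Longrightarrow> \<rho> x = 0" "cball x \<delta> \<subseteq> \<Omega>"
  shows "test_fun \<Omega> (\<lambda>y. \<rho> (x - y))"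
  unfolding test_fun_def
proof (intro conjI exI[of _ "cball x \<delta>"])
  show "smooth (\<lambda>y. \<rho> (x - y))" by (rule smooth_reflect[OF assms(1)])
qed (use assms in \<open>auto simp: dist_norm\<close>)

section \<open>Uniqueness of weak derivatives\<close>

text \<open>A completion contains all subsets of null sets, so preimages under \<open>f\<close> and
  \<open>g\<close> differ by a measurable null set.\<close>

lemma borel_measurable_completion_AE:
  fixes f g :: "'a \<Rightarrow> 'b::topological_space"
  assumes "g \<in> borel_measurable (completion M)" "AE x in completion M. f x = g x"
  shows "f \<in> borel_measurable (completion M)"
proof (rule measurableI)
  fix A :: "'b set" assume A: "A \<in> sets borel"
  show "f -` A \<inter> space (completion M) \<in> sets (completion M)"
  proof (rule complete_measure.in_sets_AE[OF completion.complete_measure_axioms])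
    show "g -` A \<inter> space (completion M) \<in> sets (completion M)" by (rule measurable_sets[OF assms(1) A])
    show "AE x in completion M. (x \<in> g -` A \<inter> space (completion M)) = (x \<in> f -` A \<inter> space (completion M))"
      using assms(2) by eventually_elim simp
  qed simp
qed simp

lemma borel_representative:
  fixes w :: "'a::euclidean_space \<Rightarrow> real"
  assumes "w \<in> borel_measurable (lebesgue_on \<Omega>)" "\<Omega> \<in> sets borel"
  obtains w' where "w' \<in> borel_measurable borel" "\<And>x. x \<notin> \<Omega> \<Longrightarrow> w' x = 0" "AE x in lborel. x \<in> \<Omega> \<longrightarrow> w x = w' x"
proof -
  have "(\<lambda>x. if x \<in> \<Omega> then w x else 0) \<in> borel_measurable lebesgue"
    using assms by (subst borel_measurable_if) auto
  then obtain g where g: "g \<in> borel_measurable lborel" "AE x in lborel. (if x \<in> \<Omega> then w x else 0) = g x"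
    using completion_ex_borel_measurable_real by blast
  show ?thesis
  proof (rule that[of "\<lambda>x. if x \<in> \<Omega> then g x else 0"])
    show "(\<lambda>x. if x \<in> \<Omega> then g x else 0) \<in> borel_measurable borel"
      using g(1) assms(2) by (intro measurable_If_set) auto
    show "AE x in lborel. x \<in> \<Omega> \<longrightarrow> w x = (if x \<in> \<Omega> then g x else 0)"
      using g(2) by eventually_elim (simp split: if_splits)
  qed simp
qed

text \<open>The bridge from \<open>lebesgue_on \<Omega>\<close>, in which weak derivatives and norms
  are defined, to Borel integrals over the whole space, in which the estimates are made.\<close>

lemma integral_lebesgue_on_borel:
  fixes f g :: "'a::euclidean_space \<Rightarrow> real"
  assumes "\<Omega> \<in> sets borel" "g \<in> borel_measurable borel" "\<And>x. x \<notin> \<Omega> \<Longrightarrow> g x = 0" "AE x in lborel. x \<in> \<Omega> \<longrightarrow> f x = g x"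
  shows "(\<integral>x. f x \<partial>lebesgue_on \<Omega>) = (\<integral>x. g x \<partial>lborel)"
    "integrable (lebesgue_on \<Omega>) f \<longleftrightarrow> integrable lborel g"
    "f \<in> borel_measurable (lebesgue_on \<Omega>)"
proof -
  have gl: "g \<in> borel_measurable lebesgue" using assms(2) by (simp add: measurable_completion)
  have gi: "(\<lambda>x. indicator \<Omega> x *\<^sub>R g x) = g"
  proof
    fix x show "indicator \<Omega> x *\<^sub>R g x = g x" using assms(3)[of x] by (cases "x \<in> \<Omega>") auto
  qed
  have ae: "AE x in lebesgue_on \<Omega>. f x = g x"
    using AE_completion[OF assms(4)] assms(1) by (simp add: AE_restrict_space_iff)
  have gm: "g \<in> borel_measurable (lebesgue_on \<Omega>)" using gl by (rule measurable_restrict_space1)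
  have "(\<lambda>x. if x \<in> \<Omega> then f x else 0) \<in> borel_measurable lebesgue"
  proof (rule borel_measurable_completion_AE[OF gl AE_completion])
    show "AE x in lborel. (if x \<in> \<Omega> then f x else 0) = g x"
      using assms(4) by eventually_elim (use assms(3) in auto)
  qed
  then show fm: "f \<in> borel_measurable (lebesgue_on \<Omega>)" by (rule borel_measurable_if_D)
  have "(\<integral>x. f x \<partial>lebesgue_on \<Omega>) = (\<integral>x. g x \<partial>lebesgue_on \<Omega>)" by (rule integral_cong_AE[OF fm gm ae])
  also have "\<dots> = (\<integral>x. indicator \<Omega> x *\<^sub>R g x \<partial>lebesgue)" using assms(1) by (intro integral_restrict_space) simp
  also have "\<dots> = (\<integral>x. g x \<partial>lborel)" unfolding gi using assms(2) by (simp add: integral_completion)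
  finally show "(\<integral>x. f x \<partial>lebesgue_on \<Omega>) = (\<integral>x. g x \<partial>lborel)" .
  have "integrable (lebesgue_on \<Omega>) f \<longleftrightarrow> integrable (lebesgue_on \<Omega>) g" by (rule integrable_cong_AE[OF fm gm ae])
  also have "\<dots> \<longleftrightarrow> integrable lebesgue (\<lambda>x. indicator \<Omega> x *\<^sub>R g x)" using assms(1) by (intro integrable_restrict_space) simp
  also have "\<dots> \<longleftrightarrow> integrable lborel g" unfolding gi using assms(2) by (simp add: integrable_completion)
  finally show "integrable (lebesgue_on \<Omega>) f \<longleftrightarrow> integrable lborel g" .
qed

section \<open>The fundamental lemma of the calculus of variations\<close>

lemma loc_integrable_diff:
  assumes "loc_integrable \<Omega> f" "loc_integrable \<Omega> g" 
  shows "loc_integrable \<Omega> (\<lambda>x. f x - g x)"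
  using assms unfolding loc_integrable_def by (auto intro: set_integral_diff)

lemma loc_integrable_test_fun:
  fixes w :: "'a::euclidean_space \<Rightarrow> real"
  assumes "loc_integrable \<Omega> w" "smooth \<phi>" "compact K" "K \<subseteq> \<Omega>" "\<And>x. x \<notin> K \<Longrightarrow> \<phi> x = 0" "open \<Omega>"
  shows "integrable (lebesgue_on \<Omega>) (\<lambda>x. w x * \<phi> x)"
proof -
  have i: "integrable lebesgue (\<lambda>x. indicator K x *\<^sub>R w x)"
    using assms(1,3,4) unfolding loc_integrable_def set_integrable_def by blast
  have "compact (\<phi> ` K)" by (intro compact_continuous_image smooth_continuous assms)
  then obtain B where B: "\<And>y. y \<in> \<phi> ` K \<Longrightarrow> norm y \<le> B"
    using compact_imp_bounded bounded_pos by metis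
  have m: "(\<lambda>x. \<phi> x * (indicator K x *\<^sub>R w x)) \<in> borel_measurable lebesgue"
    using smooth_measurable[OF assms(2)]
    by (intro borel_measurable_times borel_measurable_integrable[OF i]) (simp add: measurable_completion)
  have "integrable lebesgue (\<lambda>x. \<phi> x * (indicator K x *\<^sub>R w x))"
  proof (rule Bochner_Integration.integrable_bound[OF integrable_mult_right[OF i, of B] m], rule AE_I2)
    fix x show "norm (\<phi> x * (indicator K x *\<^sub>R w x)) \<le> norm (B * (indicator K x *\<^sub>R w x))"
    proof (cases "x \<in> K")
      case True
      then have "\<bar>\<phi> x\<bar> \<le> \<bar>B\<bar>" using B[of "\<phi> x"] by simp
      then show ?thesis using True by (simp add: abs_mult mult_right_mono)
    qed simp
  qed
  moreover have "(\<lambda>x. \<phi> x * (indicator K x *\<^sub>R w x)) = (\<lambda>x. indicator \<Omega> x *\<^sub>R (w x * \<phi> x))"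
    by (rule ext) (use assms(4,5) in \<open>auto simp: indicator_def\<close>)
  ultimately have "integrable lebesgue (\<lambda>x. indicator \<Omega> x *\<^sub>R (w x * \<phi> x))" by simp
  then show ?thesis using assms(6) by (subst integrable_restrict_space) auto
qed

text \<open>Mollify the restriction of \<open>w\<close> to the ball of radius \<open>2 * r\<close>.
  At points of the smaller ball the reflected mollifier is a test function in
  \<open>\<Omega>\<close>, so the mollification vanishes there; being arbitrarily close in L^1 to
  the restriction, it forces the integral of \<open>\<bar>w\<bar>\<close> over the small ball below
  every \<open>e\<close>.\<close>

lemma weak_zero_local:
  fixes w :: "'a::euclidean_space \<Rightarrow> real"
  assumes \<Omega>: "open \<Omega>" and w: "loc_integrable \<Omega> w"
    and zero: "\<And>\<phi>. test_fun \<Omega> \<phi> \<Longrightarrow> (\<integral>x. w x * \<phi> x \<partial>lebesgue_on \<Omega>) = 0"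
    and r: "0 < r" "cball p (2 * r) \<subseteq> \<Omega>"
  shows "negligible {x \<in> ball p r. w x \<noteq> 0}"
proof -
  define K where "K = cball p (2 * r)"
  have K: "compact K" "K \<subseteq> \<Omega>" using r by (auto simp: K_def)
  have i: "integrable lebesgue (\<lambda>x. indicator K x *\<^sub>R w x)"
    using w K unfolding loc_integrable_def set_integrable_def by blast
  obtain w0 where w0: "w0 \<in> borel_measurable lborel" "AE x in lborel. indicator K x *\<^sub>R w x = w0 x"
    using completion_ex_borel_measurable_real[OF borel_measurable_integrable[OF i]] by blast
  define w1 where "w1 x = (if x \<in> K then w0 x else 0)" for x
  have w1m[measurable]: "w1 \<in> borel_measurable borel" 
    unfolding w1_def using w0(1) K(1) by (intro measurable_If_set) (auto simp: borel_compact)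
  have ae: "AE x in lborel. indicator K x *\<^sub>R w x = w1 x"
    using w0(2) by eventually_elim (auto simp: w1_def)
  have "integrable lebesgue w1"
    using i by (rule integrable_cong_AE_imp)
      (use AE_completion[OF ae] w1m in \<open>auto intro: measurable_completion elim: AE_mp\<close>)
  then have w1i: "integrable lborel w1" using w1m by (simp add: integrable_completion)
  have conv0: "conv w1 \<rho> x = 0" if "smooth \<rho>" "\<And>x. norm x \<ge> \<delta> \<Longrightarrow> \<rho> x = 0" "\<delta> \<le> r" "x \<in> ball p r" for \<rho> :: "'a \<Rightarrow> real" and \<delta> x
  proof -
    have sub: "cball x \<delta> \<subseteq> K" 
    proof
      fix y assume "y \<in> cball x \<delta>"
      then show "y \<in> K" using dist_triangle[of p y x] that by (simp add: K_def)
    qed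
    have "(\<integral>y. w y * \<rho> (x - y) \<partial>lebesgue_on \<Omega>) = (\<integral>y. w1 y * \<rho> (x - y) \<partial>lborel)"
    proof (rule integral_lebesgue_on_borel(1))
      show "(\<lambda>y. w1 y * \<rho> (x - y)) \<in> borel_measurable borel"
        using smooth_measurable[OF that(1)] by measurable
      show "w1 y * \<rho> (x - y) = 0" if "y \<notin> \<Omega>" for y using that K by (auto simp: w1_def)
      show "AE y in lborel. y \<in> \<Omega> \<longrightarrow> w y * \<rho> (x - y) = w1 y * \<rho> (x - y)"
        using ae
      proof eventually_elim
        case (elim y)
        show ?case
        proof (cases "y \<in> K")
          case True then show ?thesis using elim by simp
        next
          case False
          then have "y \<notin> cball x \<delta>" using sub by blast
          then have "norm (x - y) \<ge> \<delta>" by (simp add: dist_norm)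
          then show ?thesis using that(2) by simp
        qed
      qed
    qed (use \<Omega> in auto)
    moreover have "test_fun \<Omega> (\<lambda>y. \<rho> (x - y))"
      by (rule test_fun_mollifier[OF that(1,2)]) (use sub K in auto)
    ultimately show ?thesis using zero[of "\<lambda>y. \<rho> (x - y)"] by (simp add: conv_def)
  qed
  have le_e: "(\<integral>\<^sup>+x. ennreal \<bar>w1 x\<bar> * indicator (ball p r) x \<partial>lborel) \<le> ennreal e" if "e > 0" for e
  proof -
    obtain \<eta> where \<eta>: "\<eta> > 0" "\<And>z. norm z < \<eta> \<Longrightarrow> (\<integral>\<^sup>+x. ennreal \<bar>w1 (x + z) - w1 x\<bar> \<partial>lborel) \<le> ennreal e"
      using L1_shift_cont_nn[OF w1i \<open>e > 0\<close>] by blast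
    have "min \<eta> r > 0" using \<eta> r by simp
    from smooth_mollifier[OF this] obtain \<rho> :: "'a \<Rightarrow> real" where \<rho>: "smooth \<rho>" "\<And>x. 0 \<le> \<rho> x" 
      "\<And>x. norm x \<ge> min \<eta> r \<Longrightarrow> \<rho> x = 0" "integrable lborel \<rho>" "(\<integral>x. \<rho> x \<partial>lborel) = 1" by metis
    have "(\<integral>\<^sup>+x. ennreal \<bar>w1 x\<bar> * indicator (ball p r) x \<partial>lborel) \<le> (\<integral>\<^sup>+x. ennreal \<bar>conv w1 \<rho> x - w1 x\<bar> \<partial>lborel)"
    proof (rule nn_integral_mono)
      fix x show "ennreal \<bar>w1 x\<bar> * indicator (ball p r) x \<le> ennreal \<bar>conv w1 \<rho> x - w1 x\<bar>"
        using conv0[where x=x, OF \<rho>(1,3)] by (cases "x \<in> ball p r") auto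
    qed
    also have "\<dots> \<le> ennreal e" by (rule mollify_L1[OF w1i \<rho> \<eta>(2)]) auto
    finally show ?thesis .
  qed
  have "(\<integral>\<^sup>+x. ennreal \<bar>w1 x\<bar> * indicator (ball p r) x \<partial>lborel) \<le> 0" 
    by (rule ennreal_le_epsilon) (simp_all only: le_e add_0 ennreal_zero_less_top)
  then have "(\<integral>\<^sup>+x. ennreal \<bar>w1 x\<bar> * indicator (ball p r) x \<partial>lborel) = 0" by simp
  then have "AE x in lborel. ennreal \<bar>w1 x\<bar> * indicator (ball p r) x = 0"
  proof (subst (asm) nn_integral_0_iff_AE)
    have [measurable]: "ball p r \<in> sets borel" by simp
    show "(\<lambda>x. ennreal \<bar>w1 x\<bar> * indicator (ball p r) x) \<in> borel_measurable lborel" by measurable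
  qed
  then have "AE x in lborel. x \<in> ball p r \<longrightarrow> w x = 0"
    using ae
  proof eventually_elim
    case (elim x)
    show ?case
    proof
      assume x: "x \<in> ball p r"
      then have "x \<in> K" using r(1) by (simp add: K_def)
      moreover have "w1 x = 0" using elim(1) x by simp
      ultimately show "w x = 0" using elim(2) by simp
    qed
  qed
  then have "AE x in lebesgue. x \<notin> {x \<in> ball p r. w x \<noteq> 0}"
    by (intro AE_completion) auto
  then have "{x \<in> ball p r. w x \<noteq> 0} \<in> null_sets lebesgue"
    by (subst complete_measure.null_sets_iff_AE[OF completion.complete_measure_axioms]) simp
  then show ?thesis by (simp add: negligible_iff_null_sets)
qed

lemma weak_zero:
  fixes w :: "'a::euclidean_space \<Rightarrow> real"
  assumes \<Omega>: "open \<Omega>" and w: "loc_integrable \<Omega> w"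
    and zero: "\<And>\<phi>. test_fun \<Omega> \<phi> \<Longrightarrow> (\<integral>x. w x * \<phi> x \<partial>lebesgue_on \<Omega>) = 0"
  shows "negligible {x \<in> \<Omega>. w x \<noteq> 0}"
proof (subst locally_negligible_alt, intro ballI)
  fix p assume p: "p \<in> {x \<in> \<Omega>. w x \<noteq> 0}"
  then obtain e where e: "e > 0" "cball p e \<subseteq> \<Omega>" using \<Omega> open_contains_cball by blast
  have "negligible {x \<in> ball p (e/2). w x \<noteq> 0}"
    by (rule weak_zero_local[OF assms]) (use e in auto)
  moreover have "{x \<in> \<Omega>. w x \<noteq> 0} \<inter> ball p (e/2) = {x \<in> ball p (e/2). w x \<noteq> 0}" using e by auto
  ultimately have "negligible ({x \<in> \<Omega>. w x \<noteq> 0} \<inter> ball p (e/2))" by simp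
  moreover have "openin (top_of_set {x \<in> \<Omega>. w x \<noteq> 0}) ({x \<in> \<Omega>. w x \<noteq> 0} \<inter> ball p (e/2))"
    by (rule openin_open_Int) simp
  moreover have "p \<in> {x \<in> \<Omega>. w x \<noteq> 0} \<inter> ball p (e/2)" using p e by simp
  ultimately show "\<exists>U. openin (top_of_set {x \<in> \<Omega>. w x \<noteq> 0}) U \<and> p \<in> U \<and> negligible U" by blast
qed

text \<open>\<open>heat_solution\<close>, \<open>has_trace\<close> and \<open>sobolev_H\<close> each
  provide some weak derivative; this is what allows them to be exchanged for one another.\<close>

lemma weak_deriv_unique:
  fixes u v v' :: "'a::euclidean_space \<Rightarrow> real"
  assumes "open \<Omega>" "weak_deriv \<Omega> bs u v" "weak_deriv \<Omega> bs u v'"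
  shows "AE x in lborel. x \<in> \<Omega> \<longrightarrow> v x = v' x"
proof -
  have l: "loc_integrable \<Omega> v" "loc_integrable \<Omega> v'" using assms unfolding weak_deriv_def by auto
  have "negligible {x \<in> \<Omega>. v x - v' x \<noteq> 0}"
  proof (rule weak_zero[OF \<open>open \<Omega>\<close> loc_integrable_diff[OF l]])
    fix \<phi> assume \<phi>: "test_fun \<Omega> \<phi>"
    then obtain K where K: "smooth \<phi>" "compact K" "K \<subseteq> \<Omega>" "\<And>x. x \<notin> K \<Longrightarrow> \<phi> x = 0" unfolding test_fun_def by blast
    have "(-1) ^ length bs * (\<integral>x. v x * \<phi> x \<partial>lebesgue_on \<Omega>) = (-1) ^ length bs * (\<integral>x. v' x * \<phi> x \<partial>lebesgue_on \<Omega>)"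
      using assms(2,3) \<phi> unfolding weak_deriv_def by (metis (no_types, lifting))
    then have "(\<integral>x. v x * \<phi> x \<partial>lebesgue_on \<Omega>) = (\<integral>x. v' x * \<phi> x \<partial>lebesgue_on \<Omega>)" by simp
    then show "(\<integral>x. (v x - v' x) * \<phi> x \<partial>lebesgue_on \<Omega>) = 0"
      using loc_integrable_test_fun[OF l(1) K \<open>open \<Omega>\<close>] loc_integrable_test_fun[OF l(2) K \<open>open \<Omega>\<close>]
      by (simp add: left_diff_distrib Bochner_Integration.integral_diff)
  qed
  then have "AE x in lebesgue. x \<notin> {x \<in> \<Omega>. v x - v' x \<noteq> 0}"
    using negligible_iff_null_sets AE_not_in by blast
  then show ?thesis by (auto simp: AE_completion_iff)
qed

text \<open>A test function for the smaller set is one for the larger set, and its iterated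
  derivatives vanish off its support, so both integrals see only \<open>\<Omega>'\<close>. This
  leads from the cylinder up to \<open>T\<close> to the one up to \<open>t_i\<close>.\<close>

lemma weak_deriv_subset:
  fixes u v :: "'a::euclidean_space \<Rightarrow> real"
  assumes "weak_deriv \<Omega> bs u v" "\<Omega>' \<subseteq> \<Omega>" "open \<Omega>'" "open \<Omega>" "set bs \<subseteq> Basis"
  shows "weak_deriv \<Omega>' bs u v"
proof -
  have vanish: "foldr partial bs \<phi> x = 0" if "closed K" "\<And>x. x \<notin> K \<Longrightarrow> \<phi> x = 0" "x \<notin> K" for \<phi> :: "'a \<Rightarrow> real" and x K
    using that(3)
  proof (induction bs arbitrary: x)
    case Nil then show ?case using that(2) by simp
  next
    case (Cons b bs)
    then show ?case using partial_zero_outside[of K "foldr partial bs \<phi>" x b] that(1) by simp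
  qed
  have eq: "(\<integral>x. f x \<partial>lebesgue_on \<Omega>) = (\<integral>x. f x \<partial>lebesgue_on \<Omega>')" if "\<And>x. x \<notin> \<Omega>' \<Longrightarrow> f x = 0" for f :: "'a \<Rightarrow> real"
  proof -
    have "(\<integral>x. f x \<partial>lebesgue_on \<Omega>) = (\<integral>x. indicator \<Omega> x *\<^sub>R f x \<partial>lebesgue)" 
      using assms(4) by (intro integral_restrict_space) simp
    also have "\<dots> = (\<integral>x. indicator \<Omega>' x *\<^sub>R f x \<partial>lebesgue)"
      by (rule Bochner_Integration.integral_cong) (use that assms(2) in \<open>auto simp: indicator_def\<close>)
    also have "\<dots> = (\<integral>x. f x \<partial>lebesgue_on \<Omega>')" 
      using assms(3) by (intro integral_restrict_space[symmetric]) simp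
    finally show ?thesis .
  qed
  show ?thesis unfolding weak_deriv_def
  proof (intro conjI allI impI)
    show "loc_integrable \<Omega>' u" "loc_integrable \<Omega>' v" using assms(1,2) unfolding weak_deriv_def loc_integrable_def by blast+
    fix \<phi> assume \<phi>: "test_fun \<Omega>' \<phi>"
    then obtain K where K: "smooth \<phi>" "compact K" "K \<subseteq> \<Omega>'" "\<And>x. x \<notin> K \<Longrightarrow> \<phi> x = 0" unfolding test_fun_def by blast
    have "test_fun \<Omega> \<phi>" using K assms(2) unfolding test_fun_def by blast
    then have "(\<integral>x. u x * foldr partial bs \<phi> x \<partial>lebesgue_on \<Omega>) = (-1) ^ length bs * (\<integral>x. v x * \<phi> x \<partial>lebesgue_on \<Omega>)"
      using assms(1) unfolding weak_deriv_def by blast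
    moreover have "foldr partial bs \<phi> x = 0" if "x \<notin> \<Omega>'" for x
      using vanish[of K \<phi> x] K that compact_imp_closed by blast
    moreover have "\<phi> x = 0" if "x \<notin> \<Omega>'" for x using K that by blast
    ultimately show "(\<integral>x. u x * foldr partial bs \<phi> x \<partial>lebesgue_on \<Omega>') = (-1) ^ length bs * (\<integral>x. v x * \<phi> x \<partial>lebesgue_on \<Omega>')"
      using eq[of "\<lambda>x. u x * foldr partial bs \<phi> x"] eq[of "\<lambda>x. v x * \<phi> x"] by simp
  qed
qed

section \<open>Density of smooth functions in second-order Sobolev spaces\<close>

text \<open>Only values of \<open>c\<close> on the compact closure of \<open>\<Omega>\<close>
  matter, where \<open>c\<close> is bounded; on a bounded set
  \<open>\<bar>u\<bar> \<le> u\<^sup>2 + 1\<close> turns square integrability into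
  integrability.\<close>

lemma sq_integrable_mult_bounded:
  fixes u c :: "'a::euclidean_space \<Rightarrow> real"
  assumes u: "sq_integrable u" "\<forall>x. x \<notin> \<Omega> \<longrightarrow> u x = 0" and "bounded \<Omega>" and c: "continuous_on UNIV c"
  shows "sq_integrable (\<lambda>x. c x * u x)" "integrable lborel (\<lambda>x. u x * c x)"
proof -
  note [measurable] = borel_measurable_continuous_onI[OF c]
  have um[measurable]: "u \<in> borel_measurable borel" and ui: "integrable lborel (\<lambda>x. (u x)\<^sup>2)"
    using u(1) by (auto simp: sq_integrable_def)
  have cp: "compact (closure \<Omega>)" using \<open>bounded \<Omega>\<close> by (simp add: compact_closure)
  have "compact (c ` closure \<Omega>)" by (intro compact_continuous_image cp continuous_on_subset[OF c]) auto
  then obtain B where B: "\<And>y. y \<in> c ` closure \<Omega> \<Longrightarrow> norm y \<le> B"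
    using compact_imp_bounded bounded_pos by metis
  have B: "\<bar>c x\<bar> \<le> \<bar>B\<bar>" if "x \<in> \<Omega>" for x using B[of "c x"] closure_subset[of \<Omega>] that by fastforce
  have "integrable lborel (\<lambda>x. (c x * u x)\<^sup>2)"
  proof (rule Bochner_Integration.integrable_bound)
    show "integrable lborel (\<lambda>x. \<bar>B\<bar>\<^sup>2 * (u x)\<^sup>2)" using ui by simp
    show "AE x in lborel. norm ((c x * u x)\<^sup>2) \<le> norm (\<bar>B\<bar>\<^sup>2 * (u x)\<^sup>2)"
    proof (rule AE_I2)
      fix x
      show "norm ((c x * u x)\<^sup>2) \<le> norm (\<bar>B\<bar>\<^sup>2 * (u x)\<^sup>2)"
      proof (cases "x \<in> \<Omega>")
        case True
        have "\<bar>c x\<bar>\<^sup>2 \<le> \<bar>B\<bar>\<^sup>2" using B[OF True] by (intro power_mono) auto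
        then show ?thesis by (simp add: power_mult_distrib mult_right_mono)
      qed (simp add: u(2))
    qed
  qed measurable
  then show "sq_integrable (\<lambda>x. c x * u x)" by (simp add: sq_integrable_def)
  obtain r where r: "\<forall>x\<in>\<Omega>. norm x \<le> r" using \<open>bounded \<Omega>\<close> unfolding bounded_iff by blast
  show "integrable lborel (\<lambda>x. u x * c x)"
  proof (rule Bochner_Integration.integrable_bound)
    show "integrable lborel (\<lambda>x. \<bar>B\<bar> * ((u x)\<^sup>2 + indicat_real (cball 0 r) x))" using ui
      by (simp add: integrable_indicator_iff emeasure_lborel_cball_finite[unfolded infinity_ennreal_def] del: indicator_simps)
    show "AE x in lborel. norm (u x * c x) \<le> norm (\<bar>B\<bar> * ((u x)\<^sup>2 + indicat_real (cball 0 r) x))"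
    proof (rule AE_I2)
      fix x
      show "norm (u x * c x) \<le> norm (\<bar>B\<bar> * ((u x)\<^sup>2 + indicat_real (cball 0 r) x))"
      proof (cases "x \<in> \<Omega>")
        case True
        have "\<bar>u x\<bar> \<le> (u x)\<^sup>2 + 1"
        proof -
          have "0 \<le> (\<bar>u x\<bar> - 1)\<^sup>2" by simp
          then have "2 * \<bar>u x\<bar> \<le> (u x)\<^sup>2 + 1" unfolding power2_diff by simp
          then show ?thesis by linarith
        qed
        then have "\<bar>c x\<bar> * \<bar>u x\<bar> \<le> \<bar>B\<bar> * ((u x)\<^sup>2 + 1)" using B[OF True] by (intro mult_mono) auto
        moreover have "x \<in> cball 0 r" using r True by simp
        ultimately show ?thesis by (simp add: abs_mult mult.commute)
      qed (simp add: u(2))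
    qed
  qed measurable
qed

lemma sq_integrable_add:
  assumes "sq_integrable f" "sq_integrable g"
  shows "sq_integrable (\<lambda>x. f x + g x)"
proof -
  have [measurable]: "f \<in> borel_measurable borel" "g \<in> borel_measurable borel"
    and i: "integrable lborel (\<lambda>x. (f x)\<^sup>2)" "integrable lborel (\<lambda>x. (g x)\<^sup>2)"
    using assms by (auto simp: sq_integrable_def)
  have "integrable lborel (\<lambda>x. (f x + g x)\<^sup>2)"
  proof (rule Bochner_Integration.integrable_bound)
    show "integrable lborel (\<lambda>x. 2 * (f x)\<^sup>2 + 2 * (g x)\<^sup>2)" using i by simp
    have "(a + b)\<^sup>2 \<le> 2 * a\<^sup>2 + 2 * b\<^sup>2" for a b :: real 
      using zero_le_power2[of "a - b"] by (simp add: power2_eq_square algebra_simps)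
    then show "AE x in lborel. norm ((f x + g x)\<^sup>2) \<le> norm (2 * (f x)\<^sup>2 + 2 * (g x)\<^sup>2)" by simp
  qed measurable
  then show ?thesis by (simp add: sq_integrable_def)
qed

lemma sq_int_add:
  assumes [measurable]: "f \<in> borel_measurable borel" "g \<in> borel_measurable borel" "\<Omega> \<in> sets borel"
  shows "sq_int \<Omega> (\<lambda>x. f x + g x) \<le> 2 * sq_int \<Omega> f + 2 * sq_int \<Omega> g"
proof -
  have "sq_int \<Omega> (\<lambda>x. f x + g x) \<le> (\<integral>\<^sup>+x. 2 * (ennreal ((f x)\<^sup>2) * indicator \<Omega> x) + 2 * (ennreal ((g x)\<^sup>2) * indicator \<Omega> x) \<partial>lborel)"
    unfolding sq_int_def
  proof (rule nn_integral_mono)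
    fix x
    have "(f x + g x)\<^sup>2 \<le> 2 * (f x)\<^sup>2 + 2 * (g x)\<^sup>2"
      using zero_le_power2[of "f x - g x"] by (simp add: power2_eq_square algebra_simps)
    then have "ennreal ((f x + g x)\<^sup>2) \<le> 2 * ennreal ((f x)\<^sup>2) + 2 * ennreal ((g x)\<^sup>2)"
      by (simp add: ennreal_leI flip: ennreal_plus ennreal_mult' ennreal_numeral)
    then show "ennreal ((f x + g x)\<^sup>2) * indicator \<Omega> x \<le> 2 * (ennreal ((f x)\<^sup>2) * indicator \<Omega> x) + 2 * (ennreal ((g x)\<^sup>2) * indicator \<Omega> x)"
      by (auto simp: indicator_def)
  qed
  also have "\<dots> = 2 * sq_int \<Omega> f + 2 * sq_int \<Omega> g"
  proof -
    have m: "(\<lambda>x. ennreal ((f x)\<^sup>2) * indicator \<Omega> x) \<in> borel_measurable lborel"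
      "(\<lambda>x. ennreal ((g x)\<^sup>2) * indicator \<Omega> x) \<in> borel_measurable lborel" by measurable
    show ?thesis unfolding sq_int_def
      by (subst nn_integral_add[OF borel_measurable_times_ennreal[OF _ m(1)] borel_measurable_times_ennreal[OF _ m(2)]])
        (simp_all only: nn_integral_cmult[OF m(1)] nn_integral_cmult[OF m(2)] borel_measurable_const)
  qed
  finally show ?thesis .
qed

text \<open>Only pure second derivatives are tracked: the Laplacian does not see mixed ones, and cutoffs,
  shifts and mollification act on each coordinate direction separately.\<close>

definition H2_data :: "'a::euclidean_space set \<Rightarrow> ('a \<Rightarrow> real) \<Rightarrow> ('a \<Rightarrow> 'a \<Rightarrow> real) \<Rightarrow> ('a \<Rightarrow> 'a \<Rightarrow> real) \<Rightarrow> bool" where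
  "H2_data \<Omega> u v w \<longleftrightarrow> sq_integrable u \<and> (\<forall>x. x \<notin> \<Omega> \<longrightarrow> u x = 0) \<and>
     (\<forall>b\<in>Basis. sq_integrable (v b) \<and> sq_integrable (w b) \<and> (\<forall>x. x \<notin> \<Omega> \<longrightarrow> v b x = 0 \<and> w b x = 0) \<and>
       (\<forall>\<phi>. test_fun \<Omega> \<phi> \<longrightarrow>
          (\<integral>x. u x * partial b \<phi> x \<partial>lborel) = - (\<integral>x. v b x * \<phi> x \<partial>lborel) \<and>
          (\<integral>x. u x * partial b (partial b \<phi>) x \<partial>lborel) = (\<integral>x. w b x * \<phi> x \<partial>lborel)))"

text \<open>The approximants live on the whole space and have bounded support because they will be
  convolved with exponentials, which grow at infinity.\<close>

definition H2_approximable :: "'a::euclidean_space set \<Rightarrow> ('a \<Rightarrow> real) \<Rightarrow> ('a \<Rightarrow> 'a \<Rightarrow> real) \<Rightarrow> ('a \<Rightarrow> 'a \<Rightarrow> real) \<Rightarrow> bool" where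
  "H2_approximable \<Omega> u v w \<longleftrightarrow> (\<forall>e>0. \<exists>\<phi> r. smooth \<phi> \<and> (\<forall>x. norm x \<ge> r \<longrightarrow> \<phi> x = 0) \<and>
     sq_int \<Omega> (\<lambda>x. \<phi> x - u x) \<le> ennreal e \<and>
     (\<forall>b\<in>Basis. sq_int \<Omega> (\<lambda>x. partial b \<phi> x - v b x) \<le> ennreal e \<and>
        sq_int \<Omega> (\<lambda>x. partial b (partial b \<phi>) x - w b x) \<le> ennreal e))"

lemma test_fun_mult:
  assumes "test_fun \<Omega> \<phi>" "smooth h"
  shows "test_fun \<Omega> (\<lambda>x. h x * \<phi> x)"
proof -
  obtain K where "smooth \<phi>" "compact K" "K \<subseteq> \<Omega>" "\<And>x. x \<notin> K \<Longrightarrow> \<phi> x = 0" using assms unfolding test_fun_def by blast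
  then show ?thesis unfolding test_fun_def by (intro conjI smooth_mult[OF assms(2)] exI[of _ K]) auto
qed

text \<open>The factor is moved onto the test function:
  \<open>h \<phi>' = (h \<phi>)' - h' \<phi>\<close> and
  \<open>h \<phi>'' = (h \<phi>)'' - 2 (h' \<phi>)' + h'' \<phi>\<close>, where
  \<open>h \<phi>\<close> and \<open>h' \<phi>\<close> are test functions again. The weak identities
  for \<open>u\<close> then produce the Leibniz formulas.\<close>

lemma H2_data_mult:
  assumes H: "H2_data \<Omega> u v w" and "bounded \<Omega>" and h: "smooth h"
  shows "H2_data \<Omega> (\<lambda>x. h x * u x) (\<lambda>b x. h x * v b x + partial b h x * u x)
    (\<lambda>b x. h x * w b x + 2 * partial b h x * v b x + partial b (partial b h) x * u x)"
  unfolding H2_data_def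
proof (intro conjI ballI allI impI)
  have u: "sq_integrable u" "\<forall>x. x \<notin> \<Omega> \<longrightarrow> u x = 0" using H by (auto simp: H2_data_def)
  have hc: "continuous_on UNIV h" by (rule smooth_continuous[OF h])
  note mu = sq_integrable_mult_bounded[OF u \<open>bounded \<Omega>\<close>]
  show "sq_integrable (\<lambda>x. h x * u x)" by (rule mu(1)[OF hc])
  show "h x * u x = 0" if "x \<notin> \<Omega>" for x using u(2) that by simp
  fix b :: 'a assume b: "b \<in> Basis"
  have v: "sq_integrable (v b)" "\<forall>x. x \<notin> \<Omega> \<longrightarrow> v b x = 0" and w: "sq_integrable (w b)" "\<forall>x. x \<notin> \<Omega> \<longrightarrow> w b x = 0"
    using H b by (auto simp: H2_data_def)
  note mv = sq_integrable_mult_bounded[OF v \<open>bounded \<Omega>\<close>] and mw = sq_integrable_mult_bounded[OF w \<open>bounded \<Omega>\<close>]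
  have h1: "smooth (partial b h)" and h2: "smooth (partial b (partial b h))"
    using smooth_partial h b by blast+
  note hc1 = smooth_continuous[OF h1] and hc2 = smooth_continuous[OF h2]
  show "sq_integrable (\<lambda>x. h x * v b x + partial b h x * u x)"
    by (intro sq_integrable_add mu(1) mv(1) hc hc1)
  show "sq_integrable (\<lambda>x. h x * w b x + 2 * partial b h x * v b x + partial b (partial b h) x * u x)"
    by (intro sq_integrable_add mu(1) mv(1) mw(1) hc hc1 hc2 continuous_intros)
  show "h x * v b x + partial b h x * u x = 0" if "x \<notin> \<Omega>" for x using u(2) v(2) that by simp
  show "h x * w b x + 2 * partial b h x * v b x + partial b (partial b h) x * u x = 0" if "x \<notin> \<Omega>" for x
    using u(2) v(2) w(2) that by simp
  fix \<phi> assume \<phi>: "test_fun \<Omega> \<phi>"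
  then have s: "smooth \<phi>" by (simp add: test_fun_def)
  note s1 = smooth_partial[OF s b]
  note s2 = smooth_partial[OF s1 b]
  note c = smooth_continuous[OF s] and c1 = smooth_continuous[OF s1] and c2 = smooth_continuous[OF s2]
  have wd: "(\<integral>x. u x * partial b \<psi> x \<partial>lborel) = - (\<integral>x. v b x * \<psi> x \<partial>lborel)" 
    "(\<integral>x. u x * partial b (partial b \<psi>) x \<partial>lborel) = (\<integral>x. w b x * \<psi> x \<partial>lborel)" if "test_fun \<Omega> \<psi>" for \<psi>
    using H b that by (auto simp: H2_data_def)
  note t0 = test_fun_mult[OF \<phi> h] and t1 = test_fun_mult[OF \<phi> h1]
  have p0: "partial b (\<lambda>x. h x * \<phi> x) = (\<lambda>x. h x * partial b \<phi> x + partial b h x * \<phi> x)"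
    using partial_mult smooth_differentiable[OF h] smooth_differentiable[OF s] by blast
  have p1: "partial b (\<lambda>x. partial b h x * \<phi> x) = (\<lambda>x. partial b h x * partial b \<phi> x + partial b (partial b h) x * \<phi> x)"
    using partial_mult smooth_differentiable[OF h1] smooth_differentiable[OF s] by blast
  have p00: "partial b (partial b (\<lambda>x. h x * \<phi> x)) = (\<lambda>x. h x * partial b (partial b \<phi>) x + 2 * (partial b h x * partial b \<phi> x) + partial b (partial b h) x * \<phi> x)"
  proof
    fix x
    have d: "(\<lambda>x. h x * partial b \<phi> x) differentiable (at x)" "(\<lambda>x. partial b h x * \<phi> x) differentiable (at x)"
      by (rule smooth_differentiable[OF smooth_mult[OF h s1]], rule smooth_differentiable[OF smooth_mult[OF h1 s]])
    show "partial b (partial b (\<lambda>x. h x * \<phi> x)) x = h x * partial b (partial b \<phi>) x + 2 * (partial b h x * partial b \<phi> x) + partial b (partial b h) x * \<phi> x"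
      unfolding p0 partial_add[OF d] partial_mult[OF smooth_differentiable[OF h] smooth_differentiable[OF s1]]
       partial_mult[OF smooth_differentiable[OF h1] smooth_differentiable[OF s]] by simp
  qed
  note i = mu(2) mv(2) mw(2)
  note ci = continuous_on_mult hc hc1 hc2 c c1 c2
  have "(\<integral>x. h x * u x * partial b \<phi> x \<partial>lborel) = (\<integral>x. u x * partial b (\<lambda>x. h x * \<phi> x) x - u x * (partial b h x * \<phi> x) \<partial>lborel)"
    unfolding p0 by (intro Bochner_Integration.integral_cong) (auto simp: algebra_simps)
  also have "\<dots> = (\<integral>x. u x * partial b (\<lambda>x. h x * \<phi> x) x \<partial>lborel) - (\<integral>x. u x * (partial b h x * \<phi> x) \<partial>lborel)"
    unfolding p0 by (intro Bochner_Integration.integral_diff i ci continuous_on_add)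
  also have "\<dots> = - ((\<integral>x. v b x * (h x * \<phi> x) \<partial>lborel) + (\<integral>x. u x * (partial b h x * \<phi> x) \<partial>lborel))"
    unfolding wd(1)[OF t0] by simp
  also have "(\<integral>x. v b x * (h x * \<phi> x) \<partial>lborel) + (\<integral>x. u x * (partial b h x * \<phi> x) \<partial>lborel)
    = (\<integral>x. v b x * (h x * \<phi> x) + u x * (partial b h x * \<phi> x) \<partial>lborel)"
    by (intro Bochner_Integration.integral_add[symmetric] i ci)
  finally show "(\<integral>x. h x * u x * partial b \<phi> x \<partial>lborel) = - (\<integral>x. (h x * v b x + partial b h x * u x) * \<phi> x \<partial>lborel)"
    by (simp add: algebra_simps)
  have "(\<integral>x. h x * u x * partial b (partial b \<phi>) x \<partial>lborel) = (\<integral>x. u x * partial b (partial b (\<lambda>x. h x * \<phi> x)) x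
      - 2 * (u x * partial b (\<lambda>x. partial b h x * \<phi> x) x) + u x * (partial b (partial b h) x * \<phi> x) \<partial>lborel)"
    unfolding p00 p1 by (intro Bochner_Integration.integral_cong) (auto simp: algebra_simps)
  also have "\<dots> = (\<integral>x. u x * partial b (partial b (\<lambda>x. h x * \<phi> x)) x - 2 * (u x * partial b (\<lambda>x. partial b h x * \<phi> x) x) \<partial>lborel)
     + (\<integral>x. u x * (partial b (partial b h) x * \<phi> x) \<partial>lborel)"
    unfolding p00 p1 by (intro Bochner_Integration.integral_add Bochner_Integration.integrable_diff integrable_mult_right i ci continuous_on_add continuous_on_const)
  also have "(\<integral>x. u x * partial b (partial b (\<lambda>x. h x * \<phi> x)) x - 2 * (u x * partial b (\<lambda>x. partial b h x * \<phi> x) x) \<partial>lborel)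
    = (\<integral>x. u x * partial b (partial b (\<lambda>x. h x * \<phi> x)) x \<partial>lborel) - (\<integral>x. 2 * (u x * partial b (\<lambda>x. partial b h x * \<phi> x) x) \<partial>lborel)"
    unfolding p00 p1 by (intro Bochner_Integration.integral_diff integrable_mult_right i ci continuous_on_add continuous_on_const)
  also have "(\<integral>x. 2 * (u x * partial b (\<lambda>x. partial b h x * \<phi> x) x) \<partial>lborel) = 2 * (\<integral>x. u x * partial b (\<lambda>x. partial b h x * \<phi> x) x \<partial>lborel)"
    by simp
  also have "(\<integral>x. u x * partial b (partial b (\<lambda>x. h x * \<phi> x)) x \<partial>lborel) - 2 * (\<integral>x. u x * partial b (\<lambda>x. partial b h x * \<phi> x) x \<partial>lborel)
     + (\<integral>x. u x * (partial b (partial b h) x * \<phi> x) \<partial>lborel)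
     = (\<integral>x. w b x * (h x * \<phi> x) \<partial>lborel) + (\<integral>x. 2 * (v b x * (partial b h x * \<phi> x)) \<partial>lborel) + (\<integral>x. u x * (partial b (partial b h) x * \<phi> x) \<partial>lborel)"
    unfolding wd(2)[OF t0] wd(1)[OF t1] by simp
  also have "\<dots> = (\<integral>x. w b x * (h x * \<phi> x) + 2 * (v b x * (partial b h x * \<phi> x)) + u x * (partial b (partial b h) x * \<phi> x) \<partial>lborel)"
    by (subst Bochner_Integration.integral_add, intro Bochner_Integration.integrable_add integrable_mult_right i ci, intro i ci,
       subst Bochner_Integration.integral_add, intro i ci, intro integrable_mult_right i ci, rule refl)
  finally show "(\<integral>x. h x * u x * partial b (partial b \<phi>) x \<partial>lborel) 
    = (\<integral>x. (h x * w b x + 2 * partial b h x * v b x + partial b (partial b h) x * u x) * \<phi> x \<partial>lborel)"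
    by (simp add: algebra_simps)
qed

lemma H2_approximable_add:
  assumes 1: "H2_approximable \<Omega> u1 v1 w1" and 2: "H2_approximable \<Omega> u2 v2 w2" and [measurable]: "\<Omega> \<in> sets borel"
    and D1: "H2_data \<Omega> u1 v1 w1" and D2: "H2_data \<Omega> u2 v2 w2"
  shows "H2_approximable \<Omega> (\<lambda>x. u1 x + u2 x) (\<lambda>b x. v1 b x + v2 b x) (\<lambda>b x. w1 b x + w2 b x)"
  unfolding H2_approximable_def
proof (intro allI impI)
  fix e :: real assume "e > 0"
  then have e4: "e/4 > 0" by simp
  obtain \<phi>1 r1 where \<phi>1: "smooth \<phi>1" "\<And>x. norm x \<ge> r1 \<Longrightarrow> \<phi>1 x = 0" "sq_int \<Omega> (\<lambda>x. \<phi>1 x - u1 x) \<le> ennreal (e/4)"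
    "\<And>b. b \<in> Basis \<Longrightarrow> sq_int \<Omega> (\<lambda>x. partial b \<phi>1 x - v1 b x) \<le> ennreal (e/4)"
    "\<And>b. b \<in> Basis \<Longrightarrow> sq_int \<Omega> (\<lambda>x. partial b (partial b \<phi>1) x - w1 b x) \<le> ennreal (e/4)"
    using 1[unfolded H2_approximable_def, rule_format, OF e4] by blast
  obtain \<phi>2 r2 where \<phi>2: "smooth \<phi>2" "\<And>x. norm x \<ge> r2 \<Longrightarrow> \<phi>2 x = 0" "sq_int \<Omega> (\<lambda>x. \<phi>2 x - u2 x) \<le> ennreal (e/4)"
    "\<And>b. b \<in> Basis \<Longrightarrow> sq_int \<Omega> (\<lambda>x. partial b \<phi>2 x - v2 b x) \<le> ennreal (e/4)"
    "\<And>b. b \<in> Basis \<Longrightarrow> sq_int \<Omega> (\<lambda>x. partial b (partial b \<phi>2) x - w2 b x) \<le> ennreal (e/4)"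
    using 2[unfolded H2_approximable_def, rule_format, OF e4] by blast
  have add: "sq_int \<Omega> (\<lambda>x. (f1 x + f2 x) - (g1 x + g2 x)) \<le> ennreal e"
    if "sq_int \<Omega> (\<lambda>x. f1 x - g1 x) \<le> ennreal (e/4)" "sq_int \<Omega> (\<lambda>x. f2 x - g2 x) \<le> ennreal (e/4)"
      "smooth f1" "smooth f2" "sq_integrable g1" "sq_integrable g2" for f1 f2 g1 g2
  proof -
    have [measurable]: "f1 \<in> borel_measurable borel" "f2 \<in> borel_measurable borel"
       "g1 \<in> borel_measurable borel" "g2 \<in> borel_measurable borel"
      using that smooth_measurable by (auto simp: sq_integrable_def)
    have "sq_int \<Omega> (\<lambda>x. (f1 x + f2 x) - (g1 x + g2 x)) = sq_int \<Omega> (\<lambda>x. (f1 x - g1 x) + (f2 x - g2 x))"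
      by (simp add: algebra_simps)
    also have "\<dots> \<le> 2 * sq_int \<Omega> (\<lambda>x. f1 x - g1 x) + 2 * sq_int \<Omega> (\<lambda>x. f2 x - g2 x)"
      by (rule sq_int_add) measurable
    also have "\<dots> \<le> 2 * ennreal (e/4) + 2 * ennreal (e/4)" using that by (intro add_mono mult_left_mono) auto
    also have "\<dots> = ennreal e" using \<open>e > 0\<close> by (simp flip: ennreal_plus ennreal_mult' ennreal_numeral)
    finally show ?thesis .
  qed
  have p1: "partial b (\<lambda>x. \<phi>1 x + \<phi>2 x) = (\<lambda>x. partial b \<phi>1 x + partial b \<phi>2 x)" for b
    using partial_add smooth_differentiable \<phi>1(1) \<phi>2(1) by blast
  have p2: "partial b (\<lambda>x. partial b \<phi>1 x + partial b \<phi>2 x) = (\<lambda>x. partial b (partial b \<phi>1) x + partial b (partial b \<phi>2) x)" if "b \<in> Basis" for b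
    using partial_add smooth_differentiable[OF smooth_partial[OF \<phi>1(1) that]] smooth_differentiable[OF smooth_partial[OF \<phi>2(1) that]] by blast
  show "\<exists>\<phi> r. smooth \<phi> \<and> (\<forall>x. norm x \<ge> r \<longrightarrow> \<phi> x = 0) \<and> sq_int \<Omega> (\<lambda>x. \<phi> x - (u1 x + u2 x)) \<le> ennreal e \<and>
     (\<forall>b\<in>Basis. sq_int \<Omega> (\<lambda>x. partial b \<phi> x - (v1 b x + v2 b x)) \<le> ennreal e \<and>
        sq_int \<Omega> (\<lambda>x. partial b (partial b \<phi>) x - (w1 b x + w2 b x)) \<le> ennreal e)"
  proof (intro exI[of _ "\<lambda>x. \<phi>1 x + \<phi>2 x"] exI[of _ "max r1 r2"] conjI ballI)
    show "smooth (\<lambda>x. \<phi>1 x + \<phi>2 x)" by (rule smooth_add[OF \<phi>1(1) \<phi>2(1)])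
    show "\<forall>x. max r1 r2 \<le> norm x \<longrightarrow> \<phi>1 x + \<phi>2 x = 0" using \<phi>1(2) \<phi>2(2) by simp
    show "sq_int \<Omega> (\<lambda>x. \<phi>1 x + \<phi>2 x - (u1 x + u2 x)) \<le> ennreal e"
      using D1 D2 by (intro add \<phi>1(1,3) \<phi>2(1,3)) (auto simp: H2_data_def)
    fix b :: 'a assume b: "b \<in> Basis"
    have i: "sq_integrable (v1 b)" "sq_integrable (v2 b)" "sq_integrable (w1 b)" "sq_integrable (w2 b)"
      using D1 D2 b unfolding H2_data_def by blast+
    have s: "smooth (partial b \<phi>1)" "smooth (partial b \<phi>2)" by (rule smooth_partial[OF \<phi>1(1) b], rule smooth_partial[OF \<phi>2(1) b])
    show "sq_int \<Omega> (\<lambda>x. partial b (\<lambda>x. \<phi>1 x + \<phi>2 x) x - (v1 b x + v2 b x)) \<le> ennreal e"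
      unfolding p1 by (rule add[OF \<phi>1(4)[OF b] \<phi>2(4)[OF b] s(1,2) i(1,2)])
    show "sq_int \<Omega> (\<lambda>x. partial b (partial b (\<lambda>x. \<phi>1 x + \<phi>2 x)) x - (w1 b x + w2 b x)) \<le> ennreal e"
      unfolding p1 p2[OF b]
      by (rule add[OF \<phi>1(5)[OF b] \<phi>2(5)[OF b] smooth_partial[OF s(1) b] smooth_partial[OF s(2) b] i(3,4)])
  qed
qed

section \<open>Localisation and inward shifts\<close>

text \<open>The segment condition, with one direction and one maximal step length for all points of
  the closure near \<open>p\<close>. The closed ball keeps this part of the closure compact when
  \<open>\<Omega>\<close> is bounded.\<close>

definition inward :: "'a::euclidean_space set \<Rightarrow> 'a \<Rightarrow> real \<Rightarrow> 'a \<Rightarrow> bool" where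
  "inward \<Omega> p R e \<longleftrightarrow> 0 < R \<and>
     (\<exists>s0>0. \<forall>y\<in>closure \<Omega> \<inter> cball p R. \<forall>s. 0 < s \<and> s \<le> s0 \<longrightarrow> y + s *\<^sub>R e \<in> \<Omega>)"

lemma sq_integrable_integrable:
  assumes "sq_integrable u" "\<forall>x. x \<notin> \<Omega> \<longrightarrow> u x = 0" "bounded \<Omega>"
  shows "integrable lborel u"
  using sq_integrable_mult_bounded(2)[OF assms, of "\<lambda>_. 1"] by simp

text \<open>Shifting by \<open>s *\<^sub>R e\<close> moves the part of \<open>\<Omega>\<close> near \<open>p\<close> into the interior, where
  mollifiers are admissible test functions.\<close>

lemma H2_approximable_local:
  fixes u :: "'a::euclidean_space \<Rightarrow> real"
  assumes \<Omega>: "open \<Omega>" "bounded \<Omega>" and H: "H2_data \<Omega> u v w" and inw: "inward \<Omega> p R d"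
    and supp: "\<And>x. dist p x \<ge> R/2 \<Longrightarrow> u x = 0 \<and> (\<forall>b\<in>Basis. v b x = 0 \<and> w b x = 0)"
  shows "H2_approximable \<Omega> u v w"
  unfolding H2_approximable_def
proof (intro allI impI)
  fix e :: real assume "e > 0"
  have R: "R > 0" using inw by (simp add: inward_def)
  obtain s0 where s0: "s0 > 0" "\<forall>y\<in>closure \<Omega> \<inter> cball p R. \<forall>s. 0 < s \<and> s \<le> s0 \<longrightarrow> y + s *\<^sub>R d \<in> \<Omega>"
    using inw unfolding inward_def by blast
  \<comment> \<open>All functions to be approximated at once; being finitely many, they share one
    shift threshold \<open>\<eta>\<close>.\<close>
  define G where "G = insert u ((\<lambda>b. v b) ` Basis \<union> (\<lambda>b. w b) ` Basis)"
  have Gfin: "finite G" by (simp add: G_def)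
  have G: "sq_integrable g \<and> (\<forall>x. x \<notin> \<Omega> \<longrightarrow> g x = 0) \<and> (\<forall>x. dist p x \<ge> R/2 \<longrightarrow> g x = 0)" if "g \<in> G" for g
    using that H supp by (auto simp: G_def H2_data_def)
  have "\<exists>\<eta>>0. \<forall>g\<in>G. \<forall>z. norm z < \<eta> \<longrightarrow> (\<integral>\<^sup>+x. ennreal ((g (x + z) - g x)\<^sup>2) \<partial>lborel) \<le> ennreal e"
  proof -
    have "\<forall>g\<in>G. \<exists>\<eta>>0. \<forall>z. norm z < \<eta> \<longrightarrow> (\<integral>\<^sup>+x. ennreal ((g (x + z) - g x)\<^sup>2) \<partial>lborel) \<le> ennreal e"
    proof
      fix g assume "g \<in> G"
      then have "g \<in> borel_measurable borel" "integrable lborel (\<lambda>x. (g x)\<^sup>2)" using G by (auto simp: sq_integrable_def)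
      from L2_shift_cont[OF this \<open>e > 0\<close>]
      show "\<exists>\<eta>>0. \<forall>z. norm z < \<eta> \<longrightarrow> (\<integral>\<^sup>+x. ennreal ((g (x + z) - g x)\<^sup>2) \<partial>lborel) \<le> ennreal e" .
    qed
    from bchoice[OF this] obtain \<eta>f where \<eta>f: "\<And>g. g \<in> G \<Longrightarrow> \<eta>f g > 0"
      "\<And>g z. g \<in> G \<Longrightarrow> norm z < \<eta>f g \<Longrightarrow> (\<integral>\<^sup>+x. ennreal ((g (x + z) - g x)\<^sup>2) \<partial>lborel) \<le> ennreal e" by blast
    have ne: "\<eta>f ` G \<noteq> {}" by (simp add: G_def)
    show ?thesis
    proof (intro exI[of _ "Min (\<eta>f ` G)"] conjI ballI allI impI)
      show "Min (\<eta>f ` G) > 0" using Gfin ne \<eta>f(1) by (subst Min_gr_iff) auto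
      fix g :: "'a \<Rightarrow> real" and z :: 'a
      assume g: "g \<in> G" "norm z < Min (\<eta>f ` G)"
      then have "Min (\<eta>f ` G) \<le> \<eta>f g" using Gfin by simp
      then have "norm z < \<eta>f g" using g(2) by linarith
      then show "(\<integral>\<^sup>+x. ennreal ((g (x + z) - g x)\<^sup>2) \<partial>lborel) \<le> ennreal e" using \<eta>f(2) g(1) by blast
    qed
  qed
  then obtain \<eta> where \<eta>: "\<eta> > 0" "\<And>g z. g \<in> G \<Longrightarrow> norm z < \<eta> \<Longrightarrow> (\<integral>\<^sup>+x. ennreal ((g (x + z) - g x)\<^sup>2) \<partial>lborel) \<le> ennreal e"
    by blast
  \<comment> \<open>The shift and the mollification radius are at most \<open>m\<close> each.
    Together they do not exceed \<open>\<eta>\<close>, nor \<open>R/2\<close>, the gap between the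
    support of the data and the sphere of radius \<open>R\<close>.\<close>
  define m where "m = min \<eta> (R/2) / 2"
  have m: "m > 0" "2 * m \<le> \<eta>" "m \<le> R/4" using \<eta>(1) R by (auto simp: m_def)
  define s where "s = min s0 (m / (norm d + 1))"
  have s: "s > 0" "s \<le> s0" using s0 m by (auto simp: s_def add_nonneg_pos)
  have sd: "norm (s *\<^sub>R d) \<le> m"
  proof -
    have "s * norm d \<le> m / (norm d + 1) * norm d" by (intro mult_right_mono) (auto simp: s_def)
    also have "\<dots> \<le> m" using m(1) by (simp add: divide_le_eq add_pos_nonneg algebra_simps)
    finally show ?thesis using s by simp
  qed
  \<comment> \<open>By compactness the shifted points keep a uniform distance
    \<open>\<delta>0\<close> from the complement of \<open>\<Omega>\<close>, so one mollifier radius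
    serves them all.\<close>
  define C where "C = (\<lambda>y. y + s *\<^sub>R d) ` (closure \<Omega> \<inter> cball p R)"
  have "compact C" unfolding C_def using \<Omega>(2)
    by (intro compact_continuous_image continuous_intros) (auto simp: compact_Int_closed compact_closure)
  moreover have "C \<subseteq> \<Omega>" using s0(2) s by (auto simp: C_def)
  ultimately obtain \<delta>0 where \<delta>0: "\<delta>0 > 0" "(\<Union>x\<in>C. cball x \<delta>0) \<subseteq> \<Omega>"
    using compact_subset_open_imp_cball_epsilon_subset[of C \<Omega>] \<Omega>(1) by metis
  define \<delta> where "\<delta> = min \<delta>0 m"
  have \<delta>: "\<delta> > 0" "\<delta> \<le> \<delta>0" "\<delta> \<le> m" using \<delta>0 m by (auto simp: \<delta>_def)
  from smooth_mollifier[OF \<delta>(1)] obtain \<rho> :: "'a \<Rightarrow> real" where \<rho>: "smooth \<rho>" "\<And>x. 0 \<le> \<rho> x" 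
      "\<And>x. norm x \<ge> \<delta> \<Longrightarrow> \<rho> x = 0" "integrable lborel \<rho>" "(\<integral>x. \<rho> x \<partial>lborel) = 1" by metis
  define \<phi> where "\<phi> x = conv u \<rho> (x + s *\<^sub>R d)" for x
  have ui: "integrable lborel u" 
    using sq_integrable_integrable[of u \<Omega>] \<Omega>(2) G[of u] by (simp add: G_def)
  have p1: "partial b \<phi> x = conv u (partial b \<rho>) (x + s *\<^sub>R d)" if b: "b \<in> Basis" for b x
  proof -
    have "partial b \<phi> x = partial b (conv u \<rho>) (x + s *\<^sub>R d)" 
      unfolding \<phi>_def[abs_def] by (simp add: partial_translate)
    also have "\<dots> = conv u (partial b \<rho>) (x + s *\<^sub>R d)"
      by (rule conv_partial(2)[OF ui _ _ b]) (use \<rho>(1,3) in \<open>auto simp: smooth_def\<close>)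
    finally show ?thesis .
  qed
  have dz: "partial b \<rho> z = 0" if "norm z > \<delta>" for b z
    using partial_zero_outside[of "cball 0 \<delta>" \<rho> z b] \<rho>(3) that by auto
  have p2: "partial b (partial b \<phi>) x = conv u (partial b (partial b \<rho>)) (x + s *\<^sub>R d)" if b: "b \<in> Basis" for b x
  proof -
    have "partial b \<phi> = (\<lambda>x. conv u (partial b \<rho>) (x + s *\<^sub>R d))" using p1[OF b] by auto
    then have "partial b (partial b \<phi>) x = partial b (conv u (partial b \<rho>)) (x + s *\<^sub>R d)" 
      by (simp add: partial_translate)
    also have "\<dots> = conv u (partial b (partial b \<rho>)) (x + s *\<^sub>R d)"
      by (rule conv_partial(2)[OF ui _ _ b, of _ "\<delta> + 1"]) 
        (use smooth_partial[OF \<rho>(1) b] dz in \<open>auto simp: smooth_def\<close>)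
    finally show ?thesis .
  qed
  \<comment> \<open>Near \<open>p\<close> the mollifier centred at the shifted point is a test
    function, and the weak identity moves the derivatives from the kernel to \<open>u\<close>. Away
    from \<open>p\<close> both sides vanish, as the shifted point is farther than
    \<open>\<delta>\<close> from the support of the data.\<close>
  have conv_eq: "conv u (partial b \<rho>) (x + s *\<^sub>R d) = conv (v b) \<rho> (x + s *\<^sub>R d) \<and>
     conv u (partial b (partial b \<rho>)) (x + s *\<^sub>R d) = conv (w b) \<rho> (x + s *\<^sub>R d)" if x: "x \<in> \<Omega>" and b: "b \<in> Basis" for x b
  proof (cases "x \<in> cball p R")
    case True
    define c where "c = x + s *\<^sub>R d"
    have "c \<in> C" unfolding C_def c_def using x True closure_subset by blast
    then have "cball c \<delta>0 \<subseteq> \<Omega>" using \<delta>0(2) by blast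
    then have "cball c \<delta> \<subseteq> \<Omega>" using subset_cball[OF \<delta>(2), of c] by blast
    then have t: "test_fun \<Omega> (\<lambda>y. \<rho> (c - y))" using test_fun_mollifier[of \<rho> \<delta> c \<Omega>] \<rho>(1,3) by blast
    \<comment> \<open>Reflection contributes one sign per derivative: at first order it cancels the
      sign of the weak identity, at second order neither side has one.\<close>
    have r1: "partial b (\<lambda>y. \<rho> (c - y)) = (\<lambda>y. - partial b \<rho> (c - y))"
      using partial_reflect(1)[OF smooth_differentiable[OF \<rho>(1)]] by blast
    have r2: "partial b (\<lambda>y. - partial b \<rho> (c - y)) = (\<lambda>y. partial b (partial b \<rho>) (c - y))"
    proof
      fix y
      have d: "partial b \<rho> differentiable (at z)" for z by (rule smooth_differentiable[OF smooth_partial[OF \<rho>(1) b]])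
      have "partial b (\<lambda>y. (-1) * partial b \<rho> (c - y)) y = (-1) * partial b (\<lambda>y. partial b \<rho> (c - y)) y"
        by (rule partial_cmult[OF partial_reflect(2)[OF d]])
      then show "partial b (\<lambda>y. - partial b \<rho> (c - y)) y = partial b (partial b \<rho>) (c - y)"
        using partial_reflect(1)[where c=c and y=y and b=b, OF d] by simp
    qed
    have "(\<integral>y. u y * partial b (\<lambda>y. \<rho> (c - y)) y \<partial>lborel) = - (\<integral>y. v b y * \<rho> (c - y) \<partial>lborel)"
      "(\<integral>y. u y * partial b (partial b (\<lambda>y. \<rho> (c - y))) y \<partial>lborel) = (\<integral>y. w b y * \<rho> (c - y) \<partial>lborel)"
      using H b t unfolding H2_data_def by blast+
    then show ?thesis unfolding r1 r2 conv_def c_def[symmetric] by simp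
  next
    case False
    have far: "g y * k (x + s *\<^sub>R d - y) = 0" if "g \<in> G" "\<And>z. norm z > \<delta> \<Longrightarrow> k z = 0" for g k and y
    proof (cases "dist p y \<ge> R/2")
      case True then show ?thesis using G[OF that(1)] by simp
    next
      case F: False
      have "norm (x - y) > R/2" using F False dist_triangle[of p x y] by (simp add: dist_norm norm_minus_commute)
      moreover have "norm (x - y) \<le> norm (x + s *\<^sub>R d - y) + norm (s *\<^sub>R d)"
        using norm_triangle_ineq4[of "x + s *\<^sub>R d - y" "s *\<^sub>R d"] by (simp add: algebra_simps)
      ultimately have "norm (x + s *\<^sub>R d - y) > \<delta>" using sd \<delta>(3) m(3) by linarith
      then show ?thesis using that(2) by simp
    qed
    have "u \<in> G" "v b \<in> G" "w b \<in> G" using b by (auto simp: G_def)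
    moreover have "partial b (partial b \<rho>) z = 0" if "norm z > \<delta>" for z
      using partial_zero_outside[of "cball 0 \<delta>" "partial b \<rho>" z b] dz that by auto
    ultimately have z: "u y * partial b \<rho> (x + s *\<^sub>R d - y) = 0" "u y * partial b (partial b \<rho>) (x + s *\<^sub>R d - y) = 0"
      "v b y * \<rho> (x + s *\<^sub>R d - y) = 0" "w b y * \<rho> (x + s *\<^sub>R d - y) = 0" for y
      using far dz \<rho>(3) by (simp_all only: less_imp_le)
    show ?thesis unfolding conv_def z by simp
  qed
  have est: "sq_int \<Omega> (\<lambda>x. f x - g x) \<le> ennreal e" if g: "g \<in> G" and f: "\<And>x. x \<in> \<Omega> \<Longrightarrow> f x = conv g \<rho> (x + s *\<^sub>R d)" for f g
  proof -
    have "sq_int \<Omega> (\<lambda>x. f x - g x) \<le> (\<integral>\<^sup>+x. ennreal ((conv g \<rho> (x + s *\<^sub>R d) - g x)\<^sup>2) \<partial>lborel)"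
      unfolding sq_int_def by (rule nn_integral_mono) (use f in \<open>auto simp: indicator_def\<close>)
    also have "\<dots> \<le> ennreal e"
    proof (rule mollify_L2[OF _ _ \<rho>])
      show "sq_integrable g" using G[OF g] by blast
      show "integrable lborel g" using sq_integrable_integrable[of g \<Omega>] \<Omega>(2) G[OF g] by blast
      show "norm (s *\<^sub>R d) + \<delta> \<le> \<eta>" using sd \<delta>(3) m(2) by linarith
    qed (use \<eta>(2)[OF g] in auto)
    finally show ?thesis .
  qed
  obtain r where r: "\<forall>x\<in>\<Omega>. norm x \<le> r" using \<Omega>(2) unfolding bounded_iff by blast
  show "\<exists>\<phi> r. smooth \<phi> \<and> (\<forall>x. norm x \<ge> r \<longrightarrow> \<phi> x = 0) \<and> sq_int \<Omega> (\<lambda>x. \<phi> x - u x) \<le> ennreal e \<and>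
     (\<forall>b\<in>Basis. sq_int \<Omega> (\<lambda>x. partial b \<phi> x - v b x) \<le> ennreal e \<and>
        sq_int \<Omega> (\<lambda>x. partial b (partial b \<phi>) x - w b x) \<le> ennreal e)"
  proof (intro exI[of _ \<phi>] exI[of _ "r + \<delta> + norm (s *\<^sub>R d)"] conjI ballI allI impI)
    have "smooth (conv u \<rho>)" by (rule smooth_conv[OF ui \<rho>(1,3)])
    then show "smooth \<phi>" unfolding \<phi>_def[abs_def] smooth_def using Ck_translate by blast
    show "\<phi> x = 0" if x: "norm x \<ge> r + \<delta> + norm (s *\<^sub>R d)" for x
    proof -
      have uz: "u y * \<rho> (x + s *\<^sub>R d - y) = 0" for y
      proof (cases "y \<in> \<Omega>")
        case True
        then have "norm y \<le> r" using r by blast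
        moreover have "norm x \<le> norm (x + s *\<^sub>R d - y) + norm y + norm (s *\<^sub>R d)"
          using norm_triangle_ineq4[of "x + s *\<^sub>R d - y + y" "s *\<^sub>R d"] norm_triangle_ineq[of "x + s *\<^sub>R d - y" y]
          by (simp add: algebra_simps)
        ultimately show ?thesis using \<rho>(3) x by simp
      next
        case False
        then show ?thesis using G[of u] by (simp add: G_def)
      qed
      show ?thesis unfolding \<phi>_def conv_def uz by simp
    qed
    show "sq_int \<Omega> (\<lambda>x. \<phi> x - u x) \<le> ennreal e" by (rule est) (simp_all add: G_def \<phi>_def)
    fix b :: 'a assume b: "b \<in> Basis"
    show "sq_int \<Omega> (\<lambda>x. partial b \<phi> x - v b x) \<le> ennreal e"
      by (rule est) (use b p1[OF b] conv_eq in \<open>simp_all add: G_def\<close>)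
    show "sq_int \<Omega> (\<lambda>x. partial b (partial b \<phi>) x - w b x) \<le> ennreal e"
      by (rule est) (use b p2[OF b] conv_eq in \<open>simp_all add: G_def\<close>)
  qed
qed

text \<open>Induction over the cover takes the place of a partition of unity: a bump at
  \<open>p\<close> splits off a part to which the local lemma applies, and the remainder vanishes
  near \<open>p\<close>. The radii are staggered: the cover uses \<open>R/4\<close>, where the bump
  is 1; the bump ends at \<open>R/3\<close>; the local lemma allows supports up to
  \<open>R/2\<close>.\<close>

lemma H2_approximable_cover:
  fixes u :: "'a::euclidean_space \<Rightarrow> real"
  assumes \<Omega>: "open \<Omega>" "bounded \<Omega>" and F: "finite F" "\<And>p. p \<in> F \<Longrightarrow> inward \<Omega> p (R p) (d p)"
  shows "H2_data \<Omega> u v w \<Longrightarrow>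
    (\<And>x. u x \<noteq> 0 \<or> (\<exists>b\<in>Basis. v b x \<noteq> 0 \<or> w b x \<noteq> 0) \<Longrightarrow> \<exists>p\<in>F. dist p x < R p / 4) \<Longrightarrow>
    H2_approximable \<Omega> u v w"
  using F
proof (induction F arbitrary: u v w rule: finite_induct)
  case empty
  then have z: "u x = 0" "b \<in> Basis \<Longrightarrow> v b x = 0" "b \<in> Basis \<Longrightarrow> w b x = 0" for x b by blast+
  have "sq_int \<Omega> (\<lambda>x. 0 - g x) = 0" if "\<And>x. g x = 0" for g using that by (simp add: sq_int_def)
  then show ?case unfolding H2_approximable_def using z
    by (intro allI impI exI[of _ "\<lambda>_. 0"] exI[of _ 0]) (simp add: smooth_const)
next
  case (insert p F)
  have "inward \<Omega> p (R p) (d p)" using insert by blast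
  then have R: "R p > 0" by (simp add: inward_def)
  have "0 < R p / 4" "R p / 4 < R p / 3" using R by auto
  from smooth_bump_ball[OF this, of p] obtain h
    where h: "smooth h" "\<And>x. dist x p \<le> R p / 4 \<Longrightarrow> h x = 1" "\<And>x. dist x p \<ge> R p / 3 \<Longrightarrow> h x = 0"
    by metis
  define k where "k x = 1 - h x" for x
  have k: "smooth k" unfolding k_def[abs_def] by (rule smooth_diff[OF smooth_const h(1)])
  have kp: "partial b k = (\<lambda>x. - partial b h x)" for b
    unfolding k_def[abs_def] using partial_diff[of "\<lambda>_. 1" _ h b] smooth_differentiable[OF h(1)] by fastforce
  have kpp: "partial b (partial b k) = (\<lambda>x. - partial b (partial b h) x)" if "b \<in> Basis" for b
    unfolding kp using partial_cmult[OF smooth_differentiable[OF smooth_partial[OF h(1) that]], of b "-1"] by fastforce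
  define u1 where "u1 = (\<lambda>x. h x * u x)"
  define v1 where "v1 = (\<lambda>b x. h x * v b x + partial b h x * u x)"
  define w1 where "w1 = (\<lambda>b x. h x * w b x + 2 * partial b h x * v b x + partial b (partial b h) x * u x)"
  define u2 where "u2 = (\<lambda>x. k x * u x)"
  define v2 where "v2 = (\<lambda>b x. k x * v b x + partial b k x * u x)"
  define w2 where "w2 = (\<lambda>b x. k x * w b x + 2 * partial b k x * v b x + partial b (partial b k) x * u x)"
  have D1: "H2_data \<Omega> u1 v1 w1" unfolding u1_def v1_def w1_def by (rule H2_data_mult[OF insert.prems(1) \<Omega>(2) h(1)])
  have D2: "H2_data \<Omega> u2 v2 w2" unfolding u2_def v2_def w2_def by (rule H2_data_mult[OF insert.prems(1) \<Omega>(2) k])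
  have "H2_approximable \<Omega> u1 v1 w1"
  proof (rule H2_approximable_local[OF \<Omega> D1])
    show "inward \<Omega> p (R p) (d p)" by fact
    fix x assume x: "dist p x \<ge> R p / 2"
    then have x3: "dist p x > R p / 3" using R by linarith
    have z1: "partial b h y = 0" if "y \<notin> cball p (R p / 3)" for b y
      using partial_zero_outside[of "cball p (R p / 3)" h y b] h(3) that by (auto simp: dist_commute)
    have "partial b (partial b h) x = 0" for b
      using partial_zero_outside[of "cball p (R p / 3)" "partial b h" x b] z1 x3 by auto
    then show "u1 x = 0 \<and> (\<forall>b\<in>Basis. v1 b x = 0 \<and> w1 b x = 0)"
      using z1[of x] h(3)[of x] x3 by (simp add: u1_def v1_def w1_def dist_commute)
  qed
  moreover have "H2_approximable \<Omega> u2 v2 w2"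
  proof (rule insert.IH[OF D2])
    fix x assume nz: "u2 x \<noteq> 0 \<or> (\<exists>b\<in>Basis. v2 b x \<noteq> 0 \<or> w2 b x \<noteq> 0)"
    have "\<not> dist p x < R p / 4"
    proof
      assume "dist p x < R p / 4"
      then have xb: "x \<in> ball p (R p / 4)" by simp
      \<comment> \<open>The strict inequality in the covering condition yields an open ball, so that
        \<open>k\<close> vanishes there together with its derivatives.\<close>
      have k0: "k y = 0" if "y \<in> ball p (R p / 4)" for y using h(2)[of y] that by (simp add: k_def dist_commute)
      have k1: "partial b k y = 0" if "y \<in> ball p (R p / 4)" for b y
        using partial_cong_open[of "ball p (R p / 4)" y k "\<lambda>_. 0" b] k0 that by simp
      have k2: "partial b (partial b k) x = 0" for b
        using partial_cong_open[of "ball p (R p / 4)" x "partial b k" "\<lambda>_. 0" b] k1 xb by simp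
      show False using nz k0[OF xb] k1[OF xb] k2 by (simp add: u2_def v2_def w2_def)
    qed
    moreover have "u x \<noteq> 0 \<or> (\<exists>b\<in>Basis. v b x \<noteq> 0 \<or> w b x \<noteq> 0)"
    proof (rule ccontr)
      assume "\<not> ?thesis"
      then have "u x = 0" "\<And>b. b \<in> Basis \<Longrightarrow> v b x = 0 \<and> w b x = 0" by blast+
      then show False using nz by (simp add: u2_def v2_def w2_def)
    qed
    then have "\<exists>q\<in>insert p F. dist q x < R q / 4" by (rule insert.prems(2))
    ultimately show "\<exists>q\<in>F. dist q x < R q / 4" by blast
  next
    show "inward \<Omega> q (R q) (d q)" if "q \<in> F" for q using insert.prems(3) that by blast
  qed
  ultimately have A: "H2_approximable \<Omega> (\<lambda>x. u1 x + u2 x) (\<lambda>b x. v1 b x + v2 b x) (\<lambda>b x. w1 b x + w2 b x)"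
    using \<Omega>(1) D1 D2 by (intro H2_approximable_add) auto
  have "u1 x + u2 x = u x" "v1 b x + v2 b x = v b x" for x b
    by (simp_all add: u1_def u2_def v1_def v2_def k_def kp[unfolded k_def[abs_def]] kp algebra_simps)
  moreover have "w1 b x + w2 b x = w b x" if "b \<in> Basis" for x b
    using kpp[OF that] by (simp add: w1_def w2_def kp k_def algebra_simps)
  ultimately show ?case using A unfolding H2_approximable_def by simp
qed

theorem H2_data_approximable:
  fixes u :: "'a::euclidean_space \<Rightarrow> real"
  assumes \<Omega>: "open \<Omega>" "bounded \<Omega>" and seg: "\<And>p. p \<in> closure \<Omega> \<Longrightarrow> \<exists>R d. inward \<Omega> p R d"
    and H: "H2_data \<Omega> u v w"
  shows "H2_approximable \<Omega> u v w"
proof -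
  obtain R d where Rd: "\<And>p. p \<in> closure \<Omega> \<Longrightarrow> inward \<Omega> p (R p) (d p)" using seg by metis
  have "compact (closure \<Omega>)" using \<Omega>(2) by (simp add: compact_closure)
  moreover have "open (ball p (R p / 4))" for p by simp
  moreover have "closure \<Omega> \<subseteq> (\<Union>p\<in>closure \<Omega>. ball p (R p / 4))" using Rd by (auto simp: inward_def)
  ultimately obtain F where F: "F \<subseteq> closure \<Omega>" "finite F" "closure \<Omega> \<subseteq> (\<Union>p\<in>F. ball p (R p / 4))"
    using compactE_image[of "closure \<Omega>" "closure \<Omega>" "\<lambda>p. ball p (R p / 4)"] by metis
  show ?thesis
  proof (rule H2_approximable_cover[OF \<Omega> F(2) _ H])
    show "inward \<Omega> p (R p) (d p)" if "p \<in> F" for p using that F(1) Rd by blast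
    fix x assume "u x \<noteq> 0 \<or> (\<exists>b\<in>Basis. v b x \<noteq> 0 \<or> w b x \<noteq> 0)"
    then have "x \<in> \<Omega>" using H unfolding H2_data_def by blast
    then have "x \<in> (\<Union>p\<in>F. ball p (R p / 4))" using F(3) closure_subset by blast
    then show "\<exists>p\<in>F. dist p x < R p / 4" by auto
  qed
qed

section \<open>Density of tanh networks\<close>

lemma partial_ridge:
  fixes w :: "'a::euclidean_space"
  assumes "(g has_real_derivative g') (at (w \<bullet> x + \<beta>))"
  shows "partial b (\<lambda>x. g (w \<bullet> x + \<beta>)) x = (w \<bullet> b) * g'"
proof -
  have 1: "((\<lambda>x. w \<bullet> x + \<beta>) has_derivative (\<lambda>h. w \<bullet> h)) (at x)" by (auto intro!: derivative_eq_intros)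
  have "(g has_derivative (\<lambda>h. g' * h)) (at (w \<bullet> x + \<beta>))" using assms by (simp add: has_field_derivative_def)
  from has_derivative_compose[OF 1 this] 
  have "((\<lambda>x. g (w \<bullet> x + \<beta>)) has_derivative (\<lambda>h. g' * (w \<bullet> h))) (at x)" .
  from partial_eqI[OF this] show ?thesis by simp
qed

lemma partial_1_real: "(g has_real_derivative g') (at x) \<Longrightarrow> partial 1 g x = g'" for g :: "real \<Rightarrow> real"
  using partial_ridge[of g g' 1 x 0 1] by simp

lemma real_DERIV_differentiable: "(g has_real_derivative g') (at x) \<Longrightarrow> g differentiable (at x)"
  by (auto simp: real_differentiable_def)

lemma Ck_exp: "Ck k (exp :: real \<Rightarrow> real)"
proof (induction k)
  case (Suc k)
  have "partial 1 (exp :: real \<Rightarrow> real) = exp" using partial_1_real[OF DERIV_exp] by blast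
  then show ?case using Suc real_DERIV_differentiable[OF DERIV_exp] by simp
next
  case 0
  show ?case unfolding Ck.simps by (intro continuous_on_exp continuous_on_id)
qed

lemma DERIV_tanh_real: "(tanh has_real_derivative 1 - (tanh x)\<^sup>2) (at (x::real))"
proof -
  have "cosh x \<noteq> 0" using cosh_real_pos[of x] by linarith
  from has_field_derivative_tanh[OF this DERIV_ident] show ?thesis by simp
qed

lemma Ck_tanh: "Ck k (tanh :: real \<Rightarrow> real)"
proof (induction k)
  case 0
  show ?case using DERIV_isCont[OF DERIV_tanh_real] by (simp add: continuous_at_imp_continuous_on)
next
  case (Suc k)
  have "partial 1 (tanh :: real \<Rightarrow> real) = (\<lambda>x. 1 - tanh x * tanh x)" 
    using partial_1_real[OF DERIV_tanh_real] by (auto simp: power2_eq_square)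
  then show ?case using Suc real_DERIV_differentiable[OF DERIV_tanh_real] 
    by (auto intro!: Ck_diff Ck_const Ck_mult)
qed

lemma smooth_ridge:
  fixes w :: "'a::euclidean_space"
  assumes "\<And>k. Ck k (g :: real \<Rightarrow> real)"
  shows "smooth (\<lambda>x. g (w \<bullet> x + \<beta>))"
proof -
  have "Ck k (\<lambda>x. w \<bullet> x + \<beta>)" for k
    by (subst inner_commute) (intro Ck_add Ck_inner Ck_const)
  then show ?thesis unfolding smooth_def by (intro allI) (rule Ck_compose_real[OF assms])
qed

text \<open>Among second derivatives only the pure ones are compared, in accordance with
  \<open>H2_data\<close>.\<close>

definition C2_close :: "real \<Rightarrow> real \<Rightarrow> ('a::euclidean_space \<Rightarrow> real) \<Rightarrow> ('a \<Rightarrow> real) \<Rightarrow> bool" where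
  "C2_close e r f g \<longleftrightarrow> (\<forall>x. norm x \<le> r \<longrightarrow> \<bar>f x - g x\<bar> \<le> e \<and>
     (\<forall>b\<in>Basis. \<bar>partial b f x - partial b g x\<bar> \<le> e \<and>
        \<bar>partial b (partial b f) x - partial b (partial b g) x\<bar> \<le> e))"

lemma C2_close_trans:
  assumes "C2_close e1 r f g" "C2_close e2 r g h"
  shows "C2_close (e1 + e2) r f h"
proof -
  have *: "\<bar>a - c\<bar> \<le> e1 + e2" if "\<bar>a - b\<bar> \<le> e1" "\<bar>b - c\<bar> \<le> e2" for a b c :: real using that by linarith
  show ?thesis unfolding C2_close_def
  proof (intro allI impI conjI ballI)
    fix x :: 'a assume x: "norm x \<le> r"
    show "\<bar>f x - h x\<bar> \<le> e1 + e2" by (rule *[where b="g x"]) (use assms x in \<open>auto simp: C2_close_def\<close>)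
    fix b :: 'a assume b: "b \<in> Basis"
    show "\<bar>partial b f x - partial b h x\<bar> \<le> e1 + e2"
      by (rule *[where b="partial b g x"]) (use assms x b in \<open>auto simp: C2_close_def\<close>)
    show "\<bar>partial b (partial b f) x - partial b (partial b h) x\<bar> \<le> e1 + e2"
      by (rule *[where b="partial b (partial b g) x"]) (use assms x b in \<open>auto simp: C2_close_def\<close>)
  qed
qed

lemma C2_close_add:
  assumes "C2_close e1 r f1 g1" "C2_close e2 r f2 g2" and s: "smooth f1" "smooth f2" "smooth g1" "smooth g2"
  shows "C2_close (e1 + e2) r (\<lambda>x. f1 x + f2 x) (\<lambda>x. g1 x + g2 x)"
proof -
  have p: "partial b (\<lambda>x. h1 x + h2 x) = (\<lambda>x. partial b h1 x + partial b h2 x)" 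
    if "smooth h1" "smooth h2" for b and h1 h2 :: "'a \<Rightarrow> real"
    using partial_add smooth_differentiable that by blast
  have *: "\<bar>a + b - (c + d)\<bar> \<le> e1 + e2" if "\<bar>a - c\<bar> \<le> e1" "\<bar>b - d\<bar> \<le> e2" for a b c d :: real using that by linarith
  show ?thesis unfolding C2_close_def
  proof (intro allI impI conjI ballI)
    fix x :: 'a assume x: "norm x \<le> r"
    show "\<bar>f1 x + f2 x - (g1 x + g2 x)\<bar> \<le> e1 + e2" using assms(1,2) x unfolding C2_close_def by (blast intro: *)
    fix b :: 'a assume b: "b \<in> Basis"
    show "\<bar>partial b (\<lambda>x. f1 x + f2 x) x - partial b (\<lambda>x. g1 x + g2 x) x\<bar> \<le> e1 + e2"
      unfolding p[OF s(1,2)] p[OF s(3,4)] using assms(1,2) x b unfolding C2_close_def by (blast intro: *)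
    show "\<bar>partial b (partial b (\<lambda>x. f1 x + f2 x)) x - partial b (partial b (\<lambda>x. g1 x + g2 x)) x\<bar> \<le> e1 + e2"
      unfolding p[OF s(1,2)] p[OF s(3,4)] 
        p[OF smooth_partial[OF s(1) b] smooth_partial[OF s(2) b]] p[OF smooth_partial[OF s(3) b] smooth_partial[OF s(4) b]]
      using assms(1,2) x b unfolding C2_close_def by (blast intro: *)
  qed
qed

section \<open>Exponential sums and tanh sums\<close>

text \<open>This class is the intermediary because it is closed under products and under convolution
  with compactly supported functions; frequency \<open>w = 0\<close> yields the constants.\<close>

inductive exp_sum :: "('a::euclidean_space \<Rightarrow> real) \<Rightarrow> bool" where
  exp_sum_single: "exp_sum (\<lambda>x. c * exp (w \<bullet> x))"
| exp_sum_add: "exp_sum f \<Longrightarrow> exp_sum g \<Longrightarrow> exp_sum (\<lambda>x. f x + g x)"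

text \<open>The constant in each summand absorbs the offset between \<open>tanh\<close> and the
  exponential and ends up in the output bias of the network.\<close>

inductive tanh_sum :: "('a::euclidean_space \<Rightarrow> real) \<Rightarrow> bool" where
  tanh_sum_single: "tanh_sum (\<lambda>x. a * tanh (w \<bullet> x + \<beta>) + c)"
| tanh_sum_add: "tanh_sum f \<Longrightarrow> tanh_sum g \<Longrightarrow> tanh_sum (\<lambda>x. f x + g x)"

lemma exp_sum_smooth: "exp_sum f \<Longrightarrow> smooth f"
proof (induction rule: exp_sum.induct)
  case (exp_sum_single c w)
  show ?case using smooth_cmult[OF smooth_ridge[OF Ck_exp, of w 0], of c] unfolding add_0_right .
next
  case (exp_sum_add f g)
  show ?case by (rule smooth_add[OF exp_sum_add.IH])
qed

lemma tanh_sum_smooth: "tanh_sum f \<Longrightarrow> smooth f"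
proof (induction rule: tanh_sum.induct)
  case (tanh_sum_single a w \<beta> c)
  have "smooth (\<lambda>x. a * tanh (w \<bullet> x + \<beta>))" by (rule smooth_cmult[OF smooth_ridge[OF Ck_tanh]])
  then show ?case by (rule smooth_add[OF _ smooth_const])
next
  case (tanh_sum_add f g)
  show ?case by (rule smooth_add[OF tanh_sum_add.IH])
qed

lemma exp_sum_const: "exp_sum (\<lambda>x. c)"
  using exp_sum_single[of c 0] by simp

lemma exp_sum_mult_single: "exp_sum g \<Longrightarrow> exp_sum (\<lambda>x. c * exp (w \<bullet> x) * g x)"
proof (induction rule: exp_sum.induct)
  case (exp_sum_single d v)
  have "(\<lambda>x. c * exp (w \<bullet> x) * (d * exp (v \<bullet> x))) = (\<lambda>x. (c * d) * exp ((w + v) \<bullet> x))"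
    by (auto simp: inner_add_left exp_add)
  then show ?case by (metis exp_sum.exp_sum_single)
next
  case (exp_sum_add f g)
  then show ?case using exp_sum.exp_sum_add by (simp add: distrib_left)
qed

lemma exp_sum_mult: "exp_sum f \<Longrightarrow> exp_sum g \<Longrightarrow> exp_sum (\<lambda>x. f x * g x)"
proof (induction rule: exp_sum.induct)
  case (exp_sum_single c w) then show ?case by (rule exp_sum_mult_single)
next
  case (exp_sum_add f1 f2) then show ?case using exp_sum.exp_sum_add by (simp add: distrib_right)
qed

lemma exp_sum_power: "exp_sum f \<Longrightarrow> exp_sum (\<lambda>x. f x ^ n)"
  by (induction n) (auto intro: exp_sum_const exp_sum_mult)

lemma exp_sum_sum: "finite I \<Longrightarrow> (\<And>i. i \<in> I \<Longrightarrow> exp_sum (f i)) \<Longrightarrow> exp_sum (\<lambda>x. \<Sum>i\<in>I. f i x)"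
  by (induction I rule: finite_induct) (auto intro: exp_sum_const exp_sum_add)

lemma integrable_compact_support:
  fixes U :: "'a::euclidean_space \<Rightarrow> real"
  assumes "continuous_on UNIV U" "\<forall>x. norm x \<ge> r \<longrightarrow> U x = 0"
  shows "integrable lborel U"
proof -
  have "integrable lborel (\<lambda>x. indicator (cball 0 r) x *\<^sub>R U x)"
    using borel_integrable_compact[of "cball 0 r" U] assms(1) continuous_on_subset by (auto simp: set_integrable_def)
  moreover have "(\<lambda>x. indicator (cball 0 r) x *\<^sub>R U x) = U"
  proof
    fix x show "indicator (cball 0 r) x *\<^sub>R U x = U x" using assms(2) by (cases "norm x \<le> r") auto
  qed
  ultimately show ?thesis by simp
qed

lemma integrable_compact_support_mult:
  fixes U k :: "'a::euclidean_space \<Rightarrow> real"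
  assumes "continuous_on UNIV U" "\<forall>x. norm x \<ge> r \<longrightarrow> U x = 0" "continuous_on UNIV k"
  shows "integrable lborel (\<lambda>y. U y * k (x - y))"
proof (rule integrable_compact_support)
  have "continuous_on UNIV (\<lambda>y. k (x - y))"
    by (rule continuous_on_compose2[OF assms(3)]) (auto intro!: continuous_intros)
  then show "continuous_on UNIV (\<lambda>y. U y * k (x - y))" by (rule continuous_on_mult[OF assms(1)])
  show "\<forall>y. r \<le> norm y \<longrightarrow> U y * k (x - y) = 0" using assms(2) by simp
qed

text \<open>\<open>exp (w \<bullet> (x - y))\<close> factors, so the integral over \<open>y\<close>
  changes nothing but the coefficient. The bounded support of \<open>U\<close> secures the
  integrability behind additivity.\<close>

lemma exp_sum_conv:
  fixes U :: "'a::euclidean_space \<Rightarrow> real"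
  assumes U: "continuous_on UNIV U" "\<forall>x. norm x \<ge> r \<longrightarrow> U x = 0"
  shows "exp_sum K \<Longrightarrow> exp_sum (conv U K)"
proof (induction rule: exp_sum.induct)
  case (exp_sum_single c w)
  have "conv U (\<lambda>x. c * exp (w \<bullet> x)) x = (\<integral>y. U y * (c * exp (- (w \<bullet> y))) \<partial>lborel) * exp (w \<bullet> x)" for x
  proof -
    have "conv U (\<lambda>x. c * exp (w \<bullet> x)) x = (\<integral>y. (U y * (c * exp (- (w \<bullet> y)))) * exp (w \<bullet> x) \<partial>lborel)"
      unfolding conv_def by (intro Bochner_Integration.integral_cong) (simp_all add: inner_diff_right exp_diff exp_minus field_simps)
    then show ?thesis by simp
  qed
  then have "conv U (\<lambda>x. c * exp (w \<bullet> x)) = (\<lambda>x. (\<integral>y. U y * (c * exp (- (w \<bullet> y))) \<partial>lborel) * exp (w \<bullet> x))" by blast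
  then show ?case by (metis exp_sum.exp_sum_single)
next
  case (exp_sum_add f g)
  have c: "continuous_on UNIV f" "continuous_on UNIV g" using exp_sum_add.hyps by (auto intro: smooth_continuous exp_sum_smooth)
  have "conv U (\<lambda>x. f x + g x) x = conv U f x + conv U g x" for x
    unfolding conv_def by (subst Bochner_Integration.integral_add[symmetric]) 
      (auto intro!: integrable_compact_support_mult[OF U] c simp: distrib_left)
  then have "conv U (\<lambda>x. f x + g x) = (\<lambda>x. conv U f x + conv U g x)" by blast
  then show ?case using exp_sum.exp_sum_add[OF exp_sum_add.IH] by simp
qed

section \<open>Concentrating kernels made of exponentials\<close>

text \<open>The analogue of \<open>1 - \<bar>z\<bar>\<^sup>2\<close> in the algebra of exponentials:
  \<open>S\<close> sums the squares \<open>(exp (t/2) - exp (- (t/2)))\<^sup>2\<close> over the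
  coordinates \<open>t\<close> of \<open>z\<close>, hence is positive off the origin, and
  \<open>B\<close> is its bound on the ball.\<close>

lemma exp_bump:
  assumes "\<rho> > 0"
  obtains P :: "'a::euclidean_space \<Rightarrow> real" where "exp_sum P" "P 0 = 1" 
    "\<And>z. norm z \<le> \<rho> \<Longrightarrow> 0 \<le> P z" "\<And>z. z \<noteq> 0 \<Longrightarrow> P z < 1"
proof -
  define S where "S z = (\<Sum>b\<in>Basis. exp (b \<bullet> z) + exp ((- b) \<bullet> z) - 2)" for z :: 'a
  have sq: "exp t + exp (- t) - 2 = (exp (t/2) - exp (- (t/2)))\<^sup>2" for t :: real
    by (simp add: power2_eq_square algebra_simps flip: exp_add)
  have nonneg: "exp (b \<bullet> z) + exp ((- b) \<bullet> z) - 2 \<ge> 0" for b z :: 'a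
    unfolding inner_minus_left sq by simp
  have pos: "exp (b \<bullet> z) + exp ((- b) \<bullet> z) - 2 > 0" if "b \<bullet> z \<noteq> 0" for b z :: 'a
    unfolding inner_minus_left sq using that by (simp add: zero_less_power2)
  have "exp_sum (\<lambda>z. exp (b \<bullet> z) + exp ((- b) \<bullet> z) - 2)" for b :: 'a
    using exp_sum_add[OF exp_sum_add[OF exp_sum_single[of 1 b] exp_sum_single[of 1 "- b"]] exp_sum_const[of "-2"]] by simp
  then have eS: "exp_sum S" unfolding S_def[abs_def] by (intro exp_sum_sum) auto
  have Spos: "S z > 0" if "z \<noteq> 0" for z
  proof -
    have "\<exists>b\<in>Basis. z \<bullet> b \<noteq> 0" using that euclidean_all_zero_iff[of z] by blast
    then obtain b where b: "b \<in> Basis" "z \<bullet> b \<noteq> 0" by blast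
    then show ?thesis unfolding S_def using nonneg pos[of b z]
      by (intro sum_pos2[of Basis b]) (auto simp: inner_commute[of z])
  qed
  have "compact (S ` cball 0 \<rho>)"
    by (intro compact_continuous_image smooth_continuous exp_sum_smooth eS compact_cball)
  then obtain B where B: "B > 0" "\<forall>y \<in> S ` cball 0 \<rho>. norm y \<le> B"
    using compact_imp_bounded bounded_pos by metis
  have SB: "S z \<le> B" if "norm z \<le> \<rho>" for z
  proof -
    have "norm (S z) \<le> B" using B(2) that by simp
    then show ?thesis by simp
  qed
  show ?thesis
  proof (rule that[of "\<lambda>z. 1 + (- inverse B) * S z"])
    show "exp_sum (\<lambda>z. 1 + (- inverse B) * S z)" by (intro exp_sum_add exp_sum_mult exp_sum_const eS)
    show "1 + (- inverse B) * S 0 = 1" by (simp add: S_def)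
    show "0 \<le> 1 + (- inverse B) * S z" if "norm z \<le> \<rho>" for z using SB[OF that] B(1) by (simp add: field_simps)
    show "1 + (- inverse B) * S z < 1" if "z \<noteq> 0" for z using Spos[OF that] B(1) by simp
  qed
qed

text \<open>High powers of the bump, normalised on \<open>cball 0 \<rho>\<close>, concentrate at 0 as Landau kernels do.\<close>

lemma exp_kernel:
  assumes "\<rho> > 0" "\<eta> > 0" "\<epsilon> > 0"
  obtains K :: "'a::euclidean_space \<Rightarrow> real" where "exp_sum K" "\<And>z. norm z \<le> \<rho> \<Longrightarrow> K z \<ge> 0"
    "(\<integral>z. indicator (cball 0 \<rho>) z * K z \<partial>lborel) = 1"
    "(\<integral>z. indicator (cball 0 \<rho> - ball 0 \<eta>) z * K z \<partial>lborel) \<le> \<epsilon>"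
proof -
  from exp_bump[OF \<open>\<rho> > 0\<close>] obtain P :: "'a \<Rightarrow> real"
    where P: "exp_sum P" "P 0 = 1" "\<And>z. norm z \<le> \<rho> \<Longrightarrow> 0 \<le> P z" "\<And>z. z \<noteq> 0 \<Longrightarrow> P z < 1" by metis
  have Pc: "continuous_on S P" for S by (rule smooth_continuous[OF exp_sum_smooth[OF P(1)]])
  define Q where "Q = cball (0::'a) \<rho>"
  define A where "A = cball (0::'a) \<rho> - ball 0 \<eta>"
  have Q: "compact Q" "Q \<in> sets borel" and A: "compact A" "A \<in> sets borel" "A \<subseteq> Q"
    by (auto simp: Q_def A_def compact_diff borel_compact)
  have int: "integrable lborel (\<lambda>z. indicator S z * P z ^ m)" if "compact S" for S m
    using borel_integrable_compact[of S "\<lambda>z. P z ^ m"] that Pc continuous_on_power[OF Pc] by (simp add: set_integrable_def)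
  have "\<exists>q. 0 < q \<and> q < 1 \<and> (\<forall>z\<in>A. P z \<le> q)"
  proof (cases "A = {}")
    case True then show ?thesis by (intro exI[of _ "1/2"]) auto
  next
    case False
    obtain z0 where z0: "z0 \<in> A" "\<And>z. z \<in> A \<Longrightarrow> P z \<le> P z0" 
      using continuous_attains_sup[OF A(1) False Pc] by blast
    have "z0 \<noteq> 0" using z0(1) \<open>\<eta> > 0\<close> by (auto simp: A_def)
    then have "P z0 < 1" by (rule P(4))
    then show ?thesis using z0(2) by (intro exI[of _ "max (P z0) (1/2)"]) (auto simp: le_max_iff_disj)
  qed
  then obtain q where q: "0 < q" "q < 1" "\<And>z. z \<in> A \<Longrightarrow> P z \<le> q" by blast
  \<comment> \<open>Any value strictly between \<open>q\<close> and 1 would do: away from the origin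
    the powers are at most \<open>q ^ m\<close>, near it at least \<open>q' ^ m\<close>, so the
    normalised mass outside \<open>ball 0 \<eta>\<close> is at most a multiple of
    \<open>(q / q') ^ m\<close>.\<close>
  define q' where "q' = (1 + q) / 2"
  have q': "q < q'" "q' < 1" "0 < q'" using q by (auto simp: q'_def)
  have "\<exists>\<tau>>0. \<tau> \<le> \<rho> \<and> (\<forall>z\<in>ball 0 \<tau>. P z \<ge> q')"
  proof -
    have "isCont P 0" using Pc[of UNIV] by (simp add: continuous_on_eq_continuous_at)
    moreover have "1 - q' > 0" using q' by simp
    ultimately obtain d where d: "d > 0" "\<And>z. dist z 0 < d \<Longrightarrow> dist (P z) (P 0) < 1 - q'"
      unfolding continuous_at_eps_delta by blast
    have "P z \<ge> q'" if "z \<in> ball 0 (min d \<rho>)" for z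
      using d(2)[of z] that P(2) by (simp add: dist_real_def abs_less_iff)
    then show ?thesis using d(1) \<open>\<rho> > 0\<close> by (intro exI[of _ "min d \<rho>"]) auto
  qed
  then obtain \<tau> where \<tau>: "\<tau> > 0" "\<tau> \<le> \<rho>" "\<And>z. z \<in> ball 0 \<tau> \<Longrightarrow> P z \<ge> q'" by blast
  define v where "v = measure lborel (ball (0::'a) \<tau>)"
  define V where "V = measure lborel Q"
  have v: "v > 0" unfolding v_def using content_ball_pos[OF \<tau>(1)] by simp
  have fin: "emeasure lborel (ball (0::'a) \<tau>) < \<infinity>" "emeasure lborel Q < \<infinity>"
    unfolding Q_def by (rule emeasure_lborel_ball_finite, rule emeasure_lborel_cball_finite)
  have lower: "(\<integral>z. indicator Q z * P z ^ m \<partial>lborel) \<ge> q' ^ m * v" for m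
  proof -
    have "q' ^ m * v = (\<integral>z. q' ^ m * indicator (ball (0::'a) \<tau>) z \<partial>lborel)" unfolding v_def by simp
    also have "\<dots> \<le> (\<integral>z. indicator Q z * P z ^ m \<partial>lborel)"
    proof (rule integral_mono)
      show "integrable lborel (\<lambda>z. q' ^ m * indicat_real (ball (0::'a) \<tau>) z)"
        using fin(1) by (intro integrable_mult_right integrable_real_indicator) auto
      show "q' ^ m * indicat_real (ball 0 \<tau>) z \<le> indicator Q z * P z ^ m" for z
        using \<tau>(2) \<tau>(3)[of z] q'(3) P(3)[of z] by (auto simp: indicator_def Q_def intro!: power_mono)
    qed (rule int[OF Q(1)])
    finally show ?thesis .
  qed
  have upper: "(\<integral>z. indicator A z * P z ^ m \<partial>lborel) \<le> q ^ m * V" for m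
  proof -
    have "(\<integral>z. indicator A z * P z ^ m \<partial>lborel) \<le> (\<integral>z. q ^ m * indicator Q z \<partial>lborel)"
    proof (rule integral_mono)
      show "integrable lborel (\<lambda>z. q ^ m * indicat_real Q z)"
        using fin(2) Q(2) by (intro integrable_mult_right integrable_real_indicator) auto
      show "indicator A z * P z ^ m \<le> q ^ m * indicat_real Q z" for z
        using q(1) q(3)[of z] P(3)[of z] A(3) by (auto simp: indicator_def Q_def intro!: power_mono)
    qed (rule int[OF A(1)])
    also have "\<dots> = q ^ m * V" unfolding V_def by simp
    finally show ?thesis .
  qed
  have "(\<lambda>m. (q / q') ^ m * (V / v)) \<longlonglongrightarrow> 0 * (V / v)"
    using q q' by (intro tendsto_intros LIMSEQ_power_zero) auto
  then have "\<forall>\<^sub>F m in sequentially. (q / q') ^ m * (V / v) < \<epsilon>"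
    using \<open>\<epsilon> > 0\<close> by (intro order_tendstoD) auto
  then obtain m where m: "(q / q') ^ m * (V / v) < \<epsilon>" by (auto simp: eventually_sequentially)
  define I where "I = (\<integral>z. indicator Q z * P z ^ m \<partial>lborel)"
  have I: "I \<ge> q' ^ m * v" "I > 0"
  proof -
    show "I \<ge> q' ^ m * v" using lower[of m] by (simp add: I_def)
    moreover have "q' ^ m * v > 0" using v q' by simp
    ultimately show "I > 0" by linarith
  qed
  show ?thesis
  proof (rule that[of "\<lambda>z. inverse I * P z ^ m"])
    show "exp_sum (\<lambda>z. inverse I * P z ^ m)" by (intro exp_sum_mult exp_sum_const exp_sum_power P(1))
    show "inverse I * P z ^ m \<ge> 0" if "norm z \<le> \<rho>" for z using P(3)[OF that] I by simp
    have "(\<integral>z. indicator (cball 0 \<rho>) z * (inverse I * P z ^ m) \<partial>lborel) = (\<integral>z. inverse I * (indicator Q z * P z ^ m) \<partial>lborel)"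
      unfolding Q_def by (intro Bochner_Integration.integral_cong) auto
    also have "\<dots> = inverse I * I" unfolding I_def by simp
    finally show "(\<integral>z. indicator (cball 0 \<rho>) z * (inverse I * P z ^ m) \<partial>lborel) = 1" using I by simp
    have "(\<integral>z. indicator (cball 0 \<rho> - ball 0 \<eta>) z * (inverse I * P z ^ m) \<partial>lborel) = (\<integral>z. inverse I * (indicator A z * P z ^ m) \<partial>lborel)"
      unfolding A_def by (intro Bochner_Integration.integral_cong) auto
    also have "\<dots> = inverse I * (\<integral>z. indicator A z * P z ^ m \<partial>lborel)" by simp
    also have "\<dots> \<le> inverse I * (q ^ m * V)" using I upper by (intro mult_left_mono) auto
    also have "\<dots> \<le> inverse (q' ^ m * v) * (q ^ m * V)"
      using I q q' v by (intro mult_right_mono le_imp_inverse_le) (auto simp: V_def)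
    also have "\<dots> = (q / q') ^ m * (V / v)" by (simp add: divide_inverse power_mult_distrib power_inverse)
    finally show "(\<integral>z. indicator (cball 0 \<rho> - ball 0 \<eta>) z * (inverse I * P z ^ m) \<partial>lborel) \<le> \<epsilon>" using m by linarith
  qed
qed

text \<open>The estimate for an approximate identity: the kernel mass within \<open>\<eta>\<close>
  meets the oscillation \<open>\<alpha>\<close> of \<open>V\<close>, the mass beyond meets at most
  \<open>2 * B\<close>.\<close>

lemma conv_kernel_close:
  fixes g V :: "'a::euclidean_space \<Rightarrow> real"
  assumes g: "integrable lborel g" "\<And>z. g z \<ge> 0" "(\<integral>z. g z \<partial>lborel) = 1" "(\<integral>z. indicator (- ball 0 \<eta>) z * g z \<partial>lborel) \<le> \<epsilon>"
    and V: "continuous_on UNIV V" "\<And>x. \<bar>V x\<bar> \<le> B" and uc: "\<And>x y. norm y < \<eta> \<Longrightarrow> \<bar>V (x - y) - V x\<bar> \<le> \<alpha>" and "\<alpha> \<ge> 0"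
  shows "\<bar>conv g V x - V x\<bar> \<le> \<alpha> + 2 * B * \<epsilon>"
proof -
  have B: "B \<ge> 0" using V(2)[of 0] by linarith
  have i1: "integrable lborel (\<lambda>y. g y * V (x - y))" by (rule conv_integrable[OF g(1) V])
  have i2: "integrable lborel (\<lambda>y. g y * V (x - y) - g y * V x)" using i1 g(1) by simp
  have i3: "integrable lborel (\<lambda>y. indicator (- ball 0 \<eta>) y * g y)" 
    using integrable_mult_indicator[of "- ball 0 \<eta>" lborel g] g(1) by simp
  have "conv g V x - V x = (\<integral>y. g y * V (x - y) - g y * V x \<partial>lborel)"
    using i1 g(1,3) by (simp add: conv_def Bochner_Integration.integral_diff)
  then have "\<bar>conv g V x - V x\<bar> \<le> (\<integral>y. \<bar>g y * V (x - y) - g y * V x\<bar> \<partial>lborel)" using integral_abs_bound by simp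
  also have "\<dots> \<le> (\<integral>y. \<alpha> * g y + 2 * B * (indicator (- ball 0 \<eta>) y * g y) \<partial>lborel)"
  proof (rule integral_mono)
    show "integrable lborel (\<lambda>y. \<alpha> * g y + 2 * B * (indicator (- ball 0 \<eta>) y * g y))" using g(1) i3 by simp
    fix y
    have e: "\<bar>g y * V (x - y) - g y * V x\<bar> = g y * \<bar>V (x - y) - V x\<bar>"
      using g(2)[of y] by (simp add: abs_mult flip: right_diff_distrib)
    show "\<bar>g y * V (x - y) - g y * V x\<bar> \<le> \<alpha> * g y + 2 * B * (indicator (- ball 0 \<eta>) y * g y)"
    proof (cases "norm y < \<eta>")
      case True
      then have "g y * \<bar>V (x - y) - V x\<bar> \<le> g y * \<alpha>" using g(2) uc by (intro mult_left_mono) auto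
      then show ?thesis unfolding e using True by (simp add: mult.commute)
    next
      case False
      have "\<bar>V (x - y) - V x\<bar> \<le> 2 * B" using V(2)[of "x - y"] V(2)[of x] by linarith
      then have "g y * \<bar>V (x - y) - V x\<bar> \<le> g y * (2 * B)" using g(2) by (intro mult_left_mono) auto
      moreover have "\<alpha> * g y \<ge> 0" using g(2) \<open>\<alpha> \<ge> 0\<close> by simp
      ultimately show ?thesis unfolding e using False by (simp add: mult_ac)
    qed
  qed (use i2 in simp)
  also have "\<dots> = \<alpha> + 2 * B * (\<integral>y. indicator (- ball 0 \<eta>) y * g y \<partial>lborel)"
    using g(1,3) i3 by (subst Bochner_Integration.integral_add) auto
  also have "\<dots> \<le> \<alpha> + 2 * B * \<epsilon>" using g(4) B by (intro add_left_mono mult_left_mono) auto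
  finally show ?thesis .
qed

text \<open>If one of the two points lies in the ball of radius \<open>\<bar>r\<bar>\<close>, a step
  shorter than 1 keeps both in the enlarged ball, where compactness applies; otherwise both values
  are 0.\<close>

lemma uniformly_continuous_compact_support:
  fixes V :: "'a::euclidean_space \<Rightarrow> real"
  assumes "continuous_on UNIV V" "\<forall>x. norm x \<ge> r \<longrightarrow> V x = 0" "\<alpha> > 0"
  shows "\<exists>\<eta>>0. \<forall>x y. norm y < \<eta> \<longrightarrow> \<bar>V (x - y) - V x\<bar> \<le> \<alpha>"
proof -
  have "uniformly_continuous_on (cball 0 (\<bar>r\<bar> + 1)) V"
    by (intro compact_uniformly_continuous continuous_on_subset[OF assms(1)]) auto
  then obtain d where d: "d > 0" "\<And>x x'. x \<in> cball 0 (\<bar>r\<bar> + 1) \<Longrightarrow> x' \<in> cball 0 (\<bar>r\<bar> + 1) \<Longrightarrow> dist x' x < d \<Longrightarrow> dist (V x') (V x) < \<alpha>"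
    using \<open>\<alpha> > 0\<close> unfolding uniformly_continuous_on_def by blast
  have "\<bar>V (x - y) - V x\<bar> \<le> \<alpha>" if y: "norm y < min d 1" for x y
  proof (cases "norm x \<le> \<bar>r\<bar> \<or> norm (x - y) \<le> \<bar>r\<bar>")
    case True
    have "norm x \<le> norm (x - y) + norm y" "norm (x - y) \<le> norm x + norm y"
      using norm_triangle_ineq[of "x - y" y] norm_triangle_ineq4[of x y] by auto
    then have "x \<in> cball 0 (\<bar>r\<bar> + 1)" "x - y \<in> cball 0 (\<bar>r\<bar> + 1)" using True y by auto
    from d(2)[OF this] show ?thesis using y by (simp add: dist_norm)
  next
    case False
    then have "V x = 0" "V (x - y) = 0" using assms(2) by auto
    then show ?thesis using \<open>\<alpha> > 0\<close> by simp
  qed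
  then show ?thesis using d(1) by (intro exI[of _ "min d 1"]) auto
qed

text \<open>Inside the ball of radius \<open>R\<close> the exponential sum \<open>conv U K\<close> is a convolution with the
  truncated kernel, whose derivatives fall on \<open>U\<close>.\<close>

lemma exp_sum_approx:
  fixes U :: "'a::euclidean_space \<Rightarrow> real"
  assumes U: "smooth U" "\<forall>x. norm x \<ge> r \<longrightarrow> U x = 0" and "e > 0"
  shows "\<exists>E. exp_sum E \<and> C2_close e R U E"
proof -
  \<comment> \<open>The extra 1 puts the closed ball of radius \<open>R\<close> into an open ball,
    on which equality of functions passes to derivatives.\<close>
  define R' where "R' = \<bar>R\<bar> + 1"
  \<comment> \<open>For \<open>x\<close> in the ball of radius \<open>R'\<close> and
    \<open>y\<close> in the support of \<open>U\<close> the difference \<open>x - y\<close> stays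
    within radius \<open>\<rho>\<close>, so truncating the kernel there does not alter the
    convolution at \<open>x\<close>.\<close>
  define \<rho> where "\<rho> = R' + \<bar>r\<bar>"
  have \<rho>: "\<rho> > 0" by (simp add: \<rho>_def R'_def)
  define G where "G = insert U ((\<lambda>b. partial b U) ` Basis \<union> (\<lambda>b. partial b (partial b U)) ` Basis)"
  have Gfin: "finite G" by (simp add: G_def)
  have z1: "partial b U x = 0" if "norm x \<ge> \<bar>r\<bar> + 1" for b x
    using partial_zero_outside[of "cball 0 \<bar>r\<bar>" U x b] U(2) that by auto
  have z2: "partial b (partial b U) x = 0" if "norm x \<ge> \<bar>r\<bar> + 2" for b x
    using partial_zero_outside[of "cball 0 (\<bar>r\<bar> + 1)" "partial b U" x b] z1 that by auto
  have G: "continuous_on UNIV g \<and> (\<forall>x. norm x \<ge> \<bar>r\<bar> + 2 \<longrightarrow> g x = 0)" if "g \<in> G" for g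
  proof -
    have "continuous_on UNIV g"
      using that unfolding G_def by (auto intro!: smooth_continuous smooth_partial U(1))
    moreover have "g x = 0" if "norm x \<ge> \<bar>r\<bar> + 2" for x
      using \<open>g \<in> G\<close> z1[of x] z2[of x] U(2) that by (auto simp: G_def)
    ultimately show ?thesis by blast
  qed
  have "\<forall>g\<in>G. \<exists>\<eta>>0. \<forall>x y. norm y < \<eta> \<longrightarrow> \<bar>g (x - y) - g x\<bar> \<le> e/2"
    using uniformly_continuous_compact_support[of _ "\<bar>r\<bar> + 2" "e/2"] G \<open>e > 0\<close> by (meson half_gt_zero)
  from bchoice[OF this] obtain \<eta>f where \<eta>f: "\<And>g. g \<in> G \<Longrightarrow> \<eta>f g > 0"
    "\<And>g x y. g \<in> G \<Longrightarrow> norm y < \<eta>f g \<Longrightarrow> \<bar>g (x - y) - g x\<bar> \<le> e/2" by blast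
  define \<eta> where "\<eta> = Min (\<eta>f ` G)"
  have \<eta>: "\<eta> > 0" unfolding \<eta>_def using Gfin \<eta>f(1) by (subst Min_gr_iff) (auto simp: G_def)
  have \<eta>uc: "\<bar>g (x - y) - g x\<bar> \<le> e/2" if "g \<in> G" "norm y < \<eta>" for g x y
  proof -
    have "\<eta> \<le> \<eta>f g" unfolding \<eta>_def using Gfin that(1) by simp
    then show ?thesis using \<eta>f(2)[OF that(1)] that(2) by simp
  qed
  have "\<forall>g\<in>G. \<exists>B>0. \<forall>x. \<bar>g x\<bar> \<le> B"
  proof
    fix g assume g: "g \<in> G"
    then have c: "continuous_on UNIV g" and z: "\<And>x. norm x \<ge> \<bar>r\<bar> + 2 \<Longrightarrow> g x = 0" using G by blast+
    from compact_support_bounded[OF c z] show "\<exists>B>0. \<forall>x. \<bar>g x\<bar> \<le> B" by metis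
  qed
  from bchoice[OF this] obtain Bf where Bf: "\<And>g. g \<in> G \<Longrightarrow> Bf g > 0" "\<And>g x. g \<in> G \<Longrightarrow> \<bar>g x\<bar> \<le> Bf g" by blast
  define B where "B = (\<Sum>g\<in>G. Bf g)"
  have B: "\<bar>g x\<bar> \<le> B" if "g \<in> G" for g x
  proof -
    have "Bf g \<le> B" unfolding B_def using Gfin that Bf(1) by (intro member_le_sum) (auto intro: less_imp_le)
    then show ?thesis using Bf(2)[OF that, of x] by linarith
  qed
  have B0: "B > 0" unfolding B_def using Gfin Bf(1) by (intro sum_pos) (auto simp: G_def)
  \<comment> \<open>Half of \<open>e\<close> goes to the oscillation of the functions in
    \<open>G\<close>, the other half is \<open>2 * B * (e / (4 * B))\<close>, the contribution of
    the kernel tail.\<close>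
  have "e / (4 * B) > 0" using \<open>e > 0\<close> B0 by simp
  from exp_kernel[OF \<rho> \<eta> this] obtain K :: "'a \<Rightarrow> real" where K: "exp_sum K" "\<And>z. norm z \<le> \<rho> \<Longrightarrow> K z \<ge> 0"
    "(\<integral>z. indicator (cball 0 \<rho>) z * K z \<partial>lborel) = 1"
    "(\<integral>z. indicator (cball 0 \<rho> - ball 0 \<eta>) z * K z \<partial>lborel) \<le> e / (4 * B)" by metis
  define k where "k z = indicator (cball 0 \<rho>) z * K z" for z
  have Kc: "continuous_on S K" for S by (rule smooth_continuous[OF exp_sum_smooth[OF K(1)]])
  have ki: "integrable lborel k" 
    using borel_integrable_compact[of "cball 0 \<rho>" K] Kc unfolding k_def[abs_def] by (simp add: set_integrable_def)
  have k: "k z \<ge> 0" "(\<integral>z. k z \<partial>lborel) = 1" "(\<integral>z. indicator (- ball 0 \<eta>) z * k z \<partial>lborel) \<le> e / (4 * B)" for z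
  proof -
    show "k z \<ge> 0" using K(2) by (auto simp: k_def indicator_def)
    show "(\<integral>z. k z \<partial>lborel) = 1" using K(3) by (simp add: k_def)
    have "(\<lambda>z. indicator (- ball 0 \<eta>) z * k z) = (\<lambda>z. indicator (cball 0 \<rho> - ball 0 \<eta>) z * K z)"
      by (auto simp: k_def indicator_def)
    then show "(\<integral>z. indicator (- ball 0 \<eta>) z * k z \<partial>lborel) \<le> e / (4 * B)" using K(4) by simp
  qed
  have close: "\<bar>conv k g x - g x\<bar> \<le> e" if "g \<in> G" for g x
  proof -
    have "\<bar>conv k g x - g x\<bar> \<le> e/2 + 2 * B * (e / (4 * B))"
      using G[OF that] B[OF that] \<eta>uc[OF that] \<open>e > 0\<close> by (intro conv_kernel_close[OF ki k]) auto
    also have "\<dots> = e" using B0 by simp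
    finally show ?thesis .
  qed
  have U1: "Ck (Suc 0) U" "Ck (Suc 0) (partial b U)" if "b \<in> Basis" for b
    using U(1) smooth_partial[OF U(1) that] by (auto simp: smooth_def simp del: Ck.simps)
  have c1: "partial b (conv k U) = conv k (partial b U)" if "b \<in> Basis" for b
    using conv_partial(2)[OF ki U1(1)[OF that] _ that, of r] U(2) by auto
  have c2: "partial b (conv k (partial b U)) = conv k (partial b (partial b U))" if "b \<in> Basis" for b
    using conv_partial(2)[OF ki U1(2)[OF that] _ that, of "\<bar>r\<bar> + 1"] z1 by auto
  have Um: "U \<in> borel_measurable borel" and km: "k \<in> borel_measurable borel"
    using smooth_continuous[OF U(1)] ki by (auto intro: borel_measurable_continuous_onI simp: borel_measurable_integrable)
  define E where "E = conv U K"
  have Eeq: "E x = conv k U x" if "x \<in> ball 0 R'" for x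
  proof -
    have "U y * K (x - y) = U y * k (x - y)" for y
    proof (cases "norm y \<ge> r")
      case False
      have "norm (x - y) \<le> \<rho>" using norm_triangle_ineq4[of x y] that False by (simp add: \<rho>_def)
      then show ?thesis by (simp add: k_def)
    qed (use U(2) in simp)
    then have "E x = (\<integral>y. U y * k (x - y) \<partial>lborel)" unfolding E_def conv_def by (simp only:)
    also have "\<dots> = conv U k x" by (simp add: conv_def)
    also have "\<dots> = (\<integral>z. U (x - z) * k z \<partial>lborel)" by (rule conv_commute[OF Um km])
    also have "\<dots> = conv k U x" unfolding conv_def by (simp add: mult.commute)
    finally show ?thesis .
  qed
  have E1: "partial b E x = conv k (partial b U) x" if "x \<in> ball 0 R'" "b \<in> Basis" for b x
    using partial_cong_open[of "ball 0 R'" x E "conv k U" b] Eeq that c1 by simp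
  have E2: "partial b (partial b E) x = conv k (partial b (partial b U)) x" if "x \<in> ball 0 R'" "b \<in> Basis" for b x
    using partial_cong_open[of "ball 0 R'" x "partial b E" "conv k (partial b U)" b] E1 that c2 by simp
  have "C2_close e R U E" unfolding C2_close_def
  proof (intro allI impI conjI ballI)
    fix x :: 'a assume "norm x \<le> R"
    then have x: "x \<in> ball 0 R'" by (simp add: R'_def)
    have "U \<in> G" by (simp add: G_def)
    from close[OF this, of x] show "\<bar>U x - E x\<bar> \<le> e" unfolding Eeq[OF x] by (simp add: abs_minus_commute)
    fix b :: 'a assume b: "b \<in> Basis"
    have "partial b U \<in> G" "partial b (partial b U) \<in> G" using b by (auto simp: G_def)
    from close[OF this(1), of x] close[OF this(2), of x]
    show "\<bar>partial b U x - partial b E x\<bar> \<le> e" "\<bar>partial b (partial b U) x - partial b (partial b E) x\<bar> \<le> e" 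
      unfolding E1[OF x b] E2[OF x b] by (simp_all add: abs_minus_commute)
  qed
  moreover have "exp_sum E" unfolding E_def by (rule exp_sum_conv[OF smooth_continuous[OF U(1)] U(2) K(1)])
  ultimately show ?thesis by blast
qed

text \<open>Far out on its left tail, \<open>tanh\<close> is an exponential up to an additive constant.\<close>

lemma exp_tanh_approx:
  fixes w :: "'a::euclidean_space"
  assumes "e > 0"
  shows "\<exists>v. tanh_sum v \<and> C2_close e R (\<lambda>x. c * exp (w \<bullet> x)) v"
proof -
  define Y where "Y = norm w * \<bar>R\<bar>"
  \<comment> \<open>\<open>C\<close> collects the bound \<open>exp Y\<close> of the exponential on
    the ball, the factors from up to two differentiations and the 4 of \<open>key\<close>; the
    summand 1 keeps it positive when \<open>c = 0\<close>.\<close>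
  define C where "C = \<bar>c\<bar> * (1 + norm w)\<^sup>2 * 4 * (exp Y)\<^sup>2 + 1"
  have C: "C > 0" unfolding C_def by (simp add: add_nonneg_pos)
  define \<kappa> where "\<kappa> = e / C"
  have \<kappa>: "\<kappa> > 0" using assms C by (simp add: \<kappa>_def)
  \<comment> \<open>With this offset \<open>exp (2 * (h \<bullet> x + \<beta>))\<close> equals
    \<open>\<kappa> * exp (w \<bullet> x)\<close>, called \<open>t\<close> below. Then
    \<open>tanh\<close> is \<open>(t - 1) / (t + 1)\<close>, and with
    \<open>a = c / (2 * \<kappa>)\<close> the network \<open>a * (1 + tanh)\<close> is exactly
    \<open>c * exp (w \<bullet> x) / (1 + t)\<close>.\<close>
  define \<beta> where "\<beta> = ln \<kappa> / 2"
  define h where "h = (1/2) *\<^sub>R w"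
  define T where "T x = tanh (h \<bullet> x + \<beta>)" for x
  define a where "a = c / (2 * \<kappa>)"
  define v where "v = (\<lambda>x. a * tanh (h \<bullet> x + \<beta>) + a)"
  define f where "f = (\<lambda>x. c * exp (w \<bullet> x))"
  have tv: "tanh_sum v" unfolding v_def by (rule tanh_sum_single)
  have f1: "partial b f = (\<lambda>x. c * ((w \<bullet> b) * exp (w \<bullet> x)))" for b
  proof
    fix x
    have d: "(\<lambda>x. exp (w \<bullet> x + 0)) differentiable (at x)" by (rule smooth_differentiable[OF smooth_ridge[OF Ck_exp]])
    show "partial b f x = c * ((w \<bullet> b) * exp (w \<bullet> x))"
      unfolding f_def using partial_cmult[OF d, of b c] partial_ridge[where b=b and w=w and x=x and \<beta>=0, OF DERIV_exp] by simp
  qed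
  have f2: "partial b (partial b f) x = c * ((w \<bullet> b)\<^sup>2 * exp (w \<bullet> x))" for b x
  proof -
    have d: "(\<lambda>x. exp (w \<bullet> x + 0)) differentiable (at x)" by (rule smooth_differentiable[OF smooth_ridge[OF Ck_exp]])
    have "partial b (\<lambda>x. (c * (w \<bullet> b)) * exp (w \<bullet> x + 0)) x = (c * (w \<bullet> b)) * ((w \<bullet> b) * exp (w \<bullet> x + 0))"
      using partial_cmult[OF d, of b "c * (w \<bullet> b)"] partial_ridge[where b=b and w=w and x=x and \<beta>=0, OF DERIV_exp] by simp
    then show ?thesis unfolding f1 by (simp add: mult.assoc power2_eq_square)
  qed
  have dT: "T differentiable (at x)" for x
    unfolding T_def[abs_def] by (rule smooth_differentiable[OF smooth_ridge[OF Ck_tanh]])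
  have T1: "partial b T x = (h \<bullet> b) * (1 - (T x)\<^sup>2)" for b x
    unfolding T_def[abs_def] by (rule partial_ridge[OF DERIV_tanh_real])
  have v1: "partial b v = (\<lambda>x. a * ((h \<bullet> b) * (1 - T x * T x)))" for b
  proof
    fix x
    have "partial b (\<lambda>x. a * T x + a) x = partial b (\<lambda>x. a * T x) x + partial b (\<lambda>x. a) x"
      using dT[of x] by (intro partial_add) auto
    then show "partial b v x = a * ((h \<bullet> b) * (1 - T x * T x))"
      using partial_cmult[OF dT, of b a x] T1[of b x] unfolding v_def T_def[symmetric] by (simp add: power2_eq_square)
  qed
  have v2: "partial b (partial b v) x = a * ((h \<bullet> b)\<^sup>2 * (- 2 * T x * (1 - (T x)\<^sup>2)))" for b x
  proof -
    have "(\<lambda>x. T x * T x) differentiable (at x)" using dT[of x] by (intro derivative_intros)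
    then have "partial b (\<lambda>x. 1 - T x * T x) x = - partial b (\<lambda>x. T x * T x) x"
      using partial_diff[of "\<lambda>x. 1" x "\<lambda>x. T x * T x" b] by simp
    also have "\<dots> = - 2 * T x * ((h \<bullet> b) * (1 - (T x)\<^sup>2))"
      using partial_mult[OF dT[of x] dT[of x], of b] T1[of b x] by simp
    finally have p: "partial b (\<lambda>x. 1 - T x * T x) x = - 2 * T x * ((h \<bullet> b) * (1 - (T x)\<^sup>2))" .
    have "partial b (\<lambda>x. (a * (h \<bullet> b)) * (1 - T x * T x)) x = (a * (h \<bullet> b)) * (- 2 * T x * ((h \<bullet> b) * (1 - (T x)\<^sup>2)))"
      unfolding p[symmetric] by (intro partial_cmult derivative_intros dT)
    then show ?thesis unfolding v1 by (simp add: mult.assoc power2_eq_square algebra_simps)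
  qed
  \<comment> \<open>The factors 2 and 4 in front of \<open>E\<close> reflect the inner weight
    \<open>w/2\<close>: each derivative of the network brings \<open>w/2\<close> where that of the
    exponential brings \<open>w\<close>. All three are relative errors, of sizes \<open>t\<close>,
    \<open>2 * t\<close> and \<open>4 * t\<close>, established in \<open>q1\<close>,
    \<open>q2\<close> and \<open>q3\<close>.\<close>
  have key: "\<bar>c * E - a * (1 + T x)\<bar> \<le> \<bar>c\<bar> * (\<kappa> * 4 * E\<^sup>2)"
     "\<bar>c * (2 * E) - a * (1 - T x * T x)\<bar> \<le> \<bar>c\<bar> * (\<kappa> * 4 * E\<^sup>2)"
     "\<bar>c * (4 * E) - a * (- 2 * T x * (1 - (T x)\<^sup>2))\<bar> \<le> \<bar>c\<bar> * (\<kappa> * 16 * E\<^sup>2)" 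
     if E_def: "E = exp (w \<bullet> x)" for x E
  proof -
    define t where "t = \<kappa> * E"
    have E: "E > 0" by (simp add: E_def)
    have t: "t > 0" using E \<kappa> by (simp add: t_def)
    then have tn: "t ^ j \<ge> 0" for j by simp
    have e2: "exp (2 * (h \<bullet> x + \<beta>)) = t"
      using \<kappa> by (simp add: h_def \<beta>_def t_def E_def distrib_left exp_add mult.commute)
    have em: "exp (- 2 * (h \<bullet> x + \<beta>)) = inverse t" 
      unfolding mult_minus_left exp_minus e2 by (rule refl)
    have "T x = (1 - exp (- 2 * (h \<bullet> x + \<beta>))) / (1 + exp (- 2 * (h \<bullet> x + \<beta>)))"
      unfolding T_def by (rule tanh_real_altdef)
    then have "T x = (1 - inverse t) / (1 + inverse t)" unfolding em .
    then have Tx: "T x = (t - 1) / (t + 1)" using t by (simp add: divide_simps)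
    have ca: "a * y = c * (y / (2 * \<kappa>))" for y by (simp add: a_def)
    have b: "\<bar>c * p - a * q\<bar> \<le> \<bar>c\<bar> * s" if "\<bar>p - q / (2 * \<kappa>)\<bar> \<le> s" for p q s
      unfolding ca right_diff_distrib[symmetric] abs_mult using that by (intro mult_left_mono) auto
    have k2: "q * t / (2 * \<kappa>) = q * E / 2" for q using \<kappa> by (simp add: t_def)
    have "(1 + T x) / (2 * \<kappa>) = (2 / (1 + t)) * t / (2 * \<kappa>)" using t by (simp add: Tx divide_simps)
    also have "\<dots> = E / (1 + t)" unfolding k2 using t by (simp add: divide_simps)
    finally have e1: "(1 + T x) / (2 * \<kappa>) = E / (1 + t)" .
    have "1 - T x * T x = (4 / (1 + t)\<^sup>2) * t" using t unfolding Tx by (simp add: divide_simps power2_eq_square) (simp add: algebra_simps)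
    then have e2: "(1 - T x * T x) / (2 * \<kappa>) = 2 * E / (1 + t)\<^sup>2" using k2[of "4 / (1 + t)\<^sup>2"] by (simp only:) (simp add: mult_ac)
    have "- 2 * T x * (1 - (T x)\<^sup>2) = (8 * (1 - t) / (1 + t) ^ 3) * t"
      using t unfolding Tx by (simp add: divide_simps power2_eq_square power3_eq_cube) (simp add: algebra_simps)
    have e3: "(- 2 * T x * (1 - (T x)\<^sup>2)) / (2 * \<kappa>) = 4 * E * (1 - t) / (1 + t) ^ 3"
    proof -
      have "8 * x / p * E / 2 = 4 * E * x / p" for x p :: real by simp
      then show ?thesis using k2[of "8 * (1 - t) / (1 + t) ^ 3"] \<open>- 2 * T x * (1 - (T x)\<^sup>2) = _\<close> by (simp only:)
    qed
    have ab: "\<bar>F - F * y\<bar> = F * \<bar>1 - y\<bar>" if "F > 0" for F y :: real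
    proof -
      have "F - F * y = F * (1 - y)" by (simp add: algebra_simps)
      then show ?thesis using that by (simp add: abs_mult)
    qed
    have q1: "\<bar>1 - 1 / (1 + t)\<bar> \<le> t"
    proof -
      have "1 - 1 / (1 + t) = t / (1 + t)" using t by (simp add: divide_simps)
      moreover have "t / (1 + t) \<le> t" using t by (simp add: divide_simps)
      ultimately show ?thesis using t by simp
    qed
    have q2: "\<bar>1 - 1 / (1 + t)\<^sup>2\<bar> \<le> 2 * t"
    proof -
      have "1 / (1 + t)\<^sup>2 \<le> 1" using t by (simp add: divide_simps)
      moreover have "(1 - 2 * t) * (1 + t)\<^sup>2 \<le> 1"
      proof -
        have "(1 - 2 * t) * (1 + t)\<^sup>2 = 1 - (3 * t\<^sup>2 + 2 * t ^ 3)" by (simp add: power2_eq_square power3_eq_cube algebra_simps)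
        then show ?thesis using tn[of 2] tn[of 3] by linarith
      qed
      then have "1 - 2 * t \<le> 1 / (1 + t)\<^sup>2" using t by (simp add: le_divide_eq)
      ultimately show ?thesis by simp
    qed
    have q3: "\<bar>1 - (1 - t) / (1 + t) ^ 3\<bar> \<le> 4 * t"
    proof -
      have p3: "(1 + t) ^ 3 > 0" using t by simp
      have "1 - t \<le> (1 + t) ^ 3" using t by (simp add: power3_eq_cube algebra_simps add_nonneg_nonneg)
      then have "(1 - t) / (1 + t) ^ 3 \<le> 1" using p3 by (simp add: divide_le_eq)
      moreover have "(1 - 4 * t) * (1 + t) ^ 3 \<le> 1 - t"
      proof -
        have "(1 - 4 * t) * (1 + t) ^ 3 = 1 - t - (9 * t\<^sup>2 + 11 * t ^ 3 + 4 * t ^ 4)" 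
          by (simp add: power2_eq_square power3_eq_cube power4_eq_xxxx algebra_simps)
        then show ?thesis using tn[of 2] tn[of 3] tn[of 4] by linarith
      qed
      then have "1 - 4 * t \<le> (1 - t) / (1 + t) ^ 3" using p3 by (simp add: le_divide_eq)
      ultimately show ?thesis by simp
    qed
    have "\<bar>E - (1 + T x) / (2 * \<kappa>)\<bar> = E * \<bar>1 - 1 / (1 + t)\<bar>"
      using ab[of E "1 / (1 + t)"] E unfolding e1 by simp
    also have "\<dots> \<le> E * (4 * t)" using q1 E t by (intro mult_left_mono) auto
    also have "E * (4 * t) = \<kappa> * 4 * E\<^sup>2" by (simp add: t_def power2_eq_square mult_ac)
    finally show "\<bar>c * E - a * (1 + T x)\<bar> \<le> \<bar>c\<bar> * (\<kappa> * 4 * E\<^sup>2)" by (rule b)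
    have "\<bar>2 * E - (1 - T x * T x) / (2 * \<kappa>)\<bar> = (2 * E) * \<bar>1 - 1 / (1 + t)\<^sup>2\<bar>"
      using ab[of "2 * E" "1 / (1 + t)\<^sup>2"] E unfolding e2 by simp
    also have "\<dots> \<le> (2 * E) * (2 * t)" using q2 E t by (intro mult_left_mono) auto
    also have "(2 * E) * (2 * t) = \<kappa> * 4 * E\<^sup>2" by (simp add: t_def power2_eq_square mult_ac)
    finally show "\<bar>c * (2 * E) - a * (1 - T x * T x)\<bar> \<le> \<bar>c\<bar> * (\<kappa> * 4 * E\<^sup>2)" by (rule b)
    have "\<bar>4 * E - (- 2 * T x * (1 - (T x)\<^sup>2)) / (2 * \<kappa>)\<bar> = (4 * E) * \<bar>1 - (1 - t) / (1 + t) ^ 3\<bar>"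
      using ab[of "4 * E" "(1 - t) / (1 + t) ^ 3"] E unfolding e3 by simp
    also have "\<dots> \<le> (4 * E) * (4 * t)" using q3 E t by (intro mult_left_mono) auto
    also have "(4 * E) * (4 * t) = \<kappa> * 16 * E\<^sup>2" by (simp add: t_def power2_eq_square mult_ac)
    finally show "\<bar>c * (4 * E) - a * (- 2 * T x * (1 - (T x)\<^sup>2))\<bar> \<le> \<bar>c\<bar> * (\<kappa> * 16 * E\<^sup>2)" by (rule b)
  qed
  have "C2_close e R f v" unfolding C2_close_def
  proof (intro allI impI conjI ballI)
    fix x :: 'a assume x: "norm x \<le> R"
    define E where "E = exp (w \<bullet> x)"
    have "w \<bullet> x \<le> norm w * norm x" by (rule norm_cauchy_schwarz)
    also have "\<dots> \<le> Y" unfolding Y_def using x by (intro mult_left_mono) auto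
    finally have "E \<le> exp Y" by (simp add: E_def)
    then have E2: "E\<^sup>2 \<le> (exp Y)\<^sup>2" by (intro power_mono) (simp_all add: E_def)
    have fin: "W * (\<bar>c\<bar> * (\<kappa> * 4 * E\<^sup>2)) \<le> e" if "0 \<le> W" "W \<le> (1 + norm w)\<^sup>2" for W
    proof -
      have "W * (\<bar>c\<bar> * (\<kappa> * 4 * E\<^sup>2)) \<le> (1 + norm w)\<^sup>2 * (\<bar>c\<bar> * (\<kappa> * 4 * (exp Y)\<^sup>2))"
        using that E2 \<kappa> by (intro mult_mono mult_nonneg_nonneg) auto
      also have "\<dots> = \<kappa> * (C - 1)" by (simp add: C_def mult_ac)
      also have "\<dots> \<le> \<kappa> * C" using \<kappa> by simp
      also have "\<dots> = e" using C by (simp add: \<kappa>_def)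
      finally show ?thesis .
    qed
    note k = key[OF E_def]
    have wn: "0 \<le> norm w" "0 \<le> (norm w)\<^sup>2" "(1 + norm w)\<^sup>2 = 1 + 2 * norm w + (norm w)\<^sup>2" by (simp_all add: power2_eq_square algebra_simps)
    have "v x = a * (1 + T x)" by (simp add: v_def T_def algebra_simps)
    then have "\<bar>f x - v x\<bar> \<le> 1 * (\<bar>c\<bar> * (\<kappa> * 4 * E\<^sup>2))" using k(1) by (simp add: f_def E_def)
    also have "\<dots> \<le> e" by (rule fin; use wn in linarith)
    finally show "\<bar>f x - v x\<bar> \<le> e" .
    fix b :: 'a assume b: "b \<in> Basis"
    define W where "W = \<bar>w \<bullet> b\<bar>"
    have W: "0 \<le> W" "W \<le> norm w" using Basis_le_norm[OF b, of w] by (auto simp: W_def)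
    have W2: "W\<^sup>2 \<le> (norm w)\<^sup>2" using W by (intro power_mono) auto
    have g1: "c * (q * E) - a * (q / 2 * r) = (q / 2) * (c * (2 * E) - a * r)"
      and g2: "c * (q\<^sup>2 * E) - a * ((q / 2)\<^sup>2 * r) = (q\<^sup>2 / 4) * (c * (4 * E) - a * r)" for q r :: real
      by (simp_all add: field_simps power2_eq_square)
    have hb: "h \<bullet> b = (w \<bullet> b) / 2" by (simp add: h_def)
    have eq1: "partial b f x - partial b v x = ((w \<bullet> b) / 2) * (c * (2 * E) - a * (1 - T x * T x))"
      unfolding f1 v1 hb E_def[symmetric] by (rule g1)
    have "\<bar>partial b f x - partial b v x\<bar> = (W / 2) * \<bar>c * (2 * E) - a * (1 - T x * T x)\<bar>"
      unfolding eq1 abs_mult by (simp add: W_def)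
    also have "\<dots> \<le> (W / 2) * (\<bar>c\<bar> * (\<kappa> * 4 * E\<^sup>2))" using k(2) W by (intro mult_left_mono) auto
    also have "\<dots> \<le> e" by (rule fin; use W wn in linarith)
    finally show "\<bar>partial b f x - partial b v x\<bar> \<le> e" .
    have eq2: "partial b (partial b f) x - partial b (partial b v) x = ((w \<bullet> b)\<^sup>2 / 4) * (c * (4 * E) - a * (- 2 * T x * (1 - (T x)\<^sup>2)))"
      unfolding f2 v2 hb E_def[symmetric] by (rule g2)
    have "\<bar>partial b (partial b f) x - partial b (partial b v) x\<bar> = (W\<^sup>2 / 4) * \<bar>c * (4 * E) - a * (- 2 * T x * (1 - (T x)\<^sup>2))\<bar>"
      unfolding eq2 abs_mult by (simp add: W_def)
    also have "\<dots> \<le> (W\<^sup>2 / 4) * (\<bar>c\<bar> * (\<kappa> * 16 * E\<^sup>2))" using k(3) by (intro mult_left_mono) auto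
    also have "\<dots> = W\<^sup>2 * (\<bar>c\<bar> * (\<kappa> * 4 * E\<^sup>2))" by simp
    also have "\<dots> \<le> e" by (rule fin; use W2 wn zero_le_power2[of W] in linarith)
    finally show "\<bar>partial b (partial b f) x - partial b (partial b v) x\<bar> \<le> e" .
  qed
  with tv show ?thesis unfolding f_def by blast
qed

lemma exp_sum_tanh_approx:
  "exp_sum E \<Longrightarrow> (\<And>e. e > 0 \<Longrightarrow> \<exists>v. tanh_sum v \<and> C2_close e R E v)"
proof (induction rule: exp_sum.induct)
  case (exp_sum_single c w)
  then show ?case by (rule exp_tanh_approx)
next
  case (exp_sum_add f g)
  then have "e/2 > 0" by simp
  obtain v1 v2 where v: "tanh_sum v1" "C2_close (e/2) R f v1" "tanh_sum v2" "C2_close (e/2) R g v2"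
    using exp_sum_add.IH[OF \<open>e/2 > 0\<close>] by blast
  have "C2_close (e/2 + e/2) R (\<lambda>x. f x + g x) (\<lambda>x. v1 x + v2 x)"
    by (rule C2_close_add[OF v(2,4)]) (use exp_sum_add v in \<open>auto intro: exp_sum_smooth tanh_sum_smooth\<close>)
  then have "C2_close e R (\<lambda>x. f x + g x) (\<lambda>x. v1 x + v2 x)" by simp
  then show ?case using tanh_sum_add[OF v(1,3)] by blast
qed

theorem tanh_sum_approx:
  fixes U :: "'a::euclidean_space \<Rightarrow> real"
  assumes "smooth U" "\<forall>x. norm x \<ge> r \<longrightarrow> U x = 0" "e > 0"
  shows "\<exists>v. tanh_sum v \<and> C2_close e R U v"
proof -
  have "e/2 > 0" using \<open>e > 0\<close> by simp
  obtain E where E: "exp_sum E" "C2_close (e/2) R U E" using exp_sum_approx[OF assms(1,2) \<open>e/2 > 0\<close>] by blast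
  obtain v where v: "tanh_sum v" "C2_close (e/2) R E v" using exp_sum_tanh_approx[OF E(1) \<open>e/2 > 0\<close>] by blast
  have "C2_close (e/2 + e/2) R U v" by (rule C2_close_trans[OF E(2) v(2)])
  then show ?thesis using v(1) by auto
qed

section \<open>Tanh sums as networks\<close>

text \<open>The bound \<open>m \<ge> 1\<close> is recorded because \<open>hlconc_shape\<close>
  requires nonempty hidden layers.\<close>

lemma tanh_sum_indexed:
  "tanh_sum v \<Longrightarrow> \<exists>m a w \<beta> c. m \<ge> (1::nat) \<and> v = (\<lambda>x. (\<Sum>j<m. a j * tanh (w j \<bullet> x + \<beta> j)) + c)"
proof (induction rule: tanh_sum.induct)
  case (tanh_sum_single a w \<beta> c)
  show ?case
    by (intro exI[of _ 1] exI[of _ "\<lambda>_. a"] exI[of _ "\<lambda>_. w"] exI[of _ "\<lambda>_. \<beta>"] exI[of _ c]) simp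
next
  case (tanh_sum_add f g)
  obtain m1 a1 w1 \<beta>1 c1 where f: "m1 \<ge> (1::nat)" "f = (\<lambda>x. (\<Sum>j<m1. a1 j * tanh (w1 j \<bullet> x + \<beta>1 j)) + c1)"
    using tanh_sum_add.IH(1) by blast
  obtain m2 a2 w2 \<beta>2 c2 where g: "m2 \<ge> (1::nat)" "g = (\<lambda>x. (\<Sum>j<m2. a2 j * tanh (w2 j \<bullet> x + \<beta>2 j)) + c2)"
    using tanh_sum_add.IH(2) by blast
  have split: "(\<Sum>j<m1 + m2. F j) = (\<Sum>j<m1. F j) + (\<Sum>j<m2. F (m1 + j))" for F :: "nat \<Rightarrow> real"
    by (induction m2) (auto simp: add.assoc)
  show ?case
    by (intro exI[of _ "m1 + m2"] exI[of _ "\<lambda>j. if j < m1 then a1 j else a2 (j - m1)"]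
        exI[of _ "\<lambda>j. if j < m1 then w1 j else w2 (j - m1)"] exI[of _ "\<lambda>j. if j < m1 then \<beta>1 j else \<beta>2 (j - m1)"] exI[of _ "c1 + c2"])
      (use f(1) in \<open>auto simp: f(2) g(2) split\<close>)
qed

text \<open>\<open>from_nat_into UNIV\<close> enumerates the space coordinates bijectively and time
  comes last, so weight rows of the form \<open>st_input w\<close> realise the inner product with
  \<open>w\<close>.\<close>

lemma st_input_inner:
  fixes w z :: "(real^'d) \<times> real"
  shows "(\<Sum>c<CARD('d) + 1. st_input w c * st_input z c) = w \<bullet> z"
proof -
  have "(\<Sum>c<CARD('d) + 1. st_input w c * st_input z c) =
     (\<Sum>c<CARD('d). fst w $ from_nat_into (UNIV :: 'd set) c * fst z $ from_nat_into (UNIV :: 'd set) c) + snd w * snd z"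
    by (simp add: st_input_def)
  also have "(\<Sum>c<CARD('d). fst w $ from_nat_into (UNIV :: 'd set) c * fst z $ from_nat_into (UNIV :: 'd set) c)
     = (\<Sum>a\<in>(UNIV :: 'd set). fst w $ a * fst z $ a)"
    using sum.reindex_bij_betw[OF bij_betw_from_nat_into_finite[of "UNIV :: 'd set"], of "\<lambda>a. fst w $ a * fst z $ a"] by simp
  finally show ?thesis by (simp add: inner_prod_def inner_vec_def)
qed

text \<open>Single-hidden-layer \<open>tanh\<close> networks are the HLConcPINNs whose deeper layers have
  output weight 0.\<close>

theorem tanh_sum_net:
  fixes v :: "(real^'d) \<times> real \<Rightarrow> real"
  assumes "tanh_sum v" "L \<ge> 3" "hlconc_activations L \<sigma>"
  shows "\<exists>\<theta>. hlconc_shape L (CARD('d) + 1) 1 \<theta> \<and> net L \<sigma> \<theta> = v"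
proof -
  obtain m a and w :: "nat \<Rightarrow> (real^'d) \<times> real" and \<beta> c
    where m: "m \<ge> (1::nat)" and v: "v = (\<lambda>x. (\<Sum>j<m. a j * tanh (w j \<bullet> x + \<beta> j)) + c)"
    using tanh_sum_indexed[OF assms(1)] by blast
  \<comment> \<open>The bias \<open>c\<close> of every layer but the first covers layer
    \<open>L\<close>, where it is the output bias; likewise the width 1 from layer 2 on includes the
    output dimension.\<close>
  define \<theta> where "\<theta> = \<lparr>width = (\<lambda>k. if k = 0 then CARD('d) + 1 else if k = 1 then m else 1),
     weight = (\<lambda>k r. st_input (w r)), bias = (\<lambda>k r. if k = 1 then \<beta> r else c),
     out_weight = (\<lambda>k r j. if k = 1 then a j else 0)\<rparr>"
  have "hlconc_shape L (CARD('d) + 1) 1 \<theta>"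
    using assms(2) m by (auto simp: hlconc_shape_def \<theta>_def)
  moreover have "net L \<sigma> \<theta> z = v z" for z
  proof -
    have \<sigma>1: "\<sigma> (Suc 0) = tanh" using assms(3) by (simp add: hlconc_activations_def)
    have L1: "{1..<L} = insert 1 {2..<L}" using assms(2) by auto
    have "(\<Sum>k=1..<L. \<Sum>j<width \<theta> k. out_weight \<theta> k 0 j * hidden \<sigma> \<theta> (st_input z) k j)
      = (\<Sum>j<m. a j * hidden \<sigma> \<theta> (st_input z) 1 j)"
      unfolding L1 by (subst sum.insert) (auto simp: \<theta>_def)
    moreover have "hidden \<sigma> \<theta> (st_input z) 1 j = tanh (w j \<bullet> z + \<beta> j)" for j
      using st_input_inner[of "w j" z] by (simp add: \<sigma>1) (simp add: \<theta>_def)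
    moreover have "bias \<theta> L 0 = c" using assms(2) by (simp add: \<theta>_def)
    ultimately show ?thesis by (simp add: net_def hlconc_def v)
  qed
  ultimately show ?thesis by blast
qed

section \<open>Hausdorff measure and traces on Lipschitz boundaries\<close>

text \<open>At each scale one finite cover suffices. It is padded to a sequence by empty sets, which
  have weight 0 by definition; for \<open>s = 0\<close> the power alone would give them weight
  1.\<close>

lemma hausdorff_outer_le:
  assumes "\<And>\<delta>. \<delta> > 0 \<Longrightarrow> \<exists>\<V> m. finite \<V> \<and> A \<subseteq> \<Union>\<V> \<and> 0 \<le> m \<and> m \<le> \<delta> \<and>
     (\<forall>V\<in>\<V>. bounded V \<and> diameter V \<le> m) \<and> real (card \<V>) * (unit_ball_vol (real s) * (m / 2) ^ s) \<le> K"
  shows "hausdorff_outer s A \<le> ennreal K"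
  unfolding hausdorff_outer_def
proof (rule SUP_least)
  fix \<delta> :: real assume "\<delta> \<in> {0<..}"
  then have "\<delta> > 0" by simp
  from assms[OF this] obtain \<V> m where V: "finite \<V>" "A \<subseteq> \<Union>\<V>" "0 \<le> m" "m \<le> \<delta>" 
     "\<And>V. V \<in> \<V> \<Longrightarrow> bounded V \<and> diameter V \<le> m" "real (card \<V>) * (unit_ball_vol (real s) * (m / 2) ^ s) \<le> K" by blast
  define U where "U i = (if i < card \<V> then from_nat_into \<V> i else {})" for i
  have bij: "bij_betw (from_nat_into \<V>) {..<card \<V>} \<V>" by (rule bij_betw_from_nat_into_finite[OF V(1)])
  have UV: "U i \<in> \<V>" if "i < card \<V>" for i using bij that by (auto simp: U_def bij_betw_def)
  have cov: "A \<subseteq> (\<Union>i. U i)"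
  proof
    fix x assume "x \<in> A"
    then obtain W where W: "W \<in> \<V>" "x \<in> W" using V(2) by blast
    then have "W \<in> from_nat_into \<V> ` {..<card \<V>}" using bij by (simp add: bij_betw_def)
    then obtain i where "i < card \<V>" "from_nat_into \<V> i = W" by blast
    then show "x \<in> (\<Union>i. U i)" using W(2) by (auto simp: U_def)
  qed
  have c0: "unit_ball_vol (real s) \<ge> 0" by simp
  let ?w = "\<lambda>i. if U i = {} then 0 else ennreal (unit_ball_vol (real s) * (diameter (U i) / 2) ^ s)"
  have "(INF U\<in>{U. A \<subseteq> (\<Union>i. U i) \<and> (\<forall>i. bounded (U i) \<and> diameter (U i) \<le> \<delta>)}.
       \<Sum>i. if U i = {} then 0 else ennreal (unit_ball_vol (real s) * (diameter (U i) / 2) ^ s)) \<le> (\<Sum>i. ?w i)"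
  proof (rule INF_lower, safe)
    show "\<And>x. x \<in> A \<Longrightarrow> x \<in> (\<Union>i. U i)" using cov by blast
    show "bounded (U i)" for i using UV[of i] V(5) by (cases "i < card \<V>") (auto simp: U_def)
    show "diameter (U i) \<le> \<delta>" for i
    proof (cases "i < card \<V>")
      case True then show ?thesis using UV[of i] V(4,5) by force
    next
      case False then show ?thesis using \<open>\<delta> > 0\<close> by (simp add: U_def)
    qed
  qed
  also have "(\<Sum>i. ?w i) = (\<Sum>i<card \<V>. ?w i)" by (rule suminf_finite) (auto simp: U_def)
  also have "\<dots> \<le> (\<Sum>i<card \<V>. ennreal (unit_ball_vol (real s) * (m / 2) ^ s))"
  proof (rule sum_mono)
    fix i assume i: "i \<in> {..<card \<V>}"
    have "bounded (U i)" "diameter (U i) \<le> m" using UV[of i] V(5) i by auto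
    then have "(diameter (U i) / 2) ^ s \<le> (m / 2) ^ s" using diameter_ge_0 by (intro power_mono) auto
    then show "?w i \<le> ennreal (unit_ball_vol (real s) * (m / 2) ^ s)"
      using c0 by (auto intro!: ennreal_leI mult_left_mono)
  qed
  also have "\<dots> = ennreal (real (card \<V>) * (unit_ball_vol (real s) * (m / 2) ^ s))"
    by (simp add: ennreal_mult' ennreal_of_nat_eq_real_of_nat)
  also have "\<dots> \<le> ennreal K" using V(6) by (rule ennreal_leI)
  finally show "(INF U\<in>{U. A \<subseteq> (\<Union>i. U i) \<and> (\<forall>i. bounded (U i) \<and> diameter (U i) \<le> \<delta>)}.
       \<Sum>i. if U i = {} then 0 else ennreal (unit_ball_vol (real s) * (diameter (U i) / 2) ^ s)) \<le> ennreal K" .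
qed

text \<open>\<open>measure_of\<close> returns either the given set function or 0, so the bound holds
  for every set. All estimates of the surface measure below are drawn from it.\<close>

lemma emeasure_hausdorff_le: "emeasure (hausdorff_measure s) A \<le> hausdorff_outer s A"
  unfolding hausdorff_measure_def emeasure_measure_of_conv by simp

lemma sets_hausdorff [measurable_cong, simp]: "sets (hausdorff_measure s) = sets borel"
  unfolding hausdorff_measure_def by (subst sets_measure_of) (auto simp: sets.sigma_sets_eq[of borel, simplified])

lemma space_hausdorff [simp]: "space (hausdorff_measure s) = UNIV"
  unfolding hausdorff_measure_def by (subst space_measure_of) auto

text \<open>The l^1 distance in the remaining coordinates suits covers by boxes. In dimension 1 the
  sum is empty and \<open>G\<close> has at most one point.\<close>

definition lipschitz_graph :: "'d::finite \<Rightarrow> real \<Rightarrow> (real^'d) set \<Rightarrow> bool" where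
  "lipschitz_graph i M G \<longleftrightarrow> M \<ge> 0 \<and> (\<forall>x\<in>G. \<forall>y\<in>G. \<bar>x $ i - y $ i\<bar> \<le> M * (\<Sum>j\<in>UNIV - {i}. \<bar>x $ j - y $ j\<bar>))"

text \<open>Arises from a cover by at most \<open>(2 * N) ^ (d - 1)\<close> pieces of diameter
  \<open>d * (1 + M) * len / N\<close>, weighted by powers of half the diameter, in which
  \<open>N\<close> cancels.\<close>

definition graph_const :: "('d::finite) itself \<Rightarrow> real \<Rightarrow> real" where
  "graph_const _ M = unit_ball_vol (real (CARD('d) - 1)) * (real CARD('d) * (1 + M)) ^ (CARD('d) - 1)"

lemma graph_const_nonneg: "M \<ge> 0 \<Longrightarrow> graph_const TYPE('d::finite) M \<ge> 0"
  by (simp add: graph_const_def)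

text \<open>A Lipschitz graph over a cube of side \<open>len\<close> is covered by \<open>(N + 1)\<^sup>d\<^sup>-\<^sup>1\<close> pieces of
  diameter \<open>O(len / N)\<close>.\<close>

lemma hausdorff_outer_graph_cube:
  fixes G :: "(real^'d) set"
  assumes G: "lipschitz_graph i M G" and "len > 0" and A: "\<And>x j. x \<in> A \<Longrightarrow> j \<noteq> i \<Longrightarrow> c $ j \<le> x $ j \<and> x $ j \<le> c $ j + len" "A \<subseteq> G"
  shows "hausdorff_outer (CARD('d) - 1) A \<le> ennreal (graph_const TYPE('d) M * len ^ (CARD('d) - 1))"
proof (rule hausdorff_outer_le)
  fix \<delta> :: real assume "\<delta> > 0"
  define n where "n = real CARD('d)"
  define s where "s = CARD('d) - 1"
  have n: "n > 0" by (simp add: n_def)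
  have M: "M \<ge> 0" using G by (simp add: lipschitz_graph_def)
  \<comment> \<open>Fine enough for the diameter \<open>m\<close> to be at most
    \<open>\<delta>\<close>; the summand 1 makes \<open>N\<close> positive.\<close>
  define N :: nat where "N = nat \<lceil>n * (1 + M) * len / \<delta>\<rceil> + 1"
  have N: "N \<ge> 1" "n * (1 + M) * len / \<delta> \<le> real N" unfolding N_def by linarith+
  define m where "m = n * (1 + M) * len / real N"
  have m: "0 \<le> m" "m \<le> \<delta>"
    using n M \<open>len > 0\<close> N \<open>\<delta> > 0\<close> by (auto simp: m_def field_simps)
  \<comment> \<open>The index of a small box in the coordinates other than \<open>i\<close>. Points
    on the far face receive the value \<open>N\<close>, whence \<open>N + 1\<close> values per
    coordinate, estimated by \<open>2 * N\<close> in the final count.\<close>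
  define \<kappa> where "\<kappa> x = (\<lambda>j\<in>UNIV - {i}. nat \<lfloor>(x $ j - c $ j) * real N / len\<rfloor>)" for x :: "real^'d"
  define I where "I = PiE (UNIV - {i}) (\<lambda>_. {..N})"
  define W where "W p = {x \<in> A. \<kappa> x = p}" for p
  have fin: "finite I" unfolding I_def by (intro finite_PiE) auto
  have card: "card I = (N + 1) ^ s" unfolding I_def s_def by (simp add: card_PiE card_Diff_singleton)
  have \<kappa>I: "\<kappa> x \<in> I" if "x \<in> A" for x unfolding I_def \<kappa>_def
  proof (rule restrict_PiE_iff[THEN iffD2], intro ballI)
    fix j assume "j \<in> UNIV - {i}"
    then have "x $ j - c $ j \<le> len" using A(1)[OF that, of j] by auto
    then have "(x $ j - c $ j) * real N \<le> len * real N" by (intro mult_right_mono) auto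
    then have "(x $ j - c $ j) * real N / len \<le> real N" 
      using \<open>len > 0\<close> by (simp add: divide_le_eq mult.commute)
    then show "nat \<lfloor>(x $ j - c $ j) * real N / len\<rfloor> \<in> {..N}" by (simp add: nat_le_iff floor_le_iff) 
  qed
  have close: "norm (x - y) \<le> m" if x: "x \<in> W p" and y: "y \<in> W p" for x y p
  proof -
    have xy: "x \<in> A" "y \<in> A" and k: "\<kappa> x = \<kappa> y" using x y by (auto simp: W_def)
    have d: "\<bar>x $ j - y $ j\<bar> \<le> len / real N" if "j \<noteq> i" for j
    proof -
      let ?f = "\<lambda>x. (x $ j - c $ j) * real N / len"
      have "\<kappa> x j = \<kappa> y j" using k by simp
      then have "nat \<lfloor>?f x\<rfloor> = nat \<lfloor>?f y\<rfloor>" using that by (simp add: \<kappa>_def)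
      moreover have "?f x \<ge> 0" "?f y \<ge> 0" using A(1)[OF xy(1) that] A(1)[OF xy(2) that] \<open>len > 0\<close> by auto
      ultimately have "\<lfloor>?f x\<rfloor> = \<lfloor>?f y\<rfloor>" by (metis int_nat_eq zero_le_floor)
      then have "\<bar>?f x - ?f y\<bar> \<le> 1" by linarith
      moreover have "?f x - ?f y = (x $ j - y $ j) * (real N / len)"
        by (simp add: diff_divide_distrib[symmetric] left_diff_distrib[symmetric])
      ultimately have "\<bar>x $ j - y $ j\<bar> * (real N / len) \<le> 1" using N \<open>len > 0\<close> by (simp add: abs_mult)
      then show ?thesis using N \<open>len > 0\<close> by (simp add: field_simps)
    qed
    define S where "S = (\<Sum>j\<in>UNIV - {i}. \<bar>x $ j - y $ j\<bar>)"
    have "S \<le> (\<Sum>j\<in>UNIV - {i}. len / real N)" unfolding S_def using d by (intro sum_mono) auto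
    also have "\<dots> \<le> n * (len / real N)" 
      using \<open>len > 0\<close> unfolding n_def by (simp add: card_Diff_singleton of_nat_diff divide_right_mono mult_right_mono)
    finally have S: "S \<le> n * (len / real N)" .
    have "norm (x - y) \<le> (\<Sum>j\<in>UNIV. \<bar>(x - y) $ j\<bar>)" by (rule norm_le_l1_cart)
    also have "\<dots> = \<bar>x $ i - y $ i\<bar> + S" unfolding S_def by (simp add: sum.remove[of UNIV i])
    also have "\<dots> \<le> M * S + S" using G xy A(2) unfolding lipschitz_graph_def S_def by (intro add_right_mono) blast
    also have "\<dots> = (1 + M) * S" by (simp add: algebra_simps)
    also have "\<dots> \<le> (1 + M) * (n * (len / real N))" using S M by (intro mult_left_mono) auto
    also have "\<dots> = m" by (simp add: m_def)
    finally show ?thesis .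
  qed
  have bW: "bounded (W p)" for p
  proof (cases "W p = {}")
    case False
    then obtain x where x: "x \<in> W p" by blast
    have "W p \<subseteq> cball x m" using close[OF x] by (auto simp: dist_norm)
    then show ?thesis using bounded_cball bounded_subset by blast
  qed simp
  show "\<exists>\<V> m. finite \<V> \<and> A \<subseteq> \<Union>\<V> \<and> 0 \<le> m \<and> m \<le> \<delta> \<and>
     (\<forall>V\<in>\<V>. bounded V \<and> diameter V \<le> m) \<and> 
     real (card \<V>) * (unit_ball_vol (real (CARD('d) - 1)) * (m / 2) ^ (CARD('d) - 1)) \<le> graph_const TYPE('d) M * len ^ (CARD('d) - 1)"
  proof (intro exI[of _ "W ` I"] exI[of _ m] conjI ballI)
    show "finite (W ` I)" using fin by simp
    show "A \<subseteq> \<Union> (W ` I)" using \<kappa>I by (auto simp: W_def)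
    show "0 \<le> m" "m \<le> \<delta>" by fact+
    fix V assume "V \<in> W ` I"
    then obtain p where p: "V = W p" by blast
    show "bounded V" unfolding p by (rule bW)
    show "diameter V \<le> m" unfolding p by (rule diameter_le) (use m close in auto)
  next
    have cn: "0 \<le> unit_ball_vol (real s) * (m / 2) ^ s" using m by simp
    have "real (card (W ` I)) \<le> real (card I)" using card_image_le[OF fin] by simp
    also have "\<dots> \<le> (2 * real N) ^ s" unfolding card of_nat_power of_nat_add of_nat_1 using N(1) by (intro power_mono) auto
    finally have "real (card (W ` I)) * (unit_ball_vol (real s) * (m / 2) ^ s) \<le> (2 * real N) ^ s * (unit_ball_vol (real s) * (m / 2) ^ s)"
      using cn by (rule mult_right_mono)
    also have "\<dots> = unit_ball_vol (real s) * ((2 * real N) * (m / 2)) ^ s" by (simp only: power_mult_distrib mult_ac)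
    also have "(2 * real N) * (m / 2) = (n * (1 + M)) * len" using N(1) by (simp add: m_def)
    also have "unit_ball_vol (real s) * ((n * (1 + M)) * len) ^ s = graph_const TYPE('d) M * len ^ s"
      unfolding graph_const_def s_def n_def power_mult_distrib[of _ len] by (simp add: mult_ac)
    finally show "real (card (W ` I)) * (unit_ball_vol (real (CARD('d) - 1)) * (m / 2) ^ (CARD('d) - 1)) \<le> graph_const TYPE('d) M * len ^ (CARD('d) - 1)"
      unfolding s_def .
  qed
qed

text \<open>Open sets are covered by dyadic cubes with disjoint interiors; each closed cube has
  \<open>\<nu>\<close>-measure at most \<open>K\<close> times the volume of its interior, so shared
  faces cost nothing. Outer regularity extends the bound to Borel sets. Concentration in a large
  cube is assumed because the dyadic subdivision starts from a bounded box.\<close>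

lemma measure_le_lborel_cubes:
  fixes \<nu> :: "'a::euclidean_space measure"
  assumes sets[measurable_cong]: "sets \<nu> = sets borel" and "K \<ge> 0"
    and cube: "\<And>a len. len > 0 \<Longrightarrow> emeasure \<nu> (cbox a (a + len *\<^sub>R One)) \<le> ennreal (K * len ^ DIM('a))"
    and bdd: "emeasure \<nu> (- cbox (- (r *\<^sub>R One)) (r *\<^sub>R One)) = 0" "r > 0"
    and B: "B \<in> sets borel"
  shows "emeasure \<nu> B \<le> ennreal K * emeasure lborel B"
proof -
  define Q where "Q = cbox (- (r *\<^sub>R One)) (r *\<^sub>R One :: 'a)"
  have Qm: "Q \<in> sets borel" by (simp add: Q_def)
  have open_le: "emeasure \<nu> V \<le> ennreal K * emeasure lborel V" if V: "open V" for V
  proof -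
    have Vm: "V \<in> sets borel" using V by simp
    have "\<forall>x. \<exists>e>0. x \<in> V \<longrightarrow> ball x e \<subseteq> V" using V open_contains_ball by (metis zero_less_one)
    then obtain e where e: "\<And>x. e x > 0" "\<And>x. x \<in> V \<Longrightarrow> ball x (e x) \<subseteq> V" by metis
    have g: "gauge (\<lambda>x. ball x (e x))" using e(1) by (simp add: gauge_def)
    have ne: "box (- (r *\<^sub>R One)) (r *\<^sub>R One :: 'a) \<noteq> {}" using \<open>r > 0\<close> by (simp add: box_ne_empty)
    have sub: "V \<inter> Q \<subseteq> cbox (- (r *\<^sub>R One)) (r *\<^sub>R One)" by (simp add: Q_def)
    obtain \<D> where D: "countable \<D>" "\<And>K. K \<in> \<D> \<Longrightarrow> interior K \<noteq> {} \<and> (\<exists>c d. K = cbox c d)"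
      "pairwise (\<lambda>A B. interior A \<inter> interior B = {}) \<D>"
      "\<And>K. K \<in> \<D> \<Longrightarrow> \<exists>x \<in> (V \<inter> Q) \<inter> K. K \<subseteq> ball x (e x)"
      "\<And>u v. cbox u v \<in> \<D> \<Longrightarrow> \<exists>n. \<forall>i \<in> Basis. v \<bullet> i - u \<bullet> i = ((r *\<^sub>R One) \<bullet> i - (- (r *\<^sub>R One)) \<bullet> i) / 2^n"
      "V \<inter> Q \<subseteq> \<Union>\<D>"
      by (rule covering_lemma[OF sub ne g]) (rule that)
    define f where "f n = (if n \<in> to_nat_on \<D> ` \<D> then from_nat_into \<D> n else {})" for n
    have fD: "f n \<in> \<D>" if "n \<in> to_nat_on \<D> ` \<D>" for n using that D(1) by (auto simp: f_def)
    have fUn: "\<Union>\<D> \<subseteq> (\<Union>n. f n)"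
    proof
      fix x assume "x \<in> \<Union>\<D>"
      then obtain K where K: "K \<in> \<D>" "x \<in> K" by blast
      have "f (to_nat_on \<D> K) = K" using K D(1) by (simp add: f_def)
      then show "x \<in> (\<Union>n. f n)" using K by blast
    qed
    have fm: "f n \<in> sets borel" for n
    proof (cases "n \<in> to_nat_on \<D> ` \<D>")
      case True then show ?thesis using D(2)[OF fD[OF True]] by auto
    qed (simp add: f_def)
    have fle: "emeasure \<nu> (f n) \<le> ennreal K * emeasure lborel (interior (f n))" for n
    proof (cases "n \<in> to_nat_on \<D> ` \<D>")
      case True
      obtain c d where cd: "f n = cbox c d" using D(2)[OF fD[OF True]] by blast
      obtain p where p: "\<forall>i\<in>Basis. d \<bullet> i - c \<bullet> i = ((r *\<^sub>R One) \<bullet> i - (- (r *\<^sub>R One)) \<bullet> i) / 2^p"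
        using D(5) fD[OF True] cd by metis
      define len where "len = 2 * r / 2 ^ p"
      have len: "len > 0" using \<open>r > 0\<close> by (simp add: len_def)
      have dc: "d = c + len *\<^sub>R One"
        by (rule euclidean_eqI) (use p in \<open>simp add: len_def inner_add_left algebra_simps\<close>)
      have "emeasure lborel (interior (f n)) = ennreal (\<Prod>b\<in>Basis. (d - c) \<bullet> b)"
        unfolding cd interior_cbox by (rule emeasure_lborel_box) (use len in \<open>simp add: dc inner_add_left\<close>)
      also have "\<dots> = ennreal (len ^ DIM('a))" by (simp add: dc)
      finally have "emeasure lborel (interior (f n)) = ennreal (len ^ DIM('a))" .
      then show ?thesis using cube[OF len, of c] \<open>K \<ge> 0\<close> len unfolding cd dc by (simp add: ennreal_mult)
    qed (simp add: f_def)
    have disj: "disjoint_family (\<lambda>n. interior (f n))"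
      unfolding disjoint_family_on_def
    proof (intro ballI impI)
      fix a b :: nat assume "a \<noteq> b"
      show "interior (f a) \<inter> interior (f b) = {}"
      proof (cases "a \<in> to_nat_on \<D> ` \<D> \<and> b \<in> to_nat_on \<D> ` \<D>")
        case True
        then obtain A B where AB: "A \<in> \<D>" "B \<in> \<D>" "a = to_nat_on \<D> A" "b = to_nat_on \<D> B" by blast
        then have "A \<noteq> B" using \<open>a \<noteq> b\<close> by blast
        then show ?thesis using AB D(1,3) by (simp add: f_def pairwise_def)
      qed (auto simp: f_def)
    qed
    have subV: "(\<Union>n. interior (f n)) \<subseteq> V"
    proof
      fix x assume "x \<in> (\<Union>n. interior (f n))"
      then obtain n where n: "x \<in> interior (f n)" by blast
      then have t: "n \<in> to_nat_on \<D> ` \<D>" by (auto simp: f_def split: if_splits)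
      obtain y where "y \<in> V" "f n \<subseteq> ball y (e y)" using D(4)[OF fD[OF t]] by blast
      then have "f n \<subseteq> V" using e(2) by blast
      then show "x \<in> V" using n interior_subset by blast
    qed
    have "emeasure \<nu> V \<le> emeasure \<nu> ((V \<inter> Q) \<union> (- Q))" using Vm Qm by (intro emeasure_mono) auto
    also have "\<dots> \<le> emeasure \<nu> (V \<inter> Q) + emeasure \<nu> (- Q)" using Vm Qm by (intro emeasure_subadditive) auto
    also have "\<dots> = emeasure \<nu> (V \<inter> Q)" using bdd(1) by (simp add: Q_def)
    also have "\<dots> \<le> emeasure \<nu> (\<Union>n. f n)" using D(6) fUn fm by (intro emeasure_mono) auto
    also have "\<dots> \<le> (\<Sum>n. emeasure \<nu> (f n))" by (rule emeasure_subadditive_countably) (use fm sets in auto)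
    also have "\<dots> \<le> (\<Sum>n. ennreal K * emeasure lborel (interior (f n)))" by (intro suminf_le fle) auto
    also have "\<dots> = ennreal K * (\<Sum>n. emeasure lborel (interior (f n)))" by simp
    also have "(\<Sum>n. emeasure lborel (interior (f n))) = emeasure lborel (\<Union>n. interior (f n))"
      by (rule suminf_emeasure[OF _ disj]) auto
    also have "ennreal K * \<dots> \<le> ennreal K * emeasure lborel V" using subV Vm by (intro mult_left_mono emeasure_mono) auto
    finally show ?thesis .
  qed
  show ?thesis
  proof (rule ennreal_le_epsilon)
    fix \<epsilon> :: real assume "\<epsilon> > 0"
    then have "\<epsilon> / (K + 1) > 0" using \<open>K \<ge> 0\<close> by simp
    from outer_regular_lborel[OF B this] obtain U where U: "open U" "B \<subseteq> U" "emeasure lborel (U - B) < ennreal (\<epsilon> / (K + 1))" by metis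
    have "emeasure \<nu> B \<le> emeasure \<nu> U" using U by (intro emeasure_mono) auto
    also have "\<dots> \<le> ennreal K * emeasure lborel U" by (rule open_le[OF U(1)])
    also have "emeasure lborel U \<le> emeasure lborel (B \<union> (U - B))" using U B by (intro emeasure_mono) auto
    also have "\<dots> \<le> emeasure lborel B + emeasure lborel (U - B)" using U B by (intro emeasure_subadditive) auto
    also have "\<dots> \<le> emeasure lborel B + ennreal (\<epsilon> / (K + 1))" using U(3) by (intro add_left_mono) auto
    finally have "emeasure \<nu> B \<le> ennreal K * (emeasure lborel B + ennreal (\<epsilon> / (K + 1)))" by (simp add: mult_left_mono)
    also have "\<dots> = ennreal K * emeasure lborel B + ennreal (K * (\<epsilon> / (K + 1)))"
      unfolding distrib_left using \<open>K \<ge> 0\<close> \<open>\<epsilon> > 0\<close> by (subst ennreal_mult) auto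
    also have "\<dots> \<le> ennreal K * emeasure lborel B + ennreal \<epsilon>"
      using \<open>K \<ge> 0\<close> \<open>\<epsilon> > 0\<close> by (intro add_left_mono ennreal_leI) (simp add: field_simps)
    finally show "emeasure \<nu> B \<le> ennreal K * emeasure lborel B + ennreal \<epsilon>" .
  qed
qed

section \<open>One-dimensional traces and integration over a graph\<close>

text \<open>Apply the fundamental theorem of calculus to \<open>- (1 - t/h) * (q t)\<^sup>2\<close>,
  which is \<open>- (q 0)\<^sup>2\<close> at 0 and vanishes at \<open>h\<close>; the mixed term of
  its derivative is split by \<open>- 2 * a * b \<le> a\<^sup>2 + b\<^sup>2\<close>.\<close>

lemma trace_1d:
  fixes q q' :: "real \<Rightarrow> real"
  assumes "h > 0" and d: "\<And>t. (q has_real_derivative q' t) (at t)" and c: "\<And>t. isCont q' t"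
  shows "ennreal ((q 0)\<^sup>2) \<le> (\<integral>\<^sup>+t\<in>{0<..<h}. ennreal ((1/h + 1) * (q t)\<^sup>2 + (q' t)\<^sup>2) \<partial>lborel)"
proof -
  define F where "F t = - (1 - t / h) * (q t)\<^sup>2" for t
  define F' where "F' t = (1/h) * (q t)\<^sup>2 - (1 - t / h) * (2 * q t * q' t)" for t
  define G where "G t = (1/h + 1) * (q t)\<^sup>2 + (q' t)\<^sup>2" for t
  have qc: "isCont q t" for t using d by (rule DERIV_isCont)
  have dF: "(F has_real_derivative F' t) (at t)" for t
    unfolding F_def[abs_def] F'_def using \<open>h > 0\<close>
    by (auto intro!: derivative_eq_intros d simp: field_simps)
  have cF: "isCont F' t" for t unfolding F'_def[abs_def] using qc c \<open>h > 0\<close> by (intro continuous_intros) auto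
  have cG: "isCont G t" for t unfolding G_def[abs_def] using qc c by (intro continuous_intros) auto
  have iF: "integrable lborel (\<lambda>t. F' t * indicator {0..h} t)" by (rule borel_integrable_atLeastAtMost) (rule cF)
  have iG: "integrable lborel (\<lambda>t. G t * indicator {0..h} t)" by (rule borel_integrable_atLeastAtMost) (rule cG)
  have G0: "G t \<ge> 0" for t using \<open>h > 0\<close> by (simp add: G_def)
  have le: "F' t \<le> G t" if "0 \<le> t" "t \<le> h" for t
  proof -
    have l: "0 \<le> 1 - t / h" "1 - t / h \<le> 1" using that \<open>h > 0\<close> by auto
    have "- ((1 - t / h) * (2 * q t * q' t)) \<le> (1 - t / h) * ((q t)\<^sup>2 + (q' t)\<^sup>2)"
    proof -
      have "- (2 * q t * q' t) \<le> (q t)\<^sup>2 + (q' t)\<^sup>2" using zero_le_power2[of "q t + q' t"] by (simp add: power2_sum)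
      from mult_left_mono[OF this l(1)] show ?thesis by simp
    qed
    also have "\<dots> \<le> 1 * ((q t)\<^sup>2 + (q' t)\<^sup>2)" using l by (intro mult_right_mono) auto
    finally show ?thesis by (simp add: F'_def G_def algebra_simps)
  qed
  have "(q 0)\<^sup>2 = F h - F 0" using \<open>h > 0\<close> by (simp add: F_def)
  also have "\<dots> = (\<integral>t. F' t * indicator {0..h} t \<partial>lborel)"
    using integral_FTC_Icc_real[of 0 h F F'] \<open>h > 0\<close> dF cF by simp
  also have "\<dots> \<le> (\<integral>t. G t * indicator {0..h} t \<partial>lborel)"
    using le by (intro integral_mono iF iG) (auto simp: indicator_def)
  finally have "ennreal ((q 0)\<^sup>2) \<le> ennreal (\<integral>t. G t * indicator {0..h} t \<partial>lborel)" by (rule ennreal_leI)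
  also have "\<dots> = (\<integral>\<^sup>+t. ennreal (G t * indicator {0..h} t) \<partial>lborel)"
    using G0 by (intro nn_integral_eq_integral[symmetric] iG) auto
  also have "\<dots> = (\<integral>\<^sup>+t. ennreal (G t) * indicator {0<..<h} t \<partial>lborel)"
  proof (rule nn_integral_cong_AE)
    have "AE t in lborel. t \<noteq> (0::real)" "AE t in lborel. t \<noteq> h" by (rule AE_lborel_singleton)+
    then show "AE t in lborel. ennreal (G t * indicator {0..h} t) = ennreal (G t) * indicator {0<..<h} t"
      by eventually_elim (auto simp: indicator_def)
  qed
  finally show ?thesis unfolding G_def .
qed

lemma One_vec_nth: "(One :: real^'d) $ j = 1"
proof -
  have "axis j 1 \<in> (Basis :: (real^'d) set)" by (auto simp: Basis_vec_def)
  then have "(One :: real^'d) \<bullet> axis j 1 = 1" by simp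
  then show ?thesis by (simp only: inner_axis inner_real_def mult_1_right)
qed

text \<open>The map \<open>(x, t) \<mapsto> x + t e\<close> pushes \<open>H \<times> dt\<close> on the graph forward to a measure that is at most
  \<open>K * len ^ DIM\<close> on cubes, hence at most \<open>K\<close> times Lebesgue measure. This upper bound stands in for
  the area formula.\<close>

lemma graph_pushforward:
  fixes G :: "(real^'d) set" and F :: "real^'d \<Rightarrow> ennreal"
  assumes G: "G \<in> sets borel" "bounded G" "lipschitz_graph i M G" and \<sigma>: "\<bar>\<sigma>\<bar> = 1" and "h > 0"
    and F[measurable]: "F \<in> borel_measurable borel"
  defines "H \<equiv> hausdorff_measure (CARD('d) - 1) :: (real^'d) measure"
  shows "emeasure H G < \<infinity>"
    and "(\<integral>\<^sup>+x\<in>G. (\<integral>\<^sup>+t\<in>{0<..<h}. F (x + t *\<^sub>R (\<sigma> *\<^sub>R axis i 1)) \<partial>lborel) \<partial>H) \<le> ennreal (graph_const TYPE('d) M) * (\<integral>\<^sup>+x. F x \<partial>lborel)"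
proof -
  define K where "K = graph_const TYPE('d) M"
  define e where "e = \<sigma> *\<^sub>R axis i (1::real)"
  have M: "M \<ge> 0" using G(3) by (simp add: lipschitz_graph_def)
  have K: "K \<ge> 0" unfolding K_def by (rule graph_const_nonneg[OF M])
  have Hs[measurable_cong]: "sets H = sets borel" unfolding H_def by simp
  have Gm[measurable]: "G \<in> sets borel" by fact
  \<comment> \<open>The part of the graph over a cube of side \<open>len\<close> in the other
    coordinates; coordinate \<open>i\<close> is left free, in accordance with the covering
    bound.\<close>
  have colm: "emeasure H A \<le> ennreal (K * len ^ (CARD('d) - 1))"
    if "len > 0" "A = {x\<in>G. \<forall>j\<in>UNIV - {i}. c $ j \<le> x $ j \<and> x $ j \<le> c $ j + len}" for A len c
    unfolding K_def H_def
    by (rule order_trans[OF emeasure_hausdorff_le hausdorff_outer_graph_cube[OF G(3) that(1)]]) (use that(2) in auto)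
  obtain r0 where r0: "r0 > 0" "\<forall>x\<in>G. norm x \<le> r0" using G(2) bounded_pos by blast
  have comp: "\<bar>x $ j\<bar> \<le> r0" if "x \<in> G" for x j using component_le_norm_cart[of x j] r0(2) that by force
  have "emeasure H G \<le> ennreal (K * (2 * r0) ^ (CARD('d) - 1))"
  proof (rule colm)
    have "- r0 \<le> x $ j \<and> x $ j \<le> - r0 + 2 * r0" if "x \<in> G" for x j using comp[OF that, of j] by linarith
    then show "G = {x\<in>G. \<forall>j\<in>UNIV - {i}. (\<chi> j. - r0) $ j \<le> x $ j \<and> x $ j \<le> (\<chi> j. - r0) $ j + 2 * r0}" by auto
    show "2 * r0 > 0" using r0(1) by simp
  qed
  also have "\<dots> < \<infinity>" by simp
  finally show fin: "emeasure H G < \<infinity>" .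
  define M1 where "M1 = restrict_space H G"
  define M2 where "M2 = restrict_space lborel {0<..<h}"
  have M2f: "finite_measure M2" unfolding M2_def
    by (rule finite_measureI) (use \<open>h > 0\<close> in \<open>simp add: emeasure_restrict_space space_restrict_space\<close>)
  interpret M2: finite_measure M2 by (rule M2f)
  have id1: "(\<lambda>x. x) \<in> M1 \<rightarrow>\<^sub>M borel" unfolding M1_def by (rule measurable_restrict_space1) (simp add: measurable_def Hs sets_eq_imp_space_eq[OF Hs])
  have id2: "(\<lambda>x. x) \<in> M2 \<rightarrow>\<^sub>M borel" unfolding M2_def by (rule measurable_restrict_space1) simp
  have map: "(\<lambda>z. fst z + snd z *\<^sub>R e) \<in> M1 \<Otimes>\<^sub>M M2 \<rightarrow>\<^sub>M borel"
    using measurable_compose[OF measurable_fst id1] measurable_compose[OF measurable_snd id2] by measurable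
  define \<nu> where "\<nu> = distr (M1 \<Otimes>\<^sub>M M2) borel (\<lambda>z. fst z + snd z *\<^sub>R e)"
  have nu: "(\<integral>\<^sup>+x. f x \<partial>\<nu>) = (\<integral>\<^sup>+x\<in>G. (\<integral>\<^sup>+t\<in>{0<..<h}. f (x + t *\<^sub>R e) \<partial>lborel) \<partial>H)" if f: "f \<in> borel_measurable borel" for f
  proof -
    have "(\<integral>\<^sup>+x. f x \<partial>\<nu>) = (\<integral>\<^sup>+z. f (fst z + snd z *\<^sub>R e) \<partial>(M1 \<Otimes>\<^sub>M M2))"
      unfolding \<nu>_def by (rule nn_integral_distr[OF map]) (use f in simp)
    also have "\<dots> = (\<integral>\<^sup>+x. (\<integral>\<^sup>+t. f (x + t *\<^sub>R e) \<partial>M2) \<partial>M1)"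
      using M2.nn_integral_fst[OF measurable_compose[OF map f]] by simp
    also have "\<dots> = (\<integral>\<^sup>+x\<in>G. (\<integral>\<^sup>+t\<in>{0<..<h}. f (x + t *\<^sub>R e) \<partial>lborel) \<partial>H)"
      unfolding M1_def M2_def by (simp add: nn_integral_restrict_space Hs)
    finally show ?thesis .
  qed
  have nus: "sets \<nu> = sets borel" by (simp add: \<nu>_def)
  have ei: "e $ i = \<sigma>" "j \<noteq> i \<Longrightarrow> e $ j = 0" for j by (auto simp: e_def axis_def)
  have cube: "emeasure \<nu> (cbox a (a + len *\<^sub>R One)) \<le> ennreal (K * len ^ DIM(real^'d))" if len: "len > 0" for a len
  proof -
    define A where "A = {x\<in>G. \<forall>j\<in>UNIV - {i}. a $ j \<le> x $ j \<and> x $ j \<le> a $ j + len}"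
    have "A = G \<inter> (\<Inter>j\<in>UNIV - {i}. {x. a $ j \<le> x $ j} \<inter> {x. x $ j \<le> a $ j + len})" by (auto simp: A_def)
    moreover have "closed (\<Inter>j\<in>UNIV - {i}. {x::real^'d. a $ j \<le> x $ j} \<inter> {x. x $ j \<le> a $ j + len})"
      by (intro closed_INT ballI closed_Int closed_Collect_le continuous_intros)
    ultimately have Am: "A \<in> sets borel" using Gm by auto
    \<comment> \<open>For fixed \<open>x\<close> the parameters \<open>t\<close> that lead into the
      cube lie in an interval of length \<open>len\<close>, and there are none unless the other
      coordinates of \<open>x\<close> fit. The factor \<open>len\<close> raises the exponent from
      \<open>d - 1\<close> to \<open>d\<close>.\<close>
    have inner: "(\<integral>\<^sup>+t\<in>{0<..<h}. indicator (cbox a (a + len *\<^sub>R One)) (x + t *\<^sub>R e) \<partial>lborel) \<le> ennreal len * indicator A x" if x: "x \<in> G" for x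
    proof (cases "x \<in> A")
      case True
      have "(\<integral>\<^sup>+t\<in>{0<..<h}. indicator (cbox a (a + len *\<^sub>R One)) (x + t *\<^sub>R e) \<partial>lborel)
        \<le> (\<integral>\<^sup>+t. indicator (cball (\<sigma> * (a $ i + len/2 - x $ i)) (len/2)) t \<partial>lborel)"
      proof (rule nn_integral_mono)
        fix t
        have "t \<in> cball (\<sigma> * (a $ i + len/2 - x $ i)) (len/2)" if "x + t *\<^sub>R e \<in> cbox a (a + len *\<^sub>R One)"
        proof -
          have "a $ i \<le> x $ i + t * \<sigma> \<and> x $ i + t * \<sigma> \<le> a $ i + len"
            using that unfolding mem_box_cart by (auto simp: ei One_vec_nth simp del: sum_component dest!: spec[of _ i])
          moreover have "\<sigma> = 1 \<or> \<sigma> = -1" using \<sigma> by linarith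
          ultimately show ?thesis by (auto simp: dist_real_def abs_le_iff field_simps)
        qed
        then show "indicator (cbox a (a + len *\<^sub>R One)) (x + t *\<^sub>R e) * indicator {0<..<h} t \<le> (indicator (cball (\<sigma> * (a $ i + len/2 - x $ i)) (len/2)) t :: ennreal)"
          by (auto simp: indicator_def)
      qed
      also have "\<dots> = ennreal len" using len by (simp add: cball_eq_atLeastAtMost)
      finally show ?thesis using True by simp
    next
      case False
      have "x + t *\<^sub>R e \<notin> cbox a (a + len *\<^sub>R One)" for t
      proof
        assume "x + t *\<^sub>R e \<in> cbox a (a + len *\<^sub>R One)"
        then have "a $ j \<le> x $ j \<and> x $ j \<le> a $ j + len" if "j \<noteq> i" for j
          using that unfolding mem_box_cart by (auto simp: ei One_vec_nth simp del: sum_component dest!: spec[of _ j])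
        then show False using False x by (auto simp: A_def)
      qed
      then show ?thesis by simp
    qed
    have "emeasure \<nu> (cbox a (a + len *\<^sub>R One)) = (\<integral>\<^sup>+x. indicator (cbox a (a + len *\<^sub>R One)) x \<partial>\<nu>)"
      by (rule nn_integral_indicator[symmetric]) (simp add: nus)
    also have "\<dots> = (\<integral>\<^sup>+x\<in>G. (\<integral>\<^sup>+t\<in>{0<..<h}. indicator (cbox a (a + len *\<^sub>R One)) (x + t *\<^sub>R e) \<partial>lborel) \<partial>H)"
      by (rule nu) simp
    also have "\<dots> \<le> (\<integral>\<^sup>+x. ennreal len * indicator A x \<partial>H)"
    proof (rule nn_integral_mono)
      fix x
      show "(\<integral>\<^sup>+t\<in>{0<..<h}. indicator (cbox a (a + len *\<^sub>R One)) (x + t *\<^sub>R e) \<partial>lborel) * indicator G x \<le> ennreal len * indicator A x"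
      proof (cases "x \<in> G")
        case True
        then show ?thesis using inner[OF True] by (simp only: indicator_simps mult_1_right)
      next
        case False
        then show ?thesis by simp
      qed
    qed
    also have "\<dots> = ennreal len * emeasure H A" using Am by (simp add: nn_integral_cmult_indicator Hs)
    also have "\<dots> \<le> ennreal len * ennreal (K * len ^ (CARD('d) - 1))"
      by (intro mult_left_mono colm[OF len]) (auto simp: A_def)
    also have "\<dots> = ennreal (K * (len * len ^ (CARD('d) - 1)))" using len K by (simp add: ennreal_mult[symmetric] mult_ac)
    also have "len * len ^ (CARD('d) - 1) = len ^ DIM(real^'d)" by (simp flip: power_Suc)
    finally show ?thesis .
  qed
  have out: "emeasure \<nu> (- cbox (- ((r0 + h) *\<^sub>R One)) ((r0 + h) *\<^sub>R One)) = 0"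
  proof -
    have inq: "x + t *\<^sub>R e \<in> cbox (- ((r0 + h) *\<^sub>R One)) ((r0 + h) *\<^sub>R One)" if "x \<in> G" "0 < t" "t < h" for x t
      unfolding mem_box_cart
    proof
      fix j
      have "\<bar>t * e $ j\<bar> \<le> h" using that \<sigma> \<open>h > 0\<close> by (cases "j = i") (auto simp: ei abs_mult)
      then show "(- ((r0 + h) *\<^sub>R One)) $ j \<le> (x + t *\<^sub>R e) $ j \<and> (x + t *\<^sub>R e) $ j \<le> ((r0 + h) *\<^sub>R One) $ j"
        using comp[OF that(1), of j] by (simp add: One_vec_nth abs_le_iff del: sum_component)
    qed
    have "emeasure \<nu> (- cbox (- ((r0 + h) *\<^sub>R One)) ((r0 + h) *\<^sub>R One)) = (\<integral>\<^sup>+x. indicator (- cbox (- ((r0 + h) *\<^sub>R One)) ((r0 + h) *\<^sub>R One)) x \<partial>\<nu>)"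
      by (rule nn_integral_indicator[symmetric]) (simp add: nus)
    also have "\<dots> = (\<integral>\<^sup>+x\<in>G. (\<integral>\<^sup>+t\<in>{0<..<h}. indicator (- cbox (- ((r0 + h) *\<^sub>R One)) ((r0 + h) *\<^sub>R One)) (x + t *\<^sub>R e) \<partial>lborel) \<partial>H)"
      by (rule nu) simp
    also have "\<dots> = (\<integral>\<^sup>+x. 0 \<partial>H)"
    proof (rule nn_integral_cong)
      fix x
      have "(\<integral>\<^sup>+t\<in>{0<..<h}. indicator (- cbox (- ((r0 + h) *\<^sub>R One)) ((r0 + h) *\<^sub>R One)) (x + t *\<^sub>R e) \<partial>lborel) = (\<integral>\<^sup>+t. 0 \<partial>(lborel :: real measure))" if "x \<in> G"
        by (rule nn_integral_cong) (use inq[OF that] in \<open>auto simp: indicator_def\<close>)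
      then show "(\<integral>\<^sup>+t\<in>{0<..<h}. indicator (- cbox (- ((r0 + h) *\<^sub>R One)) ((r0 + h) *\<^sub>R One)) (x + t *\<^sub>R e) \<partial>lborel) * indicator G x = (0::ennreal)"
        by (cases "x \<in> G") simp_all
    qed
    finally show ?thesis by simp
  qed
  have le: "emeasure \<nu> B \<le> ennreal K * emeasure lborel B" if "B \<in> sets borel" for B
    by (rule measure_le_lborel_cubes[OF nus K cube out _ that]) (use r0 \<open>h > 0\<close> in auto)
  have "emeasure \<nu> A \<le> emeasure (scale_measure (ennreal K) lborel) A" for A
    by (cases "A \<in> sets borel") (use le nus in \<open>simp_all add: emeasure_notin_sets\<close>)
  then have "\<nu> \<le> scale_measure (ennreal K) lborel"
    unfolding le_measure_iff using nus sets_eq_imp_space_eq[OF nus] by (simp add: space_scale_measure le_fun_def)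
  then have "(\<integral>\<^sup>+x. F x \<partial>\<nu>) \<le> (\<integral>\<^sup>+x. F x \<partial>scale_measure (ennreal K) lborel)"
    by (intro nn_integral_mono_measure) (simp add: nus)
  also have "\<dots> = ennreal K * (\<integral>\<^sup>+x. F x \<partial>lborel)" by (rule nn_integral_scale_measure) simp
  finally show "(\<integral>\<^sup>+x\<in>G. (\<integral>\<^sup>+t\<in>{0<..<h}. F (x + t *\<^sub>R (\<sigma> *\<^sub>R axis i 1)) \<partial>lborel) \<partial>H) \<le> ennreal (graph_const TYPE('d) M) * (\<integral>\<^sup>+x. F x \<partial>lborel)"
    unfolding nu[OF F] e_def K_def .
qed

lemma partial_scale_dir:
  assumes "f differentiable (at x)"
  shows "partial (c *\<^sub>R b) f x = c * partial b f x"
proof -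
  obtain f' where f': "(f has_derivative f') (at x)" using assms differentiable_def by blast
  then have "linear f'" using has_derivative_linear by blast
  then show ?thesis using partial_eqI[OF f'] by (simp add: linear_cmul)
qed

section \<open>Geometry of the boundary and of the cylinder\<close>

text \<open>In a chart \<open>D\<close> is the strict region above the graph of
  \<open>\<gamma>\<close>, and by continuity its closure satisfies
  \<open>\<sigma> * x $ i \<ge> \<gamma> x\<close>. Since \<open>\<gamma>\<close> does not depend on
  coordinate \<open>i\<close>, a step along \<open>\<sigma> *\<^sub>R axis i 1\<close> makes the
  inequality strict and leads into \<open>D\<close>. Taking half the chart radius for
  \<open>\<rho>\<close> keeps such steps inside the chart.\<close>

lemma Ck_boundary_local:
  fixes D :: "(real^'d) set"
  assumes "open D" "Ck_boundary k D" "k \<ge> 1" "p \<in> frontier D"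
  obtains \<rho> i \<sigma> M where "\<rho> > 0" "\<bar>\<sigma>\<bar> = (1::real)" "lipschitz_graph i M (frontier D \<inter> ball p \<rho>)"
    "\<And>y t. y \<in> closure D \<inter> ball p \<rho> \<Longrightarrow> 0 < t \<Longrightarrow> t < \<rho> \<Longrightarrow> y + t *\<^sub>R (\<sigma> *\<^sub>R axis i 1) \<in> D"
proof -
  obtain r i \<sigma> \<gamma> where r: "r > 0" and \<sigma>: "\<sigma> \<in> {-1, 1::real}" and \<gamma>: "Ck k \<gamma>" "\<And>x c. \<gamma> (x + c *\<^sub>R axis i 1) = \<gamma> x"
    and D: "D \<inter> ball p r = {x \<in> ball p r. \<sigma> * x $ i > \<gamma> x}"
    using assms(2)[unfolded Ck_boundary_def, rule_format, OF assms(4)] by blast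
  have \<sigma>1: "\<bar>\<sigma>\<bar> = 1" and \<sigma>2: "\<sigma> * \<sigma> = 1" using \<sigma> by auto
  have C1: "Ck (Suc 0) \<gamma>" using Ck_mono[OF \<gamma>(1), of "Suc 0"] assms(3) by simp
  have \<gamma>c: "continuous_on S \<gamma>" for S using Ck_continuous[OF C1] .
  have above: "\<sigma> * y $ i \<ge> \<gamma> y" if y: "y \<in> closure D" "y \<in> ball p r" for y
  proof (rule ccontr)
    assume "\<not> ?thesis"
    then have yl: "\<sigma> * y $ i < \<gamma> y" by simp
    have "open (ball p r \<inter> {z. \<sigma> * z $ i < \<gamma> z})"
      using \<gamma>c by (intro open_Int open_ball open_Collect_less continuous_intros)
    moreover have "y \<in> ball p r \<inter> {z. \<sigma> * z $ i < \<gamma> z}" using y yl by simp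
    ultimately obtain z where "z \<in> D" "z \<in> ball p r" "\<sigma> * z $ i < \<gamma> z"
      using y(1) unfolding closure_iff_nhds_not_empty by blast
    then show False using D by force
  qed
  have graph: "\<sigma> * y $ i = \<gamma> y" if y: "y \<in> frontier D" "y \<in> ball p r" for y
  proof -
    have "y \<notin> D" using y(1) \<open>open D\<close> by (simp add: frontier_def interior_open)
    then have "\<not> \<sigma> * y $ i > \<gamma> y" using D y(2) by blast
    moreover have "\<sigma> * y $ i \<ge> \<gamma> y" using above[of y] y by (simp add: frontier_def)
    ultimately show ?thesis by simp
  qed
  have "\<exists>B. \<forall>b\<in>Basis. \<forall>x\<in>cball p (2 * r). \<bar>partial b \<gamma> x\<bar> \<le> B"
  proof -
    have "\<exists>B. \<forall>x\<in>cball p (2 * r). \<bar>partial b \<gamma> x\<bar> \<le> B" if "b \<in> Basis" for b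
    proof -
      have "continuous_on UNIV (partial b \<gamma>)" using C1 that by simp
      then have "continuous_on (cball p (2 * r)) (partial b \<gamma>)" by (rule continuous_on_subset) simp
      then have "compact (partial b \<gamma> ` cball p (2 * r))" by (rule compact_continuous_image[OF _ compact_cball])
      then have "bounded (partial b \<gamma> ` cball p (2 * r))" by (rule compact_imp_bounded)
      then show ?thesis unfolding bounded_iff by auto
    qed
    then obtain Bf where Bf: "\<And>b x. b \<in> Basis \<Longrightarrow> x \<in> cball p (2 * r) \<Longrightarrow> \<bar>partial b \<gamma> x\<bar> \<le> Bf b" by metis
    have "\<bar>partial b \<gamma> x\<bar> \<le> (\<Sum>b\<in>Basis. \<bar>Bf b\<bar>)" if "b \<in> Basis" "x \<in> cball p (2 * r)" for b x
      using Bf[OF that] member_le_sum[of b Basis "\<lambda>b. \<bar>Bf b\<bar>"] that(1) by fastforce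
    then show ?thesis by blast
  qed
  then obtain B0 where B0: "\<And>b x. b \<in> Basis \<Longrightarrow> x \<in> cball p (2 * r) \<Longrightarrow> \<bar>partial b \<gamma> x\<bar> \<le> B0" by blast
  define B where "B = \<bar>B0\<bar>"
  have B: "\<bar>partial b \<gamma> x\<bar> \<le> B" if "b \<in> Basis" "x \<in> cball p (2 * r)" for b x using B0[OF that] by (simp add: B_def)
  define M where "M = real DIM(real^'d) * B"
  have M: "M \<ge> 0" by (simp add: M_def B_def)
  have "lipschitz_graph i M (frontier D \<inter> ball p (r/2))"
    unfolding lipschitz_graph_def
  proof (intro conjI M ballI)
    fix x y assume x: "x \<in> frontier D \<inter> ball p (r/2)" and y: "y \<in> frontier D \<inter> ball p (r/2)"
    have br: "x \<in> ball p r" "y \<in> ball p r" using x y r by auto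
    \<comment> \<open>Adjusting coordinate \<open>i\<close> of \<open>x\<close> to that of
      \<open>y\<close> leaves \<open>\<gamma>\<close> unchanged, so the mean value estimate involves
      only the other coordinates. The new point may leave the chart but stays in
      \<open>cball p (2 * r)\<close>, where the derivatives were bounded.\<close>
    define x' where "x' = x + (y $ i - x $ i) *\<^sub>R axis i 1"
    have c: "x' $ j - y $ j = (if j = i then 0 else x $ j - y $ j)" for j by (simp add: x'_def axis_def)
    have "\<bar>y $ i - x $ i\<bar> \<le> norm (y - x)" using component_le_norm_cart[of "y - x" i] by simp
    also have "\<dots> \<le> dist p y + dist p x" using dist_triangle3[of y x p] by (simp add: dist_norm)
    also have "\<dots> \<le> r" using x y by auto
    finally have "dist x x' \<le> r" by (simp add: x'_def dist_norm)
    then have x'c: "x' \<in> cball p (2 * r)" using dist_triangle[of p x' x] br by auto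
    have yc: "y \<in> cball p (2 * r)" using br r by auto
    have "\<bar>x $ i - y $ i\<bar> = \<bar>\<sigma> * x $ i - \<sigma> * y $ i\<bar>" using \<sigma>1 by (simp add: abs_mult flip: right_diff_distrib)
    also have "\<dots> = \<bar>\<gamma> x - \<gamma> y\<bar>" using graph x y br by auto
    also have "\<dots> = \<bar>\<gamma> x' - \<gamma> y\<bar>" by (simp add: x'_def \<gamma>(2))
    also have "\<dots> \<le> M * norm (x' - y)" unfolding M_def
      by (rule bounded_partials_lipschitz[OF convex_cball _ B x'c yc]) (use C1 in auto)
    also have "\<dots> \<le> M * (\<Sum>j\<in>UNIV. \<bar>(x' - y) $ j\<bar>)" by (rule mult_left_mono[OF norm_le_l1_cart M])
    also have "(\<Sum>j\<in>UNIV. \<bar>(x' - y) $ j\<bar>) = (\<Sum>j\<in>UNIV - {i}. \<bar>x $ j - y $ j\<bar>)"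
      by (simp add: sum.remove[of UNIV i] c)
    finally show "\<bar>x $ i - y $ i\<bar> \<le> M * (\<Sum>j\<in>UNIV - {i}. \<bar>x $ j - y $ j\<bar>)" .
  qed
  moreover have "y + t *\<^sub>R (\<sigma> *\<^sub>R axis i 1) \<in> D" if y: "y \<in> closure D \<inter> ball p (r/2)" and t: "0 < t" "t < r/2" for y t
  proof -
    have "dist p (y + t *\<^sub>R (\<sigma> *\<^sub>R axis i 1)) \<le> dist p y + dist y (y + t *\<^sub>R (\<sigma> *\<^sub>R axis i 1))" by (rule dist_triangle)
    also have "dist y (y + t *\<^sub>R (\<sigma> *\<^sub>R axis i 1)) = t" using t \<sigma>1 by (simp add: dist_norm abs_mult)
    finally have b: "y + t *\<^sub>R (\<sigma> *\<^sub>R axis i 1) \<in> ball p r" using y t by simp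
    have "\<gamma> (y + t *\<^sub>R (\<sigma> *\<^sub>R axis i 1)) = \<gamma> y" using \<gamma>(2)[of y "t * \<sigma>"] by simp
    also have "\<dots> \<le> \<sigma> * y $ i" using above[of y] y r by auto
    also have "\<dots> < \<sigma> * (y + t *\<^sub>R (\<sigma> *\<^sub>R axis i 1)) $ i"
      using t \<sigma>2 by (simp add: distrib_left mult.left_commute[of \<sigma> t])
    finally show ?thesis using D b by blast
  qed
  ultimately show ?thesis using that[of "r/2" \<sigma> i M] r \<sigma>1 by simp
qed

text \<open>Pair an inward direction of \<open>D\<close> with a time direction that points away from
  the nearer end of the interval; this covers the edges, where bottom or top meets the lateral
  boundary. Points over the interior of \<open>D\<close> take spatial direction 0.\<close>

lemma inward_cylinder:
  fixes D :: "(real^'d) set" and T :: real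
  assumes D: "open D" "Ck_boundary k D" "k \<ge> 1" and "T > 0" and p: "p \<in> closure (D \<times> {0<..<T})"
  shows "\<exists>R d. inward (D \<times> {0<..<T}) p R d"
proof -
  obtain x t where pxt: "p = (x, t)" by (cases p)
  have cl: "closure (D \<times> {0<..<T}) = closure D \<times> {0..T}" using closure_greaterThanLessThan[OF \<open>T > 0\<close>] by (simp add: closure_Times)
  have x: "x \<in> closure D" and t: "0 \<le> t" "t \<le> T" using p by (auto simp: cl pxt)
  have "\<exists>\<rho>>0. \<exists>d s0. s0 > 0 \<and> (\<forall>y\<in>closure D \<inter> ball x \<rho>. \<forall>s. 0 < s \<and> s \<le> s0 \<longrightarrow> y + s *\<^sub>R d \<in> D)"
  proof (cases "x \<in> D")
    case True
    then obtain \<rho> where "\<rho> > 0" "ball x \<rho> \<subseteq> D" using D(1) open_contains_ball by blast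
    then show ?thesis by (intro exI[of _ \<rho>] conjI exI[of _ 0] exI[of _ 1]) auto
  next
    case False
    then have "x \<in> frontier D" using x D(1) by (simp add: frontier_def interior_open)
    from Ck_boundary_local[OF D this] obtain \<rho> i \<sigma> where "\<rho> > 0"
      "\<And>y t. y \<in> closure D \<inter> ball x \<rho> \<Longrightarrow> 0 < t \<Longrightarrow> t < \<rho> \<Longrightarrow> y + t *\<^sub>R (\<sigma> *\<^sub>R axis i 1) \<in> D" by metis
    then show ?thesis by (intro exI[of _ \<rho>] conjI exI[of _ "\<sigma> *\<^sub>R axis i 1"] exI[of _ "\<rho>/2"]) auto
  qed
  then obtain \<rho> d s0 where \<rho>: "\<rho> > 0" "s0 > 0" "\<And>y s. y \<in> closure D \<inter> ball x \<rho> \<Longrightarrow> 0 < s \<Longrightarrow> s \<le> s0 \<Longrightarrow> y + s *\<^sub>R d \<in> D" by metis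
  define \<tau> where "\<tau> = (if t \<le> T/2 then 1 else -1 :: real)"
  \<comment> \<open>\<open>T/8\<close> limits both the distance in time and the step: from within
    \<open>T/8\<close> of one half of the interval, a step of at most \<open>T/8\<close> towards the
    other end does not reach that end.\<close>
  define R where "R = min (\<rho>/2) (T/8)"
  have R: "R > 0" "R < \<rho>" "R \<le> T/8" using \<rho> \<open>T > 0\<close> by (auto simp: R_def)
  have "inward (D \<times> {0<..<T}) p R (d, \<tau>)" unfolding inward_def
  proof (intro conjI R exI[of _ "min s0 (T/8)"] ballI allI impI)
    show "min s0 (T/8) > 0" using \<rho> \<open>T > 0\<close> by simp
    fix y s assume y: "y \<in> closure (D \<times> {0<..<T}) \<inter> cball p R" and s: "0 < s \<and> s \<le> min s0 (T/8)"
    obtain y1 t1 where y12: "y = (y1, t1)" by (cases y)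
    have c: "y1 \<in> closure D" "0 \<le> t1" "t1 \<le> T" using y by (auto simp: cl y12)
    have "dist x y1 \<le> dist p y" "dist t t1 \<le> dist p y" using dist_fst_le[of p y] dist_snd_le[of p y] by (auto simp: pxt y12)
    then have dd: "dist x y1 \<le> R" "\<bar>t - t1\<bar> \<le> R" using y by (auto simp: dist_real_def)
    have "y1 + s *\<^sub>R d \<in> D" using \<rho>(3)[of y1 s] c dd R s by auto
    moreover have "0 < t1 + s * \<tau>" "t1 + s * \<tau> < T"
      using s c dd(2) R t \<open>T > 0\<close> by (auto simp: \<tau>_def abs_le_iff split: if_splits)
    ultimately show "y + s *\<^sub>R (d, \<tau>) \<in> D \<times> {0<..<T}" by (simp add: y12)
  qed
  then show ?thesis by blast
qed

lemma space_dir_Basis: "space_dir a \<in> Basis"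
proof -
  have "axis a (1::real) \<in> Basis" unfolding Basis_vec_def by simp blast
  then show ?thesis unfolding Basis_prod_def by blast
qed

lemma time_dir_Basis: "time_dir \<in> Basis"
  by (simp add: Basis_prod_def)

text \<open>At a fixed time, the one-dimensional estimate along the inward direction is integrated
  over a boundary chart by \<open>graph_pushforward\<close>, and finitely many charts cover the
  compact frontier. The constant is the same for all times. Finiteness of the surface measure is
  recorded for the later exchange of space and time integrals.\<close>

lemma boundary_trace:
  fixes D :: "(real^'d) set"
  assumes D: "open D" "bounded D" "Ck_boundary k D" "k \<ge> 1"
  defines "H \<equiv> hausdorff_measure (CARD('d) - 1) :: (real^'d) measure"
  shows "emeasure H (frontier D) < \<infinity> \<and> (\<exists>C\<ge>0. \<forall>\<psi> :: (real^'d) \<times> real \<Rightarrow> real. smooth \<psi> \<longrightarrow> (\<forall>t.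
     (\<integral>\<^sup>+x\<in>frontier D. ennreal ((\<psi> (x, t))\<^sup>2) \<partial>H) \<le>
     ennreal C * (\<integral>\<^sup>+y\<in>D. ennreal ((\<psi> (y, t))\<^sup>2 + (\<Sum>a\<in>UNIV. (partial (space_dir a) \<psi> (y, t))\<^sup>2)) \<partial>lborel)))"
proof -
  let ?E = "\<lambda>\<psi> t y. (\<psi> (y, t))\<^sup>2 + (\<Sum>a\<in>UNIV. (partial (space_dir a) \<psi> (y, t))\<^sup>2)"
  have Hs[measurable_cong]: "sets H = sets borel" unfolding H_def by simp
  define Q where "Q p \<rho> C \<longleftrightarrow> \<rho> > 0 \<and> C \<ge> 0 \<and> emeasure H (frontier D \<inter> ball p \<rho>) < \<infinity> \<and> (\<forall>\<psi> t. smooth \<psi> \<longrightarrow>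
     (\<integral>\<^sup>+x\<in>frontier D \<inter> ball p \<rho>. ennreal ((\<psi> (x, t))\<^sup>2) \<partial>H) \<le> ennreal C * (\<integral>\<^sup>+y\<in>D. ennreal (?E \<psi> t y) \<partial>lborel))"
    for p \<rho> C
  have local: "\<exists>\<rho> C. Q p \<rho> C" if p: "p \<in> frontier D" for p
  proof -
    from Ck_boundary_local[OF D(1,3,4) p] obtain \<rho> i \<sigma> M where \<rho>: "\<rho> > 0" "\<bar>\<sigma>\<bar> = (1::real)" "lipschitz_graph i M (frontier D \<inter> ball p \<rho>)"
      "\<And>y t. y \<in> closure D \<inter> ball p \<rho> \<Longrightarrow> 0 < t \<Longrightarrow> t < \<rho> \<Longrightarrow> y + t *\<^sub>R (\<sigma> *\<^sub>R axis i 1) \<in> D" by metis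
    define G where "G = frontier D \<inter> ball p \<rho>"
    define e where "e = \<sigma> *\<^sub>R axis i (1::real)"
    have G: "G \<in> sets borel" "bounded G" "lipschitz_graph i M G" using \<rho>(3) by (auto simp: G_def bounded_Int)
    define K where "K = graph_const TYPE('d) M"
    define c where "c = 1/\<rho> + 1"
    have c: "c \<ge> 0" "c \<ge> 1" using \<rho>(1) by (simp_all add: c_def)
    have K: "K \<ge> 0" using G(3) graph_const_nonneg unfolding K_def lipschitz_graph_def by blast
    have "(\<integral>\<^sup>+x\<in>G. ennreal ((\<psi> (x, t))\<^sup>2) \<partial>H) \<le> ennreal (K * c) * (\<integral>\<^sup>+y\<in>D. ennreal (?E \<psi> t y) \<partial>lborel)"
      if \<psi>: "smooth \<psi>" for \<psi> t
    proof -
      \<comment> \<open>Cut off to \<open>D\<close>, since the right-hand side integrates over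
        \<open>D\<close> only; every point \<open>x + s *\<^sub>R e\<close> that occurs below lies
        in \<open>D\<close>.\<close>
      define F where "F y = ennreal (c * ?E \<psi> t y) * indicator D y" for y
      have cm: "(\<lambda>y. f (y, t)) \<in> borel_measurable borel" if "smooth f" for f :: "(real^'d) \<times> real \<Rightarrow> real"
        by (intro borel_measurable_continuous_onI continuous_on_compose2[OF smooth_continuous[OF that, of UNIV]] continuous_intros) auto
      have Em: "?E \<psi> t \<in> borel_measurable borel"
        by (intro borel_measurable_add borel_measurable_sum borel_measurable_power cm \<psi> smooth_partial space_dir_Basis)
      have Dm: "D \<in> sets borel" using D(1) by simp
      have Im: "(\<lambda>y. ennreal (?E \<psi> t y) * indicator D y) \<in> borel_measurable lborel" using Em Dm by measurable
      have Fm: "F \<in> borel_measurable borel" unfolding F_def[abs_def] using Em Dm by measurable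
      have "(\<integral>\<^sup>+x\<in>G. ennreal ((\<psi> (x, t))\<^sup>2) \<partial>H) \<le> (\<integral>\<^sup>+x\<in>G. (\<integral>\<^sup>+s\<in>{0<..<\<rho>}. F (x + s *\<^sub>R e) \<partial>lborel) \<partial>H)"
      proof (rule nn_integral_mono)
        fix x
        show "ennreal ((\<psi> (x, t))\<^sup>2) * indicator G x \<le> (\<integral>\<^sup>+s\<in>{0<..<\<rho>}. F (x + s *\<^sub>R e) \<partial>lborel) * indicator G x"
        proof (cases "x \<in> G")
          case True
          define q where "q s = \<psi> ((x, t) + s *\<^sub>R (e, 0))" for s
          define q' where "q' s = partial (e, 0) \<psi> ((x, t) + s *\<^sub>R (e, 0))" for s
          have qd: "(q has_real_derivative q' s) (at s)" for s
            unfolding q_def[abs_def] q'_def by (rule has_real_derivative_partial[OF smooth_differentiable[OF \<psi>]])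
          have q'eq: "q' s = \<sigma> * partial (space_dir i) \<psi> ((x, t) + s *\<^sub>R (e, 0))" for s
            using partial_scale_dir[OF smooth_differentiable[OF \<psi>], of \<sigma> "space_dir i"] by (simp add: q'_def e_def)
          have q'c: "isCont q' s" for s
          proof -
            have "continuous_on UNIV (\<lambda>s. partial (space_dir i) \<psi> ((x, t) + s *\<^sub>R (e, 0)))"
              by (intro continuous_on_compose2[OF smooth_continuous[OF smooth_partial[OF \<psi> space_dir_Basis], of UNIV]] continuous_intros) auto
            then have "continuous_on UNIV q'" unfolding q'eq[abs_def] by (intro continuous_intros)
            then show ?thesis by (simp add: continuous_on_eq_continuous_at)
          qed
          have "ennreal ((\<psi> (x, t))\<^sup>2) = ennreal ((q 0)\<^sup>2)" by (simp add: q_def)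
          also have "\<dots> \<le> (\<integral>\<^sup>+s\<in>{0<..<\<rho>}. ennreal (c * (q s)\<^sup>2 + (q' s)\<^sup>2) \<partial>lborel)"
            by (rule trace_1d[OF \<rho>(1) qd q'c, folded c_def])
          also have "\<dots> \<le> (\<integral>\<^sup>+s\<in>{0<..<\<rho>}. F (x + s *\<^sub>R e) \<partial>lborel)"
          proof (rule nn_integral_mono)
            fix s
            show "ennreal (c * (q s)\<^sup>2 + (q' s)\<^sup>2) * indicator {0<..<\<rho>} s \<le> F (x + s *\<^sub>R e) * indicator {0<..<\<rho>} s"
            proof (cases "s \<in> {0<..<\<rho>}")
              case s: True
              have xD: "x + s *\<^sub>R e \<in> D" unfolding e_def using \<rho>(4)[of x s] True s by (simp add: G_def frontier_def)
              have "(q' s)\<^sup>2 = (partial (space_dir i) \<psi> (x + s *\<^sub>R e, t))\<^sup>2"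
              proof -
                have "\<sigma> = 1 \<or> \<sigma> = -1" using \<rho>(2) by linarith
                then have "\<sigma>\<^sup>2 = 1" by auto
                then show ?thesis unfolding q'eq power_mult_distrib by simp
              qed
              also have "\<dots> \<le> (\<Sum>a\<in>UNIV. (partial (space_dir a) \<psi> (x + s *\<^sub>R e, t))\<^sup>2)" by (rule member_le_sum) auto
              also have "\<dots> \<le> c * (\<Sum>a\<in>UNIV. (partial (space_dir a) \<psi> (x + s *\<^sub>R e, t))\<^sup>2)"
                using mult_right_mono[OF c(2)] by (simp add: sum_nonneg)
              finally have "c * (q s)\<^sup>2 + (q' s)\<^sup>2 \<le> c * ?E \<psi> t (x + s *\<^sub>R e)"
                unfolding distrib_left q_def by simp
              moreover have "indicator D (x + s *\<^sub>R e) = (1::ennreal)" "indicator {0<..<\<rho>} s = (1::ennreal)" using xD s by simp_all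
              ultimately show ?thesis unfolding F_def by (simp only: mult_1_right ennreal_leI)
            qed simp
          qed
          finally show ?thesis using True by simp
        qed simp
      qed
      also have "\<dots> \<le> ennreal K * (\<integral>\<^sup>+y. F y \<partial>lborel)"
        unfolding K_def H_def e_def by (rule graph_pushforward(2)[OF G \<rho>(2,1) Fm])
      also have "(\<integral>\<^sup>+y. F y \<partial>lborel) = (\<integral>\<^sup>+y. ennreal c * (ennreal (?E \<psi> t y) * indicator D y) \<partial>lborel)"
        unfolding F_def by (intro nn_integral_cong) (simp only: ennreal_mult'[OF c(1)] mult.assoc)
      also have "\<dots> = ennreal c * (\<integral>\<^sup>+y\<in>D. ennreal (?E \<psi> t y) \<partial>lborel)"
        by (rule nn_integral_cmult) (rule Im)
      also have "ennreal K * \<dots> = ennreal (K * c) * (\<integral>\<^sup>+y\<in>D. ennreal (?E \<psi> t y) \<partial>lborel)"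
        by (simp only: ennreal_mult[OF K c(1)] mult.assoc)
      finally show ?thesis .
    qed
    moreover have "emeasure H G < \<infinity>" unfolding H_def by (rule graph_pushforward(1)[OF G \<rho>(2,1), of "\<lambda>_. 0"]) simp
    ultimately show ?thesis using \<rho>(1) K c(1) unfolding G_def Q_def by (intro exI[of _ \<rho>] exI[of _ "K * c"]) simp
  qed
  then obtain \<rho> C where Q: "\<And>p. p \<in> frontier D \<Longrightarrow> Q p (\<rho> p) (C p)" by metis
  have \<rho>: "\<And>p. p \<in> frontier D \<Longrightarrow> \<rho> p > 0" and C: "\<And>p. p \<in> frontier D \<Longrightarrow> C p \<ge> 0"
    and fin: "\<And>p. p \<in> frontier D \<Longrightarrow> emeasure H (frontier D \<inter> ball p (\<rho> p)) < \<infinity>"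
    and tr: "\<And>p \<psi> t. p \<in> frontier D \<Longrightarrow> smooth \<psi> \<Longrightarrow>
     (\<integral>\<^sup>+x\<in>frontier D \<inter> ball p (\<rho> p). ennreal ((\<psi> (x, t))\<^sup>2) \<partial>H) \<le> ennreal (C p) * (\<integral>\<^sup>+y\<in>D. ennreal (?E \<psi> t y) \<partial>lborel)"
    using Q unfolding Q_def by blast+
  have cp: "compact (frontier D)" using D(2) by (rule compact_frontier_bounded)
  have op: "open (ball p (\<rho> p))" for p by simp
  have cov: "frontier D \<subseteq> (\<Union>p\<in>frontier D. ball p (\<rho> p))" using \<rho> by auto
  obtain P where P: "P \<subseteq> frontier D" "finite P" "frontier D \<subseteq> (\<Union>p\<in>P. ball p (\<rho> p))"
    using compactE_image[of "frontier D" "frontier D" "\<lambda>p. ball p (\<rho> p)"] cp op cov by metis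
  have fm: "frontier D \<in> sets borel" by simp
  have "emeasure H (frontier D) \<le> emeasure H (\<Union>p\<in>P. frontier D \<inter> ball p (\<rho> p))"
    using P fm Hs by (intro emeasure_mono) (auto intro!: sets.finite_UN)
  also have "\<dots> \<le> (\<Sum>p\<in>P. emeasure H (frontier D \<inter> ball p (\<rho> p)))"
    by (rule emeasure_subadditive_finite[OF P(2)]) (auto simp: Hs)
  also have "\<dots> < \<infinity>" unfolding infinity_ennreal_def ennreal_sum_less_top[OF P(2)] using P(1) fin by auto
  finally have 1: "emeasure H (frontier D) < \<infinity>" .
  have 2: "(\<integral>\<^sup>+x\<in>frontier D. ennreal ((\<psi> (x, t))\<^sup>2) \<partial>H) \<le> ennreal (\<Sum>p\<in>P. C p) * (\<integral>\<^sup>+y\<in>D. ennreal (?E \<psi> t y) \<partial>lborel)"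
    if \<psi>: "smooth \<psi>" for \<psi> t
  proof -
    have pm: "(\<lambda>x. \<psi> (x, t)) \<in> borel_measurable borel"
      by (intro borel_measurable_continuous_onI continuous_on_compose2[OF smooth_continuous[OF \<psi>, of UNIV]] continuous_intros) auto
    have gm: "(\<lambda>x. ennreal ((\<psi> (x, t))\<^sup>2) * indicator (frontier D \<inter> ball p (\<rho> p)) x) \<in> borel_measurable H" for p
    proof -
      have "frontier D \<inter> ball p (\<rho> p) \<in> sets borel" by simp
      then have "(\<lambda>x. ennreal ((\<psi> (x, t))\<^sup>2) * indicator (frontier D \<inter> ball p (\<rho> p)) x) \<in> borel_measurable borel" using pm by measurable
      then show ?thesis by (simp add: measurable_cong_sets[OF Hs refl])
    qed
    have "(\<integral>\<^sup>+x\<in>frontier D. ennreal ((\<psi> (x, t))\<^sup>2) \<partial>H) \<le> (\<integral>\<^sup>+x. (\<Sum>p\<in>P. ennreal ((\<psi> (x, t))\<^sup>2) * indicator (frontier D \<inter> ball p (\<rho> p)) x) \<partial>H)"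
    proof (rule nn_integral_mono)
      fix x
      show "ennreal ((\<psi> (x, t))\<^sup>2) * indicator (frontier D) x \<le> (\<Sum>p\<in>P. ennreal ((\<psi> (x, t))\<^sup>2) * indicator (frontier D \<inter> ball p (\<rho> p)) x)"
      proof (cases "x \<in> frontier D")
        case True
        then obtain p where p: "p \<in> P" "x \<in> ball p (\<rho> p)" using P(3) by blast
        have "ennreal ((\<psi> (x, t))\<^sup>2) * indicator (frontier D) x = ennreal ((\<psi> (x, t))\<^sup>2) * indicator (frontier D \<inter> ball p (\<rho> p)) x"
          using True p by simp
        also have "\<dots> \<le> (\<Sum>p\<in>P. ennreal ((\<psi> (x, t))\<^sup>2) * indicator (frontier D \<inter> ball p (\<rho> p)) x)"
          using p(1) P(2) by (intro member_le_sum) auto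
        finally show ?thesis .
      qed simp
    qed
    also have "\<dots> = (\<Sum>p\<in>P. (\<integral>\<^sup>+x\<in>frontier D \<inter> ball p (\<rho> p). ennreal ((\<psi> (x, t))\<^sup>2) \<partial>H))"
      by (rule nn_integral_sum) (rule gm)
    also have "\<dots> \<le> (\<Sum>p\<in>P. ennreal (C p) * (\<integral>\<^sup>+y\<in>D. ennreal (?E \<psi> t y) \<partial>lborel))"
      using tr[OF _ \<psi>] P(1) by (intro sum_mono) blast
    also have "\<dots> = (\<Sum>p\<in>P. ennreal (C p)) * (\<integral>\<^sup>+y\<in>D. ennreal (?E \<psi> t y) \<partial>lborel)" by (simp add: sum_distrib_right)
    also have "(\<Sum>p\<in>P. ennreal (C p)) = ennreal (\<Sum>p\<in>P. C p)" using C P(1) by (intro sum_ennreal) blast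
    finally show ?thesis .
  qed
  have "(\<Sum>p\<in>P. C p) \<ge> 0" using C P(1) by (intro sum_nonneg) blast
  with 1 2 show ?thesis by blast
qed

section \<open>Residuals\<close>

lemma square_add_le: "((a::real) + b)\<^sup>2 \<le> 2 * a\<^sup>2 + 2 * b\<^sup>2"
  using zero_le_power2[of "a - b"] by (simp add: power2_eq_square algebra_simps)

lemma nn_integral_square_add:
  assumes [measurable]: "f \<in> borel_measurable M" "g \<in> borel_measurable M"
  shows "(\<integral>\<^sup>+x. ennreal ((f x + g x)\<^sup>2) \<partial>M) \<le> 2 * (\<integral>\<^sup>+x. ennreal ((f x)\<^sup>2) \<partial>M) + 2 * (\<integral>\<^sup>+x. ennreal ((g x)\<^sup>2) \<partial>M)"
proof -
  have m: "(\<lambda>x. ennreal ((f x)\<^sup>2)) \<in> borel_measurable M" "(\<lambda>x. ennreal ((g x)\<^sup>2)) \<in> borel_measurable M" by measurable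
  have "(\<integral>\<^sup>+x. ennreal ((f x + g x)\<^sup>2) \<partial>M) \<le> (\<integral>\<^sup>+x. 2 * ennreal ((f x)\<^sup>2) + 2 * ennreal ((g x)\<^sup>2) \<partial>M)"
  proof (rule nn_integral_mono)
    fix x
    have "ennreal ((f x + g x)\<^sup>2) \<le> ennreal (2 * (f x)\<^sup>2 + 2 * (g x)\<^sup>2)" by (rule ennreal_leI[OF square_add_le])
    also have "\<dots> = 2 * ennreal ((f x)\<^sup>2) + 2 * ennreal ((g x)\<^sup>2)"
      by (simp add: ennreal_mult')
    finally show "ennreal ((f x + g x)\<^sup>2) \<le> 2 * ennreal ((f x)\<^sup>2) + 2 * ennreal ((g x)\<^sup>2)" .
  qed
  also have "\<dots> = 2 * (\<integral>\<^sup>+x. ennreal ((f x)\<^sup>2) \<partial>M) + 2 * (\<integral>\<^sup>+x. ennreal ((g x)\<^sup>2) \<partial>M)"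
    by (subst nn_integral_add[OF borel_measurable_times_ennreal[OF _ m(1)] borel_measurable_times_ennreal[OF _ m(2)]])
      (simp_all only: nn_integral_cmult[OF m(1)] nn_integral_cmult[OF m(2)] borel_measurable_const)
  finally show ?thesis .
qed

lemma L2_of_nn_integral:
  assumes "g \<in> borel_measurable M" "(\<integral>\<^sup>+x. ennreal ((g x)\<^sup>2) \<partial>M) \<le> ennreal (\<delta>\<^sup>2)" "\<delta> \<ge> 0"
  shows "g \<in> L2 M" "L2_norm M g \<le> \<delta>"
proof -
  have i: "integrable M (\<lambda>x. (g x)\<^sup>2)"
  proof (rule integrableI_bounded)
    show "(\<lambda>x. (g x)\<^sup>2) \<in> borel_measurable M" using assms(1) by measurable
    have "(\<integral>\<^sup>+x. ennreal (norm ((g x)\<^sup>2)) \<partial>M) \<le> ennreal (\<delta>\<^sup>2)" using assms(2) by simp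
    also have "\<dots> < \<infinity>" by simp
    finally show "(\<integral>\<^sup>+x. ennreal (norm ((g x)\<^sup>2)) \<partial>M) < \<infinity>" .
  qed
  then show "g \<in> L2 M" using assms(1) by (simp add: L2_def)
  have "ennreal (\<integral>x. (g x)\<^sup>2 \<partial>M) \<le> ennreal (\<delta>\<^sup>2)"
    using assms(2) nn_integral_eq_integral[OF i] by simp
  then have "(\<integral>x. (g x)\<^sup>2 \<partial>M) \<le> \<delta>\<^sup>2" by (subst (asm) ennreal_le_iff) auto
  then have "L2_norm M g \<le> sqrt (\<delta>\<^sup>2)" unfolding L2_norm_def by (rule real_sqrt_le_mono)
  then show "L2_norm M g \<le> \<delta>" using assms(3) by simp
qed

lemma tendsto_L2_nn_integral:
  assumes "tendsto_L2 M F g" "\<epsilon> > 0"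
  shows "\<forall>\<^sub>F n in sequentially. (\<integral>\<^sup>+x. ennreal ((F n x - g x)\<^sup>2) \<partial>M) \<le> ennreal \<epsilon>"
proof -
  have L: "\<And>n. (\<lambda>x. F n x - g x) \<in> L2 M" and t: "(\<lambda>n. L2_norm M (\<lambda>x. F n x - g x)) \<longlonglongrightarrow> 0"
    using assms(1) by (auto simp: tendsto_L2_def)
  have "\<forall>\<^sub>F n in sequentially. L2_norm M (\<lambda>x. F n x - g x) < sqrt \<epsilon>"
    by (rule order_tendstoD(2)[OF t]) (use assms(2) in simp)
  then show ?thesis
  proof eventually_elim
    case (elim n)
    have i: "integrable M (\<lambda>x. (F n x - g x)\<^sup>2)" using L[of n] by (simp add: L2_def)
    have "(\<integral>\<^sup>+x. ennreal ((F n x - g x)\<^sup>2) \<partial>M) = ennreal (\<integral>x. (F n x - g x)\<^sup>2 \<partial>M)"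
      by (rule nn_integral_eq_integral[OF i]) simp
    also have "(\<integral>x. (F n x - g x)\<^sup>2 \<partial>M) \<le> \<epsilon>" using elim unfolding L2_norm_def by simp
    finally show ?case by (simp add: ennreal_leI)
  qed
qed

lemma nn_integral_lebesgue_on_AE:
  fixes f g :: "'a::euclidean_space \<Rightarrow> real"
  assumes S: "S \<in> sets borel" and ae: "AE x in lborel. x \<in> S \<longrightarrow> f x = g x"
  shows "(\<integral>\<^sup>+x. ennreal ((f x)\<^sup>2) \<partial>lebesgue_on S) = sq_int S g"
proof -
  have "(\<integral>\<^sup>+x. ennreal ((f x)\<^sup>2) \<partial>lebesgue_on S) = (\<integral>\<^sup>+x. ennreal ((f x)\<^sup>2) * indicator S x \<partial>lebesgue)"
    using S by (intro nn_integral_restrict_space) simp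
  also have "\<dots> = (\<integral>\<^sup>+x. ennreal ((f x)\<^sup>2) * indicator S x \<partial>lborel)" by (rule nn_integral_completion)
  also have "\<dots> = sq_int S g" unfolding sq_int_def
  proof (rule nn_integral_cong_AE)
    show "AE x in lborel. ennreal ((f x)\<^sup>2) * indicator S x = ennreal ((g x)\<^sup>2) * indicator S x"
      using ae by eventually_elim (auto simp: indicator_def)
  qed
  finally show ?thesis .
qed

lemma borel_measurable_lebesgue_on_AE:
  fixes f g :: "'a::euclidean_space \<Rightarrow> real"
  assumes S: "S \<in> sets borel" and g: "g \<in> borel_measurable borel" and ae: "AE x in lborel. x \<in> S \<longrightarrow> f x = g x"
  shows "f \<in> borel_measurable (lebesgue_on S)"
proof (rule integral_lebesgue_on_borel(3)[OF S, of "\<lambda>x. if x \<in> S then g x else 0"])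
  show "(\<lambda>x. if x \<in> S then g x else 0) \<in> borel_measurable borel" using S g by (intro measurable_If_set) auto
  show "AE x in lborel. x \<in> S \<longrightarrow> f x = (if x \<in> S then g x else 0)" using ae by eventually_elim simp
qed simp

text \<open>Splitting off one summand turns a constant \<open>K\<close> into
  \<open>2 + 2 * K\<close>, which is at most \<open>4 * K\<close> once \<open>K \<ge> 1\<close>;
  hence the powers of 4.\<close>

lemma sq_int_sum:
  assumes "finite I" "\<And>i. i \<in> I \<Longrightarrow> f i \<in> borel_measurable borel" "\<And>i. i \<in> I \<Longrightarrow> sq_int \<Omega> (f i) \<le> ennreal \<epsilon>"
    and \<Omega>: "\<Omega> \<in> sets borel" and "\<epsilon> \<ge> 0"
  shows "sq_int \<Omega> (\<lambda>x. \<Sum>i\<in>I. f i x) \<le> ennreal (4 ^ card I * \<epsilon>)"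
  using assms(1-3)
proof (induction I rule: finite_induct)
  case empty then show ?case by (simp add: sq_int_def)
next
  case (insert i I)
  have "sq_int \<Omega> (\<lambda>x. \<Sum>i\<in>insert i I. f i x) = sq_int \<Omega> (\<lambda>x. f i x + (\<Sum>i\<in>I. f i x))" using insert by simp
  also have "\<dots> \<le> 2 * sq_int \<Omega> (f i) + 2 * sq_int \<Omega> (\<lambda>x. \<Sum>i\<in>I. f i x)"
    using insert.prems by (intro sq_int_add \<Omega> borel_measurable_sum) auto
  also have "\<dots> \<le> 2 * ennreal \<epsilon> + 2 * ennreal (4 ^ card I * \<epsilon>)"
    using insert.prems insert.IH by (intro add_mono mult_left_mono) auto
  also have "\<dots> = ennreal (2 * \<epsilon> + 2 * (4 ^ card I * \<epsilon>))" using \<open>\<epsilon> \<ge> 0\<close> by (simp add: ennreal_mult')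
  also have "\<dots> \<le> ennreal (4 ^ card (insert i I) * \<epsilon>)"
  proof (rule ennreal_leI)
    have "1 * \<epsilon> \<le> 4 ^ card I * \<epsilon>" using \<open>\<epsilon> \<ge> 0\<close> by (intro mult_right_mono) auto
    then show "2 * \<epsilon> + 2 * (4 ^ card I * \<epsilon>) \<le> 4 ^ card (insert i I) * \<epsilon>"
      unfolding card_insert_disjoint[OF insert.hyps(1,2)] power_Suc by linarith
  qed
  finally show ?case .
qed

lemma sq_int_uminus: "sq_int \<Omega> (\<lambda>x. - f x) = sq_int \<Omega> f"
  by (simp add: sq_int_def)

lemma sq_int_diff_commute: "sq_int \<Omega> (\<lambda>x. f x - g x) = sq_int \<Omega> (\<lambda>x. g x - f x)"
  by (simp add: sq_int_def power2_commute)

lemma sq_int_triangle: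
  assumes "f \<in> borel_measurable borel" "g \<in> borel_measurable borel" "h \<in> borel_measurable borel" "\<Omega> \<in> sets borel"
    and "sq_int \<Omega> (\<lambda>x. f x - g x) \<le> ennreal \<epsilon>" "sq_int \<Omega> (\<lambda>x. g x - h x) \<le> ennreal \<epsilon>" "\<epsilon> \<ge> 0"
  shows "sq_int \<Omega> (\<lambda>x. f x - h x) \<le> ennreal (4 * \<epsilon>)"
proof -
  have "sq_int \<Omega> (\<lambda>x. f x - h x) = sq_int \<Omega> (\<lambda>x. (f x - g x) + (g x - h x))" by simp
  also have "\<dots> \<le> 2 * sq_int \<Omega> (\<lambda>x. f x - g x) + 2 * sq_int \<Omega> (\<lambda>x. g x - h x)"
    by (intro sq_int_add borel_measurable_diff assms)
  also have "\<dots> \<le> 2 * ennreal \<epsilon> + 2 * ennreal \<epsilon>" using assms by (intro add_mono mult_left_mono) auto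
  also have "2 * ennreal \<epsilon> = ennreal (2 * \<epsilon>)" using \<open>\<epsilon> \<ge> 0\<close> by (simp add: ennreal_mult')
  also have "ennreal (2 * \<epsilon>) + ennreal (2 * \<epsilon>) = ennreal (4 * \<epsilon>)"
    using \<open>\<epsilon> \<ge> 0\<close> by (subst ennreal_plus[symmetric]) auto
  finally show ?thesis .
qed

text \<open>Passage from \<open>sobolev_H\<close> to Borel data extended by 0. The last two
  conclusions, from uniqueness, will identify the derivatives in the heat equation and in the
  definition of the traces with the data chosen here.\<close>

lemma sobolev_H2_data:
  fixes u :: "'a::euclidean_space \<Rightarrow> real"
  assumes \<Omega>: "open \<Omega>" and u: "u \<in> sobolev_H k \<Omega>" "k \<ge> 2"
  obtains u' v w where "H2_data \<Omega> u' v w" "AE x in lborel. x \<in> \<Omega> \<longrightarrow> u x = u' x"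
    "\<And>b v0. b \<in> Basis \<Longrightarrow> weak_deriv \<Omega> [b] u v0 \<Longrightarrow> AE x in lborel. x \<in> \<Omega> \<longrightarrow> v0 x = v b x"
    "\<And>b w0. b \<in> Basis \<Longrightarrow> weak_deriv \<Omega> [b, b] u w0 \<Longrightarrow> AE x in lborel. x \<in> \<Omega> \<longrightarrow> w0 x = w b x"
proof -
  have \<Omega>m: "\<Omega> \<in> sets borel" using \<Omega> by simp
  have rep: "\<exists>g'. sq_integrable g' \<and> (\<forall>x. x \<notin> \<Omega> \<longrightarrow> g' x = 0) \<and> (AE x in lborel. x \<in> \<Omega> \<longrightarrow> g x = g' x)"
    if g: "g \<in> L2 (lebesgue_on \<Omega>)" for g
  proof -
    have gm: "g \<in> borel_measurable (lebesgue_on \<Omega>)" and gi: "integrable (lebesgue_on \<Omega>) (\<lambda>x. (g x)\<^sup>2)" using g by (auto simp: L2_def)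
    obtain g' where g': "g' \<in> borel_measurable borel" "\<And>x. x \<notin> \<Omega> \<Longrightarrow> g' x = 0" "AE x in lborel. x \<in> \<Omega> \<longrightarrow> g x = g' x"
      using borel_representative[OF gm \<Omega>m] by metis
    have "integrable (lebesgue_on \<Omega>) (\<lambda>x. (g x)\<^sup>2) \<longleftrightarrow> integrable lborel (\<lambda>x. (g' x)\<^sup>2)"
    proof (rule integral_lebesgue_on_borel(2)[OF \<Omega>m])
      show "(\<lambda>x. (g' x)\<^sup>2) \<in> borel_measurable borel" using g'(1) by measurable
      show "AE x in lborel. x \<in> \<Omega> \<longrightarrow> (g x)\<^sup>2 = (g' x)\<^sup>2" using g'(3) by eventually_elim simp
    qed (simp add: g'(2))
    then show ?thesis using gi g' unfolding sq_integrable_def by blast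
  qed
  have uL: "u \<in> L2 (lebesgue_on \<Omega>)" using u(1) by (simp add: sobolev_H_def)
  obtain u' where u': "sq_integrable u'" "\<forall>x. x \<notin> \<Omega> \<longrightarrow> u' x = 0" "AE x in lborel. x \<in> \<Omega> \<longrightarrow> u x = u' x"
    using rep[OF uL] by blast
  have ex: "\<exists>g'. sq_integrable g' \<and> (\<forall>x. x \<notin> \<Omega> \<longrightarrow> g' x = 0) \<and> (\<exists>g. weak_deriv \<Omega> bs u g \<and> (AE x in lborel. x \<in> \<Omega> \<longrightarrow> g x = g' x))"
    if bs: "set bs \<subseteq> Basis" "length bs \<le> 2" for bs
  proof -
    have "length bs \<le> k" using bs(2) u(2) by simp
    then obtain g where "g \<in> L2 (lebesgue_on \<Omega>)" "weak_deriv \<Omega> bs u g" using u(1) bs(1) unfolding sobolev_H_def by blast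
    then show ?thesis using rep[of g] by blast
  qed
  have "\<forall>b\<in>Basis. \<exists>g'. sq_integrable g' \<and> (\<forall>x. x \<notin> \<Omega> \<longrightarrow> g' x = 0) \<and> (\<exists>g. weak_deriv \<Omega> [b] u g \<and> (AE x in lborel. x \<in> \<Omega> \<longrightarrow> g x = g' x))"
    using ex[of "[b]" for b] by simp
  from bchoice[OF this] obtain v where v: "\<forall>b\<in>Basis. sq_integrable (v b) \<and> (\<forall>x. x \<notin> \<Omega> \<longrightarrow> v b x = 0) \<and> (\<exists>g. weak_deriv \<Omega> [b] u g \<and> (AE x in lborel. x \<in> \<Omega> \<longrightarrow> g x = v b x))" ..
  have "\<forall>b\<in>Basis. \<exists>g'. sq_integrable g' \<and> (\<forall>x. x \<notin> \<Omega> \<longrightarrow> g' x = 0) \<and> (\<exists>g. weak_deriv \<Omega> [b, b] u g \<and> (AE x in lborel. x \<in> \<Omega> \<longrightarrow> g x = g' x))"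
    using ex[of "[b, b]" for b] by simp
  from bchoice[OF this] obtain w where w: "\<forall>b\<in>Basis. sq_integrable (w b) \<and> (\<forall>x. x \<notin> \<Omega> \<longrightarrow> w b x = 0) \<and> (\<exists>g. weak_deriv \<Omega> [b, b] u g \<and> (AE x in lborel. x \<in> \<Omega> \<longrightarrow> g x = w b x))" ..
  have tr: "(\<integral>x. g x * \<psi> x \<partial>lebesgue_on \<Omega>) = (\<integral>x. g' x * \<psi> x \<partial>lborel)"
    if "sq_integrable g'" "\<forall>x. x \<notin> \<Omega> \<longrightarrow> g' x = 0" "AE x in lborel. x \<in> \<Omega> \<longrightarrow> g x = g' x" "smooth \<psi>" for g g' \<psi>
  proof (rule integral_lebesgue_on_borel(1)[OF \<Omega>m])
    have "g' \<in> borel_measurable borel" using that(1) by (simp add: sq_integrable_def)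
    then show "(\<lambda>x. g' x * \<psi> x) \<in> borel_measurable borel"
      by (rule borel_measurable_times[OF _ smooth_measurable[OF that(4)]])
    show "AE x in lborel. x \<in> \<Omega> \<longrightarrow> g x * \<psi> x = g' x * \<psi> x" using that(3) by eventually_elim simp
  qed (use that(2) in simp)
  have H: "H2_data \<Omega> u' v w" unfolding H2_data_def
  proof (intro conjI ballI allI impI)
    show "sq_integrable u'" by fact
    show "u' x = 0" if "x \<notin> \<Omega>" for x using u'(2) that by blast
    fix b :: 'a assume b: "b \<in> Basis"
    show "sq_integrable (v b)" "sq_integrable (w b)" using v w b by blast+
    show "v b x = 0" if "x \<notin> \<Omega>" for x using v b that by blast
    show "w b x = 0" if "x \<notin> \<Omega>" for x using w b that by blast
    fix \<phi> assume \<phi>: "test_fun \<Omega> \<phi>"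
    then have s: "smooth \<phi>" by (simp add: test_fun_def)
    obtain v0 where v0: "weak_deriv \<Omega> [b] u v0" "AE x in lborel. x \<in> \<Omega> \<longrightarrow> v0 x = v b x" using v b by blast
    obtain w0 where w0: "weak_deriv \<Omega> [b, b] u w0" "AE x in lborel. x \<in> \<Omega> \<longrightarrow> w0 x = w b x" using w b by blast
    have vb: "sq_integrable (v b)" "\<forall>x. x \<notin> \<Omega> \<longrightarrow> v b x = 0" and wb: "sq_integrable (w b)" "\<forall>x. x \<notin> \<Omega> \<longrightarrow> w b x = 0"
      using v w b by blast+
    note s1 = smooth_partial[OF s b]
    note s2 = smooth_partial[OF s1 b]
    have "(\<integral>x. u x * foldr partial [b] \<phi> x \<partial>lebesgue_on \<Omega>) = (-1) ^ length [b] * (\<integral>x. v0 x * \<phi> x \<partial>lebesgue_on \<Omega>)"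
      using v0(1) \<phi> unfolding weak_deriv_def by blast
    then show "(\<integral>x. u' x * partial b \<phi> x \<partial>lborel) = - (\<integral>x. v b x * \<phi> x \<partial>lborel)"
      using tr[OF u' s1] tr[OF vb v0(2) s] by simp
    have "(\<integral>x. u x * foldr partial [b, b] \<phi> x \<partial>lebesgue_on \<Omega>) = (-1) ^ length [b, b] * (\<integral>x. w0 x * \<phi> x \<partial>lebesgue_on \<Omega>)"
      using w0(1) \<phi> unfolding weak_deriv_def by blast
    then show "(\<integral>x. u' x * partial b (partial b \<phi>) x \<partial>lborel) = (\<integral>x. w b x * \<phi> x \<partial>lborel)"
      using tr[OF u' s2] tr[OF wb w0(2) s] by simp
  qed
  show ?thesis
  proof (rule that[OF H u'(3)])
    fix b :: 'a and v0 assume b: "b \<in> Basis" and v0: "weak_deriv \<Omega> [b] u v0"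
    obtain v1 where v1: "weak_deriv \<Omega> [b] u v1" "AE x in lborel. x \<in> \<Omega> \<longrightarrow> v1 x = v b x" using v b by blast
    show "AE x in lborel. x \<in> \<Omega> \<longrightarrow> v0 x = v b x"
      using weak_deriv_unique[OF \<Omega> v0 v1(1)] v1(2) by eventually_elim simp
  next
    fix b :: 'a and w0 assume b: "b \<in> Basis" and w0: "weak_deriv \<Omega> [b, b] u w0"
    obtain w1 where w1: "weak_deriv \<Omega> [b, b] u w1" "AE x in lborel. x \<in> \<Omega> \<longrightarrow> w1 x = w b x" using w b by blast
    show "AE x in lborel. x \<in> \<Omega> \<longrightarrow> w0 x = w b x"
      using weak_deriv_unique[OF \<Omega> w0 w1(1)] w1(2) by eventually_elim simp
  qed
qed

text \<open>A uniform error \<open>e\<close> for values and derivatives on a ball containing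
  \<open>\<Omega>\<close> costs at most \<open>e\<^sup>2\<close> times the volume of
  \<open>\<Omega>\<close> in each squared norm.\<close>

lemma H2_tanh_approximable:
  fixes u :: "'a::euclidean_space \<Rightarrow> real"
  assumes H: "H2_data \<Omega> u v w" and A: "H2_approximable \<Omega> u v w" and \<Omega>: "open \<Omega>" "bounded \<Omega>" and "\<epsilon> > 0"
  obtains f where "tanh_sum f" "sq_int \<Omega> (\<lambda>x. f x - u x) \<le> ennreal \<epsilon>"
    "\<And>b. b \<in> Basis \<Longrightarrow> sq_int \<Omega> (\<lambda>x. partial b f x - v b x) \<le> ennreal \<epsilon>"
    "\<And>b. b \<in> Basis \<Longrightarrow> sq_int \<Omega> (\<lambda>x. partial b (partial b f) x - w b x) \<le> ennreal \<epsilon>"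
proof -
  have \<Omega>m: "\<Omega> \<in> sets borel" using \<Omega> by simp
  have e4: "\<epsilon>/4 > 0" using \<open>\<epsilon> > 0\<close> by simp
  obtain \<phi> r where \<phi>: "smooth \<phi>" "\<forall>x. norm x \<ge> r \<longrightarrow> \<phi> x = 0" "sq_int \<Omega> (\<lambda>x. \<phi> x - u x) \<le> ennreal (\<epsilon>/4)"
    "\<forall>b\<in>Basis. sq_int \<Omega> (\<lambda>x. partial b \<phi> x - v b x) \<le> ennreal (\<epsilon>/4) \<and> sq_int \<Omega> (\<lambda>x. partial b (partial b \<phi>) x - w b x) \<le> ennreal (\<epsilon>/4)"
    using A[unfolded H2_approximable_def, rule_format, OF e4] by blast
  obtain R where R: "\<forall>x\<in>\<Omega>. norm x \<le> R" using \<Omega>(2) unfolding bounded_iff by blast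
  define V where "V = measure lborel \<Omega>"
  have Vfin: "emeasure lborel \<Omega> = ennreal V"
    unfolding V_def using emeasure_bounded_finite[OF \<Omega>(2)] by (intro emeasure_eq_ennreal_measure) auto
  have V0: "V \<ge> 0" by (simp add: V_def)
  \<comment> \<open>The 4 compensates the factor in the triangle inequality for squared norms;
    \<open>V + 1\<close> guards against volume 0.\<close>
  define e where "e = sqrt (\<epsilon> / (4 * (V + 1)))"
  have e: "e > 0" "e\<^sup>2 * V \<le> \<epsilon>/4"
  proof -
    have p: "\<epsilon> / (4 * (V + 1)) > 0" using \<open>\<epsilon> > 0\<close> V0 by simp
    then show "e > 0" by (simp add: e_def)
    have "e\<^sup>2 * V = \<epsilon> / 4 * (V / (V + 1))" using p by (simp add: e_def)
    also have "\<dots> \<le> \<epsilon> / 4 * 1" using \<open>\<epsilon> > 0\<close> V0 by (intro mult_left_mono) auto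
    finally show "e\<^sup>2 * V \<le> \<epsilon>/4" by simp
  qed
  obtain f where f: "tanh_sum f" "C2_close e R \<phi> f" using tanh_sum_approx[OF \<phi>(1,2) e(1)] by blast
  have sf: "smooth f" by (rule tanh_sum_smooth[OF f(1)])
  have small: "sq_int \<Omega> (\<lambda>x. p x - q x) \<le> ennreal (\<epsilon>/4)" if "\<And>x. x \<in> \<Omega> \<Longrightarrow> \<bar>q x - p x\<bar> \<le> e" for p q
  proof -
    have "sq_int \<Omega> (\<lambda>x. p x - q x) \<le> (\<integral>\<^sup>+x. ennreal (e\<^sup>2) * indicator \<Omega> x \<partial>lborel)"
      unfolding sq_int_def
    proof (rule nn_integral_mono)
      fix x
      show "ennreal ((p x - q x)\<^sup>2) * indicator \<Omega> x \<le> ennreal (e\<^sup>2) * indicator \<Omega> x"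
      proof (cases "x \<in> \<Omega>")
        case True
        have "\<bar>p x - q x\<bar>\<^sup>2 \<le> e\<^sup>2" using that[OF True] by (intro power_mono) (auto simp: abs_minus_commute)
        then show ?thesis using True by (simp add: ennreal_leI)
      qed simp
    qed
    also have "\<dots> = ennreal (e\<^sup>2) * emeasure lborel \<Omega>" by (rule nn_integral_cmult_indicator) (use \<Omega>m in simp)
    also have "\<dots> = ennreal (e\<^sup>2 * V)" unfolding Vfin by (rule ennreal_mult[symmetric]) (use V0 in auto)
    also have "\<dots> \<le> ennreal (\<epsilon>/4)" using e(2) by (rule ennreal_leI)
    finally show ?thesis .
  qed
  have tri: "sq_int \<Omega> (\<lambda>x. p x - h x) \<le> ennreal \<epsilon>"
    if "\<And>x. x \<in> \<Omega> \<Longrightarrow> \<bar>q x - p x\<bar> \<le> e" "sq_int \<Omega> (\<lambda>x. q x - h x) \<le> ennreal (\<epsilon>/4)" "smooth p" "smooth q" "sq_integrable h" for p q h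
  proof -
    have "sq_int \<Omega> (\<lambda>x. p x - h x) \<le> ennreal (4 * (\<epsilon>/4))"
      by (rule sq_int_triangle[OF smooth_measurable[OF that(3)] smooth_measurable[OF that(4)] _ \<Omega>m small[OF that(1)] that(2)])
        (use that(5) e4 in \<open>auto simp: sq_integrable_def\<close>)
    then show ?thesis by simp
  qed
  have u: "sq_integrable u" and vw: "b \<in> Basis \<Longrightarrow> sq_integrable (v b)" "b \<in> Basis \<Longrightarrow> sq_integrable (w b)" for b
    using H unfolding H2_data_def by blast+
  show ?thesis
  proof (rule that[OF f(1)])
    have cl: "\<bar>\<phi> x - f x\<bar> \<le> e" "b \<in> Basis \<Longrightarrow> \<bar>partial b \<phi> x - partial b f x\<bar> \<le> e"
      "b \<in> Basis \<Longrightarrow> \<bar>partial b (partial b \<phi>) x - partial b (partial b f) x\<bar> \<le> e" if "x \<in> \<Omega>" for x b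
      using f(2) R that unfolding C2_close_def by blast+
    show "sq_int \<Omega> (\<lambda>x. f x - u x) \<le> ennreal \<epsilon>" by (rule tri[OF cl(1) \<phi>(3) sf \<phi>(1) u])
    fix b :: 'a assume b: "b \<in> Basis"
    have p: "sq_int \<Omega> (\<lambda>x. partial b \<phi> x - v b x) \<le> ennreal (\<epsilon>/4)" "sq_int \<Omega> (\<lambda>x. partial b (partial b \<phi>) x - w b x) \<le> ennreal (\<epsilon>/4)"
      using \<phi>(4) b by blast+
    note s1 = smooth_partial[OF sf b] smooth_partial[OF \<phi>(1) b]
    show "sq_int \<Omega> (\<lambda>x. partial b f x - v b x) \<le> ennreal \<epsilon>" by (rule tri[OF cl(2)[OF _ b] p(1) s1 vw(1)[OF b]])
    show "sq_int \<Omega> (\<lambda>x. partial b (partial b f) x - w b x) \<le> ennreal \<epsilon>"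
      by (rule tri[OF cl(3)[OF _ b] p(2) smooth_partial[OF s1(1) b] smooth_partial[OF s1(2) b] vw(2)[OF b]])
  qed
qed

section \<open>The lateral boundary and the trace inequalities on the cylinder\<close>

text \<open>The product before completion, on which Fubini applies and the inclusion of a shorter
  time span is measurable. Completeness is added at the end through almost-everywhere
  statements.\<close>

definition lateral_base :: "(real^'d) set \<Rightarrow> real \<Rightarrow> ((real^'d) \<times> real) measure" where
  "lateral_base D \<tau> = restrict_space (hausdorff_measure (CARD('d) - 1)) (frontier D) \<Otimes>\<^sub>M restrict_space lborel {0..\<tau>}"

lemma lateral_measure_eq: "lateral_measure D \<tau> = completion (lateral_base D \<tau>)"
  by (simp add: lateral_measure_def lateral_base_def)

lemma measurable_restrict_id:
  assumes "sets M = sets borel"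
  shows "(\<lambda>x. x) \<in> restrict_space M S \<rightarrow>\<^sub>M borel"
proof (rule measurable_restrict_space1)
  show "(\<lambda>x. x) \<in> M \<rightarrow>\<^sub>M borel" using measurable_ident_sets[OF assms] by (simp add: id_def)
qed

lemma lateral_base_id: "(\<lambda>z. z) \<in> lateral_base (D :: (real^'d) set) \<tau> \<rightarrow>\<^sub>M borel"
proof -
  have 1: "(\<lambda>z. fst z) \<in> lateral_base D \<tau> \<rightarrow>\<^sub>M borel" unfolding lateral_base_def
    by (rule measurable_compose[OF measurable_fst measurable_restrict_id]) simp
  have 2: "(\<lambda>z. snd z) \<in> lateral_base D \<tau> \<rightarrow>\<^sub>M borel" unfolding lateral_base_def
    by (rule measurable_compose[OF measurable_snd measurable_restrict_id]) simp
  have "(\<lambda>z. (fst z, snd z)) \<in> lateral_base D \<tau> \<rightarrow>\<^sub>M borel \<Otimes>\<^sub>M borel" by (rule measurable_Pair[OF 1 2])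
  then show ?thesis by (simp add: borel_prod)
qed

lemma lateral_base_measurable:
  "f \<in> borel_measurable borel \<Longrightarrow> f \<in> borel_measurable (lateral_base (D :: (real^'d) set) \<tau>)"
  by (rule measurable_compose[OF lateral_base_id])

lemma lateral_base_mono:
  assumes "\<tau> \<le> T"
  shows "(\<lambda>z. z) \<in> lateral_base (D :: (real^'d) set) \<tau> \<rightarrow>\<^sub>M lateral_base D T"
proof -
  have 1: "(\<lambda>z. fst z) \<in> lateral_base D \<tau> \<rightarrow>\<^sub>M restrict_space (hausdorff_measure (CARD('d) - 1)) (frontier D)"
    unfolding lateral_base_def by (rule measurable_fst)
  have i: "(\<lambda>x. x) \<in> restrict_space lborel {0..\<tau>} \<rightarrow>\<^sub>M restrict_space lborel {0..T}"
    by (rule measurable_restrict_space2) (use assms in \<open>auto simp: space_restrict_space intro: measurable_restrict_space1\<close>)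
  have 2: "(\<lambda>z. snd z) \<in> lateral_base D \<tau> \<rightarrow>\<^sub>M restrict_space lborel {0..T}"
    unfolding lateral_base_def by (rule measurable_compose[OF measurable_snd i])
  have "(\<lambda>z. (fst z, snd z)) \<in> lateral_base D \<tau> \<rightarrow>\<^sub>M lateral_base D T" 
    unfolding lateral_base_def[of D T] by (rule measurable_Pair[OF 1 2])
  then show ?thesis by simp
qed

lemma nn_integral_lateral_base:
  fixes D :: "(real^'d) set"
  assumes "f \<in> borel_measurable (lateral_base D \<tau>)"
  defines "H \<equiv> hausdorff_measure (CARD('d) - 1) :: (real^'d) measure"
  shows "(\<integral>\<^sup>+z. f z \<partial>lateral_base D \<tau>) = (\<integral>\<^sup>+x\<in>frontier D. (\<integral>\<^sup>+t\<in>{0..\<tau>}. f (x, t) \<partial>lborel) \<partial>H)"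
proof -
  define M2 where "M2 = restrict_space lborel {0..\<tau>}"
  have "finite_measure M2" unfolding M2_def
    by (rule finite_measureI) (simp add: emeasure_restrict_space space_restrict_space emeasure_lborel_Icc_eq)
  then interpret M2: finite_measure M2 .
  have "(\<integral>\<^sup>+z. f z \<partial>lateral_base D \<tau>) = (\<integral>\<^sup>+x. (\<integral>\<^sup>+t. f (x, t) \<partial>M2) \<partial>restrict_space H (frontier D))"
    using M2.nn_integral_fst[of f "restrict_space H (frontier D)"] assms(1) by (simp add: lateral_base_def H_def M2_def)
  then show ?thesis unfolding M2_def H_def by (simp add: nn_integral_restrict_space)
qed

lemma nn_integral_lateral_le:
  fixes D :: "(real^'d) set"
  assumes "f \<in> borel_measurable (lateral_base D T)" "\<tau> \<le> T"
  shows "(\<integral>\<^sup>+z. f z \<partial>lateral_base D \<tau>) \<le> (\<integral>\<^sup>+z. f z \<partial>lateral_base D T)"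
proof -
  have m: "f \<in> borel_measurable (lateral_base D \<tau>)" using measurable_compose[OF lateral_base_mono[OF assms(2)] assms(1)] .
  show ?thesis unfolding nn_integral_lateral_base[OF assms(1)] nn_integral_lateral_base[OF m]
    by (intro nn_integral_mono mult_right_mono) (use assms(2) in \<open>auto simp: indicator_def\<close>)
qed

text \<open>The exceptional null set is pulled back along the inclusion of the shorter cylinder,
  where monotonicity of the integral keeps its measure 0.\<close>

lemma AE_lateral_mono:
  fixes D :: "(real^'d) set"
  assumes "AE z in lateral_base D T. P z" "\<tau> \<le> T"
  shows "AE z in lateral_base D \<tau>. P z"
proof -
  obtain N where N: "{z \<in> space (lateral_base D T). \<not> P z} \<subseteq> N" "emeasure (lateral_base D T) N = 0" "N \<in> sets (lateral_base D T)"
    using assms(1) by (rule AE_E)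
  note id = lateral_base_mono[OF assms(2), of D]
  have im: "indicator N \<in> borel_measurable (lateral_base D T)" using N(3) by simp
  have Nm: "(\<lambda>z. z) -` N \<inter> space (lateral_base D \<tau>) \<in> sets (lateral_base D \<tau>)" by (rule measurable_sets[OF id N(3)])
  then have Nm: "N \<inter> space (lateral_base D \<tau>) \<in> sets (lateral_base D \<tau>)" by simp
  have "emeasure (lateral_base D \<tau>) (N \<inter> space (lateral_base D \<tau>)) = (\<integral>\<^sup>+z. indicator (N \<inter> space (lateral_base D \<tau>)) z \<partial>lateral_base D \<tau>)"
    by (rule nn_integral_indicator[OF Nm, symmetric])
  also have "\<dots> = (\<integral>\<^sup>+z. indicator N z \<partial>lateral_base D \<tau>)" by (rule nn_integral_cong) (simp add: indicator_def)
  also have "\<dots> \<le> (\<integral>\<^sup>+z. indicator N z \<partial>lateral_base D T)" by (rule nn_integral_lateral_le[OF im assms(2)])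
  also have "\<dots> = 0" using N by simp
  finally have "emeasure (lateral_base D \<tau>) (N \<inter> space (lateral_base D \<tau>)) = 0" by simp
  moreover have "z \<in> space (lateral_base D T)" if "z \<in> space (lateral_base D \<tau>)" for z
    using measurable_space[OF id that] .
  then have "{z \<in> space (lateral_base D \<tau>). \<not> P z} \<subseteq> N \<inter> space (lateral_base D \<tau>)" using N(1) by blast
  ultimately show ?thesis using Nm by (intro AE_I[of _ _ "N \<inter> space (lateral_base D \<tau>)"])
qed

text \<open>The estimate for time slices is integrated over \<open>t\<close>. The order of
  integration is exchanged on the lateral surface, where finiteness of the surface measure enters.
  The constant does not depend on \<open>\<tau>\<close>.\<close>

lemma lateral_trace:
  fixes D :: "(real^'d) set"
  assumes D: "open D" "bounded D" "Ck_boundary k D" "k \<ge> 1"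
  shows "\<exists>C\<ge>0. \<forall>\<tau> \<epsilon>. \<forall>\<psi> :: (real^'d) \<times> real \<Rightarrow> real. smooth \<psi> \<longrightarrow> \<epsilon> \<ge> 0 \<longrightarrow> sq_int (D \<times> {0..\<tau>}) \<psi> \<le> ennreal \<epsilon> \<longrightarrow>
     (\<forall>b\<in>Basis. sq_int (D \<times> {0..\<tau>}) (partial b \<psi>) \<le> ennreal \<epsilon>) \<longrightarrow>
     (\<integral>\<^sup>+z. ennreal ((\<psi> z)\<^sup>2) \<partial>lateral_base D \<tau>) \<le> ennreal (C * \<epsilon>)"
proof -
  define H where "H = (hausdorff_measure (CARD('d) - 1) :: (real^'d) measure)"
  obtain C where fin: "emeasure H (frontier D) < \<infinity>" and C: "C \<ge> 0"
    and tr: "\<And>\<psi> :: (real^'d) \<times> real \<Rightarrow> real. \<And>t. smooth \<psi> \<Longrightarrow> (\<integral>\<^sup>+x\<in>frontier D. ennreal ((\<psi> (x, t))\<^sup>2) \<partial>H) \<le>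
     ennreal C * (\<integral>\<^sup>+y\<in>D. ennreal ((\<psi> (y, t))\<^sup>2 + (\<Sum>a\<in>UNIV. (partial (space_dir a) \<psi> (y, t))\<^sup>2)) \<partial>lborel)"
    using boundary_trace[OF D, folded H_def] by blast
  have Hs[measurable_cong]: "sets H = sets borel" unfolding H_def by simp
  have "(\<integral>\<^sup>+z. ennreal ((\<psi> z)\<^sup>2) \<partial>lateral_base D \<tau>) \<le> ennreal (C * (1 + real CARD('d)) * \<epsilon>)"
    if \<psi>: "smooth \<psi>" and \<epsilon>: "\<epsilon> \<ge> 0" and b0: "sq_int (D \<times> {0..\<tau>}) \<psi> \<le> ennreal \<epsilon>"
      and b1: "\<And>b. b \<in> Basis \<Longrightarrow> sq_int (D \<times> {0..\<tau>}) (partial b \<psi>) \<le> ennreal \<epsilon>" 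
    for \<psi> :: "(real^'d) \<times> real \<Rightarrow> real" and \<tau> \<epsilon>
  proof -
    define E where "E z = (\<psi> z)\<^sup>2 + (\<Sum>a\<in>UNIV. (partial (space_dir a) \<psi> z)\<^sup>2)" for z
    have pm: "\<psi> \<in> borel_measurable borel" "partial (space_dir a) \<psi> \<in> borel_measurable borel" for a
      using smooth_measurable \<psi> smooth_partial[OF \<psi> space_dir_Basis] by blast+
    have Em: "E \<in> borel_measurable borel" unfolding E_def[abs_def] using pm by measurable
    have Sm: "D \<times> {0..\<tau>} \<in> sets borel" using D(1) by (intro borel_Times) auto
    define M1 where "M1 = restrict_space H (frontier D)"
    define M2 where "M2 = restrict_space lborel {0..\<tau>}"
    have f1: "finite_measure M1" unfolding M1_def
      by (rule finite_measureI) (use fin in \<open>simp add: emeasure_restrict_space space_restrict_space H_def\<close>)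
    have f2: "finite_measure M2" unfolding M2_def
      by (rule finite_measureI) (simp add: emeasure_restrict_space space_restrict_space emeasure_lborel_Icc_eq)
    interpret F1: finite_measure M1 by (rule f1)
    interpret F2: finite_measure M2 by (rule f2)
    interpret P: pair_sigma_finite M1 M2 ..
    have LB: "lateral_base D \<tau> = M1 \<Otimes>\<^sub>M M2" by (simp add: lateral_base_def M1_def M2_def H_def)
    have m: "(\<lambda>z. ennreal ((\<psi> z)\<^sup>2)) \<in> borel_measurable (M1 \<Otimes>\<^sub>M M2)"
      unfolding LB[symmetric] by (rule lateral_base_measurable) (use pm in measurable)
    have "(\<integral>\<^sup>+z. ennreal ((\<psi> z)\<^sup>2) \<partial>lateral_base D \<tau>) = (\<integral>\<^sup>+t. (\<integral>\<^sup>+x. ennreal ((\<psi> (x, t))\<^sup>2) \<partial>M1) \<partial>M2)"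
      unfolding LB by (rule P.nn_integral_snd[symmetric]) (use m in \<open>simp add: case_prod_beta\<close>)
    also have "\<dots> = (\<integral>\<^sup>+t\<in>{0..\<tau>}. (\<integral>\<^sup>+x\<in>frontier D. ennreal ((\<psi> (x, t))\<^sup>2) \<partial>H) \<partial>lborel)"
      unfolding M1_def M2_def by (simp add: nn_integral_restrict_space H_def)
    also have "\<dots> \<le> (\<integral>\<^sup>+t. (\<integral>\<^sup>+y. ennreal C * (ennreal (E (y, t)) * indicator (D \<times> {0..\<tau>}) (y, t)) \<partial>lborel) \<partial>lborel)"
    proof (rule nn_integral_mono)
      fix t
      show "(\<integral>\<^sup>+x\<in>frontier D. ennreal ((\<psi> (x, t))\<^sup>2) \<partial>H) * indicator {0..\<tau>} t \<le> (\<integral>\<^sup>+y. ennreal C * (ennreal (E (y, t)) * indicator (D \<times> {0..\<tau>}) (y, t)) \<partial>lborel)"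
      proof (cases "t \<in> {0..\<tau>}")
        case True
        have "(\<lambda>y. (y, t)) \<in> (borel :: (real^'d) measure) \<rightarrow>\<^sub>M borel"
          by (intro borel_measurable_continuous_onI continuous_intros)
        from measurable_compose[OF this Em] have "(\<lambda>y. E (y, t)) \<in> borel_measurable borel" .
        moreover have "D \<in> sets borel" using D(1) by simp
        ultimately have mE: "(\<lambda>y. ennreal (E (y, t)) * indicator D y) \<in> borel_measurable lborel" by measurable
        have "(\<integral>\<^sup>+x\<in>frontier D. ennreal ((\<psi> (x, t))\<^sup>2) \<partial>H) * indicator {0..\<tau>} t = (\<integral>\<^sup>+x\<in>frontier D. ennreal ((\<psi> (x, t))\<^sup>2) \<partial>H)"
          using True by simp
        also have "\<dots> \<le> ennreal C * (\<integral>\<^sup>+y\<in>D. ennreal (E (y, t)) \<partial>lborel)" using tr[OF \<psi>, of t] unfolding E_def .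
        also have "\<dots> = (\<integral>\<^sup>+y. ennreal C * (ennreal (E (y, t)) * indicator D y) \<partial>lborel)" by (rule nn_integral_cmult[OF mE, symmetric])
        also have "\<dots> = (\<integral>\<^sup>+y. ennreal C * (ennreal (E (y, t)) * indicator (D \<times> {0..\<tau>}) (y, t)) \<partial>lborel)"
          by (rule nn_integral_cong) (use True in \<open>simp add: indicator_def\<close>)
        finally show ?thesis .
      qed simp
    qed
    also have "\<dots> = (\<integral>\<^sup>+z. ennreal C * (ennreal (E z) * indicator (D \<times> {0..\<tau>}) z) \<partial>(lborel \<Otimes>\<^sub>M lborel))"
    proof (rule lborel_pair.nn_integral_snd[of "\<lambda>z. ennreal C * (ennreal (E z) * indicator (D \<times> {0..\<tau>}) z)"])
      show "(\<lambda>z. ennreal C * (ennreal (E z) * indicator (D \<times> {0..\<tau>}) z)) \<in> borel_measurable (lborel \<Otimes>\<^sub>M lborel)"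
        unfolding lborel_prod using Em Sm by measurable
    qed
    also have "\<dots> = ennreal C * (\<integral>\<^sup>+z\<in>(D \<times> {0..\<tau>}). ennreal (E z) \<partial>lborel)"
      unfolding lborel_prod by (rule nn_integral_cmult) (use Em Sm in measurable)
    also have "(\<integral>\<^sup>+z\<in>(D \<times> {0..\<tau>}). ennreal (E z) \<partial>lborel) = (\<integral>\<^sup>+z. ennreal ((\<psi> z)\<^sup>2) * indicator (D \<times> {0..\<tau>}) z + (\<Sum>a\<in>UNIV. ennreal ((partial (space_dir a) \<psi> z)\<^sup>2) * indicator (D \<times> {0..\<tau>}) z) \<partial>lborel)"
      unfolding E_def by (intro nn_integral_cong) (subst ennreal_plus, simp, simp add: sum_nonneg,
          subst sum_ennreal[symmetric], simp, simp only: distrib_right sum_distrib_right)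
    also have "\<dots> = (\<integral>\<^sup>+z. ennreal ((\<psi> z)\<^sup>2) * indicator (D \<times> {0..\<tau>}) z \<partial>lborel) + (\<integral>\<^sup>+z. (\<Sum>a\<in>UNIV. ennreal ((partial (space_dir a) \<psi> z)\<^sup>2) * indicator (D \<times> {0..\<tau>}) z) \<partial>lborel)"
      by (rule nn_integral_add) (use pm Sm in measurable)
    also have "\<dots> = sq_int (D \<times> {0..\<tau>}) \<psi> + (\<Sum>a\<in>UNIV. sq_int (D \<times> {0..\<tau>}) (partial (space_dir a) \<psi>))"
    proof -
      have "(\<integral>\<^sup>+z. (\<Sum>a\<in>UNIV. ennreal ((partial (space_dir a) \<psi> z)\<^sup>2) * indicator (D \<times> {0..\<tau>}) z) \<partial>lborel)
        = (\<Sum>a\<in>UNIV. (\<integral>\<^sup>+z. ennreal ((partial (space_dir a) \<psi> z)\<^sup>2) * indicator (D \<times> {0..\<tau>}) z \<partial>lborel))"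
        by (rule nn_integral_sum) (use pm(2) Sm in measurable)
      then show ?thesis unfolding sq_int_def by (simp only:)
    qed
    also have "\<dots> \<le> ennreal \<epsilon> + (\<Sum>a\<in>(UNIV :: 'd set). ennreal \<epsilon>)"
      using b0 b1[OF space_dir_Basis] by (intro add_mono sum_mono) auto
    also have "\<dots> = ennreal ((1 + real CARD('d)) * \<epsilon>)" 
    proof -
      have "(\<Sum>a\<in>(UNIV :: 'd set). ennreal \<epsilon>) = ennreal (real CARD('d) * \<epsilon>)"
        using \<epsilon> by (simp add: ennreal_mult ennreal_of_nat_eq_real_of_nat)
      then show ?thesis using \<epsilon> by (simp only: distrib_right mult_1_left) (subst ennreal_plus, auto)
    qed
    finally have "(\<integral>\<^sup>+z. ennreal ((\<psi> z)\<^sup>2) \<partial>lateral_base D \<tau>) \<le> ennreal C * ennreal ((1 + real CARD('d)) * \<epsilon>)"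
      by (simp add: mult_left_mono)
    also have "\<dots> = ennreal (C * (1 + real CARD('d)) * \<epsilon>)" using C \<epsilon> by (subst ennreal_mult[symmetric]) (auto simp: mult.assoc)
    finally show ?thesis .
  qed
  then show ?thesis using C by (intro exI[of _ "C * (1 + real CARD('d))"]) simp
qed

text \<open>The one-dimensional estimate in the time direction, integrated over \<open>D\<close>;
  the available height enters as \<open>1/\<tau>\<close>.\<close>

lemma bottom_trace:
  fixes D :: "(real^'d) set" and \<psi> :: "(real^'d) \<times> real \<Rightarrow> real"
  assumes "open D" "\<tau> > 0" and \<psi>: "smooth \<psi>" and "\<epsilon> \<ge> 0"
    and b: "sq_int (D \<times> {0<..<\<tau>}) \<psi> \<le> ennreal \<epsilon>" "sq_int (D \<times> {0<..<\<tau>}) (partial time_dir \<psi>) \<le> ennreal \<epsilon>"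
  shows "sq_int D (\<lambda>x. \<psi> (x, 0)) \<le> ennreal (2 * (1/\<tau> + 1) * \<epsilon>)"
proof -
  define c where "c = 1/\<tau> + 1"
  have c: "c \<ge> 1" "c \<ge> 0" using \<open>\<tau> > 0\<close> by (simp_all add: c_def)
  define E where "E z = (\<psi> z)\<^sup>2 + (partial time_dir \<psi> z)\<^sup>2" for z
  note s1 = smooth_partial[OF \<psi> time_dir_Basis]
  have pm: "\<psi> \<in> borel_measurable borel" "partial time_dir \<psi> \<in> borel_measurable borel"
    using smooth_measurable \<psi> s1 by blast+
  have Em: "E \<in> borel_measurable borel" unfolding E_def[abs_def] using pm by measurable
  have Sm: "D \<times> {0<..<\<tau>} \<in> sets borel" using assms(1) by (intro borel_Times) auto
  have m: "(\<lambda>z. ennreal (E z) * indicator (D \<times> {0<..<\<tau>}) z) \<in> borel_measurable borel" using Em Sm by measurable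
  have "sq_int D (\<lambda>x. \<psi> (x, 0)) \<le> (\<integral>\<^sup>+x. (\<integral>\<^sup>+t. ennreal c * (ennreal (E (x, t)) * indicator (D \<times> {0<..<\<tau>}) (x, t)) \<partial>lborel) \<partial>lborel)"
    unfolding sq_int_def
  proof (rule nn_integral_mono)
    fix x
    show "ennreal ((\<psi> (x, 0))\<^sup>2) * indicator D x \<le> (\<integral>\<^sup>+t. ennreal c * (ennreal (E (x, t)) * indicator (D \<times> {0<..<\<tau>}) (x, t)) \<partial>lborel)"
    proof (cases "x \<in> D")
      case True
      define q where "q t = \<psi> ((x, 0) + t *\<^sub>R time_dir)" for t
      define q' where "q' t = partial time_dir \<psi> ((x, 0) + t *\<^sub>R time_dir)" for t
      have qd: "(q has_real_derivative q' t) (at t)" for t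
        unfolding q_def[abs_def] q'_def by (rule has_real_derivative_partial[OF smooth_differentiable[OF \<psi>]])
      have q'c: "isCont q' t" for t
      proof -
        have "continuous_on UNIV q'" unfolding q'_def[abs_def]
          by (intro continuous_on_compose2[OF smooth_continuous[OF s1, of UNIV]] continuous_intros) auto
        then show ?thesis by (simp add: continuous_on_eq_continuous_at)
      qed
      have "ennreal ((q 0)\<^sup>2) \<le> (\<integral>\<^sup>+t\<in>{0<..<\<tau>}. ennreal (c * (q t)\<^sup>2 + (q' t)\<^sup>2) \<partial>lborel)"
        by (rule trace_1d[OF \<open>\<tau> > 0\<close> qd q'c, folded c_def])
      also have "\<dots> \<le> (\<integral>\<^sup>+t. ennreal c * (ennreal (E (x, t)) * indicator (D \<times> {0<..<\<tau>}) (x, t)) \<partial>lborel)"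
      proof (rule nn_integral_mono)
        fix t
        show "ennreal (c * (q t)\<^sup>2 + (q' t)\<^sup>2) * indicator {0<..<\<tau>} t \<le> ennreal c * (ennreal (E (x, t)) * indicator (D \<times> {0<..<\<tau>}) (x, t))"
        proof (cases "t \<in> {0<..<\<tau>}")
          case t: True
          have "c * (q t)\<^sup>2 + (q' t)\<^sup>2 \<le> c * E (x, t)"
            using mult_right_mono[OF c(1), of "(q' t)\<^sup>2"] by (simp add: E_def q_def q'_def distrib_left)
          then have "ennreal (c * (q t)\<^sup>2 + (q' t)\<^sup>2) \<le> ennreal c * ennreal (E (x, t))"
            unfolding ennreal_mult'[OF c(2), symmetric] by (rule ennreal_leI)
          then show ?thesis using t True by simp
        qed simp
      qed
      finally show ?thesis using True by (simp add: q_def)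
    qed simp
  qed
  also have "\<dots> = (\<integral>\<^sup>+z. ennreal c * (ennreal (E z) * indicator (D \<times> {0<..<\<tau>}) z) \<partial>(lborel \<Otimes>\<^sub>M lborel))"
    by (rule lborel.nn_integral_fst[of "\<lambda>z. ennreal c * (ennreal (E z) * indicator (D \<times> {0<..<\<tau>}) z)"])
      (use m in \<open>simp add: lborel_prod\<close>)
  also have "\<dots> = ennreal c * (\<integral>\<^sup>+z. ennreal (E z) * indicator (D \<times> {0<..<\<tau>}) z \<partial>lborel)"
    unfolding lborel_prod by (rule nn_integral_cmult) (use m in simp)
  also have "(\<integral>\<^sup>+z. ennreal (E z) * indicator (D \<times> {0<..<\<tau>}) z \<partial>lborel) =
     (\<integral>\<^sup>+z. ennreal ((\<psi> z)\<^sup>2) * indicator (D \<times> {0<..<\<tau>}) z + ennreal ((partial time_dir \<psi> z)\<^sup>2) * indicator (D \<times> {0<..<\<tau>}) z \<partial>lborel)"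
    unfolding E_def by (intro nn_integral_cong) (simp add: distrib_right)
  also have "\<dots> = sq_int (D \<times> {0<..<\<tau>}) \<psi> + sq_int (D \<times> {0<..<\<tau>}) (partial time_dir \<psi>)"
    unfolding sq_int_def by (rule nn_integral_add) (use pm Sm in measurable)
  also have "\<dots> \<le> ennreal \<epsilon> + ennreal \<epsilon>" using b by (intro add_mono)
  also have "\<dots> = ennreal (2 * \<epsilon>)" using \<open>\<epsilon> \<ge> 0\<close> by (subst ennreal_plus[symmetric]) auto
  finally have "sq_int D (\<lambda>x. \<psi> (x, 0)) \<le> ennreal c * ennreal (2 * \<epsilon>)" by (simp add: mult_left_mono)
  also have "\<dots> = ennreal (2 * c * \<epsilon>)" unfolding ennreal_mult'[OF c(2), symmetric] by (simp add: mult_ac)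
  finally show ?thesis unfolding c_def .
qed

section \<open>Traces of the solution and the comparison with smooth functions\<close>

lemma sq_int_cong_AE:
  assumes "AE x in lborel. x \<in> \<Omega> \<longrightarrow> p x = q x"
  shows "sq_int \<Omega> p = sq_int \<Omega> q"
  unfolding sq_int_def
proof (rule nn_integral_cong_AE)
  show "AE x in lborel. ennreal ((p x)\<^sup>2) * indicator \<Omega> x = ennreal ((q x)\<^sup>2) * indicator \<Omega> x"
    using assms by eventually_elim (auto simp: indicator_def)
qed

lemma sq_int_le_lebesgue_on:
  fixes p q :: "'a::euclidean_space \<Rightarrow> real"
  assumes "open \<Omega>" "\<Omega>' \<subseteq> \<Omega>" "AE x in lborel. x \<in> \<Omega>' \<longrightarrow> p x = q x"
  shows "sq_int \<Omega>' q \<le> (\<integral>\<^sup>+x. ennreal ((p x)\<^sup>2) \<partial>lebesgue_on \<Omega>)"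
proof -
  have "sq_int \<Omega>' q = sq_int \<Omega>' p" using sq_int_cong_AE[OF assms(3)] by simp
  also have "\<dots> \<le> sq_int \<Omega> p" unfolding sq_int_def
    using assms(2) by (intro nn_integral_mono mult_left_mono) (auto simp: indicator_def)
  also have "\<dots> = (\<integral>\<^sup>+x. ennreal ((p x)\<^sup>2) \<partial>lebesgue_on \<Omega>)"
    using assms(1) by (intro nn_integral_lebesgue_on_AE[symmetric]) auto
  finally show ?thesis .
qed

text \<open>One member of the approximating sequence, late enough for finitely many convergences at
  once, is close to the solution in H^1 and to the trace data. A network will be compared with this
  smooth function instead of with the solution, so the trace inequalities for smooth functions
  apply.\<close>

lemma has_trace_approx:
  fixes u :: "'a::euclidean_space \<Rightarrow> real"
  assumes tr: "has_trace \<Omega> N \<iota> u g" and \<Omega>: "open \<Omega>" "open \<Omega>'" "\<Omega>' \<subseteq> \<Omega>"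
    and u': "AE x in lborel. x \<in> \<Omega>' \<longrightarrow> u x = u' x"
    and v: "\<And>b v0. b \<in> Basis \<Longrightarrow> weak_deriv \<Omega>' [b] u v0 \<Longrightarrow> AE x in lborel. x \<in> \<Omega>' \<longrightarrow> v0 x = v b x"
    and "\<epsilon> > 0"
  shows "\<exists>\<phi>. smooth \<phi> \<and> sq_int \<Omega>' (\<lambda>x. \<phi> x - u' x) \<le> ennreal \<epsilon> \<and>
    (\<forall>b\<in>Basis. sq_int \<Omega>' (\<lambda>x. partial b \<phi> x - v b x) \<le> ennreal \<epsilon>) \<and>
    (\<lambda>y. \<phi> (\<iota> y) - g y) \<in> borel_measurable N \<and> (\<integral>\<^sup>+y. ennreal ((\<phi> (\<iota> y) - g y)\<^sup>2) \<partial>N) \<le> ennreal \<epsilon>"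
proof -
  obtain \<phi> :: "nat \<Rightarrow> 'a \<Rightarrow> real" where \<phi>: "\<And>n. smooth (\<phi> n)" "tendsto_L2 (lebesgue_on \<Omega>) \<phi> u"
     "\<forall>b\<in>Basis. \<exists>v. weak_deriv \<Omega> [b] u v \<and> tendsto_L2 (lebesgue_on \<Omega>) (\<lambda>n. partial b (\<phi> n)) v"
     "tendsto_L2 N (\<lambda>n y. \<phi> n (\<iota> y)) g"
    using tr unfolding has_trace_def by blast
  have 0: "\<forall>\<^sub>F n in sequentially. sq_int \<Omega>' (\<lambda>x. \<phi> n x - u' x) \<le> ennreal \<epsilon>"
    using tendsto_L2_nn_integral[OF \<phi>(2) \<open>\<epsilon> > 0\<close>]
  proof eventually_elim
    case (elim n)
    have "AE x in lborel. x \<in> \<Omega>' \<longrightarrow> \<phi> n x - u x = \<phi> n x - u' x" using u' by eventually_elim simp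
    from sq_int_le_lebesgue_on[OF \<Omega>(1,3) this] elim show ?case by (rule order_trans)
  qed
  have "\<forall>b\<in>Basis. \<forall>\<^sub>F n in sequentially. sq_int \<Omega>' (\<lambda>x. partial b (\<phi> n) x - v b x) \<le> ennreal \<epsilon>"
  proof
    fix b :: 'a assume b: "b \<in> Basis"
    obtain v0 where v0: "weak_deriv \<Omega> [b] u v0" "tendsto_L2 (lebesgue_on \<Omega>) (\<lambda>n. partial b (\<phi> n)) v0" using \<phi>(3) b by blast
    have "weak_deriv \<Omega>' [b] u v0" by (rule weak_deriv_subset[OF v0(1) \<Omega>(3,2,1)]) (use b in simp)
    from v[OF b this] have ae: "AE x in lborel. x \<in> \<Omega>' \<longrightarrow> v0 x = v b x" .
    show "\<forall>\<^sub>F n in sequentially. sq_int \<Omega>' (\<lambda>x. partial b (\<phi> n) x - v b x) \<le> ennreal \<epsilon>"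
      using tendsto_L2_nn_integral[OF v0(2) \<open>\<epsilon> > 0\<close>]
    proof eventually_elim
      case (elim n)
      have "AE x in lborel. x \<in> \<Omega>' \<longrightarrow> partial b (\<phi> n) x - v0 x = partial b (\<phi> n) x - v b x" using ae by eventually_elim simp
      from sq_int_le_lebesgue_on[OF \<Omega>(1,3) this] elim show ?case by (rule order_trans)
    qed
  qed
  then have 1: "\<forall>\<^sub>F n in sequentially. \<forall>b\<in>Basis. sq_int \<Omega>' (\<lambda>x. partial b (\<phi> n) x - v b x) \<le> ennreal \<epsilon>"
    by (intro eventually_ball_finite finite_Basis)
  have 2: "\<forall>\<^sub>F n in sequentially. (\<integral>\<^sup>+y. ennreal ((\<phi> n (\<iota> y) - g y)\<^sup>2) \<partial>N) \<le> ennreal \<epsilon>"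
    using tendsto_L2_nn_integral[OF \<phi>(4) \<open>\<epsilon> > 0\<close>] .
  have "\<forall>\<^sub>F n in sequentially. sq_int \<Omega>' (\<lambda>x. \<phi> n x - u' x) \<le> ennreal \<epsilon> \<and>
    (\<forall>b\<in>Basis. sq_int \<Omega>' (\<lambda>x. partial b (\<phi> n) x - v b x) \<le> ennreal \<epsilon>) \<and>
    (\<integral>\<^sup>+y. ennreal ((\<phi> n (\<iota> y) - g y)\<^sup>2) \<partial>N) \<le> ennreal \<epsilon>"
    using 0 1 2 by eventually_elim blast
  then obtain n where n: "sq_int \<Omega>' (\<lambda>x. \<phi> n x - u' x) \<le> ennreal \<epsilon>"
    "\<forall>b\<in>Basis. sq_int \<Omega>' (\<lambda>x. partial b (\<phi> n) x - v b x) \<le> ennreal \<epsilon>"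
    "(\<integral>\<^sup>+y. ennreal ((\<phi> n (\<iota> y) - g y)\<^sup>2) \<partial>N) \<le> ennreal \<epsilon>"
    unfolding eventually_sequentially by blast
  have "(\<lambda>y. \<phi> n (\<iota> y) - g y) \<in> borel_measurable N" using \<phi>(4) unfolding tendsto_L2_def L2_def by blast
  with n \<phi>(1)[of n] show ?thesis by blast
qed

text \<open>Measurability of \<open>g\<close> refers to the completion up to \<open>T\<close>. A
  representative that is measurable for the uncompleted product is restricted to the shorter span,
  where it still agrees with \<open>g\<close> almost everywhere.\<close>

lemma lateral_measure_restrict:
  fixes D :: "(real^'d) set"
  assumes "\<tau> \<le> T" and g: "g \<in> borel_measurable (lateral_measure D T)"
  shows "(g :: (real^'d) \<times> real \<Rightarrow> real) \<in> borel_measurable (lateral_measure D \<tau>)"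
    and "(\<integral>\<^sup>+z. ennreal ((g z)\<^sup>2) \<partial>lateral_measure D \<tau>) \<le> (\<integral>\<^sup>+z. ennreal ((g z)\<^sup>2) \<partial>lateral_measure D T)"
proof -
  obtain g' where g': "g' \<in> borel_measurable (lateral_base D T)" "AE z in lateral_base D T. g z = g' z"
    using completion_ex_borel_measurable_real[of g "lateral_base D T"] g unfolding lateral_measure_eq by blast
  have m: "g' \<in> borel_measurable (lateral_base D \<tau>)" using measurable_compose[OF lateral_base_mono[OF assms(1)] g'(1)] .
  have ae: "AE z in lateral_base D \<tau>. g z = g' z" by (rule AE_lateral_mono[OF g'(2) assms(1)])
  show "g \<in> borel_measurable (lateral_measure D \<tau>)" unfolding lateral_measure_eq
    by (rule borel_measurable_completion_AE[OF measurable_completion[OF m] AE_completion[OF ae]])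
  have "(\<integral>\<^sup>+z. ennreal ((g z)\<^sup>2) \<partial>lateral_measure D \<tau>) = (\<integral>\<^sup>+z. ennreal ((g z)\<^sup>2) \<partial>lateral_base D \<tau>)"
    unfolding lateral_measure_eq by (rule nn_integral_completion)
  also have "\<dots> = (\<integral>\<^sup>+z. ennreal ((g' z)\<^sup>2) \<partial>lateral_base D \<tau>)"
    by (rule nn_integral_cong_AE) (use ae in eventually_elim, simp)
  also have "\<dots> \<le> (\<integral>\<^sup>+z. ennreal ((g' z)\<^sup>2) \<partial>lateral_base D T)"
    by (rule nn_integral_lateral_le[OF _ assms(1)]) (use g'(1) in measurable)
  also have "\<dots> = (\<integral>\<^sup>+z. ennreal ((g z)\<^sup>2) \<partial>lateral_base D T)"
    by (rule nn_integral_cong_AE) (use g'(2) in eventually_elim, simp)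
  also have "\<dots> = (\<integral>\<^sup>+z. ennreal ((g z)\<^sup>2) \<partial>lateral_measure D T)"
    unfolding lateral_measure_eq by (rule nn_integral_completion[symmetric])
  finally show "(\<integral>\<^sup>+z. ennreal ((g z)\<^sup>2) \<partial>lateral_measure D \<tau>) \<le> (\<integral>\<^sup>+z. ennreal ((g z)\<^sup>2) \<partial>lateral_measure D T)" .
qed

lemma AE_snd_neq: "AE z in (lborel :: ((real^'d) \<times> real) measure). snd z \<noteq> c"
proof -
  have "negligible {z :: (real^'d) \<times> real. (0, 1) \<bullet> z = c}"
    by (rule negligible_hyperplane) (simp add: zero_prod_def)
  then have "AE z in lebesgue. z \<notin> {z :: (real^'d) \<times> real. (0, 1) \<bullet> z = c}"
    using negligible_iff_null_sets AE_not_in by blast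
  then show ?thesis by (auto simp: AE_completion_iff inner_prod_def)
qed

text \<open>Residuals are measured over a closed time interval while weak derivatives live on the
  open one; the hyperplanes at times 0 and \<open>\<tau>\<close> are null sets.\<close>

lemma AE_closed_time:
  fixes D :: "(real^'d) set" and \<tau> :: real
  shows "AE z in lborel. z \<in> D \<times> {0..\<tau>} \<longrightarrow> z \<in> D \<times> {0<..<\<tau>}"
proof -
  have "AE z in (lborel :: ((real^'d) \<times> real) measure). snd z \<noteq> 0" "AE z in (lborel :: ((real^'d) \<times> real) measure). snd z \<noteq> \<tau>"
    by (rule AE_snd_neq)+
  then show ?thesis by eventually_elim auto
qed

lemma sq_int_closed_time: "sq_int (D \<times> {0..\<tau>}) f = sq_int (D \<times> {0<..<\<tau>}) (f :: (real^'d) \<times> real \<Rightarrow> real)"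
  unfolding sq_int_def
proof (rule nn_integral_cong_AE)
  show "AE z in lborel. ennreal ((f z)\<^sup>2) * indicator (D \<times> {0..\<tau>}) z = ennreal ((f z)\<^sup>2) * indicator (D \<times> {0<..<\<tau>}) z"
    using AE_closed_time by eventually_elim (auto simp: indicator_def)
qed

text \<open>Both functions are close to the same data, so the triangle inequality provides what the
  trace inequalities ask of their difference.\<close>

lemma difference_H1_bound:
  fixes g \<phi> :: "'a::euclidean_space \<Rightarrow> real"
  assumes "smooth g" "smooth \<phi>" "\<Omega> \<in> sets borel" "\<epsilon> \<ge> 0" "u \<in> borel_measurable borel" "\<And>b. b \<in> Basis \<Longrightarrow> v b \<in> borel_measurable borel"
    and "sq_int \<Omega> (\<lambda>x. g x - u x) \<le> ennreal \<epsilon>" "sq_int \<Omega> (\<lambda>x. \<phi> x - u x) \<le> ennreal \<epsilon>"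
    and g: "\<And>b. b \<in> Basis \<Longrightarrow> sq_int \<Omega> (\<lambda>x. partial b g x - v b x) \<le> ennreal \<epsilon>"
    and \<phi>: "\<And>b. b \<in> Basis \<Longrightarrow> sq_int \<Omega> (\<lambda>x. partial b \<phi> x - v b x) \<le> ennreal \<epsilon>"
  shows "sq_int \<Omega> (\<lambda>x. g x - \<phi> x) \<le> ennreal (4 * \<epsilon>)"
    and "\<forall>b\<in>Basis. sq_int \<Omega> (partial b (\<lambda>x. g x - \<phi> x)) \<le> ennreal (4 * \<epsilon>)"
proof -
  note sm = smooth_measurable
  show "sq_int \<Omega> (\<lambda>x. g x - \<phi> x) \<le> ennreal (4 * \<epsilon>)"
    by (rule sq_int_triangle[OF sm[OF assms(1)] assms(5) sm[OF assms(2)] assms(3,7) _ assms(4)])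
      (use assms(8) sq_int_diff_commute[of \<Omega> u \<phi>] in simp)
  show "\<forall>b\<in>Basis. sq_int \<Omega> (partial b (\<lambda>x. g x - \<phi> x)) \<le> ennreal (4 * \<epsilon>)"
  proof
    fix b :: 'a assume b: "b \<in> Basis"
    have "partial b (\<lambda>x. g x - \<phi> x) = (\<lambda>x. partial b g x - partial b \<phi> x)"
      using partial_diff smooth_differentiable[OF assms(1)] smooth_differentiable[OF assms(2)] by blast
    moreover have "sq_int \<Omega> (\<lambda>x. partial b g x - partial b \<phi> x) \<le> ennreal (4 * \<epsilon>)"
      by (rule sq_int_triangle[OF sm[OF smooth_partial[OF assms(1) b]] assms(6)[OF b] sm[OF smooth_partial[OF assms(2) b]] assms(3) g[OF b] _ assms(4)])
        (use \<phi>[OF b] sq_int_diff_commute[of \<Omega> "v b" "partial b \<phi>"] in simp)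
    ultimately show "sq_int \<Omega> (partial b (\<lambda>x. g x - \<phi> x)) \<le> ennreal (4 * \<epsilon>)" by simp
  qed
qed

text \<open>Once \<open>f\<close> is expressed through \<open>v\<close> and \<open>w\<close>, the
  residual is almost everywhere a sum of approximation errors, one for the time derivative and one
  for each pure second space derivative. The constant is that of \<open>sq_int_sum\<close> after
  splitting off the time term.\<close>

lemma interior_residual_bound:
  fixes D :: "(real^'d) set" and g f :: "(real^'d) \<times> real \<Rightarrow> real"
  assumes "open D" and g: "smooth g" and "\<epsilon> \<ge> 0"
    and m: "\<And>b. b \<in> Basis \<Longrightarrow> v b \<in> borel_measurable borel" "\<And>b. b \<in> Basis \<Longrightarrow> w b \<in> borel_measurable borel"
    and f: "AE z in lborel. z \<in> D \<times> {0<..<\<tau>} \<longrightarrow> f z = v time_dir z - (\<Sum>a\<in>UNIV. w (space_dir a) z)"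
    and b1: "\<And>b. b \<in> Basis \<Longrightarrow> sq_int (D \<times> {0<..<\<tau>}) (\<lambda>z. partial b g z - v b z) \<le> ennreal \<epsilon>"
    and b2: "\<And>b. b \<in> Basis \<Longrightarrow> sq_int (D \<times> {0<..<\<tau>}) (\<lambda>z. partial b (partial b g) z - w b z) \<le> ennreal \<epsilon>"
  shows "R_int f g \<in> borel_measurable (lebesgue_on (D \<times> {0..\<tau>}))"
    and "(\<integral>\<^sup>+z. ennreal ((R_int f g z)\<^sup>2) \<partial>lebesgue_on (D \<times> {0..\<tau>})) \<le> ennreal ((2 + 2 * 4 ^ CARD('d)) * \<epsilon>)"
proof -
  let ?\<Omega> = "D \<times> {0<..<\<tau>}"
  have Sm: "D \<times> {0..\<tau>} \<in> sets borel" "?\<Omega> \<in> sets borel" using assms(1) by (auto intro!: borel_Times)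
  define p where "p z = partial time_dir g z - v time_dir z" for z
  define q where "q a z = - (partial (space_dir a) (partial (space_dir a) g) z - w (space_dir a) z)" for a z
  define Z where "Z z = p z + (\<Sum>a\<in>UNIV. q a z)" for z
  have s1: "smooth (partial b g)" if "b \<in> Basis" for b by (rule smooth_partial[OF g that])
  have pm: "p \<in> borel_measurable borel" unfolding p_def[abs_def]
    by (intro borel_measurable_diff smooth_measurable s1 time_dir_Basis m)
  have qm: "q a \<in> borel_measurable borel" for a unfolding q_def[abs_def]
    by (intro borel_measurable_uminus borel_measurable_diff smooth_measurable smooth_partial g space_dir_Basis m)
  have Zm: "Z \<in> borel_measurable borel" unfolding Z_def[abs_def] by (intro borel_measurable_add borel_measurable_sum pm qm)
  have ae: "AE z in lborel. z \<in> D \<times> {0..\<tau>} \<longrightarrow> R_int f g z = Z z"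
    using f AE_closed_time[of D \<tau>]
  proof eventually_elim
    case (elim z)
    show ?case
    proof
      assume "z \<in> D \<times> {0..\<tau>}"
      then have fz: "f z = v time_dir z - (\<Sum>a\<in>UNIV. w (space_dir a) z)" using elim by blast
      show "R_int f g z = Z z" unfolding R_int_def Z_def p_def q_def fz sum_negf sum_subtractf by simp
    qed
  qed
  show "R_int f g \<in> borel_measurable (lebesgue_on (D \<times> {0..\<tau>}))"
    by (rule borel_measurable_lebesgue_on_AE[OF Sm(1) Zm ae])
  have "(\<integral>\<^sup>+z. ennreal ((R_int f g z)\<^sup>2) \<partial>lebesgue_on (D \<times> {0..\<tau>})) = sq_int (D \<times> {0..\<tau>}) Z"
    by (rule nn_integral_lebesgue_on_AE[OF Sm(1) ae])
  also have "\<dots> = sq_int ?\<Omega> Z" by (rule sq_int_closed_time)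
  also have "\<dots> \<le> 2 * sq_int ?\<Omega> p + 2 * sq_int ?\<Omega> (\<lambda>z. \<Sum>a\<in>UNIV. q a z)"
    unfolding Z_def by (intro sq_int_add pm borel_measurable_sum qm Sm(2))
  also have "\<dots> \<le> 2 * ennreal \<epsilon> + 2 * ennreal (4 ^ card (UNIV :: 'd set) * \<epsilon>)"
  proof (intro add_mono mult_left_mono)
    show "sq_int ?\<Omega> p \<le> ennreal \<epsilon>" unfolding p_def by (rule b1[OF time_dir_Basis])
    show "sq_int ?\<Omega> (\<lambda>z. \<Sum>a\<in>UNIV. q a z) \<le> ennreal (4 ^ card (UNIV :: 'd set) * \<epsilon>)"
    proof (rule sq_int_sum[OF _ qm _ Sm(2) \<open>\<epsilon> \<ge> 0\<close>])
      show "sq_int ?\<Omega> (q a) \<le> ennreal \<epsilon>" for a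
        unfolding q_def sq_int_uminus by (rule b2[OF space_dir_Basis])
    qed simp
  qed simp_all
  also have "\<dots> = ennreal (2 * \<epsilon>) + ennreal (2 * (4 ^ CARD('d) * \<epsilon>))"
    using \<open>\<epsilon> \<ge> 0\<close> by (simp add: ennreal_mult')
  also have "\<dots> = ennreal ((2 + 2 * 4 ^ CARD('d)) * \<epsilon>)"
    using \<open>\<epsilon> \<ge> 0\<close> by (subst ennreal_plus[symmetric]) (auto simp: algebra_simps)
  finally show "(\<integral>\<^sup>+z. ennreal ((R_int f g z)\<^sup>2) \<partial>lebesgue_on (D \<times> {0..\<tau>})) \<le> ennreal ((2 + 2 * 4 ^ CARD('d)) * \<epsilon>)" .
qed

text \<open>One tanh sum close to \<open>u\<close> together with its tracked derivatives controls
  all three residuals. The initial and the lateral one are split at a smooth approximant, chosen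
  separately for each part of the boundary since each trace comes with its own sequence.\<close>

lemma cylinder_residuals:
  fixes D :: "(real^'d) set" and f u_d u :: "(real^'d) \<times> real \<Rightarrow> real"
  assumes "k \<ge> 3" and D: "open D" "bounded D" "Ck_boundary k D" and \<tau>: "0 < \<tau>" "\<tau> \<le> T"
    and heat: "heat_solution D T f u_in u_d u" and u: "u \<in> sobolev_H k (D \<times> {0<..<\<tau>})" and "\<delta> > 0"
  shows "\<exists>g. tanh_sum g \<and>
    R_int f g \<in> L2 (lebesgue_on (D \<times> {0..\<tau>})) \<and> L2_norm (lebesgue_on (D \<times> {0..\<tau>})) (R_int f g) \<le> \<delta> \<and>
    (\<lambda>x. g (x, 0) - u_in x) \<in> L2 (lebesgue_on D) \<and> L2_norm (lebesgue_on D) (\<lambda>x. g (x, 0) - u_in x) \<le> \<delta> \<and>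
    R_sb u_d g \<in> L2 (lateral_measure D \<tau>) \<and> L2_norm (lateral_measure D \<tau>) (R_sb u_d g) \<le> \<delta>"
proof -
  define \<Omega> where "\<Omega> = D \<times> {0<..<\<tau>}"
  define \<Omega>T where "\<Omega>T = D \<times> {0<..<T}"
  have \<Omega>: "open \<Omega>" "bounded \<Omega>" and \<Omega>T: "open \<Omega>T" "\<Omega> \<subseteq> \<Omega>T"
    using D \<tau> by (auto simp: \<Omega>_def \<Omega>T_def intro!: open_Times bounded_Times)
  have \<Omega>m: "\<Omega> \<in> sets borel" and Dm: "D \<in> sets borel" using \<Omega> D by simp_all
  have k: "k \<ge> 1" "k \<ge> 2" using \<open>k \<ge> 3\<close> by auto
  obtain u' v w where H: "H2_data \<Omega> u' v w" and u': "AE z in lborel. z \<in> \<Omega> \<longrightarrow> u z = u' z"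
    and v: "\<And>b v0. b \<in> Basis \<Longrightarrow> weak_deriv \<Omega> [b] u v0 \<Longrightarrow> AE z in lborel. z \<in> \<Omega> \<longrightarrow> v0 z = v b z"
    and w: "\<And>b w0. b \<in> Basis \<Longrightarrow> weak_deriv \<Omega> [b, b] u w0 \<Longrightarrow> AE z in lborel. z \<in> \<Omega> \<longrightarrow> w0 z = w b z"
    by (rule sobolev_H2_data[OF \<Omega>(1) u[folded \<Omega>_def] k(2)]) (rule that)
  have "\<exists>R d. inward \<Omega> p R d" if "p \<in> closure \<Omega>" for p
    using inward_cylinder[OF D(1,3) k(1) \<tau>(1)] that unfolding \<Omega>_def by blast
  then have A: "H2_approximable \<Omega> u' v w" by (intro H2_data_approximable[OF \<Omega> _ H])
  have um: "u' \<in> borel_measurable borel" and vm: "\<And>b. b \<in> Basis \<Longrightarrow> v b \<in> borel_measurable borel"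
    and wm: "\<And>b. b \<in> Basis \<Longrightarrow> w b \<in> borel_measurable borel"
    using H unfolding H2_data_def sq_integrable_def by blast+
  obtain u_t u_xx where ut: "weak_deriv \<Omega>T [time_dir] u u_t" and uxx: "\<And>a. weak_deriv \<Omega>T [space_dir a, space_dir a] u (u_xx a)"
    and feq: "AE z in lebesgue_on \<Omega>T. u_t z - (\<Sum>a\<in>UNIV. u_xx a z) = f z"
    and tr0: "has_trace \<Omega>T (lebesgue_on D) (\<lambda>x. (x, 0)) u u_in"
    and trl: "has_trace \<Omega>T (lateral_measure D T) (\<lambda>z. z) u u_d"
    using heat unfolding heat_solution_def Let_def \<Omega>T_def by blast
  \<comment> \<open>On the shorter cylinder the weak derivatives of the equation are identified with
    \<open>v\<close> and \<open>w\<close>, which turns \<open>f\<close> into an expression in the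
    approximated data.\<close>
  have f: "AE z in lborel. z \<in> \<Omega> \<longrightarrow> f z = v time_dir z - (\<Sum>a\<in>UNIV. w (space_dir a) z)"
  proof -
    have "weak_deriv \<Omega> [time_dir] u u_t"
      by (rule weak_deriv_subset[OF ut \<Omega>T(2) \<Omega>(1) \<Omega>T(1)]) (use time_dir_Basis in simp)
    then have t: "AE z in lborel. z \<in> \<Omega> \<longrightarrow> u_t z = v time_dir z" by (rule v[OF time_dir_Basis])
    have "AE z in lborel. z \<in> \<Omega> \<longrightarrow> u_xx a z = w (space_dir a) z" for a
    proof (rule w[OF space_dir_Basis])
      show "weak_deriv \<Omega> [space_dir a, space_dir a] u (u_xx a)"
        by (rule weak_deriv_subset[OF uxx \<Omega>T(2) \<Omega>(1) \<Omega>T(1)]) (use space_dir_Basis in simp)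
    qed
    then have x: "AE z in lborel. \<forall>a\<in>UNIV. z \<in> \<Omega> \<longrightarrow> u_xx a z = w (space_dir a) z" by (intro AE_finite_allI) simp_all
    have "AE z in lebesgue. z \<in> \<Omega>T \<longrightarrow> u_t z - (\<Sum>a\<in>UNIV. u_xx a z) = f z"
      using feq \<Omega>T(1) by (simp add: AE_restrict_space_iff)
    then have "AE z in lborel. z \<in> \<Omega>T \<longrightarrow> u_t z - (\<Sum>a\<in>UNIV. u_xx a z) = f z" by (simp add: AE_completion_iff)
    then show ?thesis using t x
    proof eventually_elim
      case (elim z)
      show ?case
      proof
        assume z: "z \<in> \<Omega>"
        then have "f z = u_t z - (\<Sum>a\<in>UNIV. u_xx a z)" using elim(1) \<Omega>T(2) by auto
        then show "f z = v time_dir z - (\<Sum>a\<in>UNIV. w (space_dir a) z)" using elim(2,3) z by simp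
      qed
    qed
  qed
  obtain C where C: "C \<ge> 0" "\<And>\<tau> \<epsilon>. \<And>\<psi> :: (real^'d) \<times> real \<Rightarrow> real. smooth \<psi> \<Longrightarrow> \<epsilon> \<ge> 0 \<Longrightarrow> sq_int (D \<times> {0..\<tau>}) \<psi> \<le> ennreal \<epsilon> \<Longrightarrow>
     (\<forall>b\<in>Basis. sq_int (D \<times> {0..\<tau>}) (partial b \<psi>) \<le> ennreal \<epsilon>) \<Longrightarrow>
     (\<integral>\<^sup>+z. ennreal ((\<psi> z)\<^sup>2) \<partial>lateral_base D \<tau>) \<le> ennreal (C * \<epsilon>)"
    using lateral_trace[OF D k(1)] by blast
  \<comment> \<open>The losses of the three estimates below: the interior bound, and for each trace
    twice the trace constant applied to \<open>4 * \<epsilon>\<close> plus twice the error of the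
    approximant.\<close>
  define Ki :: real where "Ki = 2 + 2 * 4 ^ CARD('d)"
  define Kb where "Kb = 2 * (2 * (1/\<tau> + 1) * 4) + 2"
  define Kl where "Kl = 2 * (C * 4) + 2"
  have Kpos: "Ki > (0::real)" "Kb > 0" "Kl > 0"
    using \<tau> C(1) by (simp_all add: Ki_def Kb_def Kl_def add_pos_nonneg add_nonneg_pos)
  define \<epsilon> where "\<epsilon> = \<delta>\<^sup>2 / (Ki + Kb + Kl)"
  have \<epsilon>: "\<epsilon> > 0" using Kpos \<open>\<delta> > 0\<close> by (simp add: \<epsilon>_def)
  have "(Ki + Kb + Kl) * \<epsilon> = \<delta>\<^sup>2" using Kpos by (simp add: \<epsilon>_def)
  then have "Ki * \<epsilon> + Kb * \<epsilon> + Kl * \<epsilon> = \<delta>\<^sup>2" by (simp add: distrib_right)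
  moreover have "Ki * \<epsilon> > 0" "Kb * \<epsilon> > 0" "Kl * \<epsilon> > 0" using Kpos \<epsilon> by simp_all
  ultimately have K\<epsilon>: "Ki * \<epsilon> \<le> \<delta>\<^sup>2" "Kb * \<epsilon> \<le> \<delta>\<^sup>2" "Kl * \<epsilon> \<le> \<delta>\<^sup>2" by linarith+
  obtain g where g: "tanh_sum g" "sq_int \<Omega> (\<lambda>z. g z - u' z) \<le> ennreal \<epsilon>"
    "\<And>b. b \<in> Basis \<Longrightarrow> sq_int \<Omega> (\<lambda>z. partial b g z - v b z) \<le> ennreal \<epsilon>"
    "\<And>b. b \<in> Basis \<Longrightarrow> sq_int \<Omega> (\<lambda>z. partial b (partial b g) z - w b z) \<le> ennreal \<epsilon>"
    by (rule H2_tanh_approximable[OF H A \<Omega> \<epsilon>]) (rule that)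
  have gs: "smooth g" by (rule tanh_sum_smooth[OF g(1)])
  have e0: "\<epsilon> \<ge> 0" "4 * \<epsilon> \<ge> 0" using \<epsilon> by auto
  have sum2: "2 * ennreal a + 2 * ennreal b = ennreal (2 * a + 2 * b)" if "a \<ge> 0" "b \<ge> 0" for a b
    using that by (simp add: ennreal_mult')
  have int: "R_int f g \<in> borel_measurable (lebesgue_on (D \<times> {0..\<tau>}))"
    "(\<integral>\<^sup>+z. ennreal ((R_int f g z)\<^sup>2) \<partial>lebesgue_on (D \<times> {0..\<tau>})) \<le> ennreal (\<delta>\<^sup>2)"
  proof -
    note * = interior_residual_bound[OF D(1) gs e0(1) vm wm f[unfolded \<Omega>_def] g(3,4)[unfolded \<Omega>_def]]
    show "R_int f g \<in> borel_measurable (lebesgue_on (D \<times> {0..\<tau>}))" by (rule *(1))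
    have "(\<integral>\<^sup>+z. ennreal ((R_int f g z)\<^sup>2) \<partial>lebesgue_on (D \<times> {0..\<tau>})) \<le> ennreal (Ki * \<epsilon>)" unfolding Ki_def by (rule *(2))
    then show "(\<integral>\<^sup>+z. ennreal ((R_int f g z)\<^sup>2) \<partial>lebesgue_on (D \<times> {0..\<tau>})) \<le> ennreal (\<delta>\<^sup>2)"
      using ennreal_leI[OF K\<epsilon>(1)] by (rule order_trans)
  qed
  have bot: "(\<lambda>x. g (x, 0) - u_in x) \<in> borel_measurable (lebesgue_on D)"
    "(\<integral>\<^sup>+x. ennreal ((g (x, 0) - u_in x)\<^sup>2) \<partial>lebesgue_on D) \<le> ennreal (\<delta>\<^sup>2)"
  proof -
    have ex: "\<exists>\<phi>. smooth \<phi> \<and> sq_int \<Omega> (\<lambda>z. \<phi> z - u' z) \<le> ennreal \<epsilon> \<and>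
      (\<forall>b\<in>Basis. sq_int \<Omega> (\<lambda>z. partial b \<phi> z - v b z) \<le> ennreal \<epsilon>) \<and>
      (\<lambda>x. \<phi> (x, 0) - u_in x) \<in> borel_measurable (lebesgue_on D) \<and>
      (\<integral>\<^sup>+x. ennreal ((\<phi> (x, 0) - u_in x)\<^sup>2) \<partial>lebesgue_on D) \<le> ennreal \<epsilon>"
      by (rule has_trace_approx[OF tr0 \<Omega>T(1) \<Omega>(1) \<Omega>T(2) u' _ \<epsilon>]) (rule v)
    obtain \<phi> where \<phi>: "smooth \<phi>" "sq_int \<Omega> (\<lambda>z. \<phi> z - u' z) \<le> ennreal \<epsilon>"
      "\<And>b. b \<in> Basis \<Longrightarrow> sq_int \<Omega> (\<lambda>z. partial b \<phi> z - v b z) \<le> ennreal \<epsilon>"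
      "(\<lambda>x. \<phi> (x, 0) - u_in x) \<in> borel_measurable (lebesgue_on D)"
      "(\<integral>\<^sup>+x. ennreal ((\<phi> (x, 0) - u_in x)\<^sup>2) \<partial>lebesgue_on D) \<le> ennreal \<epsilon>"
      using ex by blast
    define \<psi> where "\<psi> z = g z - \<phi> z" for z
    have \<psi>: "smooth \<psi>" unfolding \<psi>_def[abs_def] by (rule smooth_diff[OF gs \<phi>(1)])
    note * = difference_H1_bound[OF gs \<phi>(1) \<Omega>m e0(1) um vm g(2) \<phi>(2) g(3) \<phi>(3), folded \<psi>_def[abs_def]]
    have "sq_int D (\<lambda>x. \<psi> (x, 0)) \<le> ennreal (2 * (1/\<tau> + 1) * (4 * \<epsilon>))"
      by (rule bottom_trace[OF D(1) \<tau>(1) \<psi> e0(2) *(1)[unfolded \<Omega>_def]]) (use *(2) time_dir_Basis in \<open>auto simp: \<Omega>_def\<close>)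
    moreover have pm: "(\<lambda>x. \<psi> (x, 0)) \<in> borel_measurable borel"
      by (intro borel_measurable_continuous_onI continuous_on_compose2[OF smooth_continuous[OF \<psi>, of UNIV]] continuous_intros) auto
    have ml: "(\<lambda>x. \<psi> (x, 0)) \<in> borel_measurable (lebesgue_on D)"
      by (rule borel_measurable_lebesgue_on_AE[OF Dm pm]) simp
    have "(\<integral>\<^sup>+x. ennreal ((\<psi> (x, 0))\<^sup>2) \<partial>lebesgue_on D) = sq_int D (\<lambda>x. \<psi> (x, 0))"
      by (rule nn_integral_lebesgue_on_AE[OF Dm]) simp
    ultimately have p1: "(\<integral>\<^sup>+x. ennreal ((\<psi> (x, 0))\<^sup>2) \<partial>lebesgue_on D) \<le> ennreal (2 * (1/\<tau> + 1) * (4 * \<epsilon>))" by simp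
    have eq: "g (x, 0) - u_in x = \<psi> (x, 0) + (\<phi> (x, 0) - u_in x)" for x by (simp add: \<psi>_def)
    show "(\<lambda>x. g (x, 0) - u_in x) \<in> borel_measurable (lebesgue_on D)"
      unfolding eq by (rule borel_measurable_add[OF ml \<phi>(4)])
    have "(\<integral>\<^sup>+x. ennreal ((g (x, 0) - u_in x)\<^sup>2) \<partial>lebesgue_on D) 
      \<le> 2 * (\<integral>\<^sup>+x. ennreal ((\<psi> (x, 0))\<^sup>2) \<partial>lebesgue_on D) + 2 * (\<integral>\<^sup>+x. ennreal ((\<phi> (x, 0) - u_in x)\<^sup>2) \<partial>lebesgue_on D)"
      unfolding eq by (rule nn_integral_square_add[OF ml \<phi>(4)])
    also have "\<dots> \<le> 2 * ennreal (2 * (1/\<tau> + 1) * (4 * \<epsilon>)) + 2 * ennreal \<epsilon>"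
      by (intro add_mono mult_left_mono p1 \<phi>(5)) simp_all
    also have "\<dots> = ennreal (2 * (2 * (1/\<tau> + 1) * (4 * \<epsilon>)) + 2 * \<epsilon>)" by (rule sum2) (use \<tau> \<epsilon> in simp_all)
    also have "2 * (2 * (1/\<tau> + 1) * (4 * \<epsilon>)) + 2 * \<epsilon> = Kb * \<epsilon>" by (simp add: Kb_def algebra_simps)
    finally show "(\<integral>\<^sup>+x. ennreal ((g (x, 0) - u_in x)\<^sup>2) \<partial>lebesgue_on D) \<le> ennreal (\<delta>\<^sup>2)"
      using ennreal_leI[OF K\<epsilon>(2)] by (rule order_trans)
  qed
  have lat: "R_sb u_d g \<in> borel_measurable (lateral_measure D \<tau>)"
    "(\<integral>\<^sup>+z. ennreal ((R_sb u_d g z)\<^sup>2) \<partial>lateral_measure D \<tau>) \<le> ennreal (\<delta>\<^sup>2)"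
  proof -
    have ex: "\<exists>\<phi>. smooth \<phi> \<and> sq_int \<Omega> (\<lambda>z. \<phi> z - u' z) \<le> ennreal \<epsilon> \<and>
      (\<forall>b\<in>Basis. sq_int \<Omega> (\<lambda>z. partial b \<phi> z - v b z) \<le> ennreal \<epsilon>) \<and>
      (\<lambda>z. \<phi> z - u_d z) \<in> borel_measurable (lateral_measure D T) \<and>
      (\<integral>\<^sup>+z. ennreal ((\<phi> z - u_d z)\<^sup>2) \<partial>lateral_measure D T) \<le> ennreal \<epsilon>"
      by (rule has_trace_approx[OF trl \<Omega>T(1) \<Omega>(1) \<Omega>T(2) u' _ \<epsilon>]) (rule v)
    obtain \<phi> where \<phi>: "smooth \<phi>" "sq_int \<Omega> (\<lambda>z. \<phi> z - u' z) \<le> ennreal \<epsilon>"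
      "\<And>b. b \<in> Basis \<Longrightarrow> sq_int \<Omega> (\<lambda>z. partial b \<phi> z - v b z) \<le> ennreal \<epsilon>"
      "(\<lambda>z. \<phi> z - u_d z) \<in> borel_measurable (lateral_measure D T)"
      "(\<integral>\<^sup>+z. ennreal ((\<phi> z - u_d z)\<^sup>2) \<partial>lateral_measure D T) \<le> ennreal \<epsilon>"
      using ex by blast
    define \<psi> where "\<psi> z = g z - \<phi> z" for z
    have \<psi>: "smooth \<psi>" unfolding \<psi>_def[abs_def] by (rule smooth_diff[OF gs \<phi>(1)])
    note * = difference_H1_bound[OF gs \<phi>(1) \<Omega>m e0(1) um vm g(2) \<phi>(2) g(3) \<phi>(3), folded \<psi>_def[abs_def]]
    have "(\<integral>\<^sup>+z. ennreal ((\<psi> z)\<^sup>2) \<partial>lateral_base D \<tau>) \<le> ennreal (C * (4 * \<epsilon>))"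
      by (rule C(2)[OF \<psi> e0(2)]) (use * in \<open>simp_all add: sq_int_closed_time \<Omega>_def\<close>)
    then have p1: "(\<integral>\<^sup>+z. ennreal ((\<psi> z)\<^sup>2) \<partial>lateral_measure D \<tau>) \<le> ennreal (C * (4 * \<epsilon>))"
      unfolding lateral_measure_eq nn_integral_completion .
    have p2: "(\<integral>\<^sup>+z. ennreal ((\<phi> z - u_d z)\<^sup>2) \<partial>lateral_measure D \<tau>) \<le> ennreal \<epsilon>"
      by (rule order_trans[OF lateral_measure_restrict(2)[OF \<tau>(2) \<phi>(4)] \<phi>(5)])
    have m1: "\<psi> \<in> borel_measurable (lateral_measure D \<tau>)" unfolding lateral_measure_eq
      by (intro measurable_completion lateral_base_measurable smooth_measurable \<psi>)
    have m2: "(\<lambda>z. \<phi> z - u_d z) \<in> borel_measurable (lateral_measure D \<tau>)"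
      by (rule lateral_measure_restrict(1)[OF \<tau>(2) \<phi>(4)])
    have eq: "R_sb u_d g = (\<lambda>z. \<psi> z + (\<phi> z - u_d z))" by (rule ext) (simp add: R_sb_def \<psi>_def)
    show "R_sb u_d g \<in> borel_measurable (lateral_measure D \<tau>)"
      unfolding eq by (rule borel_measurable_add[OF m1 m2])
    have "(\<integral>\<^sup>+z. ennreal ((R_sb u_d g z)\<^sup>2) \<partial>lateral_measure D \<tau>) 
      \<le> 2 * (\<integral>\<^sup>+z. ennreal ((\<psi> z)\<^sup>2) \<partial>lateral_measure D \<tau>) + 2 * (\<integral>\<^sup>+z. ennreal ((\<phi> z - u_d z)\<^sup>2) \<partial>lateral_measure D \<tau>)"
      unfolding eq by (rule nn_integral_square_add[OF m1 m2])
    also have "\<dots> \<le> 2 * ennreal (C * (4 * \<epsilon>)) + 2 * ennreal \<epsilon>"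
      by (intro add_mono mult_left_mono p1 p2) simp_all
    also have "\<dots> = ennreal (2 * (C * (4 * \<epsilon>)) + 2 * \<epsilon>)" by (rule sum2) (use C(1) \<epsilon> in simp_all)
    also have "2 * (C * (4 * \<epsilon>)) + 2 * \<epsilon> = Kl * \<epsilon>" by (simp add: Kl_def algebra_simps)
    finally show "(\<integral>\<^sup>+z. ennreal ((R_sb u_d g z)\<^sup>2) \<partial>lateral_measure D \<tau>) \<le> ennreal (\<delta>\<^sup>2)"
      using ennreal_leI[OF K\<epsilon>(3)] by (rule order_trans)
  qed
  have d0: "\<delta> \<ge> 0" using \<open>\<delta> > 0\<close> by simp
  show ?thesis
    using g(1) L2_of_nn_integral[OF int d0] L2_of_nn_integral[OF bot d0] L2_of_nn_integral[OF lat d0] by blast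
qed

theorem theorem3p2:
  fixes n k l i L :: nat
    and T :: real
    and D :: "(real^'d) set"
    and f u_d u :: "(real^'d) \<times> real \<Rightarrow> real"
    and u_in :: "(real^'d) \<Rightarrow> real"
    and \<sigma> :: "nat \<Rightarrow> real \<Rightarrow> real"
  assumes "n \<ge> 2" and "k \<ge> 3"
    and "open D" and "connected D" and "bounded D" and "D \<noteq> {}" and "Ck_boundary k D"
    and "T > 0" and "l \<ge> 1" and "1 \<le> i" and "i \<le> l"
    and "L \<ge> 3" and "hlconc_activations L \<sigma>"
    and "heat_solution D T f u_in u_d u"
    and "u \<in> sobolev_H k (D \<times> {0<..<block_time T l i})"
  shows "\<exists>C>0. \<forall>N::nat. N > 5 \<longrightarrow>
    (\<exists>\<theta> :: nat \<Rightarrow> hlconc_params.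
       (\<forall>j\<in>{1..i}. hlconc_shape L (CARD('d) + 1) 1 (\<theta> j)) \<and>
       (let v = (\<lambda>j. net L \<sigma> (\<theta> j));
            t = block_time T l;
            \<Omega> = lebesgue_on (D \<times> {0..t i});
            \<Gamma> = lateral_measure D (t i) in
          R_int f (v i) \<in> L2 \<Omega> \<and>
          L2_norm \<Omega> (R_int f (v i)) \<le> C * (real N powi (2 - int k) * (ln (real N))\<^sup>2) \<and>
          (\<forall>j\<in>{1..i}. R_tb u_in t v i j \<in> L2 (lebesgue_on D) \<and>
             L2_norm (lebesgue_on D) (R_tb u_in t v i j) \<le> C * (real N powi (1 - int k) * ln (real N))) \<and>
          R_sb u_d (v i) \<in> L2 \<Gamma> \<and>
          L2_norm \<Gamma> (R_sb u_d (v i)) \<le> C * (real N powi (1 - int k) * ln (real N))))"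
proof -
  define \<tau> where "\<tau> = block_time T l i"
  have i: "real i > 0" "real l > 0" "real i \<le> real l" using assms(9-11) by auto
  then have \<tau>: "0 < \<tau>" using \<open>T > 0\<close> by (simp add: \<tau>_def block_time_def)
  have "real i * (T / real l) \<le> real l * (T / real l)" using i \<open>T > 0\<close> by (intro mult_right_mono) auto
  then have \<tau>T: "\<tau> \<le> T" using i by (simp add: \<tau>_def block_time_def)
  have t0: "block_time T l 0 = 0" by (simp add: block_time_def)
  have main: "\<exists>\<theta> :: nat \<Rightarrow> hlconc_params.
       (\<forall>j\<in>{1..i}. hlconc_shape L (CARD('d) + 1) 1 (\<theta> j)) \<and>
       (let v = (\<lambda>j. net L \<sigma> (\<theta> j));
            t = block_time T l;
            \<Omega> = lebesgue_on (D \<times> {0..t i});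
            \<Gamma> = lateral_measure D (t i) in
          R_int f (v i) \<in> L2 \<Omega> \<and>
          L2_norm \<Omega> (R_int f (v i)) \<le> 1 * (real N powi (2 - int k) * (ln (real N))\<^sup>2) \<and>
          (\<forall>j\<in>{1..i}. R_tb u_in t v i j \<in> L2 (lebesgue_on D) \<and>
             L2_norm (lebesgue_on D) (R_tb u_in t v i j) \<le> 1 * (real N powi (1 - int k) * ln (real N))) \<and>
          R_sb u_d (v i) \<in> L2 \<Gamma> \<and>
          L2_norm \<Gamma> (R_sb u_d (v i)) \<le> 1 * (real N powi (1 - int k) * ln (real N)))"
    if N: "N > 5" for N :: nat
  proof -
    define r1 where "r1 = real N powi (2 - int k) * (ln (real N))\<^sup>2"
    define r2 where "r2 = real N powi (1 - int k) * ln (real N)"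
    have r: "r1 > 0" "r2 > 0" using N by (auto simp: r1_def r2_def)
    \<comment> \<open>As \<open>N > 5\<close> makes \<open>ln (real N)\<close> positive, both rates
      are positive and hence admissible tolerances. The smaller one serves all residuals, so the
      constant is 1 for every \<open>N\<close>.\<close>
    define \<delta> where "\<delta> = min r1 r2"
    have \<delta>: "\<delta> > 0" "\<delta> \<le> r1" "\<delta> \<le> r2" using r by (auto simp: \<delta>_def)
    obtain g where g: "tanh_sum g"
      "R_int f g \<in> L2 (lebesgue_on (D \<times> {0..\<tau>}))" "L2_norm (lebesgue_on (D \<times> {0..\<tau>})) (R_int f g) \<le> \<delta>"
      "(\<lambda>x. g (x, 0) - u_in x) \<in> L2 (lebesgue_on D)" "L2_norm (lebesgue_on D) (\<lambda>x. g (x, 0) - u_in x) \<le> \<delta>"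
      "R_sb u_d g \<in> L2 (lateral_measure D \<tau>)" "L2_norm (lateral_measure D \<tau>) (R_sb u_d g) \<le> \<delta>"
      using cylinder_residuals[OF assms(2,3,5,7) \<tau> \<tau>T assms(14) assms(15)[folded \<tau>_def] \<delta>(1)] by blast
    obtain \<theta> where \<theta>: "hlconc_shape L (CARD('d) + 1) 1 \<theta>" "net L \<sigma> \<theta> = g"
      using tanh_sum_net[OF g(1) assms(12,13)] by blast
    have tb: "R_tb u_in (block_time T l) (\<lambda>j. g) i j \<in> L2 (lebesgue_on D) \<and>
      L2_norm (lebesgue_on D) (R_tb u_in (block_time T l) (\<lambda>j. g) i j) \<le> r2" for j
    \<comment> \<open>For \<open>j = 1\<close> the network meets the initial data at block time 0;
      for other \<open>j\<close> both terms come from the same network and cancel.\<close>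
    proof (cases "j = 1")
      case True
      then have "R_tb u_in (block_time T l) (\<lambda>j. g) i j = (\<lambda>x. g (x, 0) - u_in x)" by (simp add: R_tb_def t0 fun_eq_iff)
      then show ?thesis using g(4,5) \<delta>(3) by simp
    next
      case False
      then have "R_tb u_in (block_time T l) (\<lambda>j. g) i j = (\<lambda>x. 0)" by (simp add: R_tb_def fun_eq_iff)
      then show ?thesis using r(2) by (simp add: L2_def L2_norm_def)
    qed
    show ?thesis unfolding Let_def \<tau>_def[symmetric] r1_def[symmetric] r2_def[symmetric]
      using \<theta> g \<delta> tb by (intro exI[of _ "\<lambda>_. \<theta>"]) (simp add: \<tau>_def)
  qed
  show ?thesis by (intro exI[of _ "1::real"] conjI allI impI) (simp, rule main)
qed

end
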